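(* There exists a universal constant $C>0$ such that for every $n\ge1$ and every rotationally invariant log-concave probability measure $\mu$ on $\mathbb{R}^n$, $$\rho_{LS}(\mu)\le C\,\|\langle\cdot,e_1\rangle\|_{L^{\psi_2}(\mu)},$$ where $e_1$ denotes the first element of the canonical basis of $\mathbb{R}^n$.
   Context: A probability measure $\mu$ on $\mathbb{R}^n$ is log-concave if $d\mu=e^{-V(x)}dx$ for some convex $V:\mathbb{R}^n\to\mathbb{R}\cup\{+\infty\}$. It is rotationally invariant if $\mu(RA)=\mu(A)$ for every orthogonal transformation $R\in O(n)$ and every measurable set $A$. $|\cdot|$ is the Euclidean norm. Log-Sobolev constant: $\rho_{LS}(\mu)$ is the smallest $\rho$ such that for every smooth $f:\mathbb{R}^n\to\mathbb{R}$, $\mathrm{Ent}_\mu(f^2)\le 2\rho^2\int|\nabla f|^2d\mu$, where $\mathrm{Ent}_\mu(g)=\mathbb{E}_\mu[g\log g]-\mathbb{E}_\mu[g]\log\mathbb{E}_\mu[g]$ for $g\ge 0$ ($\rho_{LS}(\mu)=+\infty$ if no such $\rho$ exists). For $g:\mathbb{R}^n\to\mathbb{R}$ measurable, $\|g\|_{L^{\psi_2}(\mu)}=\inf\{t>0:\int e^{g^2/t^2}d\mu\le 2\}$ (equal to $+\infty$ if no such $t$ exists). *)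

theory Defs
  imports "HOL-Probability.Probability"
begin

text \<open>
  The dimension \<open>n\<close> is quantified inside the statement, after the universal constant, so it cannot
  be a type.  \<open>R^n\<close> is the set of extensional functions on \<open>{..<n}\<close>, that is, the
  space of \<open>PiM {..<n} (\<lambda>_. borel)\<close> and the topspace of \<open>powertop_real {..<n}\<close>; coordinates are
  numbered from \<open>0\<close>.
\<close>

abbreviation Rn :: "nat \<Rightarrow> (nat \<Rightarrow> real) set" where
  "Rn n \<equiv> {..<n} \<rightarrow>\<^sub>E UNIV"

abbreviation borel_Rn :: "nat \<Rightarrow> (nat \<Rightarrow> real) measure" where
  "borel_Rn n \<equiv> Pi\<^sub>M {..<n} (\<lambda>_. borel)"

definition lebesgue_Rn :: "nat \<Rightarrow> (nat \<Rightarrow> real) measure" where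
  "lebesgue_Rn n = completion (Pi\<^sub>M {..<n} (\<lambda>_. lborel))"

definition inner_Rn :: "nat \<Rightarrow> (nat \<Rightarrow> real) \<Rightarrow> (nat \<Rightarrow> real) \<Rightarrow> real" where
  "inner_Rn n x y = (\<Sum>i<n. x i * y i)"

definition norm_Rn :: "nat \<Rightarrow> (nat \<Rightarrow> real) \<Rightarrow> real" where
  "norm_Rn n x = sqrt (inner_Rn n x x)"

definition axis_Rn :: "nat \<Rightarrow> nat \<Rightarrow> nat \<Rightarrow> real" where
  "axis_Rn n k = (\<lambda>i\<in>{..<n}. if i = k then 1 else 0)"

definition prob_measure_Rn :: "nat \<Rightarrow> (nat \<Rightarrow> real) measure \<Rightarrow> bool" where
  "prob_measure_Rn n \<mu> \<longleftrightarrow> sets \<mu> = sets (borel_Rn n) \<and> prob_space \<mu>"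


subsection \<open>Log-concave measures\<close>

definition convex_Rn :: "nat \<Rightarrow> ((nat \<Rightarrow> real) \<Rightarrow> ereal) \<Rightarrow> bool" where
  "convex_Rn n V \<longleftrightarrow>
     (\<forall>x\<in>Rn n. V x \<noteq> - \<infinity>) \<and>
     (\<forall>x\<in>Rn n. \<forall>y\<in>Rn n. \<forall>t::real. 0 < t \<and> t < 1 \<longrightarrow>
        V (\<lambda>i\<in>{..<n}. (1 - t) * x i + t * y i) \<le> ereal (1 - t) * V x + ereal t * V y)"

definition exp_minus :: "ereal \<Rightarrow> ennreal" where
  "exp_minus v = (if v = \<infinity> then 0 else ennreal (exp (- real_of_ereal v)))"

text \<open>
  A convex \<open>V\<close> need not be Borel measurable on the boundary of its domain, but it is always
  Lebesgue measurable; hence the density is taken with respect to the completed Lebesgue measure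
  and the measurability clause below excludes no convex function.
\<close>

definition log_concave_Rn :: "nat \<Rightarrow> (nat \<Rightarrow> real) measure \<Rightarrow> bool" where
  "log_concave_Rn n \<mu> \<longleftrightarrow>
     (\<exists>V. convex_Rn n V \<and> V \<in> borel_measurable (lebesgue_Rn n) \<and>
        (\<forall>A\<in>sets (borel_Rn n).
           emeasure \<mu> A = (\<integral>\<^sup>+x\<in>A. exp_minus (V x) \<partial>lebesgue_Rn n)))"


subsection \<open>Rotational invariance\<close>

definition orthogonal_Rn :: "nat \<Rightarrow> ((nat \<Rightarrow> real) \<Rightarrow> nat \<Rightarrow> real) \<Rightarrow> bool" where
  "orthogonal_Rn n R \<longleftrightarrow>
     (\<exists>a :: nat \<Rightarrow> nat \<Rightarrow> real.
        (\<forall>x\<in>Rn n. R x = (\<lambda>i\<in>{..<n}. \<Sum>j<n. a i j * x j)) \<and>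
        (\<forall>i<n. \<forall>j<n. (\<Sum>k<n. a i k * a j k) = (if i = j then 1 else 0)))"

definition rotation_invariant_Rn :: "nat \<Rightarrow> (nat \<Rightarrow> real) measure \<Rightarrow> bool" where
  "rotation_invariant_Rn n \<mu> \<longleftrightarrow>
     (\<forall>R. orthogonal_Rn n R \<longrightarrow>
        (\<forall>A\<in>sets (borel_Rn n). emeasure \<mu> (R ` A) = emeasure \<mu> A))"


subsection \<open>Smooth functions\<close>

definition partial_Rn :: "nat \<Rightarrow> ((nat \<Rightarrow> real) \<Rightarrow> real) \<Rightarrow> (nat \<Rightarrow> real) \<Rightarrow> real" where
  "partial_Rn i f x = deriv (\<lambda>t. f (x(i := t))) (x i)"

definition grad_Rn :: "nat \<Rightarrow> ((nat \<Rightarrow> real) \<Rightarrow> real) \<Rightarrow> (nat \<Rightarrow> real) \<Rightarrow> nat \<Rightarrow> real" where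
  "grad_Rn n f x = (\<lambda>i\<in>{..<n}. partial_Rn i f x)"

primrec Ck_Rn :: "nat \<Rightarrow> nat \<Rightarrow> ((nat \<Rightarrow> real) \<Rightarrow> real) \<Rightarrow> bool" where
  "Ck_Rn n 0 f \<longleftrightarrow> continuous_map (powertop_real {..<n}) euclideanreal f"
| "Ck_Rn n (Suc k) f \<longleftrightarrow>
     continuous_map (powertop_real {..<n}) euclideanreal f \<and>
     (\<forall>i<n. (\<forall>x\<in>Rn n. (\<lambda>t. f (x(i := t))) differentiable (at (x i))) \<and>
            Ck_Rn n k (partial_Rn i f))"

definition smooth_Rn :: "nat \<Rightarrow> ((nat \<Rightarrow> real) \<Rightarrow> real) \<Rightarrow> bool" where
  "smooth_Rn n f \<longleftrightarrow> (\<forall>k. Ck_Rn n k f)"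


subsection \<open>Entropy, log-Sobolev constant, \<open>\<psi>\<^sub>2\<close> norm\<close>

definition ereal_expectation :: "'a measure \<Rightarrow> ('a \<Rightarrow> real) \<Rightarrow> ereal" where
  "ereal_expectation \<mu> g =
     enn2ereal (\<integral>\<^sup>+x. ennreal (g x) \<partial>\<mu>) - enn2ereal (\<integral>\<^sup>+x. ennreal (- g x) \<partial>\<mu>)"

text \<open>
  For \<open>g \<ge> 0\<close>, the function \<open>g log g\<close> (with \<open>0 log 0 = 0\<close>, as \<open>ln 0 = 0\<close>) is bounded
  below, so its expectation under a probability measure is well defined in \<open>(-\<infinity>, \<infinity>]\<close>.
  If \<open>g\<close> is not integrable the difference would be \<open>\<infinity> - \<infinity>\<close>; the entropy is then \<open>\<infinity>\<close>.
\<close>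

definition Ent :: "'a measure \<Rightarrow> ('a \<Rightarrow> real) \<Rightarrow> ereal" where
  "Ent \<mu> g =
     (if (\<integral>\<^sup>+x. ennreal (g x) \<partial>\<mu>) = \<infinity> then \<infinity>
      else ereal_expectation \<mu> (\<lambda>x. g x * ln (g x))
           - ereal ((\<integral>x. g x \<partial>\<mu>) * ln (\<integral>x. g x \<partial>\<mu>)))"

definition log_Sobolev :: "nat \<Rightarrow> (nat \<Rightarrow> real) measure \<Rightarrow> real \<Rightarrow> bool" where
  "log_Sobolev n \<mu> \<rho> \<longleftrightarrow>
     (\<forall>f. smooth_Rn n f \<longrightarrow>
        Ent \<mu> (\<lambda>x. (f x)\<^sup>2)
          \<le> ereal (2 * \<rho>\<^sup>2) * enn2ereal (\<integral>\<^sup>+x. ennreal ((norm_Rn n (grad_Rn n f x))\<^sup>2) \<partial>\<mu>))"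

definition rho_LS :: "nat \<Rightarrow> (nat \<Rightarrow> real) measure \<Rightarrow> ereal" where
  "rho_LS n \<mu> = Inf (ereal ` {\<rho>. 0 \<le> \<rho> \<and> log_Sobolev n \<mu> \<rho>})"

definition psi2_norm :: "'a measure \<Rightarrow> ('a \<Rightarrow> real) \<Rightarrow> ereal" where
  "psi2_norm \<mu> g =
     Inf (ereal ` {t. 0 < t \<and> (\<integral>\<^sup>+x. ennreal (exp ((g x)\<^sup>2 / t\<^sup>2)) \<partial>\<mu>) \<le> 2})"

end

theory Submission
  imports Defs
begin

text \<open>
  By rotational invariance \<open>|x|\<close> and \<open>x / |x|\<close> are independent under \<open>\<mu>\<close> as under the standard Gaussian
  measure \<open>\<gamma>\<close>, with the same law of \<open>x / |x|\<close>; so \<open>T x = \<phi>(|x|) x / |x|\<close> pushes \<open>\<gamma>\<close> to \<open>\<mu>\<close>, where \<open>\<phi>\<close>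
  is the monotone transport between the laws of \<open>|x|\<close>.  Under \<open>\<mu>\<close> this law has a density
  \<open>r ^ (n - 1) exp (- v r)\<close> with \<open>v\<close> convex and nondecreasing, which makes \<open>r F' / F\<close> nonincreasing and
  \<open>F' / (1 - F)\<close> nondecreasing for its distribution function \<open>F\<close>.  Together with the moment and tail
  estimates contained in the \<open>\<psi>\<^sub>2\<close> bound \<open>t\<close> of a marginal, a comparison of these ratios with those of the
  Gaussian radial law bounds \<open>\<phi>'(s)\<close> and \<open>\<phi>(s) / s\<close> by \<open>C t\<close>, that is, \<open>T\<close> is \<open>C t\<close>-Lipschitz.

  The Gaussian log-Sobolev inequality for \<open>f \<circ> T\<close> then gives the one for \<open>f\<close> under \<open>\<mu>\<close>.  It is obtained on
  cubes, where everything is bounded, by one-dimensional monotone transport and tensorisation, and in the limit of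
  large cubes by Fatou's lemma.
\<close>

section \<open>Gaussian log-Sobolev inequality on an interval\<close>

text \<open>The two ratios matter because \<phi> preserves levels of the distribution functions: its
  derivative is the quotient of the Gaussian density and the density of \<open>\<mu>\<close> at
  equal levels. Hence it equals the quotient of the ratios \<open>r F' / F\<close>, times
  \<open>\<phi>(s) / s\<close>, and also the quotient of the ratios \<open>F' / (1 - F)\<close>. So
  the Gaussian ratios are bounded above and those of \<open>\<mu>\<close> below by functions of the
  level alone, the first pair for levels up to 1/2, the second beyond.

  Freedom from the dimension is the obstacle. Both laws sit in a shell of relative width
  \<open>1 / sqrt n\<close>, so at level p the first ratio has order
  \<open>sqrt (n ln (1/p))\<close> until it saturates at n. For \<open>\<mu>\<close> this comes from
  tails that are Gaussian in \<open>sqrt (r / M)\<close> around a mode M.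

  The constant is 30720 = 240 * 128: 240 = 3 * 80 compares the first ratios, 128 bounds
  \<open>\<phi>(s) / (t s)\<close> at low levels.

  Two further difficulties: the potential is radial only almost everywhere, so its convexity is
  exploited along one well-chosen line; and \<open>f^2\<close> is not assumed integrable, which has
  to be deduced from finite energy before the limit of cubes.\<close>

lemma increasing_inverse_deriv:
  fixes F h :: "real \<Rightarrow> real"
  assumes D: "open D" "is_interval D"
    and der: "\<And>x. x \<in> D \<Longrightarrow> (F has_real_derivative h x) (at x)"
    and pos: "\<And>x. x \<in> D \<Longrightarrow> h x > 0"
  obtains G where "\<And>x. x \<in> D \<Longrightarrow> G (F x) = x"
    and "\<And>x. x \<in> D \<Longrightarrow> (G has_real_derivative 1 / h x) (at (F x))"
    and "\<And>x y. x \<in> D \<Longrightarrow> y \<in> D \<Longrightarrow> x < y \<Longrightarrow> F x < F y"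
proof -
  have mono: "F x < F y" if "x \<in> D" "y \<in> D" "x < y" for x y
  proof (rule DERIV_pos_imp_increasing[OF that(3)])
    fix z assume "x \<le> z" "z \<le> y"
    then have "z \<in> D" using D(2) that mem_is_interval_1_I by blast
    then show "\<exists>d. (F has_real_derivative d) (at z) \<and> 0 < d" using der pos by blast
  qed
  have inj: "inj_on F D"
    by (rule linorder_inj_onI') (use mono in fastforce)
  define G where "G = the_inv_into D F"
  have GF: "G (F x) = x" if "x \<in> D" for x
    using the_inv_into_f_f[OF inj that] by (simp add: G_def)
  have cont: "continuous_on D F"
    by (meson DERIV_continuous continuous_at_imp_continuous_on der)
  have dG: "(G has_real_derivative 1 / h x) (at (F x))" if "x \<in> D" for x
  proof -
    have "(G has_derivative (\<lambda>y. y / h x)) (at (F x))"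
    proof (rule has_derivative_inverse_strong[OF D(1) that cont])
      show "(F has_derivative (*) (h x)) (at x)"
        using der[OF that] by (simp add: has_field_derivative_def)
      show "(*) (h x) \<circ> (\<lambda>y. y / h x) = id" using pos[OF that] by (auto simp: fun_eq_iff)
    qed (use GF in auto)
    then show ?thesis unfolding has_field_derivative_def
      by (rule has_derivative_eq_rhs) (simp add: fun_eq_iff)
  qed
  show ?thesis using that GF dG mono by blast
qed

text \<open>
  Monotone transport from \<open>g w\<close> to \<open>w\<close> on \<open>[-K, K]\<close>: with the transport map \<open>T\<close> and
  \<open>d = T - id\<close>, the change of variables formula and \<open>ln (1 + d') \<le> d'\<close> give
  \<open>g w ln (c g) \<le> (g d w)' + w g'\<^sup>2 / (2 g)\<close>, and \<open>d\<close> vanishes at both ends.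
\<close>
lemma log_Sobolev_interval:
  fixes K :: real and g g' w :: "real \<Rightarrow> real"
  assumes K: "K > 0" and w: "w = (\<lambda>x. exp (- x\<^sup>2 / 2))"
    and cg: "continuous_on {-K..K} g" and gpos: "\<And>x. x \<in> {-K..K} \<Longrightarrow> g x > 0"
    and S: "finite S"
    and dg: "\<And>x. x \<in> {-K<..<K} - S \<Longrightarrow> (g has_real_derivative g' x) (at x)"
    and int: "(\<lambda>x. w x * (g' x)\<^sup>2 / g x) integrable_on {-K..K}"
    and Z: "Z = integral {-K..K} w" and m: "m = integral {-K..K} (\<lambda>x. g x * w x)"
  shows "integral {-K..K} (\<lambda>x. g x * w x * ln (Z / m * g x))
      \<le> integral {-K..K} (\<lambda>x. w x * (g' x)\<^sup>2 / g x) / 2"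
proof -
  have wpos: "w x > 0" for x by (simp add: w)
  have cw: "continuous_on A w" for A unfolding w by (intro continuous_intros) auto
  have cgw: "continuous_on {-K..K} (\<lambda>x. g x * w x)" by (intro continuous_intros cg cw)
  \<comment> \<open>The primitive starts one unit left of \<open>-K\<close>, so that
    \<open>A\<close> is differentiable on an open interval containing both endpoints and its inverse
    can be differentiated there as well.\<close>
  define a where "a = - K - 1"
  define A where "A x = integral {a..x} w" for x
  have dA: "(A has_real_derivative w x) (at x)" if "x \<in> {a<..<K+1}" for x
  proof -
    have "((\<lambda>u. integral {a..u} w) has_real_derivative w x) (at x within {a..K+1})"
      by (rule integral_has_real_derivative[OF cw]) (use that in auto)
    moreover have "at x within {a..K+1} = at x"
      by (rule at_within_interior) (use that in auto)
    ultimately show ?thesis by (simp add: A_def[abs_def])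
  qed
  obtain G where GA: "\<And>x. x \<in> {a<..<K+1} \<Longrightarrow> G (A x) = x"
    and dG: "\<And>x. x \<in> {a<..<K+1} \<Longrightarrow> (G has_real_derivative 1 / w x) (at (A x))"
    and Amono: "\<And>x y. x \<in> {a<..<K+1} \<Longrightarrow> y \<in> {a<..<K+1} \<Longrightarrow> x < y \<Longrightarrow> A x < A y"
    by (rule increasing_inverse_deriv[of "{a<..<K+1}" A w])
       (use dA wpos in \<open>auto simp: is_interval_convex_1\<close>)
  have Zpos: "Z > 0" "Z = A K - A (-K)"
  proof -
    have "A (-K) + integral {-K..K} w = A K" unfolding A_def
      by (rule Henstock_Kurzweil_Integration.integral_combine)
         (use K integrable_continuous_interval[OF cw] in \<open>auto simp: a_def\<close>)
    then show "Z = A K - A (-K)" by (simp add: Z)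
    with Amono[of "-K" K] K show "Z > 0" by (auto simp: a_def)
  qed
  define B where "B x = integral {-K..x} (\<lambda>x. g x * w x)" for x
  have dB: "(B has_real_derivative g x * w x) (at x within {-K..K})" if "x \<in> {-K..K}" for x
    unfolding B_def[abs_def] by (rule integral_has_real_derivative[OF cgw that])
  have dB': "(B has_real_derivative g x * w x) (at x)" if "x \<in> {-K<..<K}" for x
  proof -
    have "at x within {-K..K} = at x"
      by (rule at_within_interior) (use that in auto)
    with dB[of x] that show ?thesis by auto
  qed
  have cB: "continuous_on {-K..K} B"
    using dB by (intro DERIV_continuous_on) 
  have Bmono: "B x < B y" if "x \<in> {-K..K}" "y \<in> {-K..K}" "x < y" for x y
  proof (rule DERIV_pos_imp_increasing_open[OF that(3)])
    show "\<exists>l. (B has_real_derivative l) (at z) \<and> 0 < l" if "x < z" "z < y" for z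
      using dB'[of z] that \<open>x \<in> _\<close> \<open>y \<in> _\<close> gpos[of z] wpos[of z]
      by (intro exI[of _ "g z * w z"]) auto
    show "continuous_on {x..y} B"
      by (rule continuous_on_subset[OF cB]) (use that in auto)
  qed
  have B0: "B (-K) = 0" "B K = m" by (auto simp: B_def m)
  have mpos: "m > 0" using Bmono[of "-K" K] B0 K by auto
  \<comment> \<open>The factor equating the masses: \<open>c g w\<close> and \<open>w\<close> both
    have mass \<open>Z\<close> on the interval. This is what makes the transport fix the two
    endpoints.\<close>
  define c where "c = Z / m"
  have cpos: "c > 0" using Zpos mpos by (simp add: c_def)
  define b where "b x = A (-K) + c * B x" for x
  have b_range: "\<exists>y\<in>{-K..K}. A y = b x" if "x \<in> {-K..K}" for x
  proof -
    have "0 \<le> B x" using Bmono[of "-K" x] that B0 by (cases "x = -K") auto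
    moreover have "B x \<le> m" using Bmono[of x K] that B0 by (cases "x = K") auto
    ultimately have "A (-K) \<le> b x" "b x \<le> A (-K) + c * m"
      using cpos by (auto simp: b_def)
    moreover have "c * m = Z" using mpos by (simp add: c_def)
    ultimately have "A (-K) \<le> b x" "b x \<le> A K" using Zpos by auto
    moreover have "continuous_on {-K..K} A"
      by (rule DERIV_continuous_on, rule has_field_derivative_at_within, rule dA)
         (auto simp: a_def)
    ultimately show ?thesis using IVT'[of A "-K" "b x" K] K by force
  qed
  define T where "T x = G (b x)" for x
  have T: "T x \<in> {-K..K}" "A (T x) = b x" if xK: "x \<in> {-K..K}" for x
  proof -
    obtain y where y: "y \<in> {-K..K}" "A y = b x" using b_range[OF xK] by auto
    have "G (A y) = y" by (rule GA) (use y in \<open>auto simp: a_def\<close>)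
    then have "T x = y" using y by (simp add: T_def)
    with y show "T x \<in> {-K..K}" "A (T x) = b x" by auto
  qed
  have Tend: "T (-K) = -K" "T K = K"
  proof -
    have "b (-K) = A (-K)" "b K = A K" using B0 Zpos mpos by (auto simp: b_def c_def)
    then show "T (-K) = -K" "T K = K" unfolding T_def using GA[of "-K"] GA[of K] K
      by (auto simp: a_def)
  qed
  have dG': "(G has_real_derivative 1 / w (T x)) (at (b x))" if "x \<in> {-K..K}" for x
    using dG[of "T x"] T[OF that] by (auto simp: a_def)
  have dT: "(T has_real_derivative c * g x * w x / w (T x)) (at x)" if "x \<in> {-K<..<K}" for x
  proof -
    have "(b has_real_derivative c * (g x * w x)) (at x)"
      unfolding b_def[abs_def] by (auto intro!: derivative_eq_intros dB' that)
    from DERIV_chain[OF dG' this] that show ?thesis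
      by (auto simp: T_def[abs_def] o_def mult_ac)
  qed
  have cT: "continuous_on {-K..K} T"
  proof -
    have "continuous_on {-K..K} b" unfolding b_def[abs_def] by (intro continuous_intros cB)
    moreover have "continuous_on (b ` {-K..K}) G"
      by (rule continuous_at_imp_continuous_on) (use dG' DERIV_isCont in blast)
    ultimately show ?thesis unfolding T_def[abs_def]
      using continuous_on_compose2[of "b ` {-K..K}" G "{-K..K}" b] by auto
  qed
  define d where "d x = T x - x" for x
  define d' where "d' x = c * g x * w x / w (T x) - 1" for x
  have dd: "(d has_real_derivative d' x) (at x)" if "x \<in> {-K<..<K}" for x
    unfolding d_def[abs_def] d'_def by (auto intro!: derivative_eq_intros dT that)
  define Y where "Y x = g x * d x * w x" for x
  define Y' where "Y' x = g' x * d x * w x + g x * (d' x * w x - d x * x * w x)" for x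
  have dw: "(w has_real_derivative - x * w x) (at x)" for x
    unfolding w by (auto intro!: derivative_eq_intros)
  have Yint: "(Y' has_integral (Y K - Y (-K))) {-K..K}"
  proof (rule fundamental_theorem_of_calculus_interior_strong[OF S])
    fix x assume x: "x \<in> {-K<..<K} - S"
    then have x': "x \<in> {-K<..<K}" by auto
    have "(Y has_real_derivative Y' x) (at x)"
      unfolding Y_def[abs_def] Y'_def
      by (rule derivative_eq_intros dg[OF x] dd[OF x'] dw refl)+ (simp add: algebra_simps)
    then show "(Y has_vector_derivative Y' x) (at x)"
      by (simp add: has_real_derivative_iff_has_vector_derivative)
  next
    show "continuous_on {-K..K} Y" unfolding Y_def[abs_def] d_def
      by (intro continuous_intros cg cT cw)
  qed (use K in auto)
  have Y0: "Y K - Y (-K) = 0" using Tend by (simp add: Y_def d_def)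
  have cl: "continuous_on {-K..K} (\<lambda>x. g x * w x * ln (Z / m * g x))"
    using gpos cpos by (intro continuous_intros cg cw) (force simp: c_def)+
  have main: "g x * w x * ln (Z / m * g x) \<le> Y' x + w x * (g' x)\<^sup>2 / g x / 2"
    if "x \<in> {-K..K}" for x
  proof -
    have g0: "g x > 0" using gpos that by auto
    define q where "q = c * g x * w x / w (T x)"
    have q: "q > 0" using cpos g0 wpos by (simp add: q_def)
    have "c * g x = q * (w (T x) / w x)" using wpos[of x] wpos[of "T x"] by (simp add: q_def)
    moreover have "w (T x) / w x = exp (x\<^sup>2/2 - (T x)\<^sup>2/2)"
      unfolding w exp_diff[symmetric] by simp
    ultimately have "ln (c * g x) = ln q + (x\<^sup>2/2 - (T x)\<^sup>2/2)"
      using q by (simp add: ln_mult)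
    also have "\<dots> \<le> q - 1 + (x\<^sup>2/2 - (T x)\<^sup>2/2)" using ln_le_minus_one[OF q] by simp
    also have "\<dots> = d' x - x * d x - (d x)\<^sup>2 / 2"
      by (simp add: d'_def q_def d_def power2_eq_square field_simps)
    finally have 1: "g x * w x * ln (c * g x) \<le> g x * w x * (d' x - x * d x - (d x)\<^sup>2 / 2)"
      using g0 wpos by (intro mult_left_mono) (auto simp: less_imp_le)
    \<comment> \<open>Completing the square: the cross term \<open>w d g'\<close> left over from
      \<open>Y'\<close> is paid for by the quadratic loss \<open>g w d^2 / 2\<close> of the Gaussian
      weight and by \<open>w g'^2 / (2 g)\<close>.\<close>
    have "0 \<le> w x * (d x * g x + g' x)\<^sup>2 / g x / 2"
      using g0 wpos by (simp add: less_imp_le)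
    also have "\<dots> = w x * (d x)\<^sup>2 * g x / 2 + w x * d x * g' x + w x * (g' x)\<^sup>2 / g x / 2"
      using g0 by (simp add: power2_eq_square field_simps)
    finally show ?thesis using 1
      by (simp add: Y'_def c_def algebra_simps)
  qed
  have int2: "(\<lambda>x. w x * (g' x)\<^sup>2 / g x / 2) integrable_on {-K..K}"
    by (rule integrable_on_divide[OF int])
  have Y'int: "Y' integrable_on {-K..K}" using Yint by blast
  have "integral {-K..K} (\<lambda>x. g x * w x * ln (Z / m * g x))
      \<le> integral {-K..K} (\<lambda>x. Y' x + w x * (g' x)\<^sup>2 / g x / 2)"
    by (rule integral_le[OF integrable_continuous_interval[OF cl] integrable_add[OF Y'int int2] main])
  also have "\<dots> = integral {-K..K} Y' + integral {-K..K} (\<lambda>x. w x * (g' x)\<^sup>2 / g x / 2)"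
    by (rule Henstock_Kurzweil_Integration.integral_add[OF Y'int int2])
  also have "\<dots> = integral {-K..K} (\<lambda>x. w x * (g' x)\<^sup>2 / g x) / 2"
    unfolding integral_unique[OF Yint] Y0 integral_divide by simp
  finally show ?thesis .
qed

section \<open>Tensorisation of the entropy\<close>

text \<open>Real-valued counterpart of \<open>Ent\<close>, meaningful when both integrals converge;
  \<open>Ent_eq_ent\<close> links the two. All estimates on cubes are made with this
  version.\<close>

definition ent :: "'a measure \<Rightarrow> ('a \<Rightarrow> real) \<Rightarrow> real" where
  "ent M g = (\<integral>x. g x * ln (g x) \<partial>M) - (\<integral>x. g x \<partial>M) * ln (\<integral>x. g x \<partial>M)"

lemma abs_x_ln_x_le:
  fixes x :: real
  assumes "0 < e" "e \<le> x" "x \<le> B"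
  shows "\<bar>x * ln x\<bar> \<le> B * (\<bar>ln e\<bar> + \<bar>ln B\<bar>)"
proof -
  have "ln e \<le> ln x" "ln x \<le> ln B" using assms by auto
  then have "\<bar>ln x\<bar> \<le> \<bar>ln e\<bar> + \<bar>ln B\<bar>" by linarith
  then show ?thesis using assms by (auto simp: abs_mult intro!: mult_mono)
qed

context prob_space
begin

lemma expectation_bounds:
  fixes g :: "'a \<Rightarrow> real"
  assumes "g \<in> borel_measurable M" "\<And>x. x \<in> space M \<Longrightarrow> a \<le> g x" "\<And>x. x \<in> space M \<Longrightarrow> g x \<le> b"
  shows "integrable M g" "a \<le> expectation g" "expectation g \<le> b"
proof -
  show int: "integrable M g"
  proof (rule integrable_const_bound[where B="\<bar>a\<bar> + \<bar>b\<bar>"])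
    show "AE x in M. norm (g x) \<le> \<bar>a\<bar> + \<bar>b\<bar>"
    proof (rule AE_I2)
      fix x assume "x \<in> space M"
      then show "norm (g x) \<le> \<bar>a\<bar> + \<bar>b\<bar>" using assms(2,3)[of x] by simp
    qed
  qed fact
  show "a \<le> expectation g" by (rule integral_ge_const[OF int]) (rule AE_I2, rule assms(2))
  show "expectation g \<le> b" by (rule integral_le_const[OF int]) (rule AE_I2, rule assms(3))
qed

lemma expectation_abs_bound:
  fixes g :: "'a \<Rightarrow> real"
  assumes "g \<in> borel_measurable M" "\<And>x. x \<in> space M \<Longrightarrow> \<bar>g x\<bar> \<le> b"
  shows "integrable M g" "\<bar>expectation g\<bar> \<le> b"
proof -
  have "- b \<le> g x" "g x \<le> b" if "x \<in> space M" for x using assms(2)[OF that] by auto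
  from expectation_bounds[OF assms(1) this]
  show "integrable M g" "\<bar>expectation g\<bar> \<le> b" by (auto simp: abs_le_iff)
qed

lemma abs_ent_le:
  assumes "g \<in> borel_measurable M" "0 < e" "\<And>x. x \<in> space M \<Longrightarrow> e \<le> g x"
    and "\<And>x. x \<in> space M \<Longrightarrow> g x \<le> B"
  shows "\<bar>ent M g\<bar> \<le> 2 * (B * (\<bar>ln e\<bar> + \<bar>ln B\<bar>))"
proof -
  have b: "\<bar>g x * ln (g x)\<bar> \<le> B * (\<bar>ln e\<bar> + \<bar>ln B\<bar>)" if "x \<in> space M" for x
    by (rule abs_x_ln_x_le[OF assms(2) assms(3,4)[OF that]])
  have [measurable]: "g \<in> borel_measurable M" by fact
  have "\<bar>\<integral>x. g x * ln (g x) \<partial>M\<bar> \<le> B * (\<bar>ln e\<bar> + \<bar>ln B\<bar>)"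
    by (rule expectation_abs_bound(2)[OF _ b]) auto
  moreover have "\<bar>(\<integral>x. g x \<partial>M) * ln (\<integral>x. g x \<partial>M)\<bar> \<le> B * (\<bar>ln e\<bar> + \<bar>ln B\<bar>)"
    by (rule abs_x_ln_x_le[OF assms(2)]) (rule expectation_bounds[OF assms(1,3,4)]; assumption)+
  ultimately show ?thesis unfolding ent_def by linarith
qed

text \<open>Integrates \<open>ln y <= y - 1\<close> at \<open>y = m k / (q g)\<close>, with m and q
  the means of g and k. The factor \<open>m / q\<close> gives both functions the same mean, so the
  linear part integrates to 0. Entropy is thereby bounded below by testing against any k; this
  yields its convexity and, later, integrability from finite energy.\<close>

lemma Gibbs_variational:
  assumes g: "g \<in> borel_measurable M" "\<And>x. x \<in> space M \<Longrightarrow> e \<le> g x" "\<And>x. x \<in> space M \<Longrightarrow> g x \<le> B"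
    and k: "k \<in> borel_measurable M" "\<And>x. x \<in> space M \<Longrightarrow> e \<le> k x" "\<And>x. x \<in> space M \<Longrightarrow> k x \<le> B"
    and e: "0 < e"
  shows "(\<integral>x. g x * ln (k x) \<partial>M) - expectation g * ln (expectation k) \<le> ent M g"
proof -
  have [measurable]: "g \<in> borel_measurable M" "k \<in> borel_measurable M" by fact+
  define m where "m = expectation g"
  define q where "q = expectation k"
  have m: "m > 0" "integrable M g" and q: "q > 0" "integrable M k"
    using expectation_bounds[OF g] expectation_bounds[OF k] e by (auto simp: m_def q_def)
  have i1: "integrable M (\<lambda>x. g x * ln (g x))"
    by (rule expectation_abs_bound(1)[OF _ abs_x_ln_x_le[OF e g(2,3)]]) auto
  have i2: "integrable M (\<lambda>x. g x * ln (k x))"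
  proof (rule expectation_abs_bound(1)[where b="B * (\<bar>ln e\<bar> + \<bar>ln B\<bar>)"])
    fix x assume x: "x \<in> space M"
    have "ln e \<le> ln (k x)" "ln (k x) \<le> ln B" using k(2,3)[OF x] e by auto
    then have "\<bar>ln (k x)\<bar> \<le> \<bar>ln e\<bar> + \<bar>ln B\<bar>" by linarith
    then show "\<bar>g x * ln (k x)\<bar> \<le> B * (\<bar>ln e\<bar> + \<bar>ln B\<bar>)"
      using g(2,3)[OF x] e by (auto simp: abs_mult intro!: mult_mono)
  qed auto
  have "(\<integral>x. g x - m / q * k x \<partial>M) \<le> (\<integral>x. g x * ln (g x) - g x * ln (k x) + (ln q - ln m) * g x \<partial>M)"
  proof (rule integral_mono)
    fix x assume x: "x \<in> space M"
    have gx: "g x > 0" and kx: "k x > 0" using g(2)[OF x] k(2)[OF x] e by auto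
    define y where "y = m / q * k x"
    have y: "y > 0" using m q kx by (simp add: y_def)
    have "ln (y / g x) \<le> y / g x - 1" by (rule ln_le_minus_one) (use y gx in simp)
    then have "g x * ln (y / g x) \<le> y - g x"
      using gx by (simp add: field_simps)
    moreover have "ln (y / g x) = ln m - ln q + ln (k x) - ln (g x)"
      using m q gx kx by (simp add: y_def ln_div ln_mult)
    ultimately have "g x * (ln m - ln q + ln (k x) - ln (g x)) \<le> y - g x" by simp
    then show "g x - m / q * k x \<le> g x * ln (g x) - g x * ln (k x) + (ln q - ln m) * g x"
      by (simp add: y_def algebra_simps)
  qed (use m q i1 i2 in auto)
  also have "\<dots> = (\<integral>x. g x * ln (g x) \<partial>M) - (\<integral>x. g x * ln (k x) \<partial>M) + (ln q - ln m) * m"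
    using m q i1 i2 by (simp add: m_def)
  also have "(\<integral>x. g x - m / q * k x \<partial>M) = 0"
    using m q by (simp add: m_def q_def)
  finally show ?thesis unfolding ent_def m_def[symmetric] q_def[symmetric]
    by (simp add: algebra_simps)
qed

end

text \<open>Convexity of the entropy. Every slice is tested by \<open>Gibbs_variational\<close>
  against one and the same function, the average over t; averaging these lower bounds gives exactly
  the entropy of the average.\<close>

lemma ent_integral_le:
  fixes u :: "'a \<Rightarrow> 'b \<Rightarrow> real"
  assumes P: "prob_space P" "prob_space Q"
    and u[measurable]: "case_prod u \<in> borel_measurable (P \<Otimes>\<^sub>M Q)"
    and e: "0 < e" and bd: "\<And>s t. s \<in> space P \<Longrightarrow> t \<in> space Q \<Longrightarrow> e \<le> u s t \<and> u s t \<le> B"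
  shows "ent P (\<lambda>s. \<integral>t. u s t \<partial>Q) \<le> (\<integral>t. ent P (\<lambda>s. u s t) \<partial>Q)"
proof -
  interpret P: prob_space P by fact
  interpret Q: prob_space Q by fact
  interpret PQ: pair_prob_space P Q ..
  define G where "G s = (\<integral>t. u s t \<partial>Q)" for s
  have G[measurable]: "G \<in> borel_measurable P" unfolding G_def[abs_def] by measurable
  have G2: "e \<le> G s" "G s \<le> B" if "s \<in> space P" for s
    unfolding G_def by (rule Q.expectation_bounds; use bd that in auto)+
  define C where "C = B * (\<bar>ln e\<bar> + \<bar>ln B\<bar>)"
  have intG: "integrable (P \<Otimes>\<^sub>M Q) (\<lambda>(s,t). u s t * ln (G s))"
  proof (rule PQ.expectation_abs_bound(1)[where b=C])
    fix x assume x: "x \<in> space (P \<Otimes>\<^sub>M Q)"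
    then obtain s t where st: "x = (s,t)" "s \<in> space P" "t \<in> space Q"
      by (auto simp: space_pair_measure)
    have "ln e \<le> ln (G s)" "ln (G s) \<le> ln B" using G2[of s] e st by auto
    then have "\<bar>ln (G s)\<bar> \<le> \<bar>ln e\<bar> + \<bar>ln B\<bar>" by linarith
    then show "\<bar>case x of (s, t) \<Rightarrow> u s t * ln (G s)\<bar> \<le> C"
      using bd[of s t] st e by (auto simp: abs_mult C_def intro!: mult_mono)
  qed measurable
  have intu: "integrable (P \<Otimes>\<^sub>M Q) (\<lambda>(s,t). u s t)"
    by (rule PQ.expectation_bounds(1)[where a=e and b=B]) (use bd in \<open>auto simp: space_pair_measure\<close>)
  define a where "a t = (\<integral>s. u s t * ln (G s) \<partial>P) - (\<integral>s. u s t \<partial>P) * ln (P.expectation G)" for t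
  have "(\<integral>t. (\<integral>s. u s t * ln (G s) \<partial>P) \<partial>Q) = (\<integral>s. (\<integral>t. u s t * ln (G s) \<partial>Q) \<partial>P)"
    by (rule PQ.Fubini_integral) (rule intG)
  then have 1: "(\<integral>t. (\<integral>s. u s t * ln (G s) \<partial>P) \<partial>Q) = (\<integral>s. G s * ln (G s) \<partial>P)"
    by (simp add: G_def)
  have 2: "(\<integral>t. (\<integral>s. u s t \<partial>P) \<partial>Q) = P.expectation G"
    unfolding G_def by (rule PQ.Fubini_integral) (rule intu)
  have i1: "integrable Q (\<lambda>t. \<integral>s. u s t * ln (G s) \<partial>P)"
    by (rule PQ.integrable_snd) (rule intG)
  have i2: "integrable Q (\<lambda>t. \<integral>s. u s t \<partial>P)"
    by (rule PQ.integrable_snd) (rule intu)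
  have "ent P G = (\<integral>t. a t \<partial>Q)"
    unfolding a_def ent_def using i1 i2 by (simp add: 1 2)
  also have "\<dots> \<le> (\<integral>t. ent P (\<lambda>s. u s t) \<partial>Q)"
  proof (rule integral_mono)
    show "integrable Q a" unfolding a_def using i1 i2 by simp
    show "integrable Q (\<lambda>t. ent P (\<lambda>s. u s t))"
    proof (rule Q.expectation_abs_bound(1))
      show "(\<lambda>t. ent P (\<lambda>s. u s t)) \<in> borel_measurable Q" unfolding ent_def by measurable
      fix t assume t: "t \<in> space Q"
      have "(\<lambda>s. u s t) \<in> borel_measurable P" using t by measurable
      then show "\<bar>ent P (\<lambda>s. u s t)\<bar> \<le> 2 * (B * (\<bar>ln e\<bar> + \<bar>ln B\<bar>))"
        by (rule P.abs_ent_le) (use e bd t in auto)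
    qed
    fix t assume t: "t \<in> space Q"
    have "(\<lambda>s. u s t) \<in> borel_measurable P" using t by measurable
    then show "a t \<le> ent P (\<lambda>s. u s t)"
      unfolding a_def by (rule P.Gibbs_variational) (use bd t e G G2 in auto)
  qed
  finally show ?thesis by (simp add: G_def[abs_def])
qed

lemma measurable_fun_upd_pair:
  assumes "i \<in> J"
  shows "(\<lambda>(x, t). x(i := t)) \<in> measurable (Pi\<^sub>M J M \<Otimes>\<^sub>M M i) (Pi\<^sub>M J M)"
proof -
  have "(\<lambda>p. (fst p)(i := snd p)) \<in> measurable (Pi\<^sub>M J M \<Otimes>\<^sub>M M i) (Pi\<^sub>M J M)"
    by (rule measurable_fun_upd[where J=J]) (use assms in auto)
  then show ?thesis by (simp add: case_prod_beta')
qed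

text \<open>Subadditivity by induction on the index set. Integrating out coordinate i splits the
  entropy into the mean entropy in that coordinate and the entropy of the average \<open>G\<close>.
  The induction hypothesis handles \<open>G\<close>, and \<open>ent_integral_le\<close> takes the
  average over coordinate i out of the entropies in the other coordinates.\<close>

lemma ent_PiM_le:
  fixes P :: "'b measure" and g :: "('a \<Rightarrow> 'b) \<Rightarrow> real"
  assumes P: "prob_space P" and I: "finite I" and e: "0 < e"
    and g: "g \<in> borel_measurable (Pi\<^sub>M I (\<lambda>_. P))"
    and bd: "\<And>x. x \<in> space (Pi\<^sub>M I (\<lambda>_. P)) \<Longrightarrow> e \<le> g x \<and> g x \<le> B"
  shows "ent (Pi\<^sub>M I (\<lambda>_. P)) g \<le> (\<Sum>i\<in>I. \<integral>x. ent P (\<lambda>t. g (x(i := t))) \<partial>Pi\<^sub>M I (\<lambda>_. P))"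
  using I g bd
proof (induction I arbitrary: g rule: finite_induct)
  case empty
  have "(\<integral>x. h x \<partial>Pi\<^sub>M {} (\<lambda>_. P)) = h (\<lambda>_. undefined)" for h :: "('a \<Rightarrow> 'b) \<Rightarrow> real"
    by (simp add: PiM_empty lebesgue_integral_count_space_finite)
  then show ?case by (simp add: ent_def)
next
  case (insert i I)
  interpret P: prob_space P by fact
  interpret pp: product_prob_space "\<lambda>_. P" "UNIV :: 'a set" by (intro product_prob_spaceI P)
  define Q where "Q = Pi\<^sub>M I (\<lambda>_. P)"
  define R where "R = Pi\<^sub>M (insert i I) (\<lambda>_. P)"
  have PQ: "prob_space Q" and PR: "prob_space R"
    unfolding Q_def R_def by (auto intro!: prob_space_PiM P)
  interpret Q: prob_space Q by fact
  interpret R: prob_space R by fact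
  have g[measurable]: "g \<in> borel_measurable R" using insert.prems by (simp add: R_def)
  have bd: "e \<le> g x" "g x \<le> B" if "x \<in> space R" for x
    using insert.prems(2)[of x] that by (auto simp: R_def)
  have upd[measurable]: "(\<lambda>(x, t). x(i := t)) \<in> measurable (Q \<Otimes>\<^sub>M P) R"
    unfolding Q_def R_def by (rule measurable_add_dim)
  have updR[measurable]: "(\<lambda>(x, t). x(k := t)) \<in> measurable (R \<Otimes>\<^sub>M P) R" if "k \<in> insert i I" for k
    unfolding R_def by (rule measurable_fun_upd_pair) (use that in auto)
  have updQ[measurable]: "(\<lambda>(x, t). x(k := t)) \<in> measurable (Q \<Otimes>\<^sub>M P) Q" if "k \<in> I" for k
    unfolding Q_def by (rule measurable_fun_upd_pair) (use that in auto)
  define C where "C = B * (\<bar>ln e\<bar> + \<bar>ln B\<bar>)"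
  have spR: "x(i := t) \<in> space R" if "x \<in> space Q" "t \<in> space P" for x t
    using measurable_space[OF upd, of "(x,t)"] that by (auto simp: space_pair_measure)
  have spRk: "x(k := t) \<in> space R" if "x \<in> space R" "t \<in> space P" "k \<in> insert i I" for x k t
    using measurable_space[OF updR, of k "(x,t)"] that by (auto simp: space_pair_measure)
  have spQk: "x(k := t) \<in> space Q" if "x \<in> space Q" "t \<in> space P" "k \<in> I" for x k t
    using measurable_space[OF updQ, of k "(x,t)"] that by (auto simp: space_pair_measure)
  have gu[measurable]: "(\<lambda>(x,t). g (x(i := t))) \<in> borel_measurable (Q \<Otimes>\<^sub>M P)"
    using measurable_compose[OF upd g] by (simp add: case_prod_beta')
  have gRk: "(\<lambda>(x,t). g (x(k := t))) \<in> borel_measurable (R \<Otimes>\<^sub>M P)" if "k \<in> insert i I" for k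
    using measurable_compose[OF updR[OF that] g] by (simp add: case_prod_beta')
  have fold: "(\<integral>x. h x \<partial>R) = (\<integral>x. \<integral>t. h (x(i := t)) \<partial>P \<partial>Q)" if "integrable R h" for h :: "_ \<Rightarrow> real"
    unfolding R_def Q_def
    by (rule pp.product_integral_insert) (use insert that in \<open>auto simp: R_def\<close>)
  define G where "G x = (\<integral>t. g (x(i := t)) \<partial>P)" for x
  have G[measurable]: "G \<in> borel_measurable Q" unfolding G_def[abs_def] by measurable
  have gx: "(\<lambda>t. g (x(i := t))) \<in> borel_measurable P" if "x \<in> space Q" for x
    using gu that by measurable
  have G2: "e \<le> G x" "G x \<le> B" if "x \<in> space Q" for x
    unfolding G_def by (rule P.expectation_bounds[OF gx[OF that]]; use bd spR that in auto)+
  define a where "a k x = ent P (\<lambda>t. g (x(k := t)))" for k x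
  have aR: "a k \<in> borel_measurable R" if "k \<in> insert i I" for k
  proof -
    note gRk[OF that, measurable]
    show ?thesis unfolding a_def[abs_def] ent_def by measurable
  qed
  have aRb: "\<bar>a k x\<bar> \<le> 2 * C" if "x \<in> space R" "k \<in> insert i I" for x k
  proof -
    have "(\<lambda>t. g (x(k := t))) \<in> borel_measurable P"
      using gRk[OF that(2)] that(1) by measurable
    then show ?thesis unfolding a_def C_def
      by (rule P.abs_ent_le) (use e bd that spRk in auto)
  qed
  have aRint: "integrable R (a k)" if "k \<in> insert i I" for k
    by (rule R.expectation_abs_bound(1)[OF aR[OF that]]) (use aRb that in blast)
  have ai: "a i (x(i := t)) = a i x" for x t by (simp add: a_def)
  have aQ[measurable]: "a i \<in> borel_measurable Q"
    unfolding a_def[abs_def] ent_def by measurable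
  have aQb: "\<bar>a i x\<bar> \<le> 2 * C" if "x \<in> space Q" for x
  proof -
    obtain t where "t \<in> space P" using P.not_empty by blast
    then show ?thesis using aRb[of "x(i := t)" i] spR[OF that] by (simp add: ai)
  qed
  have aQint: "integrable Q (a i)"
    by (rule Q.expectation_abs_bound(1)[OF aQ aQb])
  have jg: "integrable R (\<lambda>x. g x * ln (g x))"
    by (rule R.expectation_abs_bound(1)[OF _ abs_x_ln_x_le[OF e bd]]) auto
  have jG: "integrable Q (\<lambda>x. G x * ln (G x))"
    by (rule Q.expectation_abs_bound(1)[OF _ abs_x_ln_x_le[OF e G2]]) auto
  have gint: "integrable R g" using R.expectation_bounds[OF g bd] by auto
  have "ent R g = (\<integral>x. \<integral>t. g (x(i := t)) * ln (g (x(i := t))) \<partial>P \<partial>Q)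
      - (\<integral>x. G x \<partial>Q) * ln (\<integral>x. G x \<partial>Q)"
    unfolding ent_def by (simp add: fold[OF jg] fold[OF gint] G_def)
  also have "(\<integral>x. \<integral>t. g (x(i := t)) * ln (g (x(i := t))) \<partial>P \<partial>Q) = (\<integral>x. a i x + G x * ln (G x) \<partial>Q)"
    by (simp add: a_def ent_def G_def)
  also have "\<dots> = (\<integral>x. a i x \<partial>Q) + (\<integral>x. G x * ln (G x) \<partial>Q)" using aQint jG by simp
  finally have split: "ent R g = (\<integral>x. a i x \<partial>Q) + ent Q G" by (simp add: ent_def)
  have 1: "(\<integral>x. a i x \<partial>Q) = (\<integral>x. a i x \<partial>R)"
    using aRint[of i] by (simp add: fold ai P.prob_space)
  have "ent Q G \<le> (\<Sum>k\<in>I. \<integral>x. ent P (\<lambda>s. G (x(k := s))) \<partial>Q)"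
    unfolding Q_def by (rule insert.IH) (use G G2 in \<open>auto simp: Q_def\<close>)
  also have "\<dots> \<le> (\<Sum>k\<in>I. \<integral>x. a k x \<partial>R)"
  proof (rule sum_mono)
    fix k assume k: "k \<in> I"
    then have ki: "k \<noteq> i" using insert by auto
    have kk: "k \<in> insert i I" using k by auto
    note updQ[OF k, measurable] aR[OF kk, measurable]
    have GQ[measurable]: "(\<lambda>(x,t). G (x(k := t))) \<in> borel_measurable (Q \<Otimes>\<^sub>M P)"
      using measurable_compose[OF updQ[OF k] G] by (simp add: case_prod_beta')
    have m1: "(\<lambda>x. ent P (\<lambda>s. G (x(k := s)))) \<in> borel_measurable Q"
      unfolding ent_def by measurable
    have au: "(\<lambda>(x,t). a k (x(i := t))) \<in> borel_measurable (Q \<Otimes>\<^sub>M P)"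
      using measurable_compose[OF upd aR[OF kk]] by (simp add: case_prod_beta')
    note au[measurable]
    have "(\<integral>x. ent P (\<lambda>s. G (x(k := s))) \<partial>Q) \<le> (\<integral>x. \<integral>t. a k (x(i := t)) \<partial>P \<partial>Q)"
    proof (rule integral_mono)
      show "integrable Q (\<lambda>x. ent P (\<lambda>s. G (x(k := s))))"
      proof (rule Q.expectation_abs_bound(1)[OF m1])
        fix x assume x: "x \<in> space Q"
        have "(\<lambda>s. G (x(k := s))) \<in> borel_measurable P" using GQ x by measurable
        then show "\<bar>ent P (\<lambda>s. G (x(k := s)))\<bar> \<le> 2 * (B * (\<bar>ln e\<bar> + \<bar>ln B\<bar>))"
          by (rule P.abs_ent_le) (use e G2 spQk x k in auto)
      qed
      show "integrable Q (\<lambda>x. \<integral>t. a k (x(i := t)) \<partial>P)"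
      proof (rule Q.expectation_abs_bound(1))
        show "(\<lambda>x. \<integral>t. a k (x(i := t)) \<partial>P) \<in> borel_measurable Q" by measurable
        fix x assume x: "x \<in> space Q"
        have "(\<lambda>t. a k (x(i := t))) \<in> borel_measurable P" using au x by measurable
        then show "\<bar>\<integral>t. a k (x(i := t)) \<partial>P\<bar> \<le> 2 * C"
          by (rule P.expectation_abs_bound(2)) (use aRb spR x kk in blast)
      qed
      fix x assume x: "x \<in> space Q"
      have "(\<lambda>(s,t). g ((x(k := s))(i := t))) \<in> borel_measurable (P \<Otimes>\<^sub>M P)"
      proof -
        have "(\<lambda>p. (x(k := fst p))) \<in> measurable (P \<Otimes>\<^sub>M P) Q"
          using measurable_compose[OF measurable_Pair1'[OF x] updQ[OF k]]
          by (auto intro: measurable_compose[OF measurable_fst])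
        then have "(\<lambda>p. (x(k := fst p), snd p)) \<in> measurable (P \<Otimes>\<^sub>M P) (Q \<Otimes>\<^sub>M P)" by measurable
        from measurable_compose[OF this gu] show ?thesis by (simp add: case_prod_beta')
      qed
      then have "ent P (\<lambda>s. \<integral>t. g ((x(k := s))(i := t)) \<partial>P) \<le> (\<integral>t. ent P (\<lambda>s. g ((x(k := s))(i := t))) \<partial>P)"
        by (rule ent_integral_le[OF P P _ e]) (use bd spR spQk x k in blast)
      also have "(\<lambda>t s. g ((x(k := s))(i := t))) = (\<lambda>t s. g ((x(i := t))(k := s)))"
        using ki by (auto simp: fun_upd_twist)
      finally show "ent P (\<lambda>s. G (x(k := s))) \<le> (\<integral>t. a k (x(i := t)) \<partial>P)"
        by (simp add: G_def a_def fun_upd_twist[OF ki])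
    qed
    also have "\<dots> = (\<integral>x. a k x \<partial>R)" using fold[OF aRint[OF kk]] by simp
    finally show "(\<integral>x. ent P (\<lambda>s. G (x(k := s))) \<partial>Q) \<le> (\<integral>x. a k x \<partial>R)" .
  qed
  finally have "ent R g \<le> (\<integral>x. a i x \<partial>R) + (\<Sum>k\<in>I. \<integral>x. a k x \<partial>R)"
    using split 1 by simp
  then show ?case unfolding R_def a_def sum.insert[OF insert(1,2)] .
qed

section \<open>Radial laws\<close>

text \<open>The points \<open>a + d\<close> and \<open>c\<close> are convex combinations of
  \<open>a\<close> and \<open>c + d\<close> with complementary weights, so adding the two convexity
  inequalities cancels the weights.\<close>

lemma convex_increments_mono:
  fixes f :: "real \<Rightarrow> real"
  assumes f: "convex_on D f" and D: "a \<in> D" "c + d \<in> D" and le: "a \<le> c" "0 \<le> d"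
  shows "f (a + d) + f c \<le> f a + f (c + d)"
proof (cases "c - a + d = 0")
  case True
  then have "c = a" "d = 0" using le by auto
  then show ?thesis by simp
next
  case False
  define s where "s = c - a + d"
  have s: "s > 0" using False le by (simp add: s_def)
  define l where "l = d / s"
  have l: "0 \<le> l" "l \<le> 1" using s le by (auto simp: l_def s_def)
  have ls: "l * s = d" using s by (simp add: l_def)
  have e1: "(1 - l) *\<^sub>R a + l *\<^sub>R (c + d) = a + d" and e2: "l *\<^sub>R a + (1 - l) *\<^sub>R (c + d) = c"
    using ls by (auto simp: s_def algebra_simps)
  have "f (a + d) \<le> (1 - l) * f a + l * f (c + d)"
    using convex_onD[OF f, of l a "c + d"] l D unfolding e1 by auto
  moreover have "f c \<le> l * f a + (1 - l) * f (c + d)"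
    using convex_onD[OF f, of "1 - l" a "c + d"] l D e2 by auto
  ultimately have "f (a + d) + f c \<le> ((1 - l) * f a + l * f (c + d)) + (l * f a + (1 - l) * f (c + d))"
    by (rule add_mono)
  then show ?thesis by (simp add: left_diff_distrib)
qed

text \<open>A consequence of \<open>ln (sqrt y) <= sqrt y - 1\<close>. It turns a Gamma-type tail
  into one that is Gaussian in \<open>sqrt y\<close>, on both sides of y = 1 at once.\<close>

lemma mult_exp_le_sqrt:
  fixes y :: real
  assumes "y > 0"
  shows "y * exp (1 - y) \<le> exp (- (sqrt y - 1)\<^sup>2)"
proof -
  have "ln (sqrt y) \<le> sqrt y - 1" using assms by (intro ln_le_minus_one) auto
  then have "ln y \<le> 2 * (sqrt y - 1)" using assms by (simp add: ln_sqrt)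
  then have "ln y + (1 - y) \<le> - (sqrt y - 1)\<^sup>2"
    using assms by (simp add: power2_eq_square algebra_simps)
  then have "exp (ln y + (1 - y)) \<le> exp (- (sqrt y - 1)\<^sup>2)" by simp
  then show ?thesis using assms by (simp add: exp_add)
qed

text \<open>The potential \<open>v\<close> absorbs all normalising constants, whence
  \<open>total\<close>. The set \<open>D\<close> is an interval (0, R) or the positive half-line; an
  open choice loses at most a boundary point and makes the convex \<open>v\<close> continuous on
  it.\<close>

locale radial_density =
  fixes n :: nat and D :: "real set" and v :: "real \<Rightarrow> real"
  assumes n: "n \<ge> 1" and D_open: "open D" and D_pos: "\<And>x. x \<in> D \<Longrightarrow> 0 < x"
    and D_down: "\<And>x y. y \<in> D \<Longrightarrow> 0 < x \<Longrightarrow> x \<le> y \<Longrightarrow> x \<in> D" and D_ne: "D \<noteq> {}"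
    and v_convex: "convex_on D v"
    and v_mono: "\<And>x y. x \<in> D \<Longrightarrow> y \<in> D \<Longrightarrow> x \<le> y \<Longrightarrow> v x \<le> v y"
    and total: "(\<integral>\<^sup>+x. ennreal (indicator D x * (x ^ (n - 1) * exp (- v x))) \<partial>lborel) = 1"
begin

definition h :: "real \<Rightarrow> real" where "h x = indicator D x * (x ^ (n - 1) * exp (- v x))"

definition law :: "real measure" where "law = density lborel (\<lambda>x. ennreal (h x))"

abbreviation "F \<equiv> cdf law"

definition Fb :: "real \<Rightarrow> real" where "Fb x = 1 - F x"

text \<open>The derivative of \<open>ln F\<close> with respect to \<open>ln x\<close>, hence
  invariant under scaling. Likewise \<open>hazard\<close> below is the failure rate, the derivative
  of \<open>- ln Fb\<close>.\<close>

definition kappa :: "real \<Rightarrow> real" where "kappa x = x * h x / F x"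

definition hazard :: "real \<Rightarrow> real" where "hazard x = h x / Fb x"

lemma D_borel[measurable]: "D \<in> sets borel" using D_open by simp

lemma D_interval: "is_interval D"
  unfolding is_interval_1 using D_down D_pos by (meson order_less_le_trans)

lemma h_D: "x \<in> D \<Longrightarrow> h x = x ^ (n - 1) * exp (- v x)" by (simp add: h_def)

lemma h_0: "x \<notin> D \<Longrightarrow> h x = 0" by (simp add: h_def)

lemma h_nonneg: "0 \<le> h x" using D_pos[of x] by (auto simp: h_def indicator_def less_imp_le)

lemma h_pos: "x \<in> D \<Longrightarrow> 0 < h x" using D_pos[of x] by (auto simp: h_D)

lemma v_cont: "continuous_on D v" by (rule convex_on_continuous[OF D_open v_convex])

lemma h_cont: "continuous_on D h"
proof -
  have "continuous_on D (\<lambda>x. x ^ (n - 1) * exp (- v x))" by (intro continuous_intros v_cont)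
  then show ?thesis using h_D by (simp cong: continuous_on_cong)
qed

lemma h_borel[measurable]: "h \<in> borel_measurable borel"
proof -
  have "continuous_on D (\<lambda>x. x ^ (n - 1) * exp (- v x))" by (intro continuous_intros v_cont)
  then have "(\<lambda>x. indicator D x *\<^sub>R (x ^ (n - 1) * exp (- v x))) \<in> borel_measurable borel"
    by (rule borel_measurable_continuous_on_indicator[rotated]) simp
  then show ?thesis by (simp add: h_def[abs_def])
qed

lemma emeasure_law: "A \<in> sets borel \<Longrightarrow> emeasure law A = (\<integral>\<^sup>+x. ennreal (h x) * indicator A x \<partial>lborel)"
  by (simp add: law_def emeasure_density)

sublocale law: real_distribution law
proof (intro real_distribution.intro prob_spaceI real_distribution_axioms.intro)
  show "emeasure law (space law) = 1"
    using total emeasure_law[of UNIV] by (simp add: law_def h_def[abs_def])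
qed (simp_all add: law_def)

lemma sets_law[simp, measurable_cong]: "sets law = sets borel" by (simp add: law_def)

lemma F_nn: "ennreal (F x) = (\<integral>\<^sup>+y. ennreal (h y) * indicator {..x} y \<partial>lborel)"
  by (simp add: cdf_def law.emeasure_eq_measure[symmetric] emeasure_law)

lemma Fb_nn: "ennreal (Fb x) = (\<integral>\<^sup>+y. ennreal (h y) * indicator {x<..} y \<partial>lborel)"
proof -
  have "measure law (UNIV - {..x}) = 1 - measure law {..x}"
    using law.prob_compl[of "{..x}"] by simp
  moreover have "UNIV - {..x} = {x<..}" by auto
  ultimately have "Fb x = measure law {x<..}" by (simp add: Fb_def cdf_def)
  then show ?thesis by (simp add: law.emeasure_eq_measure[symmetric] emeasure_law)
qed

lemma F_diff:
  assumes "a \<in> D" "b \<in> D" "a \<le> b"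
  shows "F b - F a = integral {a..b} h"
proof -
  have sub: "{a..b} \<subseteq> D" using D_down[OF assms(2)] D_pos[OF assms(1)] by auto
  have "(h has_integral integral {a..b} h) {a..b}"
    by (intro integrable_integral integrable_continuous_interval continuous_on_subset[OF h_cont sub])
  then have *: "(\<integral>\<^sup>+x. ennreal (h x) * indicator {a..b} x \<partial>lborel) = ennreal (integral {a..b} h)"
    by (intro nn_integral_has_integral_lebesgue' h_nonneg)
  have "AE x in lborel. x \<noteq> a" by (rule AE_lborel_singleton)
  then have "(\<integral>\<^sup>+x. ennreal (h x) * indicator {a..b} x \<partial>lborel) = (\<integral>\<^sup>+x. ennreal (h x) * indicator {a<..b} x \<partial>lborel)"
    by (intro nn_integral_cong_AE) (auto simp: indicator_def)
  also have "\<dots> = ennreal (measure law {a<..b})"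
    by (simp add: law.emeasure_eq_measure[symmetric] emeasure_law)
  finally have "measure law {a<..b} = integral {a..b} h"
    using * integral_nonneg[OF integrable_continuous_interval[OF continuous_on_subset[OF h_cont sub]] h_nonneg]
    by (metis ennreal_inj measure_nonneg)
  then show ?thesis
  proof (cases "a = b")
    case False
    then show ?thesis using law.cdf_diff_eq[of a b] assms \<open>measure law _ = _\<close> by simp
  qed simp
qed

lemma F_deriv:
  assumes "x \<in> D"
  shows "(F has_real_derivative h x) (at x)"
proof -
  obtain e where e: "e > 0" "cball x e \<subseteq> D"
    using D_open assms open_contains_cball by blast
  have D: "{x - e..x + e} \<subseteq> D" using e(2) by (simp add: cball_eq_atLeastAtMost)
  have cont: "continuous_on {x - e..x + e} h" by (rule continuous_on_subset[OF h_cont D])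
  have "((\<lambda>u. integral {x - e..u} h) has_real_derivative h x) (at x within {x - e..x + e})"
    by (rule integral_has_real_derivative[OF cont]) (use e in auto)
  then have "((\<lambda>u. F (x - e) + integral {x - e..u} h) has_real_derivative h x) (at x within {x - e..x + e})"
    by (auto intro!: derivative_eq_intros)
  then have "(F has_real_derivative h x) (at x within {x - e..x + e})"
  proof (rule has_field_derivative_transform_within[OF _ e(1)])
    show "x \<in> {x - e..x + e}" using e by auto
    fix u assume "u \<in> {x - e..x + e}" "dist u x < e"
    moreover have "x - e \<in> {x - e..x + e}" using e by auto
    ultimately have "x - e \<in> D" "u \<in> D" "x - e \<le> u" using D \<open>u \<in> _\<close> by auto
    from F_diff[OF this] show "F (x - e) + integral {x - e..u} h = F u" by simp
  qed
  moreover have "at x within {x - e..x + e} = at x"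
    by (rule at_within_interior) (use e in auto)
  ultimately show ?thesis by simp
qed

lemma F_strict: "x \<in> D \<Longrightarrow> y \<in> D \<Longrightarrow> x < y \<Longrightarrow> F x < F y"
  using increasing_inverse_deriv[OF D_open D_interval F_deriv h_pos] by metis

lemma F_mono: "x \<le> y \<Longrightarrow> F x \<le> F y" by (rule law.cdf_nondecreasing)

lemma F_bounds: assumes "x \<in> D" shows "0 < F x" "F x < 1"
proof -
  have "x / 2 \<in> D" using D_down[OF assms, of "x/2"] D_pos[OF assms] by auto
  then have "F (x / 2) < F x" using F_strict[OF _ assms] D_pos[OF assms] by auto
  then show "0 < F x" using law.cdf_nonneg[of "x/2"] by linarith
  obtain e where e: "e > 0" "cball x e \<subseteq> D"
    using D_open assms open_contains_cball by blast
  have "x + e \<in> D" using e by (auto simp: subset_iff dist_real_def)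
  then have "F x < F (x + e)" using F_strict[OF assms] e by auto
  then show "F x < 1" using law.cdf_bounded_prob[of "x + e"] by linarith
qed

lemma Fb_bounds: assumes "x \<in> D" shows "0 < Fb x" "Fb x < 1"
  using F_bounds[OF assms] by (auto simp: Fb_def)

lemma Fb_deriv: "x \<in> D \<Longrightarrow> (Fb has_real_derivative - h x) (at x)"
  unfolding Fb_def[abs_def] by (auto intro!: derivative_eq_intros F_deriv)

text \<open>The law has no atoms, so the continuous \<open>F\<close> takes every such level; it does
  so inside \<open>D\<close> because \<open>F\<close> is 0 to the left of \<open>D\<close> and 1 to
  the right of it.\<close>

lemma quantile:
  assumes "0 < p" "p < 1"
  obtains r where "r \<in> D" "F r = p"
proof -
  have cont: "isCont F x" for x
  proof -
    have "AE y in lborel. ennreal (h y) * indicator {x} y = 0"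
      by (rule eventually_mono[OF AE_lborel_singleton[of x]]) auto
    then have "emeasure law {x} = 0"
      by (subst emeasure_law) (auto simp: nn_integral_0_iff_AE)
    then show ?thesis by (simp add: law.isCont_cdf measure_def)
  qed
  have "eventually (\<lambda>x. F x < p) at_bot"
    using law.cdf_lim_at_bot assms(1) by (rule order_tendstoD(2))
  then obtain a where a: "F a < p" by (auto simp: eventually_at_bot_linorder)
  have "eventually (\<lambda>x. p < F x) at_top"
    using law.cdf_lim_at_top_prob assms(2) by (rule order_tendstoD(1))
  then obtain b where b: "p < F b" by (auto simp: eventually_at_top_linorder)
  have "a \<le> b" using F_mono[of b a] a b by (rule_tac ccontr) auto
  then obtain r where r: "F r = p"
    using IVT[of F a p b] a b cont by auto
  have "r \<in> D"
  proof (rule ccontr)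
    assume rD: "r \<notin> D"
    show False
    proof (cases "r \<le> 0")
      case True
      then have "ennreal (h y) * indicator {..r} y = 0" for y
        using D_pos[of y] by (cases "y \<in> D") (auto simp: h_0)
      then have "(\<integral>\<^sup>+y. ennreal (h y) * indicator {..r} y \<partial>lborel) = (\<integral>\<^sup>+y. 0 \<partial>(lborel :: real measure))"
        by (intro nn_integral_cong)
      then have "ennreal (F r) = 0" unfolding F_nn by simp
      then show False using r assms by (simp add: ennreal_eq_0_iff)
    next
      case False
      then have "y \<notin> D" if "y > r" for y using D_down[of y r] rD that by auto
      then have "ennreal (h y) * indicator {r<..} y = 0" for y
        by (cases "y > r") (auto simp: h_0)
      then have "(\<integral>\<^sup>+y. ennreal (h y) * indicator {r<..} y \<partial>lborel) = (\<integral>\<^sup>+y. 0 \<partial>(lborel :: real measure))"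
        by (intro nn_integral_cong)
      then have "ennreal (Fb r) = 0" unfolding Fb_nn by simp
      then show False using r assms by (simp add: ennreal_eq_0_iff Fb_def)
    qed
  qed
  then show ?thesis using that r by blast
qed

text \<open>Both monotonicity properties hold pointwise under the integral sign, after the
  substitutions \<open>x \<mapsto> r x / s\<close> and \<open>x \<mapsto> r + x\<close> respectively.\<close>

lemma F_scale_le:
  assumes "r \<in> D" "s \<in> D" "r \<le> s"
  shows "F r * (s * h s) \<le> F s * (r * h r)"
proof (cases "r = s")
  case True
  then show ?thesis by simp
next
  case False
  define c where "c = r / s"
  have pos: "0 < r" "0 < s" using assms D_pos by auto
  have c: "0 < c" "c < 1" "c * s = r" using pos assms(3) False by (auto simp: c_def field_simps)
  have key: "c * h (c * y) * (s * h s) \<le> h y * (r * h r)" if "y \<le> s" for y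
  proof (cases "0 < y")
    case False
    then have "c * y \<notin> D" using D_pos[of "c * y"] c by (auto simp: zero_less_mult_iff)
    then show ?thesis using h_nonneg[of y] h_nonneg[of r] pos by (simp add: h_0)
  next
    case True
    have cyy: "c * y \<le> y" using c True by simp
    have y: "y \<in> D" using D_down[OF assms(2) True that] .
    have cy: "c * y \<in> D" using D_down[OF y _ cyy] c True by simp
    have le: "y + c * (s - y) \<le> s" using c that mult_right_mono[of c 1 "s - y"] by simp
    have nn: "0 \<le> c * (s - y)" using c that by simp
    have yc: "y + c * (s - y) \<in> D" using D_down[OF assms(2) _ le] nn True by linarith
    \<comment> \<open>Two increments of equal length \<open>c (s - y)\<close>: one from
      \<open>c y\<close> to \<open>r\<close>, the other from the larger point \<open>y\<close> to a
      point not beyond \<open>s\<close>. Convexity compares them, and monotonicity of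
      \<open>v\<close> then replaces the last endpoint by \<open>s\<close>.\<close>
    have "v (c * y + c * (s - y)) + v y \<le> v (c * y) + v (y + c * (s - y))"
      by (rule convex_increments_mono[OF v_convex cy yc cyy nn])
    moreover have "c * y + c * (s - y) = r" using c by (simp add: algebra_simps)
    ultimately have "v r + v y \<le> v (c * y) + v s" using v_mono[OF yc assms(2) le] by auto
    then have e: "exp (- v (c * y)) * exp (- v s) \<le> exp (- v y) * exp (- v r)"
      by (simp add: exp_add[symmetric])
    have "c * h (c * y) * (s * h s) = r * ((c * y * s) ^ (n - 1)) * (exp (- v (c * y)) * exp (- v s))"
      using c by (simp add: h_D cy assms(2) power_mult_distrib)
    also have "\<dots> \<le> r * ((c * y * s) ^ (n - 1)) * (exp (- v y) * exp (- v r))"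
      by (rule mult_left_mono[OF e]) (use pos c True in simp)
    also have "c * y * s = y * r" using c by (simp add: mult_ac)
    finally show ?thesis using c by (simp add: h_D y assms(1) power_mult_distrib mult_ac)
  qed
  have "ennreal (F r) = ennreal \<bar>c\<bar> * (\<integral>\<^sup>+y. ennreal (h (0 + c * y)) * indicator {..r} (0 + c * y) \<partial>lborel)"
    unfolding F_nn by (rule nn_integral_real_affine) (use c in auto)
  also have "\<dots> = (\<integral>\<^sup>+y. ennreal (c * h (c * y)) * indicator {..s} y \<partial>lborel)"
  proof (subst nn_integral_cmult[symmetric])
    have "indicator {..r} (c * y) = (indicator {..s} y :: ennreal)" for y
      using mult_le_cancel_left_pos[OF c(1), of y s] c(3) by (simp add: indicator_def)
    then show "(\<integral>\<^sup>+y. ennreal \<bar>c\<bar> * (ennreal (h (0 + c * y)) * indicator {..r} (0 + c * y)) \<partial>lborel)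
        = (\<integral>\<^sup>+y. ennreal (c * h (c * y)) * indicator {..s} y \<partial>lborel)"
      using c by (intro nn_integral_cong) (simp add: ennreal_mult h_nonneg mult.assoc)
  qed measurable
  finally have "ennreal (F r * (s * h s)) = (\<integral>\<^sup>+y. ennreal (c * h (c * y)) * indicator {..s} y \<partial>lborel) * ennreal (s * h s)"
    using law.cdf_nonneg by (simp add: ennreal_mult' h_nonneg)
  also have "\<dots> = (\<integral>\<^sup>+y. ennreal (c * h (c * y)) * indicator {..s} y * ennreal (s * h s) \<partial>lborel)"
    by (rule nn_integral_multc[symmetric]) measurable
  also have "\<dots> \<le> (\<integral>\<^sup>+y. ennreal (h y) * indicator {..s} y * ennreal (r * h r) \<partial>lborel)"
  proof (rule nn_integral_mono)
    fix y
    show "ennreal (c * h (c * y)) * indicator {..s} y * ennreal (s * h s)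
        \<le> ennreal (h y) * indicator {..s} y * ennreal (r * h r)"
    proof (cases "y \<le> s")
      case True
      have "ennreal (c * h (c * y)) * ennreal (s * h s) = ennreal (c * h (c * y) * (s * h s))"
        by (rule ennreal_mult'[symmetric]) (use c h_nonneg in simp)
      also have "\<dots> \<le> ennreal (h y * (r * h r))" by (rule ennreal_leI[OF key[OF True]])
      also have "\<dots> = ennreal (h y) * ennreal (r * h r)" by (rule ennreal_mult'[OF h_nonneg])
      finally show ?thesis using True by simp
    qed simp
  qed
  also have "\<dots> = ennreal (F s) * ennreal (r * h r)"
    unfolding F_nn by (rule nn_integral_multc) measurable
  also have "\<dots> = ennreal (F s * (r * h r))"
    using pos by (simp add: ennreal_mult' law.cdf_nonneg h_nonneg)
  finally show ?thesis
    using pos by (subst (asm) ennreal_le_iff) (auto simp: law.cdf_nonneg h_nonneg)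
qed

lemma Fb_shift_le:
  assumes "r \<in> D" "s \<in> D" "r \<le> s"
  shows "Fb s * h r \<le> Fb r * h s"
proof -
  have pos: "0 < r" "0 < s" using assms D_pos by auto
  have key: "h (s + y) * h r \<le> h (r + y) * h s" if "0 \<le> y" for y
  proof (cases "s + y \<in> D")
    case False
    then show ?thesis by (simp add: h_0 h_nonneg)
  next
    case True
    have ry: "r + y \<in> D" by (rule D_down[OF True]) (use assms that pos in auto)
    have "v (r + y) + v s \<le> v r + v (s + y)"
      by (rule convex_increments_mono[OF v_convex assms(1) True assms(3) that])
    then have e: "exp (- v (s + y)) * exp (- v r) \<le> exp (- v (r + y)) * exp (- v s)"
      by (simp add: exp_add[symmetric])
    \<comment> \<open>The power factor of the density is log-concave too; cross-multiplied, this is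
      all that is required of it.\<close>
    have "(s + y) * r \<le> (r + y) * s"
      using mult_left_mono[OF assms(3) that] by (simp add: algebra_simps)
    then have p: "((s + y) * r) ^ (n - 1) \<le> ((r + y) * s) ^ (n - 1)"
      by (rule power_mono) (use pos that in auto)
    show ?thesis
      using mult_mono[OF p e] pos that
      by (simp add: h_D True ry assms power_mult_distrib mult_ac)
  qed
  have shift: "ennreal (Fb x) = (\<integral>\<^sup>+y. ennreal (h (x + y)) * indicator {0<..} y \<partial>lborel)" for x
  proof -
    have "ennreal (Fb x) = ennreal \<bar>1\<bar> * (\<integral>\<^sup>+y. ennreal (h (x + 1 * y)) * indicator {x<..} (x + 1 * y) \<partial>lborel)"
      unfolding Fb_nn by (rule nn_integral_real_affine) auto
    also have "\<dots> = (\<integral>\<^sup>+y. ennreal (h (x + y)) * indicator {0<..} y \<partial>lborel)"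
      by (auto intro!: nn_integral_cong simp: indicator_def)
    finally show ?thesis .
  qed
  have nn: "0 \<le> Fb x" for x using law.cdf_bounded_prob[of x] by (simp add: Fb_def)
  have "ennreal (Fb s * h r) = (\<integral>\<^sup>+y. ennreal (h (s + y)) * indicator {0<..} y * ennreal (h r) \<partial>lborel)"
    by (subst nn_integral_multc) (auto simp: shift[symmetric] ennreal_mult' nn h_nonneg)
  also have "\<dots> \<le> (\<integral>\<^sup>+y. ennreal (h (r + y)) * indicator {0<..} y * ennreal (h s) \<partial>lborel)"
  proof (rule nn_integral_mono)
    fix y
    show "ennreal (h (s + y)) * indicator {0<..} y * ennreal (h r) \<le> ennreal (h (r + y)) * indicator {0<..} y * ennreal (h s)"
    proof (cases "0 < y")
      case True
      have "ennreal (h (s + y)) * ennreal (h r) = ennreal (h (s + y) * h r)"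
        by (rule ennreal_mult'[OF h_nonneg, symmetric])
      also have "\<dots> \<le> ennreal (h (r + y) * h s)" by (rule ennreal_leI[OF key]) (use True in simp)
      also have "\<dots> = ennreal (h (r + y)) * ennreal (h s)" by (rule ennreal_mult'[OF h_nonneg])
      finally show ?thesis using True by simp
    qed simp
  qed
  also have "\<dots> = ennreal (Fb r * h s)"
    by (subst nn_integral_multc) (auto simp: shift[symmetric] ennreal_mult' nn h_nonneg)
  finally show ?thesis by (subst (asm) ennreal_le_iff) (auto simp: nn h_nonneg)
qed

lemma kappa_pos: "x \<in> D \<Longrightarrow> 0 < kappa x"
  using D_pos h_pos F_bounds by (simp add: kappa_def)

lemma hazard_pos: "x \<in> D \<Longrightarrow> 0 < hazard x"
  using h_pos Fb_bounds by (simp add: hazard_def)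

lemma kappa_antimono: "r \<in> D \<Longrightarrow> s \<in> D \<Longrightarrow> r \<le> s \<Longrightarrow> kappa s \<le> kappa r"
  using F_scale_le[of r s] F_bounds[of r] F_bounds[of s] by (simp add: kappa_def field_simps)

lemma hazard_mono: "r \<in> D \<Longrightarrow> s \<in> D \<Longrightarrow> r \<le> s \<Longrightarrow> hazard r \<le> hazard s"
  using Fb_shift_le[of r s] Fb_bounds[of r] Fb_bounds[of s] by (simp add: hazard_def field_simps)

lemma ln_F_deriv:
  assumes "x \<in> D"
  shows "((\<lambda>x. ln (F x)) has_real_derivative kappa x / x) (at x)"
proof -
  have "((\<lambda>x. ln (F x)) has_real_derivative 1 / F x * h x) (at x)"
    by (rule DERIV_chain2[OF DERIV_ln_divide[OF F_bounds(1)[OF assms]] F_deriv[OF assms]])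
  then show ?thesis using D_pos[OF assms] by (simp add: kappa_def)
qed

lemma ln_Fb_deriv:
  assumes "x \<in> D"
  shows "((\<lambda>x. ln (Fb x)) has_real_derivative - hazard x) (at x)"
proof -
  have "((\<lambda>x. ln (Fb x)) has_real_derivative 1 / Fb x * - h x) (at x)"
    by (rule DERIV_chain2[OF DERIV_ln_divide[OF Fb_bounds(1)[OF assms]] Fb_deriv[OF assms]])
  then show ?thesis by (simp add: hazard_def)
qed

lemma D_between: "r \<in> D \<Longrightarrow> s \<in> D \<Longrightarrow> r \<le> x \<Longrightarrow> x \<le> s \<Longrightarrow> x \<in> D"
  using D_down[of s x] D_pos[of r] by auto

text \<open>The derivative of \<open>ln F\<close> in the variable \<open>ln x\<close> is
  \<open>kappa\<close>, which is nonincreasing; its values at the two ends therefore bound the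
  increment over \<open>ln (s / r)\<close>. \<open>ln_Fb_diff\<close> is the same with the
  nondecreasing \<open>hazard\<close> and the length \<open>s - r\<close>.\<close>

lemma ln_F_diff:
  assumes "r \<in> D" "s \<in> D" "r \<le> s"
  shows "ln (F s) - ln (F r) \<le> kappa r * ln (s / r)" "kappa s * ln (s / r) \<le> ln (F s) - ln (F r)"
proof -
  have pos: "0 < r" "0 < s" using assms D_pos by auto
  have d: "((\<lambda>x. ln (F x) - k * ln x) has_real_derivative (kappa x - k) / x) (at x)"
    if "r \<le> x" "x \<le> s" for x k
  proof -
    have x: "x \<in> D" using D_between[OF assms(1,2) that] .
    show ?thesis
      using DERIV_diff[OF ln_F_deriv[OF x] DERIV_cmult[OF DERIV_ln_divide[OF D_pos[OF x]], of k]]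
      by (simp add: diff_divide_distrib)
  qed
  have "ln (F r) - kappa s * ln r \<le> ln (F s) - kappa s * ln s"
  proof (rule DERIV_nonneg_imp_nondecreasing[OF assms(3), where f="\<lambda>x. ln (F x) - kappa s * ln x"])
    fix x assume x: "r \<le> x" "x \<le> s"
    have "0 \<le> (kappa x - kappa s) / x"
      using kappa_antimono[of x s] D_between[OF assms(1,2) x] x assms D_pos[of x] by simp
    then show "\<exists>y. ((\<lambda>x. ln (F x) - kappa s * ln x) has_real_derivative y) (at x) \<and> 0 \<le> y"
      using d[OF x] by blast
  qed
  then show "kappa s * ln (s / r) \<le> ln (F s) - ln (F r)"
    using pos by (simp add: ln_div algebra_simps)
  have "ln (F s) - kappa r * ln s \<le> ln (F r) - kappa r * ln r"
  proof (rule DERIV_nonpos_imp_nonincreasing[OF assms(3), where f="\<lambda>x. ln (F x) - kappa r * ln x"])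
    fix x assume x: "r \<le> x" "x \<le> s"
    have "(kappa x - kappa r) / x \<le> 0"
      using kappa_antimono[of r x] D_between[OF assms(1,2) x] x assms D_pos[of x]
      by (simp add: divide_nonpos_pos)
    then show "\<exists>y. ((\<lambda>x. ln (F x) - kappa r * ln x) has_real_derivative y) (at x) \<and> y \<le> 0"
      using d[OF x] by blast
  qed
  then show "ln (F s) - ln (F r) \<le> kappa r * ln (s / r)"
    using pos by (simp add: ln_div algebra_simps)
qed

lemma ln_Fb_diff:
  assumes "r \<in> D" "s \<in> D" "r \<le> s"
  shows "ln (Fb r) - ln (Fb s) \<le> hazard s * (s - r)" "hazard r * (s - r) \<le> ln (Fb r) - ln (Fb s)"
proof -
  have d: "((\<lambda>x. ln (Fb x) + k * x) has_real_derivative (k - hazard x)) (at x)"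
    if "r \<le> x" "x \<le> s" for x k
  proof -
    have x: "x \<in> D" using D_between[OF assms(1,2) that] .
    show ?thesis
      using DERIV_add[OF ln_Fb_deriv[OF x] DERIV_cmult[OF DERIV_ident, of k]] by simp
  qed
  have "ln (Fb r) + hazard s * r \<le> ln (Fb s) + hazard s * s"
  proof (rule DERIV_nonneg_imp_nondecreasing[OF assms(3), where f="\<lambda>x. ln (Fb x) + hazard s * x"])
    fix x assume x: "r \<le> x" "x \<le> s"
    have "0 \<le> hazard s - hazard x"
      using hazard_mono[of x s] D_between[OF assms(1,2) x] x assms by simp
    then show "\<exists>y. ((\<lambda>x. ln (Fb x) + hazard s * x) has_real_derivative y) (at x) \<and> 0 \<le> y"
      using d[OF x] by blast
  qed
  then show "ln (Fb r) - ln (Fb s) \<le> hazard s * (s - r)" by (simp add: algebra_simps)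
  have "ln (Fb s) + hazard r * s \<le> ln (Fb r) + hazard r * r"
  proof (rule DERIV_nonpos_imp_nonincreasing[OF assms(3), where f="\<lambda>x. ln (Fb x) + hazard r * x"])
    fix x assume x: "r \<le> x" "x \<le> s"
    have "hazard r - hazard x \<le> 0"
      using hazard_mono[of r x] D_between[OF assms(1,2) x] x assms by simp
    then show "\<exists>y. ((\<lambda>x. ln (Fb x) + hazard r * x) has_real_derivative y) (at x) \<and> y \<le> 0"
      using d[OF x] by blast
  qed
  then show "hazard r * (s - r) \<le> ln (Fb r) - ln (Fb s)" by (simp add: algebra_simps)
qed

text \<open>Since \<open>v\<close> is nondecreasing, replacing it by its largest value
  \<open>v r\<close> on (0, r] only lowers the integral for \<open>F r\<close>, and the remaining
  integral of a pure power is explicit.\<close>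

lemma kappa_le:
  assumes r: "r \<in> D"
  shows "kappa r \<le> n"
proof -
  have pos: "r > 0" using D_pos r by auto
  have n': "Suc (n - 1) = n" using n by simp
  have "(\<integral>\<^sup>+x. ennreal (x ^ (n - 1) * exp (- v r)) * indicator {0..r} x \<partial>lborel)
      = r ^ n / n * exp (- v r) - 0 ^ n / n * exp (- v r)"
  proof (rule nn_integral_FTC_Icc[where F="\<lambda>x. x ^ n / n * exp (- v r)"])
    fix x assume x: "x \<in> {0..r}"
    show "((\<lambda>x. x ^ n / n * exp (- v r)) has_real_derivative x ^ (n - 1) * exp (- v r)) (at x)"
      using n by (auto intro!: derivative_eq_intros)
    show "0 \<le> x ^ (n - 1) * exp (- v r)" using x by simp
  qed (use pos in auto)
  moreover have "(\<integral>\<^sup>+x. ennreal (x ^ (n - 1) * exp (- v r)) * indicator {0..r} x \<partial>lborel) \<le> ennreal (F r)"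
    unfolding F_nn
  proof (rule nn_integral_mono_AE, rule eventually_mono[OF AE_lborel_singleton[of 0]])
    fix x :: real assume "x \<noteq> 0"
    show "ennreal (x ^ (n - 1) * exp (- v r)) * indicator {0..r} x \<le> ennreal (h x) * indicator {..r} x"
    proof (cases "0 < x \<and> x \<le> r")
      case True
      then have "x \<in> D" using D_down[OF r] by auto
      then have "x ^ (n - 1) * exp (- v r) \<le> h x" using True v_mono[OF _ r] by (auto simp: h_D)
      then show ?thesis using True by (auto intro!: ennreal_leI)
    qed (use \<open>x \<noteq> 0\<close> in \<open>auto simp: indicator_def\<close>)
  qed
  ultimately have "ennreal (r ^ n / n * exp (- v r)) \<le> ennreal (F r)"
    using n by (simp add: power_0_left)
  then have "r ^ n / n * exp (- v r) \<le> F r" by (simp add: law.cdf_nonneg)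
  moreover have "r * h r = r ^ n * exp (- v r)" using n' r by (metis h_D mult.assoc power_Suc)
  ultimately show ?thesis using F_bounds[OF r] n by (simp add: kappa_def field_simps)
qed

end

section \<open>Mode of the radial law and tails around it\<close>

context radial_density
begin

text \<open>All chords of \<open>v\<close> ending at \<open>a\<close> from the left have slope at
  most \<open>n / a\<close>: the function \<open>x^n exp (- v x)\<close>, which is
  \<open>x h x\<close>, still increases up to \<open>a\<close>. Dually, \<open>above\<close> says
  that it decreases from \<open>a\<close> on.\<close>

definition below :: "real \<Rightarrow> bool" where
  "below a \<longleftrightarrow> a \<in> D \<and> (\<forall>r\<in>D. r \<le> a \<longrightarrow> v a - v r \<le> n * (1 - r / a))"

definition above :: "real \<Rightarrow> bool" where
  "above a \<longleftrightarrow> a \<in> D \<and> (\<forall>r\<in>D. a \<le> r \<longrightarrow> n * (r / a - 1) \<le> v r - v a)"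

text \<open>If some chord to the right of \<open>a\<close> has slope less than \<open>n / a\<close>,
  convexity makes every chord to the left of \<open>a\<close> have slope below \<open>n / a\<close>
  as well.\<close>

lemma below_or_above:
  assumes a: "a \<in> D"
  shows "below a \<or> above a"
proof (rule disjCI)
  assume "\<not> above a"
  then obtain s where s: "s \<in> D" "a \<le> s" "v s - v a < n * (s / a - 1)"
    using a by (auto simp: above_def not_le)
  have a0: "a > 0" using D_pos a by auto
  have as: "a < s" using s a0 by (cases "a = s") auto
  have sl: "(v s - v a) / (s - a) < n / a"
    using s as a0 by (simp add: field_simps)
  show "below a" unfolding below_def
  proof (intro conjI ballI impI a)
    fix r assume r: "r \<in> D" "r \<le> a"
    show "v a - v r \<le> n * (1 - r / a)"
    proof (cases "r = a")
      case True
      then show ?thesis using a0 by simp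
    next
      case False
      then have ra: "r < a" using r by auto
      have "(v r - v a) / (r - a) \<le> (v r - v s) / (r - s)"
        "(v r - v s) / (r - s) \<le> (v a - v s) / (a - s)"
        by (rule convex_on_slope_le[OF v_convex r(1) s(1) ra as])+
      then have "(v r - v a) / (r - a) \<le> (v a - v s) / (a - s)" by linarith
      also have "\<dots> = (v s - v a) / (s - a)" using minus_divide_divide[of "v s - v a" "s - a"] by simp
      finally have "(v r - v a) / (r - a) \<le> n / a" using sl by linarith
      moreover have "(v r - v a) / (r - a) = (v a - v r) / (a - r)"
        using minus_divide_divide[of "v a - v r" "a - r"] by simp
      ultimately have "v a - v r \<le> n / a * (a - r)" using ra by (simp add: pos_divide_le_eq)
      also have "\<dots> = n * (1 - r / a)" using a0 by (simp add: field_simps)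
      finally show ?thesis .
    qed
  qed
qed

lemma exp_tail_le:
  fixes y :: real
  assumes "y > 0"
  shows "y ^ n * exp (n * (1 - y)) \<le> exp (- (n * (sqrt y - 1)\<^sup>2))"
proof -
  have "(y * exp (1 - y)) ^ n \<le> exp (- (sqrt y - 1)\<^sup>2) ^ n"
    by (rule power_mono[OF mult_exp_le_sqrt[OF assms]]) (use assms in simp)
  then show ?thesis by (simp add: power_mult_distrib exp_of_nat_mult[symmetric])
qed

lemma rh: "r \<in> D \<Longrightarrow> r * h r = r ^ n * exp (- v r)"
  using n by (simp add: h_D power_eq_if)

text \<open>Monotonicity of \<open>kappa\<close> bounds \<open>F r\<close> by the quotient
  \<open>r h r / (a h a)\<close>, and \<open>below\<close> bounds this quotient by
  \<open>y^n exp (n (1 - y))\<close> with \<open>y = r / a\<close>, which is in the form of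
  \<open>exp_tail_le\<close>. The upper tail in \<open>Fb_le_above\<close> is treated in the same
  way with \<open>hazard\<close>.\<close>

lemma F_le_below:
  assumes a: "below a" and r: "r \<in> D" "r \<le> a"
  shows "F r \<le> exp (- (n * (sqrt (r / a) - 1)\<^sup>2))"
proof -
  have aD: "a \<in> D" and va: "v a - v r \<le> n * (1 - r / a)" using a r by (auto simp: below_def)
  have pos: "0 < a" "0 < r" using aD r D_pos by auto
  have "F r * (a * h a) \<le> F a * (r * h r)" by (rule F_scale_le[OF r(1) aD r(2)])
  also have "\<dots> \<le> 1 * (r * h r)"
    by (rule mult_right_mono) (use law.cdf_bounded_prob pos h_nonneg in auto)
  finally have "F r * (a ^ n * exp (- v a)) \<le> r ^ n * exp (- v r)" by (simp add: rh aD r)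
  then have "F r \<le> r ^ n * exp (- v r) / (a ^ n * exp (- v a))"
    using pos by (simp add: pos_le_divide_eq)
  also have "\<dots> = (r / a) ^ n * exp (v a - v r)"
    by (simp add: power_divide exp_diff exp_minus field_simps)
  also have "\<dots> \<le> (r / a) ^ n * exp (n * (1 - r / a))"
    using va pos by (intro mult_left_mono) auto
  also have "\<dots> \<le> exp (- (n * (sqrt (r / a) - 1)\<^sup>2))"
    by (rule exp_tail_le) (use pos in simp)
  finally show ?thesis .
qed

lemma Fb_le_above:
  assumes a: "above a" and r: "r \<in> D" "a \<le> r"
  shows "Fb r \<le> exp (- (n * (sqrt (r / a) - 1)\<^sup>2))"
proof -
  have aD: "a \<in> D" and va: "n * (r / a - 1) \<le> v r - v a" using a r by (auto simp: above_def)
  have pos: "0 < a" "0 < r" using aD r D_pos by auto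
  have "Fb r * h a \<le> Fb a * h r" by (rule Fb_shift_le[OF aD r])
  also have "\<dots> \<le> 1 * h r"
    by (rule mult_right_mono) (use Fb_bounds[OF aD] h_nonneg in auto)
  finally have "Fb r \<le> h r / h a" using h_pos[OF aD] by (simp add: pos_le_divide_eq)
  also have "\<dots> = (r / a) ^ (n - 1) * exp (v a - v r)"
    by (simp add: h_D aD r power_divide exp_diff exp_minus field_simps)
  \<comment> \<open>Since \<open>r >= a\<close>, an extra factor \<open>r / a\<close> may be
    inserted; it raises the exponent from n - 1 to the n that \<open>exp_tail_le\<close>
    expects.\<close>
  also have "\<dots> \<le> (r / a) ^ n * exp (n * (1 - r / a))"
    by (rule mult_mono) (use va pos r in \<open>auto simp: algebra_simps intro!: power_increasing\<close>)
  also have "\<dots> \<le> exp (- (n * (sqrt (r / a) - 1)\<^sup>2))"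
    by (rule exp_tail_le) (use pos in simp)
  finally show ?thesis .
qed

lemma below_exists: "\<exists>a. below a"
proof -
  obtain e where e: "e \<in> D" using D_ne by auto
  obtain d where d: "d > 0" "cball e d \<subseteq> D"
    using D_open e open_contains_cball by blast
  define e' where "e' = e + d"
  have e': "e' \<in> D" "e < e'" using d by (auto simp: e'_def subset_iff dist_real_def)
  define s where "s = (v e' - v e) / (e' - e)"
  have s0: "s \<ge> 0" using v_mono[OF e e'(1)] e' by (simp add: s_def)
  \<comment> \<open>By convexity the slope \<open>s\<close> over [e, e'] bounds every chord lying to
    the left of \<open>e\<close>, so \<open>below a\<close> holds as soon as
    \<open>s a <= n\<close>. Adding 1 to \<open>s\<close> keeps the quotient meaningful for s =
    0.\<close>
  define a where "a = min e (n / (s + 1))"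
  have a0: "a > 0" using D_pos[OF e] n s0 by (simp add: a_def)
  have ae: "a \<le> e" by (simp add: a_def)
  have aD: "a \<in> D" by (rule D_down[OF e a0 ae])
  have na: "s * a \<le> n"
  proof -
    have "s * a \<le> (s + 1) * a" using a0 by simp
    also have "\<dots> \<le> (s + 1) * (n / (s + 1))" using s0 by (intro mult_left_mono) (auto simp: a_def)
    finally show ?thesis using s0 by simp
  qed
  have "v a - v r \<le> n * (1 - r / a)" if r: "r \<in> D" "r \<le> a" for r
  proof (cases "r = a")
    case True
    then show ?thesis using a0 by simp
  next
    case False
    then have ra: "r < a" using r by auto
    have s1: "(v r - v a) / (r - a) \<le> s"
    proof -
      have "(v r - v a) / (r - a) \<le> (v r - v e') / (r - e')" "(v r - v e') / (r - e') \<le> (v a - v e') / (a - e')"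
        by (rule convex_on_slope_le[OF v_convex r(1) e'(1) ra]; use ae e' in simp)+
      then have 1: "(v r - v a) / (r - a) \<le> (v a - v e') / (a - e')" by linarith
      have 2: "(v a - v e') / (a - e') \<le> (v e - v e') / (e - e')"
      proof (cases "a = e")
        case False
        then show ?thesis
          by (intro convex_on_slope_le(2)[OF v_convex aD e'(1)]) (use ae e' in auto)
      qed simp
      have "(v e - v e') / (e - e') = s"
        using minus_divide_divide[of "v e' - v e" "e' - e"] by (simp add: s_def)
      with 1 2 show ?thesis by linarith
    qed
    moreover have "(v r - v a) / (r - a) = (v a - v r) / (a - r)"
      using minus_divide_divide[of "v a - v r" "a - r"] by simp
    ultimately have "v a - v r \<le> s * (a - r)" using ra by (simp add: pos_divide_le_eq)
    also have "\<dots> = s * a * (1 - r / a)" using a0 by (simp add: field_simps)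
    also have "\<dots> \<le> n * (1 - r / a)" using na ra a0 by (intro mult_right_mono) auto
    finally show ?thesis .
  qed
  then show ?thesis using aD by (auto simp: below_def)
qed

text \<open>The number \<open>M\<close> below is the mode of the density \<open>r h(r)\<close> of the law in the variable \<open>ln r\<close>.\<close>
lemma two_sided_tails:
  assumes bd: "\<And>a. below a \<Longrightarrow> a \<le> A"
  obtains M where "0 < M" "M \<le> A"
    and "\<And>r. r \<in> D \<Longrightarrow> r \<le> M \<Longrightarrow> F r \<le> exp (- (n * (sqrt (r / M) - 1)\<^sup>2))"
    and "\<And>r. r \<in> D \<Longrightarrow> M \<le> r \<Longrightarrow> Fb r \<le> exp (- (n * (sqrt (r / M) - 1)\<^sup>2))"
proof -
  define M where "M = Sup (Collect below)"
  have ne: "Collect below \<noteq> {}" using below_exists by auto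
  have bdd: "bdd_above (Collect below)" by (rule bdd_aboveI[of _ A]) (use bd in auto)
  have up: "a \<le> M" if "below a" for a unfolding M_def using that bdd by (auto intro: cSup_upper)
  have MA: "M \<le> A" unfolding M_def using ne bd by (auto intro: cSup_least)
  have M0: "M > 0" using below_exists up D_pos by (force simp: below_def)
  have cont: "isCont (\<lambda>a. exp (- (n * (sqrt (r / a) - 1)\<^sup>2))) M" for r
    using M0 by (intro continuous_intros) auto
  \<comment> \<open>The estimate is known at points \<open>a\<close> satisfying \<open>below\<close>
    arbitrarily close to \<open>M\<close>. A strict violation at \<open>M\<close> would persist at
    such a point, because the bound is continuous in \<open>a\<close>.\<close>
  have 1: "F r \<le> exp (- (n * (sqrt (r / M) - 1)\<^sup>2))" if r: "r \<in> D" "r \<le> M" for r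
  proof (rule ccontr)
    define T where "T a = exp (- (n * (sqrt (r / a) - 1)\<^sup>2))" for a
    assume "\<not> F r \<le> exp (- (n * (sqrt (r / M) - 1)\<^sup>2))"
    then have *: "T M < F r" by (simp add: T_def)
    have rM: "r < M" using * F_bounds[OF r(1)] r M0 by (cases "r = M") (auto simp: T_def)
    have "(T \<longlongrightarrow> T M) (at M)" using cont[of r] by (simp add: isCont_def T_def[abs_def])
    then have "eventually (\<lambda>a. T a < F r) (at M)" using * by (rule order_tendstoD(2))
    then obtain d where d: "d > 0" "\<And>a. a \<noteq> M \<Longrightarrow> dist a M < d \<Longrightarrow> T a < F r"
      by (auto simp: eventually_at)
    have "max r (M - d) < M" using rM d by simp
    then obtain a where a: "below a" "max r (M - d) < a"
      unfolding M_def using less_cSup_iff[OF ne bdd] by auto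
    have "T a < F r"
      using d(2)[of a] a up[OF a(1)] * by (cases "a = M") (auto simp: dist_real_def)
    moreover have "F r \<le> T a" unfolding T_def by (rule F_le_below[OF a(1) r(1)]) (use a in simp)
    ultimately show False by simp
  qed
  have 2: "Fb r \<le> exp (- (n * (sqrt (r / M) - 1)\<^sup>2))" if r: "r \<in> D" "M \<le> r" for r
  proof (rule ccontr)
    define T where "T a = exp (- (n * (sqrt (r / a) - 1)\<^sup>2))" for a
    assume "\<not> Fb r \<le> exp (- (n * (sqrt (r / M) - 1)\<^sup>2))"
    then have *: "T M < Fb r" by (simp add: T_def)
    have rM: "M < r" using * Fb_bounds[OF r(1)] r M0 by (cases "r = M") (auto simp: T_def)
    have "(T \<longlongrightarrow> T M) (at M)" using cont[of r] by (simp add: isCont_def T_def[abs_def])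
    then have "eventually (\<lambda>a. T a < Fb r) (at M)" using * by (rule order_tendstoD(2))
    then obtain d where d: "d > 0" "\<And>a. a \<noteq> M \<Longrightarrow> dist a M < d \<Longrightarrow> T a < Fb r"
      by (auto simp: eventually_at)
    \<comment> \<open>Points just beyond the supremum \<open>M\<close> fail \<open>below\<close>,
      hence satisfy \<open>above\<close>, and the continuity argument can be repeated from the
      right.\<close>
    obtain a where a: "M < a" "a < min r (M + d)" using dense[of M "min r (M + d)"] rM d by auto
    have aD: "a \<in> D" by (rule D_down[OF r(1)]) (use a M0 in auto)
    have "\<not> below a" using up[of a] a by auto
    then have ab: "above a" using below_or_above[OF aD] by auto
    have "T a < Fb r" using d(2)[of a] a by (auto simp: dist_real_def)
    moreover have "Fb r \<le> T a" unfolding T_def by (rule Fb_le_above[OF ab r(1)]) (use a in simp)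
    ultimately show False by simp
  qed
  from that[OF M0 MA 1 2] show thesis .
qed

text \<open>At half the distance, \<open>F_le_below\<close> leaves a definite mass beyond
  \<open>a / 2\<close>: with \<open>q = 3/2 - sqrt 2 >= 2/25\<close> one gets
  \<open>Fb (a / 2) >= 1 - 25/27 >= 1/16\<close>. Chebyshev's inequality then gives
  \<open>a^2 / 64 <= n t^2\<close>, whence the factor 8.\<close>

lemma below_le_second_moment:
  fixes t :: real
  assumes t: "0 < t" and mom: "(\<integral>\<^sup>+x. ennreal (x\<^sup>2 * h x) \<partial>lborel) \<le> ennreal (n * t\<^sup>2)"
    and a: "below a"
  shows "a \<le> 8 * (sqrt n * t)"
proof -
  have aD: "a \<in> D" using a by (simp add: below_def)
  have a0: "a > 0" using D_pos aD by auto
  have a2D: "a / 2 \<in> D" by (rule D_down[OF aD]) (use a0 in auto)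
  have n1: "real n \<ge> 1" using n by simp
  define q :: real where "q = (sqrt (1/2) - 1)\<^sup>2"
  have "q = 3 / 2 - sqrt 2"
  proof -
    have "sqrt (1/2) = sqrt 2 / 2" by (simp add: real_sqrt_divide real_div_sqrt field_simps)
    then show ?thesis by (simp add: q_def power2_eq_square algebra_simps)
  qed
  moreover have "sqrt 2 \<le> 71/50" by (rule real_le_lsqrt) (auto simp: power2_eq_square)
  ultimately have q: "q \<ge> 2/25" by simp
  have "F (a / 2) \<le> exp (- (n * (sqrt (a / 2 / a) - 1)\<^sup>2))"
    by (rule F_le_below[OF a a2D]) (use a0 in simp)
  also have "\<dots> = exp (- (n * q))" using a0 by (simp add: q_def)
  also have "\<dots> \<le> exp (- q)" using mult_right_mono[OF n1, of q] q by simp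
  also have "\<dots> = inverse (exp q)" by (rule exp_minus)
  also have "\<dots> \<le> inverse (27/25)"
  proof (rule le_imp_inverse_le)
    show "27/25 \<le> exp q" using exp_ge_add_one_self[of q] q by linarith
  qed simp
  finally have Fb: "Fb (a / 2) \<ge> 1/16" by (simp add: Fb_def)
  have "ennreal (a\<^sup>2 / 4 * Fb (a / 2)) = ennreal (a\<^sup>2 / 4) * (\<integral>\<^sup>+y. ennreal (h y) * indicator {a/2<..} y \<partial>lborel)"
    unfolding Fb_nn[symmetric] by (rule ennreal_mult') simp
  also have "\<dots> = (\<integral>\<^sup>+y. ennreal (a\<^sup>2 / 4) * (ennreal (h y) * indicator {a/2<..} y) \<partial>lborel)"
    by (rule nn_integral_cmult[symmetric]) measurable
  also have "\<dots> \<le> (\<integral>\<^sup>+x. ennreal (x\<^sup>2 * h x) \<partial>lborel)"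
  proof (rule nn_integral_mono)
    fix y
    show "ennreal (a\<^sup>2 / 4) * (ennreal (h y) * indicator {a/2<..} y) \<le> ennreal (y\<^sup>2 * h y)"
    proof (cases "a / 2 < y")
      case True
      have "(a / 2)\<^sup>2 \<le> y\<^sup>2" by (rule power_mono) (use True a0 in auto)
      then have "a\<^sup>2 / 4 * h y \<le> y\<^sup>2 * h y"
        by (intro mult_right_mono h_nonneg) (simp add: power_divide)
      then have "ennreal (a\<^sup>2 / 4 * h y) \<le> ennreal (y\<^sup>2 * h y)" by (rule ennreal_leI)
      then have "ennreal (a\<^sup>2 / 4) * ennreal (h y) \<le> ennreal (y\<^sup>2 * h y)"
        by (subst ennreal_mult'[symmetric]) auto
      then show ?thesis using True by simp
    qed simp
  qed
  also note mom
  finally have "a\<^sup>2 / 4 * Fb (a / 2) \<le> n * t\<^sup>2" by (subst (asm) ennreal_le_iff) auto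
  moreover have "a\<^sup>2 / 4 * (1 / 16) \<le> a\<^sup>2 / 4 * Fb (a / 2)" using Fb by (intro mult_left_mono) auto
  ultimately have "a\<^sup>2 \<le> 64 * (n * t\<^sup>2)" by simp
  also have "\<dots> = (8 * (sqrt n * t))\<^sup>2" by (simp add: power_mult_distrib)
  finally show ?thesis by (rule power2_le_imp_le) (use t in simp)
qed

end

lemma ln_4_3_le: "ln (4/3) \<le> ln 2 / (2::real)"
proof -
  have "2 * ln (4/3) = ln ((4/3)\<^sup>2 :: real)" by (simp add: ln_realpow)
  also have "\<dots> \<le> ln 2" by (subst ln_le_cancel_iff) (auto simp: power2_eq_square)
  finally show ?thesis by simp
qed

text \<open>Used to compare a level p of at most 1/2 with a reference point where the same function
  equals 3/4, and so its complement 1/4: the logarithmic gap to 3/4 is still at least L / 2, and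
  \<open>ln 4\<close> is at most 2 L.\<close>

lemma ln_half_bound:
  fixes p L :: real
  assumes "0 < p" "p \<le> 1/2" "L = - ln p"
  shows "ln 2 \<le> L" "L / 2 \<le> ln (3/4) + L" "ln 4 \<le> 2 * L"
proof -
  have "ln p \<le> ln (1/2)" using assms by simp
  then show 1: "ln 2 \<le> L" using assms by (simp add: ln_div)
  have "ln (4::real) = ln (2\<^sup>2)" by simp
  also have "\<dots> = 2 * ln 2" by (subst ln_realpow) auto
  finally show "ln 4 \<le> 2 * L" using 1 by simp
  have "ln (3/4::real) = - ln (4/3)" by (simp add: ln_div)
  then show "L / 2 \<le> ln (3/4) + L" using 1 ln_4_3_le by simp
qed

section \<open>Lower bounds for the two ratios in terms of the level\<close>

context radial_density
begin

text \<open>The first two claims invert the tail bounds. For the third, let L = - ln (F r) and let q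
  be the point of level 3/4: between r and q the function \<open>ln F\<close> grows by at least L /
  2, while both points lie in the shell, so that \<open>ln (q / r) <= 32 sqrt (L / n)\<close>.
  Dividing gives a lower bound for \<open>kappa r\<close> of order
  \<open>sqrt (n L)\<close>.\<close>

lemma kappa_lower:
  assumes M: "0 < M"
    and left: "\<And>r. r \<in> D \<Longrightarrow> r \<le> M \<Longrightarrow> F r \<le> exp (- (n * (sqrt (r / M) - 1)\<^sup>2))"
    and right: "\<And>r. r \<in> D \<Longrightarrow> M \<le> r \<Longrightarrow> Fb r \<le> exp (- (n * (sqrt (r / M) - 1)\<^sup>2))"
  shows sqrt_lower: "r \<in> D \<Longrightarrow> 1 - sqrt (- ln (F r) / n) \<le> sqrt (r / M)"
    and sqrt_upper: "r \<in> D \<Longrightarrow> sqrt (r / M) \<le> 1 + sqrt (- ln (Fb r) / n)"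
    and "r \<in> D \<Longrightarrow> F r \<le> 1/2 \<Longrightarrow> sqrt (n * - ln (F r)) \<le> 80 * kappa r \<or> n \<le> 80 * kappa r"
proof -
  have n1: "real n \<ge> 1" using n by simp
  have sl: "1 - sqrt (- ln (F r) / n) \<le> sqrt (r / M)" if r: "r \<in> D" for r
  proof (cases "r \<le> M")
    case True
    have "ln (F r) \<le> - (n * (sqrt (r / M) - 1)\<^sup>2)"
      using left[OF r True] F_bounds[OF r] by (metis exp_le_cancel_iff exp_ln)
    then have "(sqrt (r / M) - 1)\<^sup>2 \<le> - ln (F r) / n" using n1 by (simp add: field_simps)
    then have "\<bar>sqrt (r / M) - 1\<bar> \<le> sqrt (- ln (F r) / n)" by (rule real_le_rsqrt[of "\<bar>_\<bar>", simplified])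
    then show ?thesis by simp
  next
    case False
    then have "1 \<le> sqrt (r / M)" using M by simp
    moreover have "0 \<le> sqrt (- ln (F r) / n)" using F_bounds[OF r] by (simp add: divide_nonpos_nonneg)
    ultimately show ?thesis by linarith
  qed
  have su: "sqrt (r / M) \<le> 1 + sqrt (- ln (Fb r) / n)" if r: "r \<in> D" for r
  proof (cases "M \<le> r")
    case True
    have "ln (Fb r) \<le> - (n * (sqrt (r / M) - 1)\<^sup>2)"
      using right[OF r True] Fb_bounds[OF r] by (metis exp_le_cancel_iff exp_ln)
    then have "(sqrt (r / M) - 1)\<^sup>2 \<le> - ln (Fb r) / n" using n1 by (simp add: field_simps)
    then have "\<bar>sqrt (r / M) - 1\<bar> \<le> sqrt (- ln (Fb r) / n)" by (rule real_le_rsqrt[of "\<bar>_\<bar>", simplified])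
    then show ?thesis by simp
  next
    case False
    then have "sqrt (r / M) \<le> 1" using M by simp
    moreover have "0 \<le> sqrt (- ln (Fb r) / n)" using Fb_bounds[OF r] by (simp add: divide_nonpos_nonneg)
    ultimately show ?thesis by linarith
  qed
  show "r \<in> D \<Longrightarrow> 1 - sqrt (- ln (F r) / n) \<le> sqrt (r / M)" by (rule sl)
  show "r \<in> D \<Longrightarrow> sqrt (r / M) \<le> 1 + sqrt (- ln (Fb r) / n)" by (rule su)
  obtain q where q: "q \<in> D" "F q = 3/4" by (rule quantile[of "3/4"]) auto
  \<comment> \<open>The threshold 7/10 keeps \<open>sqrt (L / n)\<close> below 0.84, hence
    \<open>sqrt (r / M)\<close> above 0.16. This lower bound is needed when
    \<open>ln (q / r)\<close> is estimated by a quotient with denominator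
    \<open>sqrt (r / M)\<close>.\<close>
  have small: "sqrt (n * - ln (F r)) \<le> 64 * kappa r"
    if r: "r \<in> D" "F r \<le> 1/2" and Ln: "- ln (F r) \<le> 7/10 * n" for r
  proof -
    define L where "L = - ln (F r)"
    have L: "ln 2 \<le> L" "L / 2 \<le> ln (3/4) + L" "ln 4 \<le> 2 * L"
      using ln_half_bound[of "F r" L] F_bounds[OF r(1)] r(2) by (auto simp: L_def)
    have L0: "L > 0" using L(1) ln_gt_zero[of 2] by linarith
    have rq: "r \<le> q" using F_mono[of q r] q r(2) by (rule_tac ccontr) auto
    have pos: "0 < r" "0 < q" using r q D_pos by auto
    define s where "s = sqrt (L / n)"
    have s0: "s > 0" using L0 n1 by (simp add: s_def)
    define x where "x = sqrt (q / M)"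
    define y where "y = sqrt (r / M)"
    have "ln (Fb q) = - ln 4" unfolding Fb_def q by (simp add: ln_div)
    then have "x \<le> 1 + sqrt (ln 4 / n)" using su[OF q(1)] by (simp add: x_def)
    also have "sqrt (ln 4 / n) \<le> sqrt (2 * (L / n))"
      using L(3) n1 by (intro real_sqrt_le_mono) (simp add: field_simps)
    also have "\<dots> = sqrt 2 * s" by (simp add: s_def real_sqrt_mult real_sqrt_divide)
    also have "\<dots> \<le> 3/2 * s"
      using s0 real_le_lsqrt[of "3/2" 2] by (intro mult_right_mono) (auto simp: power2_eq_square)
    finally have x: "x \<le> 1 + 3/2 * s" by simp
    have y: "1 - s \<le> y" using sl[OF r(1)] by (simp add: s_def y_def L_def)
    have "s \<le> 84/100" unfolding s_def
      by (rule real_le_lsqrt) (use Ln n1 in \<open>auto simp: L_def[symmetric] power2_eq_square field_simps\<close>)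
    then have y16: "y \<ge> 16/100" using y by simp
    have x0: "x > 0" using pos M by (simp add: x_def)
    have "q / r = (x / y)\<^sup>2" using pos M by (simp add: x_def y_def power_divide)
    then have "ln (q / r) = 2 * ln (x / y)" using x0 y16 by (simp add: ln_realpow)
    also have "\<dots> \<le> 2 * (x / y - 1)" using x0 y16 ln_le_minus_one[of "x / y"] by simp
    also have "\<dots> = 2 * ((x - y) / y)" using y16 by (simp add: field_simps)
    also have "(x - y) / y \<le> (5/2 * s) / (16/100)"
      by (rule frac_le) (use x y y16 s0 in auto)
    finally have lnqr: "ln (q / r) \<le> 32 * s" using s0 by simp
    have "L / 2 \<le> ln (F q) - ln (F r)" using L unfolding q by (simp add: L_def)
    also have "\<dots> \<le> kappa r * ln (q / r)" by (rule ln_F_diff(1)[OF r(1) q(1) rq])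
    also have "\<dots> \<le> kappa r * (32 * s)"
      by (rule mult_left_mono[OF lnqr]) (use kappa_pos[OF r(1)] in simp)
    finally have "L \<le> 64 * kappa r * s" by simp
    moreover have "L = sqrt (n * L) * s"
      using L0 n1 by (simp add: s_def real_sqrt_mult real_sqrt_divide)
    ultimately have "sqrt (n * L) * s \<le> 64 * kappa r * s" by simp
    then have "sqrt (n * L) \<le> 64 * kappa r" using s0 by simp
    then show ?thesis by (simp add: L_def)
  qed
  assume r: "r \<in> D" "F r \<le> 1/2"
  show "sqrt (n * - ln (F r)) \<le> 80 * kappa r \<or> n \<le> 80 * kappa r"
  proof (cases "- ln (F r) \<le> 7/10 * n")
    case True
    then show ?thesis using small[OF r] kappa_pos[OF r(1)] by linarith
  next
    case False
    \<comment> \<open>For smaller levels the shell bound degenerates, so \<open>kappa\<close> is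
      compared by monotonicity with its value at the threshold level. This level is at most 1/2
      because \<open>ln 2 <= 25/36 < 7/10\<close>; there \<open>kappa\<close> is already of order
      n.\<close>
    define p where "p = exp (- (7/10 * real n))"
    have "p \<le> exp (- ln 2)" unfolding p_def using ln2_le_25_over_36 n1 by simp
    then have p: "0 < p" "p \<le> 1/2" by (auto simp: p_def exp_minus)
    obtain u where u: "u \<in> D" "F u = p" by (rule quantile[of p]) (use p in auto)
    have "exp (ln (F r)) < p" unfolding p_def exp_less_cancel_iff using False by simp
    then have "F r < p" using F_bounds[OF r(1)] by simp
    then have "r \<le> u" using F_mono[of u r] u by (rule_tac ccontr) auto
    then have k: "kappa u \<le> kappa r" by (rule kappa_antimono[OF r(1) u(1)])
    have "sqrt (n * - ln (F u)) \<le> 64 * kappa u"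
      by (rule small[OF u(1)]) (use u p in \<open>auto simp: p_def\<close>)
    moreover have "8/10 * n \<le> sqrt (n * - ln (F u))"
      by (rule real_le_rsqrt) (simp add: u p_def power2_eq_square)
    ultimately have "8/10 * n \<le> 64 * kappa r" using k by linarith
    then show ?thesis by simp
  qed
qed

end

text \<open>The moment and tail hypotheses are those inherited from the marginal \<open>\<psi>\<^sub>2\<close> bound \<open>t\<close>.\<close>
locale radial_psi2 = radial_density +
  fixes t :: real
  assumes t: "0 < t"
    and moment: "(\<integral>\<^sup>+x. ennreal (x\<^sup>2 * h x) \<partial>lborel) \<le> ennreal (n * t\<^sup>2)"
    and tail: "\<And>r. r \<in> D \<Longrightarrow> Fb r * exp (r\<^sup>2 / (2 * t\<^sup>2)) \<le> 2 * exp (4 * n)"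
begin

lemma mode:
  obtains M where "0 < M" "M \<le> 8 * (sqrt n * t)"
    and "\<And>r. r \<in> D \<Longrightarrow> 1 - sqrt (- ln (F r) / n) \<le> sqrt (r / M)"
    and "\<And>r. r \<in> D \<Longrightarrow> sqrt (r / M) \<le> 1 + sqrt (- ln (Fb r) / n)"
    and "\<And>r. r \<in> D \<Longrightarrow> F r \<le> 1/2 \<Longrightarrow> sqrt (n * - ln (F r)) \<le> 80 * kappa r \<or> n \<le> 80 * kappa r"
proof -
  obtain M where M: "0 < M" "M \<le> 8 * (sqrt n * t)"
    and l: "\<And>r. r \<in> D \<Longrightarrow> r \<le> M \<Longrightarrow> F r \<le> exp (- (n * (sqrt (r / M) - 1)\<^sup>2))"
    and r: "\<And>r. r \<in> D \<Longrightarrow> M \<le> r \<Longrightarrow> Fb r \<le> exp (- (n * (sqrt (r / M) - 1)\<^sup>2))"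
    by (rule two_sided_tails[of "8 * (sqrt n * t)"]) (use below_le_second_moment[OF t moment] in auto)
  show thesis
    by (rule that[OF M]; rule kappa_lower[OF M(1) l r]; assumption)
qed

lemma kappa_ge:
  "r \<in> D \<Longrightarrow> F r \<le> 1/2 \<Longrightarrow> sqrt (n * - ln (F r)) \<le> 80 * kappa r \<or> n \<le> 80 * kappa r"
  by (rule mode) blast

text \<open>Between \<open>r\<close> and the median m the bound \<open>kappa <= n\<close> makes
  \<open>F\<close> fall no faster than the n-th power, and the upper shell bound places m below
  \<open>4 M <= 32 sqrt n t\<close>. The factor 2 from the level 1/2 is absorbed as
  \<open>2 <= 2^n\<close>.\<close>

lemma power_le_F:
  assumes r: "r \<in> D" "F r \<le> 1/2"
  shows "r ^ n \<le> (64 * (sqrt n * t)) ^ n * F r"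
proof -
  have n1: "real n \<ge> 1" using n by simp
  obtain M where M: "0 < M" "M \<le> 8 * (sqrt n * t)"
    and su: "\<And>r. r \<in> D \<Longrightarrow> sqrt (r / M) \<le> 1 + sqrt (- ln (Fb r) / n)"
    by (rule mode) blast
  obtain m where m: "m \<in> D" "F m = 1/2" by (rule quantile[of "1/2"]) auto
  have pos: "0 < r" "0 < m" using r m D_pos by auto
  have rm: "r \<le> m" using F_strict[OF m(1) r(1)] m r by (rule_tac ccontr) auto
  have "ln (Fb m) = - ln 2" unfolding Fb_def m by (simp add: ln_div)
  then have "sqrt (m / M) \<le> 1 + sqrt (ln 2 / n)" using su[OF m(1)] by simp
  also have "sqrt (ln 2 / n) \<le> 1"
    using ln2_le_25_over_36 n1 by (intro real_le_lsqrt) (auto simp: field_simps)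
  finally have "sqrt (m / M) \<le> 2" by simp
  then have "m / M \<le> 2\<^sup>2" by (rule sqrt_le_D)
  then have m32: "m \<le> 32 * (sqrt n * t)" using M by (simp add: field_simps)
  have "ln (1/2) - ln (F r) \<le> kappa r * ln (m / r)"
    using ln_F_diff(1)[OF r(1) m(1) rm] m by simp
  also have "\<dots> \<le> n * ln (m / r)"
    by (rule mult_right_mono[OF kappa_le[OF r(1)]]) (use rm pos in simp)
  also have "\<dots> = ln ((m / r) ^ n)" using pos by (simp add: ln_realpow)
  finally have "ln (1/2 / F r) \<le> ln ((m / r) ^ n)" using F_bounds[OF r(1)] by (simp add: ln_div ln_mult)
  then have "1/2 / F r \<le> (m / r) ^ n"
    using F_bounds[OF r(1)] pos by (subst (asm) ln_le_cancel_iff) auto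
  then have "r ^ n \<le> 2 * m ^ n * F r"
    using F_bounds[OF r(1)] pos by (simp add: power_divide field_simps)
  also have "2 * m ^ n \<le> 2 ^ n * m ^ n"
    using n pos power_increasing[of 1 n "2::real"] by (intro mult_right_mono) auto
  also have "\<dots> = (2 * m) ^ n" by (simp add: power_mult_distrib)
  also have "\<dots> \<le> (64 * (sqrt n * t)) ^ n" by (rule power_mono) (use m32 pos in \<open>simp_all add: mult_ac\<close>)
  finally show ?thesis using F_bounds[OF r(1)] by (simp add: mult_right_mono)
qed

text \<open>With L = - ln (Fb r) and b the point of level 1/4, \<open>ln Fb\<close> falls by at
  least L / 2 from b to r, and \<open>r - b <= 80 t sqrt L\<close>. For \<open>L <= n\<close> this
  distance bound is the width of the shell; for \<open>L > n\<close> it follows from the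
  sub-Gaussian tail hypothesis, whose loss \<open>exp (4 n)\<close> is then harmless. Dividing
  bounds the nondecreasing \<open>hazard\<close> at r.\<close>

lemma hazard_ge:
  assumes r: "r \<in> D" "Fb r \<le> 1/2"
  shows "sqrt (- ln (Fb r)) \<le> 160 * t * hazard r"
proof -
  have n1: "real n \<ge> 1" using n by simp
  obtain M where M: "0 < M" "M \<le> 8 * (sqrt n * t)"
    and sl: "\<And>r. r \<in> D \<Longrightarrow> 1 - sqrt (- ln (F r) / n) \<le> sqrt (r / M)"
    and su: "\<And>r. r \<in> D \<Longrightarrow> sqrt (r / M) \<le> 1 + sqrt (- ln (Fb r) / n)"
    by (rule mode) blast
  obtain b where b: "b \<in> D" "F b = 1/4" by (rule quantile[of "1/4"]) auto
  have Fbb: "Fb b = 3/4" using b by (simp add: Fb_def)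
  define L where "L = - ln (Fb r)"
  have L: "ln 2 \<le> L" "L / 2 \<le> ln (3/4) + L" "ln 4 \<le> 2 * L"
    using ln_half_bound[of "Fb r" L] Fb_bounds[OF r(1)] r(2) by (auto simp: L_def)
  have L0: "L > 0" using L(1) ln_gt_zero[of 2] by linarith
  have br: "b \<le> r" using F_mono[of r b] b r by (rule_tac ccontr) (auto simp: Fb_def)
  have pos: "0 < r" "0 < b" using r b D_pos by auto
  have dist: "r - b \<le> 80 * t * sqrt L"
  proof (cases "L \<le> n")
    case True
    define s where "s = sqrt (L / n)"
    have s: "0 < s" "s \<le> 1" using L0 n1 True by (auto simp: s_def)
    define x where "x = sqrt (r / M)"
    define y where "y = sqrt (b / M)"
    have x: "x \<le> 1 + s" using su[OF r(1)] by (simp add: x_def s_def L_def)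
    have "1 - sqrt (ln 4 / n) \<le> y" using sl[OF b(1)] b by (simp add: y_def ln_div)
    moreover have "sqrt (ln 4 / n) \<le> sqrt (2 * (L / n))"
      using L(3) n1 by (intro real_sqrt_le_mono) (simp add: field_simps)
    moreover have "\<dots> = sqrt 2 * s" by (simp add: s_def real_sqrt_mult real_sqrt_divide)
    moreover have "\<dots> \<le> 3/2 * s"
      using s real_le_lsqrt[of "3/2" 2] by (intro mult_right_mono) (auto simp: power2_eq_square)
    ultimately have y: "1 - 3/2 * s \<le> y" by linarith
    have yx: "0 \<le> y" "y \<le> x" using pos br M by (auto simp: x_def y_def divide_right_mono)
    have "r - b = M * (x\<^sup>2 - y\<^sup>2)" using pos M by (simp add: x_def y_def field_simps)
    also have "\<dots> = M * ((x - y) * (x + y))" by (simp add: power2_eq_square algebra_simps)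
    also have "\<dots> \<le> M * ((5/2 * s) * 4)"
      by (intro mult_left_mono mult_mono) (use x y yx s M in auto)
    also have "\<dots> \<le> 8 * (sqrt n * t) * ((5/2 * s) * 4)"
      by (rule mult_right_mono[OF M(2)]) (use s in simp)
    also have "\<dots> = 80 * t * (sqrt n * s)" by simp
    also have "sqrt n * s = sqrt L" using n1 by (simp add: s_def real_sqrt_divide)
    finally show ?thesis .
  next
    case False
    have "Fb r * exp (r\<^sup>2 / (2 * t\<^sup>2)) \<le> 2 * exp (4 * n)" by (rule tail[OF r(1)])
    then have "ln (Fb r * exp (r\<^sup>2 / (2 * t\<^sup>2))) \<le> ln (2 * exp (4 * n))"
      using Fb_bounds[OF r(1)] by (subst ln_le_cancel_iff) auto
    then have "r\<^sup>2 / (2 * t\<^sup>2) \<le> L + ln 2 + 4 * n"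
      using Fb_bounds[OF r(1)] by (simp add: ln_mult L_def)
    also have "\<dots> \<le> 6 * L" using L(1) False by simp
    finally have "r\<^sup>2 \<le> 12 * L * t\<^sup>2" using t by (simp add: field_simps)
    also have "\<dots> \<le> (80 * t * sqrt L)\<^sup>2" using L0 by (simp add: power_mult_distrib)
    finally have "r \<le> 80 * t * sqrt L" by (rule power2_le_imp_le) (use t L0 in simp)
    then show ?thesis using pos by simp
  qed
  have "L / 2 \<le> ln (Fb b) - ln (Fb r)" using L unfolding Fbb by (simp add: L_def)
  also have "\<dots> \<le> hazard r * (r - b)" by (rule ln_Fb_diff(1)[OF b(1) r(1) br])
  also have "\<dots> \<le> hazard r * (80 * t * sqrt L)"
    by (rule mult_left_mono[OF dist]) (use hazard_pos[OF r(1)] in simp)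
  finally have "sqrt L * sqrt L \<le> (160 * t * hazard r) * sqrt L" using L0 by (simp add: mult_ac)
  then have "sqrt L \<le> 160 * t * hazard r" by (rule mult_right_le_imp_le) (use L0 in simp)
  then show ?thesis by (simp add: L_def)
qed

end

section \<open>Transport of the radial Gaussian law\<close>

text \<open>The chi law with n degrees of freedom, that is, the law of the norm of a standard
  Gaussian vector; c is the logarithm of the normalising constant.\<close>

locale chi = radial_density n "{0<..}" "\<lambda>s. s\<^sup>2 / 2 + c" for n :: nat and c :: real
begin

lemma sh_deriv: "0 < (s::real) \<Longrightarrow> ((\<lambda>s. s * h s) has_real_derivative (real n - s\<^sup>2) * h s) (at s)"
proof -
  assume s: "0 < s"
  have hs: "h s = s ^ (n - 1) * exp (- (s\<^sup>2 / 2 + c))" using s by (simp add: h_D)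
  have sn: "s ^ n = s * s ^ (n - 1)" using n by (simp add: power_eq_if)
  have "((\<lambda>s. s ^ n * exp (- (s\<^sup>2 / 2 + c))) has_real_derivative
      real n * s ^ (n - 1) * exp (- (s\<^sup>2 / 2 + c)) + s ^ n * (exp (- (s\<^sup>2 / 2 + c)) * - s)) (at s)"
    by (auto intro!: derivative_eq_intros)
  also have "real n * s ^ (n - 1) * exp (- (s\<^sup>2 / 2 + c)) + s ^ n * (exp (- (s\<^sup>2 / 2 + c)) * - s)
      = (real n - s\<^sup>2) * h s"
    unfolding hs sn by (simp add: power2_eq_square algebra_simps)
  finally have "((\<lambda>s. s ^ n * exp (- (s\<^sup>2 / 2 + c))) has_real_derivative (real n - s\<^sup>2) * h s) (at s)" .
  then show ?thesis
    by (rule has_field_derivative_transform_within_open[where S="{0<..}"]) (use s in \<open>auto simp: rh\<close>)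
qed

lemma h_deriv: "0 < (s::real) \<Longrightarrow> (h has_real_derivative - (s - (real n - 1) / s) * h s) (at s)"
proof -
  assume s: "0 < s"
  have "((\<lambda>s. s * h s / s) has_real_derivative ((real n - s\<^sup>2) * h s * s - s * h s * 1) / (s * s)) (at s)"
    by (rule DERIV_divide[OF sh_deriv[OF s] DERIV_ident]) (use s in simp)
  moreover have "((real n - s\<^sup>2) * h s * s - s * h s * 1) / (s * s) = - (s - (real n - 1) / s) * h s"
    using s n by (simp add: field_simps power2_eq_square of_nat_diff)
  ultimately have "((\<lambda>s. s * h s / s) has_real_derivative - (s - (real n - 1) / s) * h s) (at s)" by simp
  then show ?thesis
    by (rule has_field_derivative_transform_within_open[where S="{0<..}"]) (use s in auto)
qed

text \<open>The function \<open>s h s\<close> has its mode at \<open>sqrt n\<close>. Up to there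
  \<open>F_scale_le\<close> compares \<open>F s\<close> with its value at the mode, the exponential
  quotient being at most \<open>exp (n / 2)\<close>; beyond the mode the right-hand side is at least
  1.\<close>

lemma F_le_power: "0 < (s::real) \<Longrightarrow> F s \<le> (sqrt (exp 1) * s / sqrt n) ^ n"
proof -
  assume s: "0 < s"
  have n0: "real n > 0" using n by simp
  have e: "sqrt (exp 1) = exp (1/2 :: real)" by (simp add: real_sqrt_unique power2_eq_square exp_add[symmetric])
  show ?thesis
  proof (cases "s \<le> sqrt n")
    case True
    have "F s * (sqrt n * h (sqrt n)) \<le> F (sqrt n) * (s * h s)"
      by (rule F_scale_le) (use s n0 True in auto)
    also have "\<dots> \<le> 1 * (s * h s)"
      by (rule mult_right_mono) (use law.cdf_bounded_prob s h_nonneg in auto)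
    finally have "F s * (sqrt n ^ n * exp (- (n / 2 + c))) \<le> s ^ n * exp (- (s\<^sup>2 / 2 + c))"
      using s n0 by (simp add: rh)
    then have "F s \<le> s ^ n * exp (- (s\<^sup>2 / 2 + c)) / (sqrt n ^ n * exp (- (n / 2 + c)))"
      using n0 by (simp add: pos_le_divide_eq)
    also have "\<dots> = (s / sqrt n) ^ n * (exp (- (s\<^sup>2 / 2 + c)) / exp (- (n / 2 + c)))"
      by (simp add: power_divide)
    also have "exp (- (s\<^sup>2 / 2 + c)) / exp (- (n / 2 + c)) = exp (n / 2 - s\<^sup>2 / 2)"
      by (simp add: exp_diff[symmetric])
    also have "(s / sqrt n) ^ n * exp (n / 2 - s\<^sup>2 / 2) \<le> (s / sqrt n) ^ n * exp (n * (1/2))"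
      using s by (intro mult_left_mono) auto
    also have "\<dots> = (sqrt (exp 1) * s / sqrt n) ^ n"
      unfolding e exp_of_nat_mult by (simp add: power_mult_distrib power_divide)
    finally show ?thesis .
  next
    case False
    have "1 \<le> sqrt (exp 1) * s / sqrt n"
    proof -
      have "1 \<le> sqrt (exp (1::real))" by simp
      then have "1 * sqrt n \<le> sqrt (exp 1) * s" using False by (intro mult_mono) auto
      then show ?thesis using n0 by (simp add: pos_le_divide_eq)
    qed
    then have "1 \<le> (sqrt (exp 1) * s / sqrt n) ^ n" by (rule one_le_power)
    then show ?thesis using law.cdf_bounded_prob[of s] by linarith
  qed
qed

text \<open>For \<open>J(s) = s h(s) - (real n - s\<^sup>2) F(s)\<close> one has \<open>J' = 2 s F\<close>, while
  \<open>F(x) \<le> F(s) (x / s) ^ kappa(s)\<close> for \<open>x \<le> s\<close>.\<close>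
lemma kappa_sq_le:
  fixes s :: real
  assumes s: "0 < s"
  shows "kappa s * (kappa s - (real n - s\<^sup>2)) \<le> 2 * s\<^sup>2"
proof -
  define k where "k = kappa s"
  have k: "k > 0" unfolding k_def by (rule kappa_pos) (use s in simp)
  define J where "J x = x * h x - (real n - x\<^sup>2) * F x" for x
  \<comment> \<open>The primitive, vanishing at 0, of the majorant \<open>2 x F(s) (x / s)^k\<close>
    of \<open>J'\<close>; its value at s is \<open>2 s^2 F(s) / (k + 2)\<close>.\<close>
  define H where "H x = F s * s powr (- k) * (2 / (k + 2)) * x powr (k + 2)" for x
  have dJ: "(J has_real_derivative 2 * x * F x) (at x)" if "0 < x" for x
    unfolding J_def[abs_def]
    using DERIV_diff[OF sh_deriv[OF that] DERIV_mult[OF DERIV_diff[OF DERIV_const[of "real n"] DERIV_power[OF DERIV_ident, where n=2]] F_deriv[of x]]] that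
    by (simp add: algebra_simps)
  have dH: "(H has_real_derivative 2 * x * (F s * (x / s) powr k)) (at x)" if x: "0 < x" for x
  proof -
    have "((\<lambda>x. x powr (k + 2)) has_real_derivative (k + 2) * x powr (k + 2 - 1)) (at x)"
      by (rule has_real_derivative_powr[OF x])
    then have *: "(H has_real_derivative F s * s powr (- k) * (2 / (k + 2)) * ((k + 2) * x powr (k + 2 - 1))) (at x)"
      unfolding H_def[abs_def] by (rule DERIV_cmult)
    have p1: "x powr (k + 2 - 1) = x powr k * x"
      using x by (simp add: powr_add)
    have p2: "(x / s) powr k = x powr k * s powr (- k)"
      using x s by (simp add: powr_divide powr_minus_divide)
    have p3: "A * B * (2 / (k + 2)) * ((k + 2) * (P * x)) = 2 * x * (A * (P * B))" for A B P :: real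
      using k by (simp add: divide_simps)
    from * show ?thesis unfolding p1 p2 p3 .
  qed
  have Fle: "F x \<le> F s * (x / s) powr k" if x: "0 < x" "x \<le> s" for x
  proof -
    have "k * ln (s / x) \<le> ln (F s) - ln (F x)"
      unfolding k_def by (rule ln_F_diff(2)) (use x s in auto)
    then have "ln (F x) \<le> ln (F s) + k * ln (x / s)" using x s by (simp add: ln_div algebra_simps)
    then have "exp (ln (F x)) \<le> exp (ln (F s) + k * ln (x / s))" by simp
    then show ?thesis using F_bounds[of x] F_bounds[of s] x s by (simp add: exp_add powr_def)
  qed
  have mono: "H x - J x \<le> H s - J s" if x: "0 < x" "x \<le> s" for x
  proof (rule DERIV_nonneg_imp_nondecreasing[OF x(2), where f="\<lambda>x. H x - J x"])
    fix y assume y: "x \<le> y" "y \<le> s"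
    then have y0: "0 < y" using x by simp
    have "0 \<le> 2 * y * (F s * (y / s) powr k) - 2 * y * F y"
      using Fle[OF y0 y(2)] y0 by (simp add: algebra_simps)
    then show "\<exists>d. ((\<lambda>x. H x - J x) has_real_derivative d) (at y) \<and> 0 \<le> d"
      using DERIV_diff[OF dH[OF y0] dJ[OF y0]] by blast
  qed
  have JH: "J s \<le> H s"
  proof (rule field_le_epsilon)
    fix e :: real assume e: "e > 0"
    \<comment> \<open>Replaces the limit of \<open>J\<close> at 0: at a point x of level p the
      estimate \<open>x h x <= n F x\<close> leaves at most \<open>x^2 F x\<close> in
      \<open>J x\<close>, and p is chosen so small that this is at most e.\<close>
    define p where "p = min (F s) (e / (n + s\<^sup>2))"
    have p: "0 < p" "p < 1" using F_bounds[of s] s e n by (auto simp: p_def add_pos_nonneg)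
    obtain x where x: "x \<in> {0<..}" "F x = p" by (rule quantile[OF p])
    have xs: "x \<le> s" using F_strict[of s x] x s by (rule_tac ccontr) (auto simp: p_def)
    have "x * h x = kappa x * F x" using F_bounds[OF x(1)] by (simp add: kappa_def)
    also have "\<dots> \<le> n * F x" by (rule mult_right_mono[OF kappa_le[OF x(1)]]) (use F_bounds[OF x(1)] in simp)
    finally have "J x \<le> x\<^sup>2 * F x" by (simp add: J_def algebra_simps)
    also have "\<dots> \<le> s\<^sup>2 * F x" by (rule mult_right_mono) (use x xs F_bounds[OF x(1)] in \<open>auto intro: power_mono\<close>)
    also have "\<dots> \<le> (n + s\<^sup>2) * F x" using F_bounds[OF x(1)] by simp
    also have "\<dots> \<le> (n + s\<^sup>2) * (e / (n + s\<^sup>2))" using x s n by (intro mult_left_mono) (auto simp: p_def)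
    also have "\<dots> = e" using n s by (simp add: add_pos_nonneg less_imp_neq[symmetric])
    finally have "J x \<le> e" .
    moreover have "0 \<le> H x" using k F_bounds[of s] s by (simp add: H_def)
    ultimately show "J s \<le> H s + e" using mono[of x] x xs by simp
  qed
  have p: "s powr (- k) * s powr (k + 2) = s\<^sup>2" using s by (simp add: powr_add[symmetric])
  have "H s = F s * (2 / (k + 2)) * (s powr (- k) * s powr (k + 2))" by (simp add: H_def mult_ac)
  then have "H s = F s * (2 * s\<^sup>2 / (k + 2))" unfolding p by simp
  moreover have "J s = F s * (k - (real n - s\<^sup>2))"
  proof -
    have "s * h s = k * F s" using F_bounds[of s] s by (simp add: k_def kappa_def)
    then show ?thesis unfolding J_def mult.commute[of "F s"] by (simp only: left_diff_distrib)
  qed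
  ultimately have "F s * (k - (real n - s\<^sup>2)) \<le> F s * (2 * s\<^sup>2 / (k + 2))" using JH by (simp only:)
  then have "k - (real n - s\<^sup>2) \<le> 2 * s\<^sup>2 / (k + 2)"
    by (rule mult_left_le_imp_le) (use F_bounds[of s] s in simp)
  then have "(k - (real n - s\<^sup>2)) * (k + 2) \<le> 2 * s\<^sup>2" using k by (simp add: pos_le_divide_eq)
  then have "k * (k - (real n - s\<^sup>2)) \<le> 2 * s\<^sup>2"
  proof (cases "0 \<le> k - (real n - s\<^sup>2)")
    case False
    then have "k * (k - (real n - s\<^sup>2)) \<le> 0" using k by (simp add: mult_nonneg_nonpos)
    then show ?thesis using zero_le_power2[of s] by linarith
  qed (simp add: algebra_simps)
  then show ?thesis by (simp add: k_def)
qed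

text \<open>At \<open>sqrt n\<close> the quadratic inequality \<open>kappa_sq_le\<close> reads
  \<open>kappa^2 <= 2 n\<close>. To its left, \<open>kappa' = kappa (n - x^2 - kappa) / x\<close>
  and the same inequality show that \<open>kappa^2 + 4 n ln F\<close> is nondecreasing; to its right
  \<open>kappa\<close> only gets smaller.\<close>

lemma kappa_upper:
  fixes s :: real
  assumes s: "0 < s"
  shows "(kappa s)\<^sup>2 \<le> 2 * real n + 4 * real n * - ln (F s)"
proof -
  have n0: "sqrt n > 0" using n by simp
  have k0: "0 < kappa x" if "0 < x" for x by (rule kappa_pos) (use that in simp)
  have top: "(kappa (sqrt n))\<^sup>2 \<le> 2 * n"
    using kappa_sq_le[OF n0] by (simp add: power2_eq_square)
  show ?thesis
  proof (cases "s \<le> sqrt n")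
    case True
    define Q where "Q x = (kappa x)\<^sup>2 + 4 * n * ln (F x)" for x
    have "Q s \<le> Q (sqrt n)"
    proof (rule DERIV_nonneg_imp_nondecreasing[OF True])
      fix x assume x: "s \<le> x" "x \<le> sqrt n"
      then have x0: "0 < x" using s by simp
      have Fx: "F x > 0" using F_bounds[of x] x0 by simp
      have dk: "(kappa has_real_derivative kappa x / x * (real n - x\<^sup>2 - kappa x)) (at x)"
      proof -
        have "((\<lambda>x. x * h x / F x) has_real_derivative
            ((real n - x\<^sup>2) * h x * F x - x * h x * h x) / (F x * F x)) (at x)"
          by (rule DERIV_divide[OF sh_deriv[OF x0] F_deriv]) (use x0 Fx in auto)
        moreover have "((real n - x\<^sup>2) * h x * F x - x * h x * h x) / (F x * F x)
            = kappa x / x * (real n - x\<^sup>2 - kappa x)"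
          unfolding kappa_def using Fx x0 by (simp add: divide_simps) (simp add: algebra_simps)
        ultimately show ?thesis by (simp add: kappa_def[abs_def])
      qed
      have dQ: "(Q has_real_derivative 2 * kappa x * (kappa x / x * (real n - x\<^sup>2 - kappa x)) + 4 * n * (kappa x / x)) (at x)"
        unfolding Q_def[abs_def]
        using DERIV_add[OF DERIV_power[OF dk, of 2] DERIV_cmult[OF ln_F_deriv, of x "4 * real n"]] x0
        by (simp add: mult_ac)
      have "x\<^sup>2 \<le> (sqrt n)\<^sup>2" by (rule power_mono) (use x x0 in auto)
      then have "kappa x * (kappa x - (real n - x\<^sup>2)) \<le> 2 * n" using kappa_sq_le[OF x0] by simp
      then have "0 \<le> 2 * kappa x / x * (2 * n - kappa x * (kappa x - (real n - x\<^sup>2)))"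
        using k0[OF x0] x0 by (intro mult_nonneg_nonneg) auto
      also have "\<dots> = 2 * kappa x * (kappa x / x * (real n - x\<^sup>2 - kappa x)) + 4 * n * (kappa x / x)"
        by (simp add: algebra_simps)
      finally show "\<exists>y. (Q has_real_derivative y) (at x) \<and> 0 \<le> y" using dQ by blast
    qed
    moreover have "4 * n * ln (F (sqrt n)) \<le> 0"
      using F_bounds[of "sqrt n"] n0 by (auto intro!: mult_nonneg_nonpos)
    ultimately show ?thesis using top by (simp add: Q_def)
  next
    case False
    have "kappa s \<le> kappa (sqrt n)" by (rule kappa_antimono) (use False n0 s in auto)
    then have "(kappa s)\<^sup>2 \<le> (kappa (sqrt n))\<^sup>2" using k0[OF s] by (intro power_mono) auto
    moreover have "0 \<le> 4 * n * - ln (F s)" using F_bounds[of s] s by (intro mult_nonneg_nonneg) auto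
    ultimately show ?thesis using top by linarith
  qed
qed

lemma h_tendsto_0: "(h \<longlongrightarrow> 0) at_top"
proof -
  have lim: "((\<lambda>x::real. x ^ (n - 1) / exp x * exp (- c)) \<longlongrightarrow> 0 * exp (- c)) at_top"
    by (intro tendsto_intros tendsto_power_div_exp_0)
  have le: "h x \<le> x ^ (n - 1) / exp x * exp (- c)" if "x \<ge> 2" for x
  proof -
    have "x \<le> x\<^sup>2 / 2" using mult_right_mono[OF that, of x] that by (simp add: power2_eq_square)
    then have "exp (- (x\<^sup>2 / 2 + c)) \<le> exp (- x - c)" by simp
    also have "\<dots> = exp (- c) / exp x" by (simp add: exp_diff exp_minus field_simps)
    finally have "x ^ (n - 1) * exp (- (x\<^sup>2 / 2 + c)) \<le> x ^ (n - 1) * (exp (- c) / exp x)"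
      using that by (intro mult_left_mono) auto
    then show ?thesis using that by (simp add: h_D)
  qed
  show ?thesis
  proof (rule tendsto_sandwich[OF _ _ tendsto_const])
    show "((\<lambda>x::real. x ^ (n - 1) / exp x * exp (- c)) \<longlongrightarrow> 0) at_top" using lim by simp
    show "eventually (\<lambda>x. h x \<le> x ^ (n - 1) / exp x * exp (- c)) at_top"
      by (rule eventually_mono[OF eventually_ge_at_top[of 2]]) (rule le)
  qed (simp add: h_nonneg)
qed

text \<open>The same argument for \<open>h - b Fb\<close> with \<open>b = - (ln h)'\<close>, integrating from infinity.\<close>
lemma hazard_sq_le:
  fixes s :: real
  assumes s: "0 < s"
  shows "hazard s * (hazard s - (s - (real n - 1) / s)) \<le> 1 + (real n - 1) / s\<^sup>2"
proof -
  define g where "g = hazard s"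
  have g: "g > 0" unfolding g_def by (rule hazard_pos) (use s in simp)
  define b where "b x = x - (real n - 1) / x" for x
  define B where "B = 1 + (real n - 1) / s\<^sup>2"
  have B0: "B > 0" using n by (simp add: B_def add_pos_nonneg)
  define J where "J x = h x - b x * Fb x" for x
  \<comment> \<open>The integral from x to infinity of \<open>B Fb(s) exp (- g (y - s))\<close>,
    which dominates \<open>- J'\<close> beyond s because \<open>Fb\<close> decays there at rate at
    least \<open>g\<close>.\<close>
  define H where "H x = B * Fb s / g * exp (- (g * (x - s)))" for x
  have db: "(b has_real_derivative 1 + (real n - 1) / x\<^sup>2) (at x)" if "0 < x" for x
    unfolding b_def[abs_def] using that
    by (auto intro!: derivative_eq_intros simp: power2_eq_square diff_divide_distrib)
  have dJ: "(J has_real_derivative - (1 + (real n - 1) / x\<^sup>2) * Fb x) (at x)" if x: "0 < x" for x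
  proof -
    have "(J has_real_derivative - b x * h x - ((1 + (real n - 1) / x\<^sup>2) * Fb x + - h x * b x)) (at x)"
      unfolding J_def[abs_def]
      by (rule DERIV_diff[OF _ DERIV_mult[OF db[OF x] Fb_deriv]]) (use h_deriv[OF x] x in \<open>auto simp: b_def\<close>)
    then show ?thesis by (simp add: algebra_simps)
  qed
  have dH: "(H has_real_derivative - (B * Fb s * exp (- (g * (x - s))))) (at x)" for x
    unfolding H_def[abs_def] using g by (auto intro!: derivative_eq_intros)
  have Fle: "Fb x \<le> Fb s * exp (- (g * (x - s)))" if x: "s \<le> x" for x
  proof -
    have "g * (x - s) \<le> ln (Fb s) - ln (Fb x)"
      unfolding g_def by (rule ln_Fb_diff(2)) (use x s in auto)
    then have "exp (ln (Fb x)) \<le> exp (ln (Fb s) + - (g * (x - s)))" by simp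
    then show ?thesis using Fb_bounds[of x] Fb_bounds[of s] x s unfolding exp_add by simp
  qed
  have mono: "H x - J x \<le> H s - J s" if x: "s \<le> x" for x
  proof (rule DERIV_nonpos_imp_nonincreasing[OF x, where f="\<lambda>x. H x - J x"])
    fix y assume y: "s \<le> y" "y \<le> x"
    then have y0: "0 < y" using s by simp
    have "(1 + (real n - 1) / y\<^sup>2) * Fb y \<le> B * (Fb s * exp (- (g * (y - s))))"
    proof (rule mult_mono)
      have "s\<^sup>2 \<le> y\<^sup>2" by (rule power_mono) (use y s in auto)
      then show "1 + (real n - 1) / y\<^sup>2 \<le> B"
        unfolding B_def using s n y0 by (intro add_mono divide_left_mono) auto
    qed (use Fle[OF y(1)] Fb_bounds[of y] y0 B0 in auto)
    then have "- (B * Fb s * exp (- (g * (y - s)))) - (- (1 + (real n - 1) / y\<^sup>2) * Fb y) \<le> 0"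
      by (simp only: minus_mult_left mult.assoc diff_minus_eq_add)
    then show "\<exists>d. ((\<lambda>x. H x - J x) has_real_derivative d) (at y) \<and> d \<le> 0"
      using DERIV_diff[OF dH dJ[OF y0]] by blast
  qed
  have "J s \<le> H s"
  proof (rule field_le_epsilon)
    fix e :: real assume e: "e > 0"
    \<comment> \<open>Replaces the limit at infinity: far out, \<open>h\<close> is below e and
      \<open>b\<close> is nonnegative once x is at least n, so \<open>J x <= e\<close>.\<close>
    have "eventually (\<lambda>x. h x < e \<and> max s n \<le> x) at_top"
      by (intro eventually_conj order_tendstoD(2)[OF h_tendsto_0 e] eventually_ge_at_top)
    then obtain x :: real where x: "h x < e" "s \<le> x" "n \<le> x"
      by (auto simp: eventually_at_top_linorder)
    have x1: "x \<ge> 1" using x n by simp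
    have "(real n - 1) / x \<le> x"
    proof -
      have "(real n - 1) / x \<le> (real n - 1) / 1" using x1 n by (intro divide_left_mono) auto
      then show ?thesis using x by simp
    qed
    then have "0 \<le> b x * Fb x" using Fb_bounds[of x] x1 by (simp add: b_def)
    then have "J x \<le> e" using x by (simp add: J_def)
    moreover have "0 \<le> H x" using g B0 Fb_bounds[of s] s by (simp add: H_def)
    ultimately show "J s \<le> H s + e" using mono[OF x(2)] by simp
  qed
  moreover have "H s = Fb s * (B / g)" by (simp add: H_def)
  moreover have "J s = Fb s * (g - b s)"
  proof -
    have "h s = g * Fb s" using Fb_bounds[of s] s by (simp add: g_def hazard_def)
    then show ?thesis unfolding J_def mult.commute[of "Fb s"] by (simp only: left_diff_distrib)
  qed
  ultimately have "Fb s * (g - b s) \<le> Fb s * (B / g)" by (simp only:)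
  then have "g - b s \<le> B / g" by (rule mult_left_le_imp_le) (use Fb_bounds[of s] s in simp)
  then show ?thesis using g by (simp add: g_def[symmetric] b_def B_def[symmetric] pos_le_divide_eq mult.commute)
qed

text \<open>Mirror image of \<open>kappa_upper\<close>: \<open>hazard' = hazard (hazard - b)\<close>
  with \<open>b = - (ln h)'\<close>, and \<open>hazard_sq_le\<close> makes
  \<open>hazard^2 + 4 ln Fb\<close> nonincreasing beyond \<open>sqrt n\<close>, where
  \<open>hazard <= 2\<close>. Before \<open>sqrt n\<close> the monotonicity of \<open>hazard\<close>
  suffices.\<close>

lemma hazard_upper:
  fixes s :: real
  assumes s: "0 < s"
  shows "(hazard s)\<^sup>2 \<le> 4 + 4 * - ln (Fb s)"
proof -
  have n0: "sqrt n > 0" and n1: "real n \<ge> 1" using n by auto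
  have g0: "0 < hazard x" if "0 < x" for x by (rule hazard_pos) (use that in simp)
  have B: "1 + (real n - 1) / x\<^sup>2 \<le> 2" if "sqrt n \<le> x" for x
  proof -
    have x0: "x > 0" using that n0 by linarith
    have "(sqrt n)\<^sup>2 \<le> x\<^sup>2" by (rule power_mono) (use that in auto)
    then have "(real n - 1) / x\<^sup>2 \<le> 1" using x0 by (simp add: divide_le_eq)
    then show ?thesis by simp
  qed
  have top: "hazard (sqrt n) \<le> 2"
  proof (rule ccontr)
    define g where "g = hazard (sqrt n)"
    assume "\<not> hazard (sqrt n) \<le> 2"
    then have g2: "g > 2" by (simp add: g_def)
    have "sqrt n - (real n - 1) / sqrt n = 1 / sqrt n" using n0 by (simp add: field_simps)
    also have "\<dots> \<le> 1" using n1 by simp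
    finally have "g * (g - 1) \<le> g * (g - (sqrt n - (real n - 1) / sqrt n))"
      using g2 by (intro mult_left_mono) auto
    also have "\<dots> \<le> 2" using hazard_sq_le[OF n0] B[of "sqrt n"] by (simp add: g_def)
    finally have "g * (g - 1) \<le> 2" .
    moreover have "2 * 1 < g * (g - 1)" by (rule mult_strict_mono) (use g2 in auto)
    ultimately show False by simp
  qed
  show ?thesis
  proof (cases "sqrt n \<le> s")
    case True
    define Q where "Q x = (hazard x)\<^sup>2 + 4 * ln (Fb x)" for x
    have "Q s \<le> Q (sqrt n)"
    proof (rule DERIV_nonpos_imp_nonincreasing[OF True])
      fix x assume x: "sqrt n \<le> x" "x \<le> s"
      then have x0: "0 < x" using n0 by linarith
      have Fx: "Fb x > 0" using Fb_bounds[of x] x0 by simp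
      define b where "b = x - (real n - 1) / x"
      have dk: "(hazard has_real_derivative hazard x * (hazard x - b)) (at x)"
      proof -
        have "((\<lambda>x. h x / Fb x) has_real_derivative
            (- b * h x * Fb x - h x * - h x) / (Fb x * Fb x)) (at x)"
          unfolding b_def by (rule DERIV_divide[OF h_deriv[OF x0] Fb_deriv]) (use x0 Fx in auto)
        moreover have "(- b * h x * Fb x - h x * - h x) / (Fb x * Fb x) = hazard x * (hazard x - b)"
          unfolding hazard_def using Fx x0 by (simp add: divide_simps) (simp add: algebra_simps)
        ultimately show ?thesis by (simp add: hazard_def[abs_def])
      qed
      have dQ: "(Q has_real_derivative 2 * hazard x * (hazard x * (hazard x - b)) + 4 * - hazard x) (at x)"
        unfolding Q_def[abs_def]
        using DERIV_add[OF DERIV_power[OF dk, of 2] DERIV_cmult[OF ln_Fb_deriv, of x 4]] x0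
        by (simp add: mult_ac)
      have "hazard x * (hazard x - b) \<le> 2"
        using hazard_sq_le[OF x0] B[OF x(1)] by (simp add: b_def)
      then have "2 * hazard x * (hazard x * (hazard x - b)) + 4 * - hazard x \<le> 0"
        using g0[OF x0] mult_left_mono[of "hazard x * (hazard x - b)" 2 "2 * hazard x"] by simp
      then show "\<exists>y. (Q has_real_derivative y) (at x) \<and> y \<le> 0" using dQ by blast
    qed
    moreover have "ln (Fb (sqrt n)) \<le> 0" using Fb_bounds[of "sqrt n"] n0 by simp
    moreover have "(hazard (sqrt n))\<^sup>2 \<le> 2\<^sup>2" by (rule power_mono[OF top]) (use g0[OF n0] in simp)
    ultimately show ?thesis by (simp add: Q_def)
  next
    case False
    have "hazard s \<le> hazard (sqrt n)" by (rule hazard_mono) (use False n0 s in auto)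
    then have "(hazard s)\<^sup>2 \<le> 2\<^sup>2" using g0[OF s] top by (intro power_mono) auto
    moreover have "0 \<le> - ln (Fb s)" using Fb_bounds[of s] s by simp
    ultimately show ?thesis by simp
  qed
qed

end

lemma radial_transport:
  assumes "chi n c" and "radial_psi2 n D v t"
  obtains \<phi> \<phi>' where
    "\<And>s. 0 < s \<Longrightarrow> \<phi> s \<in> D"
    "\<And>s. 0 < s \<Longrightarrow> cdf (radial_density.law n D v) (\<phi> s) = cdf (radial_density.law n {0<..} (\<lambda>s. s\<^sup>2 / 2 + c)) s"
    "\<And>s. 0 < s \<Longrightarrow> (\<phi> has_real_derivative \<phi>' s) (at s)"
    "continuous_on {0<..} \<phi>'"
    "\<And>s. 0 < s \<Longrightarrow> 0 \<le> \<phi>' s \<and> \<phi>' s \<le> 30720 * t"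
    "\<And>s. 0 < s \<Longrightarrow> 0 < \<phi> s \<and> \<phi> s \<le> 30720 * t * s"
proof -
  interpret X: chi n c by fact
  interpret Y: radial_psi2 n D v t by fact
  have n1: "real n \<ge> 1" using Y.n by simp
  obtain G where GF: "\<And>x. x \<in> D \<Longrightarrow> G (Y.F x) = x"
    and dG: "\<And>x. x \<in> D \<Longrightarrow> (G has_real_derivative 1 / Y.h x) (at (Y.F x))"
    and "\<And>x y. x \<in> D \<Longrightarrow> y \<in> D \<Longrightarrow> x < y \<Longrightarrow> Y.F x < Y.F y"
    by (rule increasing_inverse_deriv[OF Y.D_open Y.D_interval Y.F_deriv Y.h_pos]) blast+
  define \<phi> where "\<phi> s = G (X.F s)" for s
  define \<phi>' where "\<phi>' s = X.h s / Y.h (\<phi> s)" for s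
  have 1: "\<phi> s \<in> D" "Y.F (\<phi> s) = X.F s" if s: "0 < s" for s
  proof -
    obtain r where r: "r \<in> D" "Y.F r = X.F s"
      by (rule Y.quantile[of "X.F s"]) (use X.F_bounds[of s] s in auto)
    then have "\<phi> s = r" using GF[of r] by (simp add: \<phi>_def)
    with r show "\<phi> s \<in> D" "Y.F (\<phi> s) = X.F s" by auto
  qed
  have der: "(\<phi> has_real_derivative \<phi>' s) (at s)" if s: "0 < s" for s
  proof -
    have "(G has_real_derivative 1 / Y.h (\<phi> s)) (at (X.F s))"
      using dG[OF 1(1)[OF s]] 1(2)[OF s] by simp
    from DERIV_chain2[OF this X.F_deriv] s show ?thesis
      by (simp add: \<phi>_def[abs_def] \<phi>'_def)
  qed
  have cont: "continuous_on {0<..} \<phi>'"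
  proof -
    have "continuous_on {0<..} \<phi>"
      by (rule continuous_at_imp_continuous_on) (use der DERIV_isCont in auto)
    then have "continuous_on {0<..} (\<lambda>s. Y.h (\<phi> s))"
      by (rule continuous_on_compose2[OF Y.h_cont]) (use 1 in auto)
    then show ?thesis unfolding \<phi>'_def[abs_def]
      by (intro continuous_on_divide X.h_cont) (use Y.h_pos 1 in force)+
  qed
  have pos: "0 < \<phi> s" if "0 < s" for s using Y.D_pos 1 that by blast
  have nn: "0 \<le> \<phi>' s" if "0 < s" for s
    using X.h_nonneg Y.h_nonneg by (simp add: \<phi>'_def)
  \<comment> \<open>Combines the n-th power bounds for both distribution functions at the common
    level; taking n-th roots cancels \<open>sqrt n\<close>. The constant is 128 = 64 * 2, with
    \<open>sqrt e <= 2\<close>.\<close>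
  have low: "\<phi> s \<le> 128 * t * s" if s: "0 < s" and p: "X.F s \<le> 1/2" for s
  proof -
    define r where "r = \<phi> s"
    have r: "r \<in> D" "Y.F r = X.F s" using 1[OF s] by (auto simp: r_def)
    have r0: "0 < r" using pos[OF s] by (simp add: r_def)
    have "r ^ n \<le> (64 * (sqrt n * t)) ^ n * Y.F r" by (rule Y.power_le_F) (use r p in auto)
    also have "\<dots> \<le> (64 * (sqrt n * t)) ^ n * (sqrt (exp 1) * s / sqrt n) ^ n"
      using X.F_le_power[OF s] Y.t r by (intro mult_left_mono) auto
    also have "\<dots> = ((64 * (sqrt n * t)) * (sqrt (exp 1) * s / sqrt n)) ^ n"
      by (rule power_mult_distrib[symmetric])
    also have "(64 * (sqrt n * t)) * (sqrt (exp 1) * s / sqrt n) = 64 * t * sqrt (exp 1) * s"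
      using n1 by simp
    finally have "r \<le> 64 * t * sqrt (exp 1) * s"
      by (subst (asm) power_mono_iff) (use Y.n Y.t s r0 in auto)
    also have "\<dots> \<le> 64 * t * 2 * s"
      using exp_le Y.t s by (intro mult_right_mono mult_left_mono real_le_lsqrt) auto
    finally show ?thesis by (simp add: r_def)
  qed
  \<comment> \<open>Since L is at least 2/3, the Gaussian ratio is at most
    \<open>3 sqrt (n L)\<close>, and it never exceeds n; both alternatives of
    \<open>kappa_ge\<close> therefore give a quotient of at most 240. The remaining factor
    \<open>\<phi> s / s\<close> costs 128 t.\<close>
  have d1: "\<phi>' s \<le> 30720 * t" if s: "0 < s" and p: "X.F s \<le> 1/2" for s
  proof -
    define r where "r = \<phi> s"
    have r: "r \<in> D" "Y.F r = X.F s" using 1[OF s] by (auto simp: r_def)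
    have r0: "0 < r" using pos[OF s] by (simp add: r_def)
    have Fs: "0 < X.F s" "X.F s < 1" using X.F_bounds[of s] s by auto
    have ky: "0 < Y.kappa r" by (rule Y.kappa_pos[OF r(1)])
    define L where "L = - ln (X.F s)"
    have L: "ln 2 \<le> L" using ln_half_bound(1)[of "X.F s" L] Fs p by (simp add: L_def)
    then have L23: "2 / 3 \<le> L" using ln2_ge_two_thirds by linarith
    have "(X.kappa s)\<^sup>2 \<le> 2 * real n + 4 * real n * L" using X.kappa_upper[OF s] by (simp add: L_def)
    also have "2 * real n \<le> 5 * real n * L" using mult_left_mono[OF L23, of "3 * real n"] n1 L23
      by (simp add: mult_ac)
    finally have "(X.kappa s)\<^sup>2 \<le> (3 * sqrt (n * L))\<^sup>2"
      using L23 by (simp add: power_mult_distrib mult.commute)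
    then have k1: "X.kappa s \<le> 3 * sqrt (n * L)" by (rule power2_le_imp_le) (use L23 in simp)
    have k2: "X.kappa s \<le> n" by (rule X.kappa_le) (use s in simp)
    have "X.kappa s \<le> 240 * Y.kappa r"
      using Y.kappa_ge[OF r(1)] r(2) p k1 k2 ky by (auto simp: L_def)
    moreover have "X.kappa s = s * X.h s / X.F s" "Y.kappa r = r * Y.h r / X.F s"
      by (simp_all add: X.kappa_def Y.kappa_def r(2))
    ultimately have "s * X.h s \<le> 240 * (r * Y.h r)" using Fs by (simp add: divide_le_cancel field_simps)
    also have "\<dots> \<le> 240 * (128 * t * s * Y.h r)"
      using low[OF s p] Y.h_nonneg by (intro mult_left_mono mult_right_mono) (auto simp: r_def)
    finally have "s * X.h s \<le> s * (30720 * t * Y.h r)" by (simp add: mult_ac)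
    then have "X.h s \<le> 30720 * t * Y.h r" using s by simp
    then show ?thesis using Y.h_pos[OF r(1)] by (simp add: \<phi>'_def r_def pos_divide_le_eq)
  qed
  \<comment> \<open>At equal levels \<phi>' is the quotient of the two hazards, bounded by 4 * 160
    t.\<close>
  have d2: "\<phi>' s \<le> 640 * t" if s: "0 < s" and p: "1/2 \<le> X.F s" for s
  proof -
    define r where "r = \<phi> s"
    have r: "r \<in> D" "Y.F r = X.F s" using 1[OF s] by (auto simp: r_def)
    have Fs: "0 < X.Fb s" "X.Fb s < 1" using X.Fb_bounds[of s] s by auto
    have Fbr: "Y.Fb r = X.Fb s" using r by (simp add: X.Fb_def Y.Fb_def)
    define L where "L = - ln (X.Fb s)"
    have p': "X.Fb s \<le> 1/2" using p by (simp add: X.Fb_def)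
    have L: "ln 2 \<le> L" using ln_half_bound(1)[of "X.Fb s" L] Fs p' by (simp add: L_def)
    then have L23: "2 / 3 \<le> L" using ln2_ge_two_thirds by linarith
    have "(X.hazard s)\<^sup>2 \<le> 4 + 4 * L" using X.hazard_upper[OF s] by (simp add: L_def)
    also have "\<dots> \<le> (4 * sqrt L)\<^sup>2" using L23 by (simp add: power_mult_distrib)
    finally have g: "X.hazard s \<le> 4 * sqrt L" by (rule power2_le_imp_le) (use L23 in simp)
    have "sqrt L \<le> 160 * t * Y.hazard r" using Y.hazard_ge[OF r(1)] p' by (simp add: Fbr L_def)
    then have "X.hazard s \<le> 640 * t * Y.hazard r" using g by simp
    then have "X.h s \<le> 640 * t * Y.h r" using Fs
      by (simp add: X.hazard_def Y.hazard_def Fbr pos_divide_le_eq)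
    then show ?thesis using Y.h_pos[OF r(1)] by (simp add: \<phi>'_def r_def pos_divide_le_eq)
  qed
  have d: "\<phi>' s \<le> 30720 * t" if s: "0 < s" for s
  proof (cases "X.F s \<le> 1/2")
    case False
    then show ?thesis using d2[OF s] Y.t by simp
  qed (rule d1[OF s])
  have le: "\<phi> s \<le> 30720 * t * s" if s: "0 < s" for s
  proof (cases "X.F s \<le> 1/2")
    case True
    have "128 * t * s \<le> 30720 * t * s" using Y.t s by simp
    then show ?thesis using low[OF s True] by linarith
  next
    case False
    \<comment> \<open>Above the median the linear bound on \<phi> follows by integrating the bound
      on its derivative, starting from the median, where \<open>low\<close> applies.\<close>
    obtain m where m: "m \<in> {0<..}" "X.F m = 1/2" by (rule X.quantile[of "1/2"]) auto
    have m0: "0 < m" using m by simp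
    have ms: "m \<le> s" using X.F_mono[of s m] m False by (rule_tac ccontr) auto
    have "\<phi> s - 30720 * t * s \<le> \<phi> m - 30720 * t * m"
    proof (rule DERIV_nonpos_imp_nonincreasing[OF ms, where f="\<lambda>s. \<phi> s - 30720 * t * s"])
      fix x assume x: "m \<le> x" "x \<le> s"
      then have x0: "0 < x" using m0 by simp
      have "((\<lambda>s. \<phi> s - 30720 * t * s) has_real_derivative \<phi>' x - 30720 * t * 1) (at x)"
        by (intro DERIV_diff der x0 DERIV_cmult DERIV_ident)
      then show "\<exists>y. ((\<lambda>s. \<phi> s - 30720 * t * s) has_real_derivative y) (at x) \<and> y \<le> 0"
        using d[OF x0] by (intro exI[of _ "\<phi>' x - 30720 * t * 1"]) simp
    qed
    moreover have "\<phi> m \<le> 128 * t * m" using low[OF m0] m by simp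
    moreover have "128 * t * m \<le> 30720 * t * m" using Y.t m0 by simp
    ultimately show ?thesis by linarith
  qed
  show thesis
  proof (rule that[of \<phi> \<phi>'])
    show "continuous_on {0<..} \<phi>'" by (rule cont)
    fix s :: real
    assume s: "0 < s"
    show "\<phi> s \<in> D" "Y.F (\<phi> s) = X.F s" by (rule 1[OF s])+
    show "(\<phi> has_real_derivative \<phi>' s) (at s)" by (rule der[OF s])
    show "0 \<le> \<phi>' s \<and> \<phi>' s \<le> 30720 * t" using nn[OF s] d[OF s] by simp
    show "0 < \<phi> s \<and> \<phi> s \<le> 30720 * t * s" using pos[OF s] le[OF s] by simp
  qed
qed

section \<open>Reflections and polar coordinates\<close>

interpretation lborel_prod: product_sigma_finite "\<lambda>_::nat. lborel :: real measure" ..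

abbreviation leb_PiM :: "nat set \<Rightarrow> (nat \<Rightarrow> real) measure" where
  "leb_PiM I \<equiv> Pi\<^sub>M I (\<lambda>_. lborel)"

lemma sets_leb_PiM: "sets (leb_PiM I) = sets (Pi\<^sub>M I (\<lambda>_. borel))"
  by (rule sets_PiM_cong) auto

lemma measurable_affine_map:
  assumes S: "S \<subseteq> I" and l: "\<And>k. k \<in> S \<Longrightarrow> l k \<in> borel_measurable (leb_PiM I)"
  shows "(\<lambda>x k. if k \<in> S then a * x k + l k x else x k) \<in> measurable (leb_PiM I) (leb_PiM I)"
proof -
  have "(\<lambda>x. \<lambda>k\<in>I. if k \<in> S then a * x k + l k x else x k) \<in> measurable (leb_PiM I) (leb_PiM I)"
  proof (rule measurable_restrict)
    fix k assume k: "k \<in> I"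
    have [measurable]: "(\<lambda>x. x k) \<in> borel_measurable (leb_PiM I)"
      using measurable_component_singleton[OF k, of "\<lambda>_. lborel"] by simp
    show "(\<lambda>x. if k \<in> S then a * x k + l k x else x k) \<in> measurable (leb_PiM I) lborel"
    proof (cases "k \<in> S")
      case True
      note l[OF True, measurable]
      show ?thesis using True by simp
    qed simp
  qed
  then show ?thesis
  proof (rule measurable_cong[THEN iffD1, rotated])
    fix x assume "x \<in> space (leb_PiM I)"
    then show "(\<lambda>k\<in>I. if k \<in> S then a * x k + l k x else x k) = (\<lambda>k. if k \<in> S then a * x k + l k x else x k)"
      using S by (auto simp: space_PiM PiE_def extensional_def fun_eq_iff)
  qed
qed

text \<open>The map is block triangular with determinant \<open>a ^ card S\<close>.\<close>
lemma nn_integral_affine_map: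
  assumes I: "finite I" and S: "S \<subseteq> I" and a: "a \<noteq> 0"
    and l: "\<And>k. k \<in> S \<Longrightarrow> l k \<in> borel_measurable (leb_PiM I)"
    and dep: "\<And>k x y. k \<in> S \<Longrightarrow> (\<And>j. j \<in> I - S \<Longrightarrow> x j = y j) \<Longrightarrow> l k x = l k y"
    and g: "g \<in> borel_measurable (leb_PiM I)"
  shows "ennreal (\<bar>a\<bar> ^ card S) * (\<integral>\<^sup>+x. g (\<lambda>k. if k \<in> S then a * x k + l k x else x k) \<partial>leb_PiM I)
    = (\<integral>\<^sup>+x. g x \<partial>leb_PiM I)"
proof -
  have "finite S" by (rule finite_subset[OF S I])
  then have "ennreal (\<bar>a\<bar> ^ card S) * (\<integral>\<^sup>+x. g (\<lambda>k. if k \<in> S then a * x k + l k x else x k) \<partial>leb_PiM I)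
    = (\<integral>\<^sup>+x. g x \<partial>leb_PiM I)"
    using S l dep g
  proof (induction S arbitrary: g rule: finite_induct)
    case empty
    show ?case by simp
  next
    case (insert j S)
    have j: "j \<in> I" using insert.prems(1) by auto
    define A where "A y = y(j := a * y j + l j y)" for y :: "nat \<Rightarrow> real"
    define M where "M x = (\<lambda>k. if k \<in> S then a * x k + l k x else x k)" for x :: "nat \<Rightarrow> real"
    have A_meas: "A \<in> measurable (leb_PiM I) (leb_PiM I)"
    proof -
      have "A = (\<lambda>x k. if k \<in> {j} then a * x k + l k x else x k)"
        by (auto simp: A_def fun_eq_iff)
      then show ?thesis using measurable_affine_map[of "{j}" I l a] insert.prems(2) j by simp
    qed
    have comp: "(\<lambda>k. if k \<in> insert j S then a * x k + l k x else x k) = A (M x)" for x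
    proof -
      have "l j x = l j (M x)"
        by (rule insert.prems(3)) (use insert.hyps in \<open>auto simp: M_def\<close>)
      then show ?thesis using insert.hyps by (auto simp: A_def M_def fun_eq_iff)
    qed
    have gA: "(\<lambda>x. g (A x)) \<in> borel_measurable (leb_PiM I)"
      by (rule measurable_compose[OF A_meas insert.prems(4)])
    have IH: "ennreal (\<bar>a\<bar> ^ card S) * (\<integral>\<^sup>+x. g (A (M x)) \<partial>leb_PiM I) = (\<integral>\<^sup>+x. g (A x) \<partial>leb_PiM I)"
      unfolding M_def
    proof (rule insert.IH)
      show "l k x = l k y" if "k \<in> S" "\<And>j. j \<in> I - S \<Longrightarrow> x j = y j" for k x y
        by (rule insert.prems(3)) (use that in auto)
    qed (use insert.prems(1,2) gA in auto)
    have Ieq: "insert j (I - {j}) = I" using j by auto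
    have fin: "finite (I - {j})" "j \<notin> I - {j}" using I by auto
    have fold: "(\<integral>\<^sup>+x. f x \<partial>leb_PiM I) = (\<integral>\<^sup>+x. (\<integral>\<^sup>+t. f (x(j := t)) \<partial>lborel) \<partial>leb_PiM (I - {j}))"
      if "f \<in> borel_measurable (leb_PiM I)" for f
      by (rule lborel_prod.product_nn_integral_insert[OF fin, of f, unfolded Ieq, OF that])
    have "ennreal \<bar>a\<bar> * (\<integral>\<^sup>+x. g (A x) \<partial>leb_PiM I)
        = (\<integral>\<^sup>+x. ennreal \<bar>a\<bar> * (\<integral>\<^sup>+t. g (A (x(j := t))) \<partial>lborel) \<partial>leb_PiM (I - {j}))"
    proof (subst fold[OF gA], rule nn_integral_cmult[symmetric])
      have "(\<lambda>(x, t). x(j := t)) \<in> measurable (leb_PiM (I - {j}) \<Otimes>\<^sub>M lborel) (leb_PiM (insert j (I - {j})))"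
        by (rule measurable_add_dim)
      then have "(\<lambda>(x, t). x(j := t)) \<in> measurable (leb_PiM (I - {j}) \<Otimes>\<^sub>M lborel) (leb_PiM I)"
        unfolding Ieq .
      from measurable_compose[OF this gA]
      have [measurable]: "(\<lambda>(x, t). g (A (x(j := t)))) \<in> borel_measurable (leb_PiM (I - {j}) \<Otimes>\<^sub>M lborel)"
        by (simp add: case_prod_beta')
      show "(\<lambda>x. \<integral>\<^sup>+t. g (A (x(j := t))) \<partial>lborel) \<in> borel_measurable (leb_PiM (I - {j}))"
        by measurable
    qed
    also have "\<dots> = (\<integral>\<^sup>+x. (\<integral>\<^sup>+t. g (x(j := t)) \<partial>lborel) \<partial>leb_PiM (I - {j}))"
    proof (rule nn_integral_cong)
      fix x assume x: "x \<in> space (leb_PiM (I - {j}))"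
      have lj: "l j (x(j := t)) = l j x" for t
        by (rule insert.prems(3)) auto
      have "(\<lambda>t. x(j := t)) \<in> measurable lborel (leb_PiM (insert j (I - {j})))"
        using measurable_compose[OF measurable_Pair1'[OF x] measurable_add_dim[of j "I - {j}" "\<lambda>_. lborel"]]
        by (simp only: case_prod_conv)
      then have "(\<lambda>t. g (x(j := t))) \<in> borel_measurable lborel"
        unfolding Ieq by (rule measurable_compose[OF _ insert.prems(4)])
      then have "(\<integral>\<^sup>+t. g (x(j := t)) \<partial>lborel) = ennreal \<bar>a\<bar> * (\<integral>\<^sup>+t. g (x(j := l j x + a * t)) \<partial>lborel)"
        by (intro nn_integral_real_affine a) auto
      also have "(\<lambda>t. g (x(j := l j x + a * t))) = (\<lambda>t. g (A (x(j := t))))"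
        by (simp add: A_def lj add.commute)
      finally show "ennreal \<bar>a\<bar> * (\<integral>\<^sup>+t. g (A (x(j := t))) \<partial>lborel) = (\<integral>\<^sup>+t. g (x(j := t)) \<partial>lborel)" ..
    qed
    also have "\<dots> = (\<integral>\<^sup>+x. g x \<partial>leb_PiM I)" by (rule fold[symmetric]) (rule insert.prems)
    finally have 2: "ennreal \<bar>a\<bar> * (\<integral>\<^sup>+x. g (A x) \<partial>leb_PiM I) = (\<integral>\<^sup>+x. g x \<partial>leb_PiM I)" .
    have "ennreal (\<bar>a\<bar> ^ card (insert j S)) = ennreal \<bar>a\<bar> * ennreal (\<bar>a\<bar> ^ card S)"
      using insert.hyps by (simp add: ennreal_mult')
    then show ?case unfolding comp using IH 2 by (simp add: mult.assoc)
  qed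
  then show ?thesis .
qed

section \<open>Norm, direction and Householder reflections\<close>

definition reflect :: "nat \<Rightarrow> (nat \<Rightarrow> real) \<Rightarrow> (nat \<Rightarrow> real) \<Rightarrow> nat \<Rightarrow> real" where
  "reflect n u x = (\<lambda>k\<in>{..<n}. x k - 2 * inner_Rn n x u * u k)"

text \<open>At the origin division by zero yields the zero vector. Consequently
  \<open>smul_norm_dir\<close> holds there too, and the origin belongs to no narrow cap.\<close>

definition dir :: "nat \<Rightarrow> (nat \<Rightarrow> real) \<Rightarrow> nat \<Rightarrow> real" where
  "dir n x = (\<lambda>k\<in>{..<n}. x k / norm_Rn n x)"

definition smul :: "nat \<Rightarrow> real \<Rightarrow> (nat \<Rightarrow> real) \<Rightarrow> nat \<Rightarrow> real" where
  "smul n r x = (\<lambda>k\<in>{..<n}. r * x k)"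

lemma inner_Rn_commute: "inner_Rn n x y = inner_Rn n y x"
  by (simp add: inner_Rn_def mult.commute)

lemma inner_Rn_nonneg: "0 \<le> inner_Rn n x x"
  by (simp add: inner_Rn_def sum_nonneg)

lemma norm_Rn_nonneg: "0 \<le> norm_Rn n x"
  by (simp add: norm_Rn_def inner_Rn_nonneg)

lemma norm_Rn_sq: "(norm_Rn n x)\<^sup>2 = inner_Rn n x x"
  by (simp add: norm_Rn_def inner_Rn_nonneg)

lemma norm_Rn_sq': "(norm_Rn n x)\<^sup>2 = (\<Sum>i<n. (x i)\<^sup>2)"
  unfolding norm_Rn_sq by (simp add: inner_Rn_def power2_eq_square)

lemma norm_Rn_eq_0_iff: "norm_Rn n x = 0 \<longleftrightarrow> (\<forall>i<n. x i = 0)"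
  by (auto simp: norm_Rn_def inner_Rn_def sum_nonneg_eq_0_iff)

lemma abs_le_norm_Rn:
  assumes "i < n"
  shows "\<bar>x i\<bar> \<le> norm_Rn n x"
proof (rule power2_le_imp_le[OF _ norm_Rn_nonneg])
  have "(x i)\<^sup>2 \<le> (\<Sum>i<n. (x i)\<^sup>2)"
    by (rule member_le_sum) (use assms in auto)
  then show "\<bar>x i\<bar>\<^sup>2 \<le> (norm_Rn n x)\<^sup>2" unfolding norm_Rn_sq' by simp
qed

lemma reflect_apply: "k < n \<Longrightarrow> reflect n u x k = x k - 2 * inner_Rn n x u * u k"
  by (simp add: reflect_def)

lemma inner_reflect_right:
  "inner_Rn n x (reflect n u y) = inner_Rn n x y - 2 * inner_Rn n y u * inner_Rn n x u"
proof -
  have "inner_Rn n x (reflect n u y) = (\<Sum>i<n. x i * y i - 2 * inner_Rn n y u * (x i * u i))"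
    unfolding inner_Rn_def[of n x "reflect n u y"] by (intro sum.cong) (auto simp: reflect_apply algebra_simps)
  also have "\<dots> = inner_Rn n x y - 2 * inner_Rn n y u * inner_Rn n x u"
    by (simp add: sum_subtractf sum_distrib_left[symmetric] inner_Rn_def)
  finally show ?thesis .
qed

lemma inner_reflect_left:
  "inner_Rn n (reflect n u x) y = inner_Rn n x y - 2 * inner_Rn n x u * inner_Rn n y u"
  by (subst (1 2) inner_Rn_commute) (rule inner_reflect_right)

lemma inner_reflect_swap: "inner_Rn n x (reflect n u y) = inner_Rn n (reflect n u x) y"
  by (simp add: inner_reflect_left inner_reflect_right)

lemma inner_reflect_axis:
  "inner_Rn n u u = 1 \<Longrightarrow> inner_Rn n (reflect n u x) u = - inner_Rn n x u"
  by (simp add: inner_reflect_left)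

lemma inner_reflect:
  assumes "inner_Rn n u u = 1"
  shows "inner_Rn n (reflect n u x) (reflect n u y) = inner_Rn n x y"
  by (simp add: inner_reflect_right inner_reflect_axis[OF assms]) (simp add: inner_reflect_left)

lemma norm_reflect: "inner_Rn n u u = 1 \<Longrightarrow> norm_Rn n (reflect n u x) = norm_Rn n x"
  by (simp add: norm_Rn_def inner_reflect)

lemma reflect_in_Rn: "reflect n u x \<in> Rn n" by (simp add: reflect_def)

lemma dir_in_Rn: "dir n x \<in> Rn n" by (simp add: dir_def)

lemma smul_in_Rn: "smul n r x \<in> Rn n" by (simp add: smul_def)

lemma Rn_eqI: "x \<in> Rn n \<Longrightarrow> y \<in> Rn n \<Longrightarrow> (\<And>k. k < n \<Longrightarrow> x k = y k) \<Longrightarrow> x = y"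
  by (rule PiE_ext) auto

lemma reflect_reflect:
  assumes "inner_Rn n u u = 1" "x \<in> Rn n"
  shows "reflect n u (reflect n u x) = x"
  by (rule Rn_eqI[OF reflect_in_Rn assms(2)])
     (simp add: reflect_apply inner_reflect_axis[OF assms(1)])

lemma dir_reflect:
  assumes "inner_Rn n u u = 1"
  shows "dir n (reflect n u x) = reflect n u (dir n x)"
proof (rule Rn_eqI[OF dir_in_Rn reflect_in_Rn])
  fix k assume k: "k < n"
  have "inner_Rn n (dir n x) u = inner_Rn n x u / norm_Rn n x"
    by (simp add: inner_Rn_def dir_def sum_divide_distrib)
  then show "dir n (reflect n u x) k = reflect n u (dir n x) k"
    using k by (simp add: dir_def reflect_apply norm_reflect[OF assms] diff_divide_distrib)
qed

lemma norm_smul: "norm_Rn n (smul n r x) = \<bar>r\<bar> * norm_Rn n x"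
proof -
  have "inner_Rn n (smul n r x) (smul n r x) = r\<^sup>2 * inner_Rn n x x"
    by (simp add: inner_Rn_def smul_def sum_distrib_left power2_eq_square mult_ac)
  then show ?thesis by (simp add: norm_Rn_def real_sqrt_mult)
qed

lemma norm_dir: "norm_Rn n x \<noteq> 0 \<Longrightarrow> norm_Rn n (dir n x) = 1"
proof -
  assume "norm_Rn n x \<noteq> 0"
  moreover have "dir n x = smul n (1 / norm_Rn n x) x" by (auto simp: dir_def smul_def)
  ultimately show ?thesis using norm_Rn_nonneg[of n x] by (simp add: norm_smul)
qed

lemma smul_norm_dir:
  assumes "x \<in> Rn n"
  shows "smul n (norm_Rn n x) (dir n x) = x"
proof (rule Rn_eqI[OF smul_in_Rn assms])
  fix k assume "k < n"
  then show "smul n (norm_Rn n x) (dir n x) k = x k"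
    by (cases "norm_Rn n x = 0") (auto simp: smul_def dir_def norm_Rn_eq_0_iff)
qed

text \<open>The normal of the mirror is the normalised difference \<open>x - y\<close>; equality of
  the norms makes the reflection exchange the two points. This transitivity on the sphere is the
  only use made of the orthogonal group.\<close>

lemma exists_reflection:
  assumes x: "x \<in> Rn n" "norm_Rn n x = 1" and y: "y \<in> Rn n" "norm_Rn n y = 1" and ne: "x \<noteq> y"
  shows "\<exists>u. inner_Rn n u u = 1 \<and> reflect n u x = y"
proof -
  have ix: "inner_Rn n x x = 1" "inner_Rn n y y = 1" using x y by (auto simp: norm_Rn_sq[symmetric])
  define c where "c = inner_Rn n x y"
  define w where "w k = x k - y k" for k
  have iw: "inner_Rn n z w = inner_Rn n z x - inner_Rn n z y" for z
    by (simp add: inner_Rn_def w_def right_diff_distrib sum_subtractf)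
  have ww: "inner_Rn n w w = 2 - 2 * c"
    using iw[of w] iw[of x] iw[of y] ix inner_Rn_commute[of n w x] inner_Rn_commute[of n w y]
      inner_Rn_commute[of n y x] unfolding c_def by linarith
  have pos: "inner_Rn n w w > 0"
  proof (rule ccontr)
    assume "\<not> inner_Rn n w w > 0"
    then have "norm_Rn n w = 0" using inner_Rn_nonneg[of n w] by (simp add: norm_Rn_def)
    then have "x k = y k" if "k < n" for k using that by (auto simp: norm_Rn_eq_0_iff w_def)
    then show False using Rn_eqI[OF x(1) y(1)] ne by auto
  qed
  define u where "u k = w k / norm_Rn n w" for k
  have nw: "norm_Rn n w > 0" using pos by (simp add: norm_Rn_def)
  have iu: "inner_Rn n z u = inner_Rn n z w / norm_Rn n w" for z
    by (simp add: inner_Rn_def u_def sum_divide_distrib)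
  have "inner_Rn n u u = inner_Rn n w w / norm_Rn n w / norm_Rn n w"
    by (metis iu inner_Rn_commute)
  then have uu: "inner_Rn n u u = 1"
    using nw pos norm_Rn_sq[of n w] by (simp add: power2_eq_square)
  have "reflect n u x = y"
  proof (rule Rn_eqI[OF reflect_in_Rn y(1)])
    fix k assume k: "k < n"
    have "2 * inner_Rn n x u * u k = (2 * inner_Rn n x w) * w k / (norm_Rn n w)\<^sup>2"
      by (simp add: iu u_def power2_eq_square)
    also have "2 * inner_Rn n x w = inner_Rn n w w" using iw[of x] ix ww by (simp add: c_def)
    also have "inner_Rn n w w * w k / (norm_Rn n w)\<^sup>2 = w k" using nw by (simp add: norm_Rn_sq[symmetric])
    finally show "reflect n u x k = y k" using k by (simp add: reflect_apply w_def)
  qed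
  with uu show ?thesis by blast
qed

lemma component_measurable[measurable (raw)]:
  "i < n \<Longrightarrow> (\<lambda>x. x i) \<in> borel_measurable (borel_Rn n)"
  by (rule measurable_component_singleton) simp

lemma inner_Rn_measurable_left: "(\<lambda>x. inner_Rn n x u) \<in> borel_measurable (borel_Rn n)"
  unfolding inner_Rn_def by (intro borel_measurable_sum borel_measurable_times component_measurable) auto

lemma norm_Rn_measurable[measurable]: "norm_Rn n \<in> borel_measurable (borel_Rn n)"
proof -
  have "(\<lambda>x. sqrt (\<Sum>i<n. x i * x i)) \<in> borel_measurable (borel_Rn n)"
    by (intro measurable_compose[OF _ borel_measurable_sqrt] borel_measurable_sum borel_measurable_times component_measurable) auto
  then show ?thesis by (simp add: norm_Rn_def[abs_def] inner_Rn_def)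
qed

lemma reflect_measurable[measurable]: "reflect n u \<in> measurable (borel_Rn n) (borel_Rn n)"
  unfolding reflect_def[abs_def]
  by (intro measurable_restrict borel_measurable_diff borel_measurable_times inner_Rn_measurable_left
      component_measurable borel_measurable_const) auto

lemma dir_measurable[measurable]: "dir n \<in> measurable (borel_Rn n) (borel_Rn n)"
  unfolding dir_def[abs_def]
  by (intro measurable_restrict borel_measurable_divide component_measurable norm_Rn_measurable) auto

lemma smul_measurable[measurable]:
  "(\<lambda>(r, x). smul n r x) \<in> measurable (borel \<Otimes>\<^sub>M borel_Rn n) (borel_Rn n)"
  unfolding smul_def[abs_def] case_prod_beta'
  by (intro measurable_restrict borel_measurable_times measurable_fst
      measurable_compose[OF measurable_snd component_measurable]) auto

lemma smul_measurable'[measurable]: "smul n r \<in> measurable (borel_Rn n) (borel_Rn n)"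
  unfolding smul_def[abs_def]
  by (intro measurable_restrict borel_measurable_times borel_measurable_const component_measurable) auto

text \<open>A reflection is factored into maps covered by \<open>nn_integral_affine_map\<close>.
  With \<open>u j\<close> nonzero, \<open>A\<close> stores the inner product of x with u in slot j,
  \<open>B\<close> subtracts its multiple from the other coordinates, \<open>C\<close> flips the
  sign of the slot, and \<open>E\<close> solves back for coordinate j. The factors are
  \<open>|u j|\<close>, 1, 1 and \<open>1 / |u j|\<close>.\<close>

lemma nn_integral_reflect:
  assumes u: "inner_Rn n u u = 1" and g: "g \<in> borel_measurable (borel_Rn n)"
  shows "(\<integral>\<^sup>+x. g (reflect n u x) \<partial>leb_PiM {..<n}) = (\<integral>\<^sup>+x. g x \<partial>leb_PiM {..<n})"
proof -
  let ?I = "{..<n}"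
  let ?m = "leb_PiM ?I"
  have borel_eq: "borel_measurable ?m = borel_measurable (borel_Rn n)"
    by (rule measurable_cong_sets) (auto simp: sets_leb_PiM)
  have g': "g \<in> borel_measurable ?m" using g by (simp add: borel_eq)
  have "\<exists>j<n. u j \<noteq> 0"
  proof (rule ccontr)
    assume "\<not> (\<exists>j<n. u j \<noteq> 0)"
    then have "inner_Rn n u u = 0" by (simp add: inner_Rn_def)
    then show False using u by simp
  qed
  then obtain j where j: "j < n" "u j \<noteq> 0" by blast
  define s where "s x = (\<Sum>i\<in>?I - {j}. u i * x i)" for x
  have s_meas: "s \<in> borel_measurable ?m"
    unfolding borel_eq s_def[abs_def]
    by (intro borel_measurable_sum borel_measurable_times borel_measurable_const component_measurable) auto
  have s_dep: "s x = s y" if "\<And>k. k \<in> ?I - {j} \<Longrightarrow> x k = y k" for x y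
    unfolding s_def using that by (intro sum.cong) auto
  have inner_s: "inner_Rn n x u = u j * x j + s x" for x
    unfolding inner_Rn_def s_def using j
    by (subst sum.remove[of _ j]) (auto simp: mult.commute)
  define A where "A x = (\<lambda>k. if k \<in> {j} then u j * x k + s x else x k)" for x
  define B where "B x = (\<lambda>k. if k \<in> ?I - {j} then 1 * x k + (- 2 * x j * u k) else x k)" for x
  define C where "C x = (\<lambda>k. if k \<in> {j} then - 1 * x k + 0 else x k)" for x :: "nat \<Rightarrow> real"
  define E where "E x = (\<lambda>k. if k \<in> {j} then 1 / u j * x k + (- s x / u j) else x k)" for x
  have xj: "(\<lambda>x. - 2 * x j * u k) \<in> borel_measurable ?m" for k
    unfolding borel_eq using j by (intro borel_measurable_times borel_measurable_const component_measurable) auto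
  have mC: "C \<in> measurable ?m ?m" unfolding C_def[abs_def]
    by (rule measurable_affine_map) (use j in auto)
  have mB: "B \<in> measurable ?m ?m" unfolding B_def[abs_def]
    by (rule measurable_affine_map[where l="\<lambda>k x. - 2 * x j * u k"]) (use xj in auto)
  have mE: "E \<in> measurable ?m ?m" unfolding E_def[abs_def]
    by (rule measurable_affine_map[where l="\<lambda>k x. - s x / u j"]) (use j s_meas in auto)
  have g1: "(\<lambda>x. g (E x)) \<in> borel_measurable ?m" by (rule measurable_compose[OF mE g'])
  have g2: "(\<lambda>x. g (E (C x))) \<in> borel_measurable ?m" by (rule measurable_compose[OF mC g1])
  have g3: "(\<lambda>x. g (E (C (B x)))) \<in> borel_measurable ?m" by (rule measurable_compose[OF mB g2])
  have "ennreal (\<bar>u j\<bar> ^ card {j}) * (\<integral>\<^sup>+x. g (E (C (B (A x)))) \<partial>?m) = (\<integral>\<^sup>+x. g (E (C (B x))) \<partial>?m)"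
    unfolding A_def
  proof (rule nn_integral_affine_map[where l="\<lambda>_. s" and g="\<lambda>x. g (E (C (B x)))"])
    show "s x = s y" if "k \<in> {j}" and "\<And>i. i \<in> ?I - {j} \<Longrightarrow> x i = y i" for k x y
      by (rule s_dep[OF that(2)])
  qed (use j s_meas g3 in auto)
  then have e4: "ennreal \<bar>u j\<bar> * (\<integral>\<^sup>+x. g (E (C (B (A x)))) \<partial>?m) = (\<integral>\<^sup>+x. g (E (C (B x))) \<partial>?m)"
    by simp
  have "ennreal (\<bar>1\<bar> ^ card (?I - {j})) * (\<integral>\<^sup>+x. g (E (C (B x))) \<partial>?m) = (\<integral>\<^sup>+x. g (E (C x)) \<partial>?m)"
    unfolding B_def
  proof (rule nn_integral_affine_map[where l="\<lambda>k x. - 2 * x j * u k" and g="\<lambda>x. g (E (C x))"])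
    show "- 2 * x j * u k = - 2 * y j * u k" if "\<And>i. i \<in> ?I - (?I - {j}) \<Longrightarrow> x i = y i" for k and x y :: "nat \<Rightarrow> real"
      using that[of j] j by simp
  qed (use xj g2 in auto)
  then have e3: "(\<integral>\<^sup>+x. g (E (C (B x))) \<partial>?m) = (\<integral>\<^sup>+x. g (E (C x)) \<partial>?m)" by simp
  have "ennreal (\<bar>- 1\<bar> ^ card {j}) * (\<integral>\<^sup>+x. g (E (C x)) \<partial>?m) = (\<integral>\<^sup>+x. g (E x) \<partial>?m)"
    unfolding C_def
    by (rule nn_integral_affine_map[where l="\<lambda>_ _. 0" and g="\<lambda>x. g (E x)"]) (use j g1 in auto)
  then have e2: "(\<integral>\<^sup>+x. g (E (C x)) \<partial>?m) = (\<integral>\<^sup>+x. g (E x) \<partial>?m)" by simp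
  have "ennreal (\<bar>1 / u j\<bar> ^ card {j}) * (\<integral>\<^sup>+x. g (E x) \<partial>?m) = (\<integral>\<^sup>+x. g x \<partial>?m)"
    unfolding E_def
  proof (rule nn_integral_affine_map[where l="\<lambda>_ x. - s x / u j"])
    show "- s x / u j = - s y / u j" if "k \<in> {j}" and "\<And>i. i \<in> ?I - {j} \<Longrightarrow> x i = y i" for k x y
      by (subst s_dep[OF that(2)]) auto
  qed (use j s_meas g' in auto)
  then have e1: "ennreal \<bar>1 / u j\<bar> * (\<integral>\<^sup>+x. g (E x) \<partial>?m) = (\<integral>\<^sup>+x. g x \<partial>?m)"
    by simp
  have red: "E (C (B (A x))) = reflect n u x" if x: "x \<in> Rn n" for x
  proof (rule Rn_eqI[OF _ reflect_in_Rn])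
    show "E (C (B (A x))) \<in> Rn n"
      using x j by (auto simp: E_def C_def B_def A_def PiE_def extensional_def)
    define q where "q = inner_Rn n x u"
    have Aj: "A x j = q" by (simp add: A_def q_def inner_s)
    have Y: "C (B (A x)) k = x k - 2 * q * u k" if "k < n" "k \<noteq> j" for k
      using that Aj by (simp add: C_def B_def) (simp add: A_def)
    \<comment> \<open>A reflection reverses the component along u, so after the sign flip slot j
      holds the inner product of the reflected point with u, exactly what \<open>E\<close>
      expects.\<close>
    have Yj: "C (B (A x)) j = - q" using Aj by (simp add: C_def B_def)
    have "s (C (B (A x))) = s (\<lambda>k. x k - 2 * q * u k)"
      by (rule s_dep) (use Y in auto)
    also have "\<dots> = s x - 2 * q * s u"
      by (simp add: s_def right_diff_distrib sum_subtractf sum_distrib_left mult_ac)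
    also have "s u = 1 - (u j)\<^sup>2" using inner_s[of u] u by (simp add: power2_eq_square)
    also have "s x = q - u j * x j" using inner_s[of x] by (simp add: q_def)
    finally have sY: "s (C (B (A x))) = q - u j * x j - 2 * q * (1 - (u j)\<^sup>2)" .
    fix k assume k: "k < n"
    show "E (C (B (A x))) k = reflect n u x k"
    proof (cases "k = j")
      case True
      have "E (C (B (A x))) j = (- q - s (C (B (A x)))) / u j"
        using j(2) by (simp add: E_def Yj diff_divide_distrib)
      also have "\<dots> = x j - 2 * q * u j"
        unfolding sY using j(2) by (simp add: field_simps power2_eq_square)
      finally show ?thesis using True k by (simp add: reflect_apply q_def)
    next
      case False
      then show ?thesis using Y[OF k False] k by (simp add: E_def reflect_apply q_def)
    qed
  qed
  have "(\<integral>\<^sup>+x. g (reflect n u x) \<partial>?m) = (\<integral>\<^sup>+x. g (E (C (B (A x)))) \<partial>?m)"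
    by (rule nn_integral_cong) (simp add: red space_PiM)
  also have "\<dots> = ennreal \<bar>1 / u j\<bar> * (ennreal \<bar>u j\<bar> * (\<integral>\<^sup>+x. g (E (C (B (A x)))) \<partial>?m))"
  proof -
    have "ennreal \<bar>1 / u j\<bar> * ennreal \<bar>u j\<bar> = 1"
      using j(2) by (simp add: ennreal_mult'[symmetric] abs_mult[symmetric])
    then show ?thesis by (simp add: mult.assoc[symmetric])
  qed
  also have "\<dots> = (\<integral>\<^sup>+x. g x \<partial>?m)" unfolding e4 e3 e2 by (rule e1)
  finally show ?thesis .
qed

lemma nn_integral_smul:
  assumes c: "c \<noteq> 0" and g: "g \<in> borel_measurable (borel_Rn n)"
  shows "ennreal (\<bar>c\<bar> ^ n) * (\<integral>\<^sup>+x. g (smul n c x) \<partial>leb_PiM {..<n}) = (\<integral>\<^sup>+x. g x \<partial>leb_PiM {..<n})"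
proof -
  have "borel_measurable (leb_PiM {..<n}) = borel_measurable (borel_Rn n)"
    by (rule measurable_cong_sets) (auto simp: sets_leb_PiM)
  then have "ennreal (\<bar>c\<bar> ^ n) * (\<integral>\<^sup>+x. g (\<lambda>k. if k \<in> {..<n} then c * x k + 0 else x k) \<partial>leb_PiM {..<n})
      = (\<integral>\<^sup>+x. g x \<partial>leb_PiM {..<n})"
    using nn_integral_affine_map[of "{..<n}" "{..<n}" c "\<lambda>k x. 0" g] c g by simp
  moreover have "(\<lambda>k. if k \<in> {..<n} then c * x k + 0 else x k) = smul n c x" if "x \<in> space (leb_PiM {..<n})" for x
    using that by (auto simp: smul_def space_PiM PiE_def extensional_def fun_eq_iff)
  ultimately show ?thesis by (simp cong: nn_integral_cong_simp)
qed

section \<open>The standard Gaussian measure\<close>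

abbreviation std_gauss :: "real measure" where
  "std_gauss \<equiv> density lborel (\<lambda>x. ennreal (std_normal_density x))"

definition gauss :: "nat \<Rightarrow> (nat \<Rightarrow> real) measure" where
  "gauss n = Pi\<^sub>M {..<n} (\<lambda>_. std_gauss)"

lemma PiM_density_lborel:
  fixes f :: "real \<Rightarrow> real"
  assumes f[measurable]: "f \<in> borel_measurable borel" and P: "prob_space (density lborel (\<lambda>x. ennreal (f x)))"
    and I: "finite (I :: nat set)"
  shows "Pi\<^sub>M I (\<lambda>_. density lborel (\<lambda>x. ennreal (f x))) = density (leb_PiM I) (\<lambda>x. \<Prod>i\<in>I. ennreal (f (x i)))"
proof -
  interpret D: product_prob_space "\<lambda>_::nat. density lborel (\<lambda>x. ennreal (f x))"
    by (intro product_prob_spaceI P)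
  have sets: "sets (leb_PiM I) = sets (Pi\<^sub>M I (\<lambda>_. density lborel (\<lambda>x. ennreal (f x))))"
    by (rule sets_PiM_cong) auto
  have [measurable]: "(\<lambda>x. \<Prod>i\<in>I. ennreal (f (x i))) \<in> borel_measurable (leb_PiM I)"
    by measurable
  have "density (leb_PiM I) (\<lambda>x. \<Prod>i\<in>I. ennreal (f (x i))) = Pi\<^sub>M I (\<lambda>_. density lborel (\<lambda>x. ennreal (f x)))"
  proof (rule D.PiM_eqI[OF I])
    fix A assume A: "\<And>i. i \<in> I \<Longrightarrow> A i \<in> sets (density lborel (\<lambda>x. ennreal (f x)))"
    then have A': "\<And>i. i \<in> I \<Longrightarrow> A i \<in> sets borel" by simp
    have PA: "Pi\<^sub>E I A \<in> sets (leb_PiM I)" by (rule sets_PiM_I_finite[OF I]) (use A' in auto)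
    have "emeasure (density (leb_PiM I) (\<lambda>x. \<Prod>i\<in>I. ennreal (f (x i)))) (Pi\<^sub>E I A)
        = (\<integral>\<^sup>+x. (\<Prod>i\<in>I. ennreal (f (x i))) * indicator (Pi\<^sub>E I A) x \<partial>leb_PiM I)"
      by (rule emeasure_density) (use PA in auto)
    also have "\<dots> = (\<integral>\<^sup>+x. (\<Prod>i\<in>I. ennreal (f (x i)) * indicator (A i) (x i)) \<partial>leb_PiM I)"
    proof (rule nn_integral_cong)
      fix x assume x: "x \<in> space (leb_PiM I)"
      have "indicator (Pi\<^sub>E I A) x = (\<Prod>i\<in>I. indicator (A i) (x i) :: ennreal)"
        using x I by (auto simp: indicator_def space_PiM PiE_def Pi_def)
      then show "(\<Prod>i\<in>I. ennreal (f (x i))) * indicator (Pi\<^sub>E I A) x = (\<Prod>i\<in>I. ennreal (f (x i)) * indicator (A i) (x i))"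
        by (simp add: prod.distrib)
    qed
    also have "\<dots> = (\<Prod>i\<in>I. \<integral>\<^sup>+t. ennreal (f t) * indicator (A i) t \<partial>lborel)"
    proof (rule lborel_prod.product_nn_integral_prod[OF I])
      fix i assume "i \<in> I"
      then have [measurable]: "A i \<in> sets borel" by (rule A')
      show "(\<lambda>t. ennreal (f t) * indicator (A i) t) \<in> borel_measurable lborel" by measurable
    qed
    also have "\<dots> = (\<Prod>i\<in>I. emeasure (density lborel (\<lambda>x. ennreal (f x))) (A i))"
      by (intro prod.cong refl emeasure_density[symmetric]) (use A' in auto)
    finally show "emeasure (density (leb_PiM I) (\<lambda>x. \<Prod>i\<in>I. ennreal (f (x i)))) (Pi\<^sub>E I A)
        = (\<Prod>i\<in>I. emeasure (density lborel (\<lambda>x. ennreal (f x))) (A i))" .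
  qed (simp add: sets)
  then show ?thesis ..
qed

lemma prob_std_gauss: "prob_space std_gauss"
  by (rule prob_space_normal_density) simp

lemma prob_gauss: "prob_space (gauss n)"
  unfolding gauss_def by (intro prob_space_PiM prob_std_gauss)

lemma sets_gauss[simp, measurable_cong]: "sets (gauss n) = sets (borel_Rn n)"
  unfolding gauss_def by (rule sets_PiM_cong) auto

lemma space_gauss[simp]: "space (gauss n) = Rn n"
  by (simp add: gauss_def space_PiM)

definition gauss_profile :: "nat \<Rightarrow> real \<Rightarrow> real" where
  "gauss_profile n r = (1 / sqrt (2 * pi)) ^ n * exp (- r\<^sup>2 / 2)"

lemma gauss_profile_pos: "0 < gauss_profile n r"
  by (simp add: gauss_profile_def)

lemma gauss_profile_measurable[measurable]: "gauss_profile n \<in> borel_measurable borel"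
  unfolding gauss_profile_def[abs_def] by measurable

lemma gauss_density: "gauss n = density (leb_PiM {..<n}) (\<lambda>x. ennreal (gauss_profile n (norm_Rn n x)))"
proof -
  have "(\<Prod>i<n. ennreal (std_normal_density (x i))) = ennreal (gauss_profile n (norm_Rn n x))" for x
  proof -
    have "(\<Prod>i<n. std_normal_density (x i)) = (1 / sqrt (2 * pi)) ^ n * exp (\<Sum>i<n. - (x i)\<^sup>2 / 2)"
      by (simp add: std_normal_density_def exp_sum prod_dividef power_one_over)
    also have "(\<Sum>i<n. - (x i)\<^sup>2 / 2) = - (norm_Rn n x)\<^sup>2 / 2"
      unfolding norm_Rn_sq' by (simp add: sum_negf sum_divide_distrib)
    finally show ?thesis by (simp add: prod_ennreal gauss_profile_def)
  qed
  then show ?thesis unfolding gauss_def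
    by (subst PiM_density_lborel) (auto simp: prob_std_gauss)
qed

lemma emeasure_gauss:
  assumes "A \<in> sets (borel_Rn n)"
  shows "emeasure (gauss n) A = (\<integral>\<^sup>+x. ennreal (gauss_profile n (norm_Rn n x)) * indicator A x \<partial>leb_PiM {..<n})"
proof -
  have [measurable_cong]: "sets (leb_PiM {..<n}) = sets (borel_Rn n)" by (rule sets_leb_PiM)
  have "A \<in> sets (leb_PiM {..<n})" using assms by (simp add: sets_leb_PiM)
  then show ?thesis unfolding gauss_density by (subst emeasure_density) auto
qed

section \<open>Reflection-invariant measures, caps, and independence of norm and direction\<close>

definition reflect_inv :: "nat \<Rightarrow> (nat \<Rightarrow> real) measure \<Rightarrow> bool" where
  "reflect_inv n \<mu> \<longleftrightarrow> (\<forall>u. inner_Rn n u u = 1 \<longrightarrow>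
     (\<forall>A\<in>sets (borel_Rn n). emeasure \<mu> (reflect n u -` A \<inter> Rn n) = emeasure \<mu> A))"

lemma space_borel_Rn: "space (borel_Rn n) = Rn n" by (simp add: space_PiM)

lemma reflect_inv_gauss: "reflect_inv n (gauss n)"
  unfolding reflect_inv_def
proof (intro allI impI ballI)
  fix u A assume u: "inner_Rn n u u = 1" and A[measurable]: "A \<in> sets (borel_Rn n)"
  have RA: "reflect n u -` A \<inter> Rn n \<in> sets (borel_Rn n)"
    using measurable_sets[OF reflect_measurable A] by (simp add: space_borel_Rn)
  have g: "(\<lambda>x. ennreal (gauss_profile n (norm_Rn n x)) * indicator A x) \<in> borel_measurable (borel_Rn n)"
    by measurable
  have "emeasure (gauss n) (reflect n u -` A \<inter> Rn n)
      = (\<integral>\<^sup>+x. ennreal (gauss_profile n (norm_Rn n (reflect n u x))) * indicator A (reflect n u x) \<partial>leb_PiM {..<n})"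
    unfolding emeasure_gauss[OF RA]
    by (rule nn_integral_cong) (auto simp: norm_reflect[OF u] space_PiM indicator_def)
  also have "\<dots> = emeasure (gauss n) A"
    unfolding emeasure_gauss[OF A] by (rule nn_integral_reflect[OF u g])
  finally show "emeasure (gauss n) (reflect n u -` A \<inter> Rn n) = emeasure (gauss n) A" .
qed

text \<open>A spherical cap around the direction z, extended radially over the norms in A. For e < 1
  it omits the origin, whose \<open>dir\<close> is 0.\<close>

definition cap :: "nat \<Rightarrow> real \<Rightarrow> real set \<Rightarrow> (nat \<Rightarrow> real) \<Rightarrow> (nat \<Rightarrow> real) set" where
  "cap n e A z = {x \<in> Rn n. norm_Rn n x \<in> A \<and> 1 - e < inner_Rn n z (dir n x)}"

lemma cap_pair_measurable:
  assumes A: "A \<in> sets borel"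
  shows "{p \<in> space (borel_Rn n \<Otimes>\<^sub>M borel_Rn n). norm_Rn n (fst p) \<in> A
      \<and> 1 - e < inner_Rn n (dir n (snd p)) (dir n (fst p))} \<in> sets (borel_Rn n \<Otimes>\<^sub>M borel_Rn n)"
proof -
  have c: "(\<lambda>x. dir n x i) \<in> borel_measurable (borel_Rn n)" if "i < n" for i
    using measurable_compose[OF dir_measurable component_measurable[OF that]] .
  have [measurable]: "(\<lambda>p. inner_Rn n (dir n (snd p)) (dir n (fst p))) \<in> borel_measurable (borel_Rn n \<Otimes>\<^sub>M borel_Rn n)"
    unfolding inner_Rn_def
    by (intro borel_measurable_sum borel_measurable_times measurable_compose[OF measurable_snd c]
        measurable_compose[OF measurable_fst c]) auto
  have [measurable]: "(\<lambda>p. norm_Rn n (fst p)) \<in> borel_measurable (borel_Rn n \<Otimes>\<^sub>M borel_Rn n)"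
    by measurable
  show ?thesis using A by measurable
qed

lemma cap_sets: "A \<in> sets borel \<Longrightarrow> cap n e A z \<in> sets (borel_Rn n)"
proof -
  assume A[measurable]: "A \<in> sets borel"
  have "(\<lambda>x. inner_Rn n (dir n x) z) \<in> borel_measurable (borel_Rn n)"
    by (rule measurable_compose[OF dir_measurable inner_Rn_measurable_left])
  then have [measurable]: "(\<lambda>x. inner_Rn n z (dir n x)) \<in> borel_measurable (borel_Rn n)"
    by (subst inner_Rn_commute)
  have "{x \<in> space (borel_Rn n). norm_Rn n x \<in> A \<and> 1 - e < inner_Rn n z (dir n x)} \<in> sets (borel_Rn n)"
    by measurable
  then show ?thesis by (simp add: cap_def space_borel_Rn)
qed

text \<open>The reflection that exchanges the two centres carries one cap onto the other. Equal mass
  for all centres is the substitute for uniformity of the direction on the sphere.\<close>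

lemma emeasure_cap_eq:
  assumes inv: "reflect_inv n \<mu>" and A: "A \<in> sets borel"
    and x: "x \<in> Rn n" "norm_Rn n x = 1" and y: "y \<in> Rn n" "norm_Rn n y = 1"
  shows "emeasure \<mu> (cap n e A x) = emeasure \<mu> (cap n e A y)"
proof (cases "x = y")
  case False
  then obtain u where u: "inner_Rn n u u = 1" "reflect n u x = y"
    using exists_reflection[OF x y] by blast
  have ry: "reflect n u y = x" using u(2) reflect_reflect[OF u(1) x(1)] by simp
  have "inner_Rn n y (dir n (reflect n u z)) = inner_Rn n x (dir n z)" for z
    by (simp only: dir_reflect[OF u(1)] inner_reflect_swap ry)
  then have "reflect n u -` cap n e A y \<inter> Rn n = cap n e A x"
    unfolding cap_def by (auto simp: norm_reflect[OF u(1)] reflect_in_Rn)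
  then show ?thesis using inv u(1) cap_sets[OF A, of n e y] unfolding reflect_inv_def by metis
qed simp

lemma std_gauss_interval_ge:
  assumes ab: "a \<le> b" and le: "\<And>x. a \<le> x \<Longrightarrow> x \<le> b \<Longrightarrow> c \<le> std_normal_density x"
  shows "ennreal (c * (b - a)) \<le> emeasure std_gauss {a..b}"
proof -
  have "ennreal (c * (b - a)) \<le> (\<integral>\<^sup>+x. ennreal c * indicator {a..b} x \<partial>lborel)"
    using ab by (subst nn_integral_cmult_indicator) (auto simp: ennreal_mult'')
  also have "\<dots> \<le> (\<integral>\<^sup>+x. ennreal (std_normal_density x) * indicator {a..b} x \<partial>lborel)"
    by (intro nn_integral_mono) (auto simp: indicator_def intro!: ennreal_leI le)
  also have "\<dots> = emeasure std_gauss {a..b}" by (subst emeasure_density) auto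
  finally show ?thesis .
qed

text \<open>Rests on \<open>sqrt (2 pi) <= e\<close>, which lets the normalising constant be written
  as an exponential.\<close>

lemma std_normal_density_ge:
  assumes "\<bar>x\<bar> \<le> (c::real)"
  shows "exp (- 1 - c\<^sup>2 / 2) \<le> std_normal_density x"
proof -
  have "2 * pi \<le> (27/10)\<^sup>2" using pi_less_4 pi_approx by (simp add: power2_eq_square)
  also have "(27/10::real)\<^sup>2 \<le> (exp 1)\<^sup>2"
    using e_approx_32 by (intro power_mono) (auto simp: abs_if split: if_splits)
  finally have "sqrt (2 * pi) \<le> exp 1" by (intro real_le_lsqrt) auto
  then have "exp (- 1) \<le> 1 / sqrt (2 * pi)"
    by (simp add: exp_minus field_simps)
  moreover have "exp (- (c\<^sup>2 / 2)) \<le> exp (- (x\<^sup>2 / 2))"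
    using power_mono[OF assms, of 2] by simp
  ultimately have "exp (- 1) * exp (- (c\<^sup>2 / 2)) \<le> 1 / sqrt (2 * pi) * exp (- (x\<^sup>2 / 2))"
    by (intro mult_mono) auto
  then show ?thesis by (simp add: std_normal_density_def exp_add[symmetric])
qed

text \<open>A box whose points have a direction close to the first axis when a is large compared
  with \<open>sqrt n d\<close>; being a product, it has an explicit lower bound for its Gaussian
  mass.\<close>

definition slab :: "nat \<Rightarrow> real \<Rightarrow> real \<Rightarrow> (nat \<Rightarrow> real) set" where
  "slab n a d = (\<Pi>\<^sub>E i\<in>{..<n}. if i = 0 then {a..a + 1} else {- d..d})"

lemma gauss_slab_ge:
  assumes n: "1 \<le> n" and a: "0 \<le> a" and d: "0 < d"
  shows "ennreal (exp (- 1 - (a + 1)\<^sup>2 / 2) * (exp (- 1 - d\<^sup>2 / 2) * (2 * d)) ^ (n - 1)) \<le> emeasure (gauss n) (slab n a d)"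
proof -
  interpret G: product_prob_space "\<lambda>_::nat. std_gauss"
    by (intro product_prob_spaceI prob_std_gauss)
  have "emeasure (gauss n) (slab n a d) = (\<Prod>i<n. emeasure std_gauss (if i = 0 then {a..a + 1} else {- d..d}))"
    unfolding gauss_def slab_def by (rule G.emeasure_PiM) auto
  also have "{..<n} = insert 0 {1..<n}" using n by auto
  also have "(\<Prod>i\<in>insert 0 {1..<n}. emeasure std_gauss (if i = 0 then {a..a + 1} else {- d..d}))
      = emeasure std_gauss {a..a + 1} * (\<Prod>i\<in>{1..<n}. emeasure std_gauss {- d..d})"
    by (subst prod.insert) (auto intro!: arg_cong2[where f="(*)"] prod.cong)
  also have "\<dots> = emeasure std_gauss {a..a + 1} * emeasure std_gauss {- d..d} ^ (n - 1)" by simp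
  finally have eq: "emeasure (gauss n) (slab n a d) = emeasure std_gauss {a..a + 1} * emeasure std_gauss {- d..d} ^ (n - 1)" .
  have 1: "ennreal (exp (- 1 - (a + 1)\<^sup>2 / 2) * (a + 1 - a)) \<le> emeasure std_gauss {a..a + 1}"
    by (rule std_gauss_interval_ge) (use a in \<open>auto intro!: std_normal_density_ge\<close>)
  have 2: "ennreal (exp (- 1 - d\<^sup>2 / 2) * (d - (- d))) \<le> emeasure std_gauss {- d..d}"
    by (rule std_gauss_interval_ge) (use d in \<open>auto intro!: std_normal_density_ge\<close>)
  define B where "B = exp (- 1 - d\<^sup>2 / 2) * (2 * d)"
  have B0: "0 \<le> B" using d by (simp add: B_def)
  have "ennreal (exp (- 1 - (a + 1)\<^sup>2 / 2)) * ennreal B ^ (n - 1) \<le> emeasure (gauss n) (slab n a d)"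
    unfolding eq B_def using 1 2 by (intro mult_mono power_mono) auto
  then have "ennreal (exp (- 1 - (a + 1)\<^sup>2 / 2) * B ^ (n - 1)) \<le> emeasure (gauss n) (slab n a d)"
    using B0 by (simp add: ennreal_mult' ennreal_power)
  then show ?thesis by (simp only: B_def)
qed

lemma slab_norm_le:
  assumes n: "1 \<le> n" and x: "x \<in> slab n a d" and a: "0 \<le> a" and d: "0 \<le> d"
  shows "a \<le> x 0" "(norm_Rn n x)\<^sup>2 \<le> (x 0)\<^sup>2 + n * d\<^sup>2"
proof -
  have x0: "x 0 \<in> {a..a + 1}" and xi: "\<And>i. i < n \<Longrightarrow> i \<noteq> 0 \<Longrightarrow> x i \<in> {- d..d}"
    using x n unfolding slab_def PiE_def Pi_def by fastforce+
  show "a \<le> x 0" using x0 by simp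
  have "{..<n} = insert 0 {1..<n}" using n by auto
  then have "(norm_Rn n x)\<^sup>2 = (x 0)\<^sup>2 + (\<Sum>i\<in>{1..<n}. (x i)\<^sup>2)" unfolding norm_Rn_sq' by simp
  also have "(\<Sum>i\<in>{1..<n}. (x i)\<^sup>2) \<le> (\<Sum>i\<in>{1..<n}. d\<^sup>2)"
  proof (rule sum_mono)
    fix i assume "i \<in> {1..<n}"
    then have "\<bar>x i\<bar> \<le> \<bar>d\<bar>" using xi[of i] d by auto
    then show "(x i)\<^sup>2 \<le> d\<^sup>2" by (simp only: abs_le_square_iff)
  qed
  also have "\<dots> \<le> n * d\<^sup>2" by (simp add: mult_right_mono)
  finally show "(norm_Rn n x)\<^sup>2 \<le> (x 0)\<^sup>2 + n * d\<^sup>2" by simp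
qed

lemma inner_axis_0: "1 \<le> n \<Longrightarrow> inner_Rn n x (axis_Rn n 0) = x 0" 
proof -
  assume n: "1 \<le> n"
  have "inner_Rn n x (axis_Rn n 0) = (\<Sum>i<n. if i = 0 then x i else 0)"
    unfolding inner_Rn_def axis_Rn_def by (intro sum.cong) auto
  also have "\<dots> = x 0" using n by simp
  finally show ?thesis .
qed

lemma axis_Rn_norm: "1 \<le> n \<Longrightarrow> norm_Rn n (axis_Rn n 0) = 1"
  by (simp add: norm_Rn_def inner_axis_0) (simp add: axis_Rn_def)

lemma gauss_cap_pos:
  assumes n: "1 \<le> n" and e: "0 < e" "e < 1"
  shows "0 < emeasure (gauss n) (cap n e UNIV (axis_Rn n 0))"
proof -
  \<comment> \<open>With this width the squared norm exceeds \<open>(x 0)^2\<close> by at most e,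
    while \<open>x 0 >= 1\<close>; then \<open>x 0\<close> divided by the norm is larger than 1 - e
    because \<open>(1 - e)^2 (1 + e) < 1\<close>.\<close>
  define d where "d = sqrt (e / n)"
  have d: "0 < d" using n e by (simp add: d_def)
  have nd: "n * d\<^sup>2 = e" using n e by (simp add: d_def)
  have "slab n 1 d \<subseteq> cap n e UNIV (axis_Rn n 0)"
  proof
    fix x assume x: "x \<in> slab n 1 d"
    have x0: "1 \<le> x 0" and N: "(norm_Rn n x)\<^sup>2 \<le> (x 0)\<^sup>2 + e"
      using slab_norm_le[OF n x] d nd by auto
    have Npos: "norm_Rn n x > 0" using abs_le_norm_Rn[of 0 n x] n x0 by linarith
    have "(1 - e)\<^sup>2 * (1 + e) = (1 - e) * (1 - e\<^sup>2)" by (simp add: power2_eq_square algebra_simps)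
    also have "\<dots> < 1 * 1" using e by (intro mult_strict_mono) (auto simp: power_le_one less_imp_le)
    finally have k: "(1 - e)\<^sup>2 * (1 + e) < 1" by simp
    have "((1 - e) * norm_Rn n x)\<^sup>2 \<le> (1 - e)\<^sup>2 * ((x 0)\<^sup>2 + e)"
      unfolding power_mult_distrib by (rule mult_left_mono[OF N]) simp
    also have "\<dots> \<le> (1 - e)\<^sup>2 * ((x 0)\<^sup>2 * (1 + e))"
      using e x0 by (intro mult_left_mono) (auto simp: distrib_left)
    also have "\<dots> = (1 - e)\<^sup>2 * (1 + e) * (x 0)\<^sup>2" by simp
    also have "\<dots> < 1 * (x 0)\<^sup>2" by (rule mult_strict_right_mono[OF k]) (use x0 in simp)
    finally have "(1 - e) * norm_Rn n x < x 0" using x0 by (intro power2_less_imp_less[of _ "x 0"]) auto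
    then have "1 - e < x 0 / norm_Rn n x" using Npos by (simp add: pos_less_divide_eq)
    moreover have "inner_Rn n (axis_Rn n 0) (dir n x) = x 0 / norm_Rn n x"
      using n by (simp add: inner_Rn_commute[of n "axis_Rn n 0"] inner_axis_0 dir_def)
    ultimately show "x \<in> cap n e UNIV (axis_Rn n 0)"
      using x by (auto simp: cap_def slab_def PiE_def)
  qed
  then have "emeasure (gauss n) (slab n 1 d) \<le> emeasure (gauss n) (cap n e UNIV (axis_Rn n 0))"
    by (rule emeasure_mono) (simp add: cap_sets)
  moreover have "0 < emeasure (gauss n) (slab n 1 d)"
    using d by (intro less_le_trans[OF _ gauss_slab_ge[OF n]]) auto
  ultimately show ?thesis by (rule less_le_trans[rotated])
qed

text \<open>In the slab with \<open>x 0 >= sqrt n\<close> and the other coordinates of modulus at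
  most 1, the first coordinate carries at least half of the squared norm. Its mass is exponentially
  small in n; this is the origin of the factor \<open>exp (4 * n)\<close> in the tail hypothesis of
  \<open>radial_psi2\<close>.\<close>

lemma gauss_dir_0_ge:
  assumes n: "1 \<le> n"
  shows "ennreal (exp (- (4 * real n))) \<le> emeasure (gauss n) {x \<in> Rn n. 1/2 \<le> (dir n x 0)\<^sup>2}"
proof -
  have s: "slab n (sqrt n) 1 \<subseteq> {x \<in> Rn n. 1/2 \<le> (dir n x 0)\<^sup>2}"
  proof
    fix x assume x: "x \<in> slab n (sqrt n) 1"
    have x0: "sqrt n \<le> x 0" and N: "(norm_Rn n x)\<^sup>2 \<le> (x 0)\<^sup>2 + n"
      using slab_norm_le[OF n x] by auto
    have "(sqrt n)\<^sup>2 \<le> (x 0)\<^sup>2" by (rule power_mono[OF x0]) simp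
    then have N2: "(norm_Rn n x)\<^sup>2 \<le> 2 * (x 0)\<^sup>2" using N by simp
    have "0 < sqrt n" using n by simp
    then have Npos: "norm_Rn n x > 0" using abs_le_norm_Rn[of 0 n x] n x0 by linarith
    have "1/2 \<le> (x 0)\<^sup>2 / (norm_Rn n x)\<^sup>2" using N2 Npos by (simp add: le_divide_eq)
    then show "x \<in> {x \<in> Rn n. 1/2 \<le> (dir n x 0)\<^sup>2}"
      using x n by (auto simp: slab_def PiE_def dir_def power_divide)
  qed
  have m: "{x \<in> Rn n. 1/2 \<le> (dir n x 0)\<^sup>2} \<in> sets (borel_Rn n)"
  proof -
    have [measurable]: "(\<lambda>x. dir n x 0) \<in> borel_measurable (borel_Rn n)"
      by (rule measurable_compose[OF dir_measurable component_measurable]) (use n in simp)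
    have "{x \<in> space (borel_Rn n). 1/2 \<le> (dir n x 0)\<^sup>2} \<in> sets (borel_Rn n)" by measurable
    then show ?thesis by (simp add: space_borel_Rn)
  qed
  have "exp (- (4 * real n)) \<le> exp (- 1 - (sqrt n + 1)\<^sup>2 / 2) * (exp (- 1 - 1\<^sup>2 / 2) * (2 * 1)) ^ (n - 1)"
  proof -
    have "1 \<le> sqrt n" using n by simp
    then have "(sqrt n + 1)\<^sup>2 \<le> (2 * sqrt n)\<^sup>2" by (intro power_mono) auto
    then have "(sqrt n + 1)\<^sup>2 / 2 \<le> 2 * n" by (simp add: power_mult_distrib)
    then have 1: "exp (- 1 - 2 * real n) \<le> exp (- 1 - (sqrt n + 1)\<^sup>2 / 2)" by simp
    have 2: "exp (- (3/2) :: real) ^ (n - 1) \<le> (exp (- 1 - 1\<^sup>2 / 2) * (2 * 1)) ^ (n - 1)"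
      by (intro power_mono) auto
    have "exp (- (4 * real n)) \<le> exp ((- 1 - 2 * real n) + real (n - 1) * (- (3/2)))"
      using n by (simp add: of_nat_diff field_simps)
    also have "\<dots> = exp (- 1 - 2 * real n) * exp (real (n - 1) * (- (3/2)))" by (rule exp_add)
    also have "exp (real (n - 1) * (- (3/2))) = exp (- (3/2) :: real) ^ (n - 1)" by (rule exp_of_nat_mult)
    also have "exp (- 1 - 2 * real n) * exp (- (3/2) :: real) ^ (n - 1)
        \<le> exp (- 1 - (sqrt n + 1)\<^sup>2 / 2) * (exp (- 1 - 1\<^sup>2 / 2) * (2 * 1)) ^ (n - 1)"
      by (rule mult_mono[OF 1 2]) auto
    finally show ?thesis .
  qed
  then have "ennreal (exp (- (4 * real n)))
      \<le> ennreal (exp (- 1 - (sqrt n + 1)\<^sup>2 / 2) * (exp (- 1 - 1\<^sup>2 / 2) * (2 * 1)) ^ (n - 1))"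
    by (rule ennreal_leI)
  also have "\<dots> \<le> emeasure (gauss n) (slab n (sqrt n) 1)" by (rule gauss_slab_ge[OF n]) auto
  also have "\<dots> \<le> emeasure (gauss n) {x \<in> Rn n. 1/2 \<le> (dir n x 0)\<^sup>2}"
    using s m by (intro emeasure_mono) auto
  finally show ?thesis .
qed

lemma borel_Rn_generator:
  "sets (borel_Rn n) = sigma_sets (Rn n) {Pi\<^sub>E {..<n} A | A. \<forall>i\<in>{..<n}. A i \<in> range (\<lambda>a::real. {..a})}"
proof -
  define P where "P = {{f \<in> Rn n. \<forall>i\<in>J. f i \<in> A i} | A J. J \<in> {{..<n}} \<and> A \<in> Pi J (\<lambda>i. range (\<lambda>a::real. {..a}))}"
  have b: "(borel :: real measure) = sigma UNIV (range (\<lambda>a. {..a}))" by (rule borel_eq_atMost)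
  have cover: "\<And>i. i \<in> {..<n} \<Longrightarrow> \<exists>S\<subseteq>range (\<lambda>a::real. {..a}). countable S \<and> UNIV = \<Union>S"
  proof (intro exI conjI)
    show "range (\<lambda>k::nat. {..real k}) \<subseteq> range (\<lambda>a::real. {..a})" by auto
    show "UNIV = \<Union>(range (\<lambda>k::nat. {..real k}))" by (auto simp: real_arch_simple)
  qed auto
  have "sets (Pi\<^sub>M {..<n} (\<lambda>i. sigma UNIV (range (\<lambda>a::real. {..a})))) = sets (sigma (Rn n) P)"
    unfolding P_def
    by (rule sets_PiM_sigma[where \<Omega>="\<lambda>_. UNIV"]) (use cover in \<open>auto simp: \<close>)
  moreover have "P = {Pi\<^sub>E {..<n} A | A. \<forall>i\<in>{..<n}. A i \<in> range (\<lambda>a::real. {..a})}"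
  proof -
    have e: "{f \<in> Rn n. \<forall>i\<in>{..<n}. f i \<in> A i} = Pi\<^sub>E {..<n} A" for A :: "nat \<Rightarrow> real set"
      by (rule set_eqI) (simp only: PiE_iff mem_Collect_eq UNIV_I simp_thms, blast)
    have "P = {{f \<in> Rn n. \<forall>i\<in>{..<n}. f i \<in> A i} | A. A \<in> Pi {..<n} (\<lambda>i. range (\<lambda>a::real. {..a}))}"
      unfolding P_def by blast
    then show ?thesis unfolding e by (simp only: Pi_iff)
  qed
  moreover have "P \<subseteq> Pow (Rn n)" unfolding P_def by auto
  ultimately show ?thesis unfolding b by simp
qed

definition polar :: "nat \<Rightarrow> (nat \<Rightarrow> real) \<Rightarrow> real \<times> (nat \<Rightarrow> real)" where
  "polar n x = (norm_Rn n x, dir n x)"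

lemma polar_measurable[measurable]: "polar n \<in> measurable (borel_Rn n) (borel \<Otimes>\<^sub>M borel_Rn n)"
  unfolding polar_def[abs_def] by measurable

lemma cap_Int: "cap n e A z \<inter> Rn n = cap n e A z"
  by (auto simp: cap_def)

text \<open>For a direction-dependent function \<open>b\<close>, compare \<open>b(dir x)\<close> and \<open>b(dir y)\<close> on the pairs
  \<open>(x, y)\<close> with nearby directions; by invariance the measure of such partners \<open>y\<close> of \<open>x\<close> (and of such
  partners \<open>x\<close> of \<open>y\<close>) is constant.\<close>
lemma polar_factorises_Lipschitz:
  assumes n: "1 \<le> n"
    and mu: "prob_space \<mu>" "sets \<mu> = sets (borel_Rn n)" "reflect_inv n \<mu>" "AE x in \<mu>. norm_Rn n x \<noteq> 0"
    and g0: "AE x in gauss n. norm_Rn n x \<noteq> 0"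
    and A[measurable]: "A \<in> sets borel"
    and b: "b \<in> borel_measurable (borel_Rn n)" "\<And>x. \<bar>b x\<bar> \<le> 1"
    and lip: "\<And>x y i. norm_Rn n x = 1 \<Longrightarrow> norm_Rn n y = 1 \<Longrightarrow>
      \<bar>b x - b y\<bar> \<le> B * sqrt (2 - 2 * inner_Rn n x y)" and B: "0 \<le> B"
  shows "(\<integral>x. indicator A (norm_Rn n x) * b (dir n x) \<partial>\<mu>)
    = measure \<mu> {x \<in> Rn n. norm_Rn n x \<in> A} * (\<integral>y. b (dir n y) \<partial>gauss n)"
proof -
  interpret M: prob_space \<mu> by fact
  interpret G: prob_space "gauss n" by (rule prob_gauss)
  interpret MG: pair_prob_space \<mu> "gauss n" ..
  note [measurable_cong] = mu(2)
  have spM: "space \<mu> = Rn n" using sets_eq_imp_space_eq[OF mu(2)] by (simp add: space_borel_Rn)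
  have pm: "sets (\<mu> \<Otimes>\<^sub>M gauss n) = sets (borel_Rn n \<Otimes>\<^sub>M borel_Rn n)"
    by (rule sets_pair_measure_cong) (auto simp: mu)
  define x0 where "x0 = axis_Rn n 0"
  have x0: "x0 \<in> Rn n" "norm_Rn n x0 = 1" using axis_Rn_norm[OF n] by (auto simp: x0_def axis_Rn_def)
  have bd[measurable]: "(\<lambda>x. b (dir n x)) \<in> borel_measurable (borel_Rn n)"
    by (rule measurable_compose[OF dir_measurable b(1)])
  define I where "I = (\<integral>x. indicator A (norm_Rn n x) * b (dir n x) \<partial>\<mu>)"
  define J where "J = measure \<mu> {x \<in> Rn n. norm_Rn n x \<in> A} * (\<integral>y. b (dir n y) \<partial>gauss n)"
  have key: "\<bar>I - J\<bar> \<le> B * sqrt (2 * e)" if e: "0 < e" "e < 1" for e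
  proof -
    define W where "W = {p \<in> space (borel_Rn n \<Otimes>\<^sub>M borel_Rn n). norm_Rn n (fst p) \<in> A
      \<and> 1 - e < inner_Rn n (dir n (snd p)) (dir n (fst p))}"
    have W: "W \<in> sets (\<mu> \<Otimes>\<^sub>M gauss n)" unfolding pm W_def by (rule cap_pair_measurable[OF A])
    define w where "w x y = (indicator W (x, y) :: real)" for x y
    have w_meas[measurable]: "case_prod w \<in> borel_measurable (\<mu> \<Otimes>\<^sub>M gauss n)"
      unfolding w_def using W by (simp add: case_prod_beta')
    have b1[measurable]: "(\<lambda>p. b (dir n (fst p))) \<in> borel_measurable (\<mu> \<Otimes>\<^sub>M gauss n)"
      by measurable
    have b2[measurable]: "(\<lambda>p. b (dir n (snd p))) \<in> borel_measurable (\<mu> \<Otimes>\<^sub>M gauss n)"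
      by measurable
    have b1': "(\<lambda>(x, y). w x y * b (dir n x)) \<in> borel_measurable (\<mu> \<Otimes>\<^sub>M gauss n)"
      using borel_measurable_times[OF w_meas b1] by (simp add: case_prod_beta')
    have b2': "(\<lambda>(x, y). w x y * b (dir n y)) \<in> borel_measurable (\<mu> \<Otimes>\<^sub>M gauss n)"
      using borel_measurable_times[OF w_meas b2] by (simp add: case_prod_beta')
    have w01: "0 \<le> w x y" "w x y \<le> 1" for x y by (auto simp: w_def indicator_def)
    have wb: "\<bar>w x y * b z\<bar> \<le> 1" for x y z
      using mult_mono[of "\<bar>w x y\<bar>" 1 "\<bar>b z\<bar>" 1] w01 b(2) by (auto simp: abs_mult)
    have int0: "integrable (\<mu> \<Otimes>\<^sub>M gauss n) (\<lambda>(x, y). w x y)"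
    proof (rule MG.integrable_const_bound[where B=1])
      show "AE p in \<mu> \<Otimes>\<^sub>M gauss n. norm (case p of (x, y) \<Rightarrow> w x y) \<le> 1"
        by (rule AE_I2) (simp add: case_prod_beta' abs_of_nonneg w01)
    qed (use w_meas in simp)
    have int1: "integrable (\<mu> \<Otimes>\<^sub>M gauss n) (\<lambda>(x, y). w x y * b (dir n x))"
    proof (rule MG.integrable_const_bound[where B=1])
      show "AE p in \<mu> \<Otimes>\<^sub>M gauss n. norm (case p of (x, y) \<Rightarrow> w x y * b (dir n x)) \<le> 1"
        by (rule AE_I2) (simp only: case_prod_beta' real_norm_def wb)
    qed (rule b1')
    have int2: "integrable (\<mu> \<Otimes>\<^sub>M gauss n) (\<lambda>(x, y). w x y * b (dir n y))"
    proof (rule MG.integrable_const_bound[where B=1])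
      show "AE p in \<mu> \<Otimes>\<^sub>M gauss n. norm (case p of (x, y) \<Rightarrow> w x y * b (dir n y)) \<le> 1"
        by (rule AE_I2) (simp only: case_prod_beta' real_norm_def wb)
    qed (rule b2')
    define c where "c = measure (gauss n) (cap n e UNIV x0)"
    define d where "d = measure \<mu> (cap n e A x0)"
    have c0: "c > 0"
      using gauss_cap_pos[OF n e] by (simp add: c_def x0_def G.emeasure_eq_measure)
    have wc: "(\<integral>y. w x y \<partial>gauss n) = indicator A (norm_Rn n x) * c" if x: "x \<in> Rn n" "norm_Rn n x \<noteq> 0" for x
    proof -
      have "(\<lambda>y. w x y) = (\<lambda>y. indicator A (norm_Rn n x) * indicator (cap n e UNIV (dir n x)) y)"
        using x by (auto simp: fun_eq_iff w_def W_def cap_def indicator_def space_pair_measure space_borel_Rn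
            inner_Rn_commute[of n "dir n x"])
      then have "(\<integral>y. w x y \<partial>gauss n) = indicator A (norm_Rn n x) * measure (gauss n) (cap n e UNIV (dir n x))"
        using cap_sets[of UNIV n e "dir n x"] by (simp add: cap_Int)
      also have "measure (gauss n) (cap n e UNIV (dir n x)) = c"
        unfolding c_def measure_def
        by (subst emeasure_cap_eq[OF reflect_inv_gauss _ dir_in_Rn norm_dir[OF x(2)] x0]) auto
      finally show ?thesis .
    qed
    have wd: "(\<integral>x. w x y \<partial>\<mu>) = d" if y: "y \<in> Rn n" "norm_Rn n y \<noteq> 0" for y
    proof -
      have "(\<integral>x. w x y \<partial>\<mu>) = (\<integral>x. indicator (cap n e A (dir n y)) x \<partial>\<mu>)"
        by (rule Bochner_Integration.integral_cong)
           (use y in \<open>auto simp: w_def W_def cap_def indicator_def space_pair_measure space_borel_Rn spM\<close>)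
      also have "\<dots> = measure \<mu> (cap n e A (dir n y))"
        using cap_sets[OF A, of n e "dir n y"] mu(2) by (simp add: cap_Int spM)
      also have "\<dots> = d"
        unfolding d_def measure_def
        by (subst emeasure_cap_eq[OF mu(3) A dir_in_Rn norm_dir[OF y(2)] x0]) auto
      finally show ?thesis .
    qed
    have AEm: "AE x in \<mu>. x \<in> Rn n \<and> norm_Rn n x \<noteq> 0"
      using mu(4) AE_space[of \<mu>] by eventually_elim (simp add: spM)
    have AEg: "AE x in gauss n. x \<in> Rn n \<and> norm_Rn n x \<noteq> 0"
      using g0 AE_space[of "gauss n"] by eventually_elim simp
    have m1: "(\<lambda>x. \<integral>y. w x y * b (dir n x) \<partial>gauss n) \<in> borel_measurable \<mu>"
      by (rule G.borel_measurable_lebesgue_integral) (use b1' in simp)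
    have E1: "(\<integral>x. (\<integral>y. w x y * b (dir n x) \<partial>gauss n) \<partial>\<mu>) = c * I"
    proof -
      have "(\<integral>x. (\<integral>y. w x y * b (dir n x) \<partial>gauss n) \<partial>\<mu>) = (\<integral>x. c * (indicator A (norm_Rn n x) * b (dir n x)) \<partial>\<mu>)"
        by (rule integral_cong_AE[OF m1]) (measurable, use AEm in \<open>eventually_elim, simp add: wc\<close>)
      then show ?thesis by (simp add: I_def)
    qed
    have m2: "(\<lambda>y. \<integral>x. w x y * b (dir n y) \<partial>\<mu>) \<in> borel_measurable (gauss n)"
      by (intro M.borel_measurable_lebesgue_integral) (use measurable_pair_swap[OF b2'] in simp)
    have E2: "(\<integral>x. (\<integral>y. w x y * b (dir n y) \<partial>gauss n) \<partial>\<mu>) = d * (\<integral>y. b (dir n y) \<partial>gauss n)"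
    proof -
      have "(\<integral>x. (\<integral>y. w x y * b (dir n y) \<partial>gauss n) \<partial>\<mu>) = (\<integral>y. (\<integral>x. w x y * b (dir n y) \<partial>\<mu>) \<partial>gauss n)"
        by (rule MG.Fubini_integral[symmetric, OF int2])
      also have "\<dots> = (\<integral>y. d * b (dir n y) \<partial>gauss n)"
        by (rule integral_cong_AE[OF m2]) (measurable, use AEg in \<open>eventually_elim, simp add: wd\<close>)
      finally show ?thesis by simp
    qed
    have mset: "{x \<in> Rn n. norm_Rn n x \<in> A} \<in> sets \<mu>"
    proof -
      have "{x \<in> space \<mu>. norm_Rn n x \<in> A} \<in> sets \<mu>" by measurable
      then show ?thesis by (simp add: spM)
    qed
    \<comment> \<open>Counts the mass of \<open>W\<close> in both orders of integration: every y has
      partners of mass d, every x with norm in A has partners of mass c.\<close>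
    have dc: "d = c * measure \<mu> {x \<in> Rn n. norm_Rn n x \<in> A}"
    proof -
      have m0: "(\<lambda>x. \<integral>y. w x y \<partial>gauss n) \<in> borel_measurable \<mu>"
        by (rule G.borel_measurable_lebesgue_integral) (use w_meas in simp)
      have m0': "(\<lambda>y. \<integral>x. w x y \<partial>\<mu>) \<in> borel_measurable (gauss n)"
        by (intro M.borel_measurable_lebesgue_integral) (use measurable_pair_swap[OF w_meas] in simp)
      have "d = (\<integral>y. d \<partial>gauss n)" by (simp add: G.prob_space[simplified])
      also have "\<dots> = (\<integral>y. (\<integral>x. w x y \<partial>\<mu>) \<partial>gauss n)"
        by (rule integral_cong_AE[OF _ m0']) (simp, use AEg in \<open>eventually_elim, simp add: wd\<close>)
      also have "\<dots> = (\<integral>x. (\<integral>y. w x y \<partial>gauss n) \<partial>\<mu>)" by (rule MG.Fubini_integral[OF int0])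
      also have "\<dots> = (\<integral>x. c * indicator {x \<in> Rn n. norm_Rn n x \<in> A} x \<partial>\<mu>)"
      proof (rule integral_cong_AE[OF m0])
        show "(\<lambda>x. c * indicator {x \<in> Rn n. norm_Rn n x \<in> A} x) \<in> borel_measurable \<mu>"
          using mset by (intro borel_measurable_times borel_measurable_const borel_measurable_indicator)
        show "AE x in \<mu>. (\<integral>y. w x y \<partial>gauss n) = c * indicator {x \<in> Rn n. norm_Rn n x \<in> A} x"
          using AEm by eventually_elim (simp add: wc indicator_def)
      qed
      finally show ?thesis using mset by simp
    qed
    have diff: "\<bar>w x y * b (dir n x) - w x y * b (dir n y)\<bar> \<le> B * sqrt (2 * e) * w x y" for x y
    proof (cases "(x, y) \<in> W")
      case True
      then have i: "1 - e < inner_Rn n (dir n y) (dir n x)" by (simp add: W_def)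
      have "norm_Rn n x \<noteq> 0"
      proof
        assume "norm_Rn n x = 0"
        then have "inner_Rn n (dir n y) (dir n x) = 0" by (simp add: inner_Rn_def dir_def)
        then show False using i e by simp
      qed
      moreover have "norm_Rn n y \<noteq> 0"
      proof
        assume "norm_Rn n y = 0"
        then have "inner_Rn n (dir n y) (dir n x) = 0" by (simp add: inner_Rn_def dir_def)
        then show False using i e by simp
      qed
      ultimately have "\<bar>b (dir n x) - b (dir n y)\<bar> \<le> B * sqrt (2 - 2 * inner_Rn n (dir n x) (dir n y))"
        by (intro lip norm_dir)
      also have "\<dots> \<le> B * sqrt (2 * e)"
        using i inner_Rn_commute[of n "dir n x" "dir n y"] by (intro mult_left_mono B real_sqrt_le_mono) linarith
      finally show ?thesis using True by (simp add: w_def)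
    qed (simp add: w_def)
    have "\<bar>c * I - c * J\<bar> = \<bar>(\<integral>p. (case p of (x, y) \<Rightarrow> w x y * b (dir n x)) \<partial>(\<mu> \<Otimes>\<^sub>M gauss n))
        - (\<integral>p. (case p of (x, y) \<Rightarrow> w x y * b (dir n y)) \<partial>(\<mu> \<Otimes>\<^sub>M gauss n))\<bar>"
      using E1 E2 dc MG.integral_fst'[OF int1] MG.integral_fst'[OF int2] by (simp add: J_def mult_ac)
    also have "\<dots> = \<bar>\<integral>p. (case p of (x, y) \<Rightarrow> w x y * b (dir n x)) - (case p of (x, y) \<Rightarrow> w x y * b (dir n y)) \<partial>(\<mu> \<Otimes>\<^sub>M gauss n)\<bar>"
      by (subst Bochner_Integration.integral_diff[OF int1 int2]) simp
    also have "\<dots> \<le> (\<integral>p. B * sqrt (2 * e) * (case p of (x, y) \<Rightarrow> w x y) \<partial>(\<mu> \<Otimes>\<^sub>M gauss n))"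
    proof (rule order_trans[OF integral_abs_bound integral_mono])
      show "integrable (\<mu> \<Otimes>\<^sub>M gauss n) (\<lambda>p. \<bar>(case p of (x, y) \<Rightarrow> w x y * b (dir n x)) - (case p of (x, y) \<Rightarrow> w x y * b (dir n y))\<bar>)"
        by (intro integrable_abs Bochner_Integration.integrable_diff int1 int2)
      show "integrable (\<mu> \<Otimes>\<^sub>M gauss n) (\<lambda>p. B * sqrt (2 * e) * (case p of (x, y) \<Rightarrow> w x y))"
        by (intro integrable_mult_right int0)
    qed (simp only: case_prod_beta' diff)
    also have "\<dots> = B * sqrt (2 * e) * d"
    proof -
      have "(\<integral>p. (case p of (x, y) \<Rightarrow> w x y) \<partial>(\<mu> \<Otimes>\<^sub>M gauss n)) = (\<integral>y. (\<integral>x. w x y \<partial>\<mu>) \<partial>gauss n)"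
        using MG.integral_snd[OF int0] by simp
      also have "\<dots> = (\<integral>y. d \<partial>gauss n)"
      proof (rule integral_cong_AE)
        show "(\<lambda>y. \<integral>x. w x y \<partial>\<mu>) \<in> borel_measurable (gauss n)"
          by (intro M.borel_measurable_lebesgue_integral) (use measurable_pair_swap[OF w_meas] in simp)
        show "AE y in gauss n. (\<integral>x. w x y \<partial>\<mu>) = d"
          using AEg by eventually_elim (simp add: wd)
      qed simp
      finally show ?thesis by (simp add: G.prob_space[simplified])
    qed
    \<comment> \<open>Both sides carry the factor c, the mass of a cap, which tends to 0 with e.
      Dividing by it leaves an error that still vanishes.\<close>
    also have "\<dots> \<le> B * sqrt (2 * e) * c"
    proof (rule mult_left_mono)
      show "d \<le> c" unfolding dc using c0 by (simp add: mult_le_cancel_left1)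
    qed (use B e in simp)
    also have "\<bar>c * I - c * J\<bar> = \<bar>I - J\<bar> * c"
      using c0 by (simp add: right_diff_distrib[symmetric] abs_mult)
    finally show ?thesis by (rule mult_right_le_imp_le) (rule c0)
  qed
  have "\<bar>I - J\<bar> \<le> 0"
  proof (rule tendsto_lowerbound)
    have "((\<lambda>e. B * sqrt (2 * e)) \<longlongrightarrow> B * sqrt (2 * 0)) (at_right 0)"
      by (intro tendsto_intros)
    then show "((\<lambda>e. B * sqrt (2 * e)) \<longlongrightarrow> 0) (at_right 0)" by simp
    show "eventually (\<lambda>e. \<bar>I - J\<bar> \<le> B * sqrt (2 * e)) (at_right 0)"
      using eventually_at_right_real[OF zero_less_one] by eventually_elim (rule key; simp)
  qed simp
  then show ?thesis by (simp add: I_def J_def)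
qed

text \<open>Equals 1 up to a, falls linearly to 0 over a length 1 / k, and so is a k-Lipschitz
  approximation of the indicator of \<open>{..a}\<close>.\<close>

definition ramp :: "nat \<Rightarrow> real \<Rightarrow> real \<Rightarrow> real" where
  "ramp k a t = max 0 (min 1 (1 - real k * (t - a)))"

lemma ramp_bounds: "0 \<le> ramp k a t" "ramp k a t \<le> 1" by (auto simp: ramp_def)

lemma ramp_lipschitz: "\<bar>ramp k a s - ramp k a t\<bar> \<le> real k * \<bar>s - t\<bar>"
proof -
  have "\<bar>max 0 (min 1 (1 - p)) - max 0 (min 1 (1 - q))\<bar> \<le> \<bar>p - q\<bar>" for p q :: real
    by linarith
  from this[of "real k * (s - a)" "real k * (t - a)"]
  have "\<bar>ramp k a s - ramp k a t\<bar> \<le> \<bar>real k * (s - t)\<bar>"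
    unfolding ramp_def by (simp add: algebra_simps)
  then show ?thesis by (simp add: abs_mult)
qed

lemma ramp_tendsto: "(\<lambda>k. ramp k a t) \<longlonglongrightarrow> indicator {..a} t"
proof (cases "t \<le> a")
  case True
  have "ramp k a t = 1" for k
    using mult_nonneg_nonpos[of "real k" "t - a"] True by (simp add: ramp_def min_def)
  then show ?thesis using True by simp
next
  case False
  have "eventually (\<lambda>k. 1 / (t - a) \<le> real k) sequentially"
    by (rule eventually_sequentiallyI[of "nat \<lceil>1 / (t - a)\<rceil>"]) linarith
  then have "eventually (\<lambda>k. ramp k a t = indicator {..a} t) sequentially"
  proof eventually_elim
    fix k assume "1 / (t - a) \<le> real k"
    then have "1 \<le> real k * (t - a)" using False by (simp add: divide_le_eq)
    then show "ramp k a t = indicator {..a} t" using False by (simp add: ramp_def)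
  qed
  then show ?thesis by (rule tendsto_eventually)
qed

text \<open>The indicator of the box is the limit of products of ramps. Such a product has Lipschitz
  constant at most n k with respect to the Euclidean distance, which on the unit sphere is
  \<open>sqrt (2 - 2 <x, y>)\<close>, and dominated convergence passes to the limit.\<close>

lemma polar_factorises_box:
  assumes n: "1 \<le> n"
    and mu: "prob_space \<mu>" "sets \<mu> = sets (borel_Rn n)" "reflect_inv n \<mu>" "AE x in \<mu>. norm_Rn n x \<noteq> 0"
    and g0: "AE x in gauss n. norm_Rn n x \<noteq> 0"
    and A[measurable]: "A \<in> sets borel" and Q: "Q = Pi\<^sub>E {..<n} (\<lambda>i. {..a i})"
  shows "(\<integral>x. indicator A (norm_Rn n x) * indicator Q (dir n x) \<partial>\<mu>)
    = measure \<mu> {x \<in> Rn n. norm_Rn n x \<in> A} * (\<integral>y. indicator Q (dir n y) \<partial>gauss n :: real)"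
proof -
  interpret M: prob_space \<mu> by fact
  interpret G: prob_space "gauss n" by (rule prob_gauss)
  note [measurable_cong] = mu(2)
  define b where "b k x = (\<Prod>i<n. ramp k (a i) (x i))" for k and x :: "nat \<Rightarrow> real"
  have b01: "0 \<le> b k x" "b k x \<le> 1" for k x
    unfolding b_def by (auto intro!: prod_nonneg prod_le_1 ramp_bounds)
  have b_meas[measurable]: "b k \<in> borel_measurable (borel_Rn n)" for k
  proof -
    have "(\<lambda>x. ramp k (a i) (x i)) \<in> borel_measurable (borel_Rn n)" if "i < n" for i
      unfolding ramp_def
      by (intro borel_measurable_max borel_measurable_min borel_measurable_diff borel_measurable_times
          component_measurable that borel_measurable_const)
    then show ?thesis unfolding b_def[abs_def] by (intro borel_measurable_prod) auto
  qed
  have b_lim: "(\<lambda>k. b k x) \<longlonglongrightarrow> indicator Q x" if "x \<in> Rn n" for x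
  proof -
    have "(\<lambda>k. b k x) \<longlonglongrightarrow> (\<Prod>i<n. indicator {..a i} (x i))"
      unfolding b_def by (intro tendsto_prod ramp_tendsto)
    also have "(\<Prod>i<n. indicator {..a i} (x i)) = (indicator Q x :: real)"
    proof (cases "x \<in> Q")
      case True
      then have "indicator {..a i} (x i) = (1::real)" if "i < n" for i
        using that by (auto simp: Q PiE_iff)
      then show ?thesis using True by simp
    next
      case False
      then obtain i where "i < n" "\<not> x i \<le> a i" using \<open>x \<in> Rn n\<close> by (auto simp: Q PiE_iff)
      then have "(\<Prod>i<n. indicator {..a i} (x i)) = (0::real)" by (intro prod_zero bexI[of _ i]) auto
      then show ?thesis using False by simp
    qed
    finally show ?thesis .
  qed
  have Q_sets[measurable]: "Q \<in> sets (borel_Rn n)" unfolding Q by (rule sets_PiM_I_finite) auto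
  have eq: "(\<integral>x. indicator A (norm_Rn n x) * b k (dir n x) \<partial>\<mu>)
    = measure \<mu> {x \<in> Rn n. norm_Rn n x \<in> A} * (\<integral>y. b k (dir n y) \<partial>gauss n)" for k
  proof (rule polar_factorises_Lipschitz[OF n mu g0 A b_meas])
    show "\<bar>b k x\<bar> \<le> 1" for x using b01[of k x] by simp
    show "0 \<le> real n * real k" by simp
    fix x y :: "nat \<Rightarrow> real" assume xy: "norm_Rn n x = 1" "norm_Rn n y = 1"
    have sq: "(\<Sum>i<n. (x i - y i)\<^sup>2) = 2 - 2 * inner_Rn n x y"
    proof -
      have "(\<Sum>i<n. (x i - y i)\<^sup>2) = (\<Sum>i<n. (x i)\<^sup>2) + (\<Sum>i<n. (y i)\<^sup>2) - 2 * inner_Rn n x y"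
        by (simp add: power2_diff sum.distrib sum_subtractf inner_Rn_def sum_distrib_left mult_ac)
      then show ?thesis using xy norm_Rn_sq'[of n x] norm_Rn_sq'[of n y] by simp
    qed
    have "\<bar>b k x - b k y\<bar> \<le> (\<Sum>i<n. \<bar>ramp k (a i) (x i) - ramp k (a i) (y i)\<bar>)"
      unfolding b_def real_norm_def[symmetric]
      by (rule norm_prod_diff) (use ramp_bounds in \<open>auto simp: abs_of_nonneg\<close>)
    also have "\<dots> \<le> (\<Sum>i<n. real k * sqrt (2 - 2 * inner_Rn n x y))"
    proof (rule sum_mono)
      fix i assume i: "i \<in> {..<n}"
      have "(x i - y i)\<^sup>2 \<le> (\<Sum>i<n. (x i - y i)\<^sup>2)" by (rule member_le_sum) (use i in auto)
      then have "\<bar>x i - y i\<bar> \<le> sqrt (2 - 2 * inner_Rn n x y)" unfolding sq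
        by (intro real_le_rsqrt) simp
      then show "\<bar>ramp k (a i) (x i) - ramp k (a i) (y i)\<bar> \<le> real k * sqrt (2 - 2 * inner_Rn n x y)"
        by (intro order_trans[OF ramp_lipschitz] mult_left_mono) auto
    qed
    also have "\<dots> = real n * real k * sqrt (2 - 2 * inner_Rn n x y)" by simp
    finally show "\<bar>b k x - b k y\<bar> \<le> real n * real k * sqrt (2 - 2 * inner_Rn n x y)" .
  qed
  have bdir[measurable]: "(\<lambda>x. b k (dir n x)) \<in> borel_measurable (borel_Rn n)" for k
    by (rule measurable_compose[OF dir_measurable b_meas])
  have Qdir[measurable]: "(\<lambda>x. indicator Q (dir n x) :: real) \<in> borel_measurable (borel_Rn n)"
    by (rule measurable_compose[OF dir_measurable borel_measurable_indicator[OF Q_sets]])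
  have 1: "(\<lambda>k. \<integral>x. indicator A (norm_Rn n x) * b k (dir n x) \<partial>\<mu>)
      \<longlonglongrightarrow> (\<integral>x. indicator A (norm_Rn n x) * indicator Q (dir n x) \<partial>\<mu>)"
  proof (rule integral_dominated_convergence[where w="\<lambda>_. 1"])
    show "AE x in \<mu>. (\<lambda>k. indicator A (norm_Rn n x) * b k (dir n x))
        \<longlonglongrightarrow> indicator A (norm_Rn n x) * indicator Q (dir n x)"
      by (intro AE_I2 tendsto_mult_left b_lim dir_in_Rn)
    show "AE x in \<mu>. norm (indicator A (norm_Rn n x) * b k (dir n x)) \<le> 1" for k
      by (rule AE_I2) (use b01 in \<open>auto simp: indicator_def abs_mult abs_of_nonneg\<close>)
  qed simp_all
  have 2: "(\<lambda>k. measure \<mu> {x \<in> Rn n. norm_Rn n x \<in> A} * (\<integral>y. b k (dir n y) \<partial>gauss n))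
      \<longlonglongrightarrow> measure \<mu> {x \<in> Rn n. norm_Rn n x \<in> A} * (\<integral>y. indicator Q (dir n y) \<partial>gauss n)"
  proof (intro tendsto_mult_left integral_dominated_convergence[where w="\<lambda>_. 1"])
    show "AE x in gauss n. (\<lambda>k. b k (dir n x)) \<longlonglongrightarrow> indicator Q (dir n x)"
      by (intro AE_I2 b_lim dir_in_Rn)
    show "AE x in gauss n. norm (b k (dir n x)) \<le> 1" for k
      by (rule AE_I2) (use b01 in \<open>auto simp: abs_of_nonneg\<close>)
  qed simp_all
  show ?thesis using LIMSEQ_unique[OF 1] 2 by (simp only: eq)
qed

text \<open>Norm and direction are independent, and the law of the direction is that of the
  Gaussian. Equality on rectangles suffices, and for a fixed radial set it reduces to boxes in the
  direction variable.\<close>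

lemma polar_factorises:
  assumes n: "1 \<le> n"
    and mu: "prob_space \<mu>" "sets \<mu> = sets (borel_Rn n)" "reflect_inv n \<mu>" "AE x in \<mu>. norm_Rn n x \<noteq> 0"
    and g0: "AE x in gauss n. norm_Rn n x \<noteq> 0"
  shows "distr \<mu> (borel \<Otimes>\<^sub>M borel_Rn n) (polar n)
    = distr \<mu> borel (norm_Rn n) \<Otimes>\<^sub>M distr (gauss n) (borel_Rn n) (dir n)"
proof -
  interpret M: prob_space \<mu> by fact
  interpret G: prob_space "gauss n" by (rule prob_gauss)
  note [measurable_cong] = mu(2)
  have spM: "space \<mu> = Rn n" using sets_eq_imp_space_eq[OF mu(2)] by (simp add: space_borel_Rn)
  interpret N: prob_space "distr \<mu> borel (norm_Rn n)" by (rule M.prob_space_distr) simp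
  interpret S: prob_space "distr (gauss n) (borel_Rn n) (dir n)" by (rule G.prob_space_distr) simp
  have "distr \<mu> borel (norm_Rn n) \<Otimes>\<^sub>M distr (gauss n) (borel_Rn n) (dir n)
      = distr \<mu> (borel \<Otimes>\<^sub>M borel_Rn n) (polar n)"
  proof (rule pair_measure_eqI)
    show "sigma_finite_measure (distr \<mu> borel (norm_Rn n))"
      "sigma_finite_measure (distr (gauss n) (borel_Rn n) (dir n))"
      by (rule N.sigma_finite_measure_axioms S.sigma_finite_measure_axioms)+
    show "sets (distr \<mu> borel (norm_Rn n) \<Otimes>\<^sub>M distr (gauss n) (borel_Rn n) (dir n))
        = sets (distr \<mu> (borel \<Otimes>\<^sub>M borel_Rn n) (polar n))"
      by (simp cong: sets_pair_measure_cong)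
  next
    fix A B assume A': "A \<in> sets (distr \<mu> borel (norm_Rn n))" and B': "B \<in> sets (distr (gauss n) (borel_Rn n) (dir n))"
    have A[measurable]: "A \<in> sets borel" and B[measurable]: "B \<in> sets (borel_Rn n)"
      using A' B' by simp_all
    define \<alpha> where "\<alpha> = measure \<mu> {x \<in> Rn n. norm_Rn n x \<in> A}"
    \<comment> \<open>With A fixed, both finite measures of the direction agree on lower boxes,
      which form an intersection-stable generator; hence they agree on B.\<close>
    define M1 where "M1 = distr (density \<mu> (\<lambda>x. indicator A (norm_Rn n x))) (borel_Rn n) (dir n)"
    define M2 where "M2 = scale_measure (ennreal \<alpha>) (distr (gauss n) (borel_Rn n) (dir n))"
    have e1: "emeasure M1 Q = (\<integral>\<^sup>+x. indicator A (norm_Rn n x) * indicator Q (dir n x) \<partial>\<mu>)"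
      if Q[measurable]: "Q \<in> sets (borel_Rn n)" for Q
    proof -
      have "emeasure M1 Q = emeasure (density \<mu> (\<lambda>x. indicator A (norm_Rn n x))) (dir n -` Q \<inter> space \<mu>)"
        unfolding M1_def by (subst emeasure_distr) auto
      also have "\<dots> = (\<integral>\<^sup>+x. indicator A (norm_Rn n x) * indicator (dir n -` Q \<inter> space \<mu>) x \<partial>\<mu>)"
        by (rule emeasure_density) (auto intro!: measurable_sets[OF dir_measurable, simplified] simp: spM mu space_borel_Rn[symmetric] simp del: space_PiM)
      also have "\<dots> = (\<integral>\<^sup>+x. indicator A (norm_Rn n x) * indicator Q (dir n x) \<partial>\<mu>)"
        by (rule nn_integral_cong) (auto simp: indicator_def)
      finally show ?thesis .
    qed
    have e2: "emeasure M2 Q = ennreal \<alpha> * emeasure (gauss n) (dir n -` Q \<inter> Rn n)"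
      if "Q \<in> sets (borel_Rn n)" for Q
      unfolding M2_def using that by (simp add: emeasure_distr)
    have "M1 = M2"
    proof (rule measure_eqI_generator_eq[where \<Omega>="Rn n" and A="\<lambda>k. Pi\<^sub>E {..<n} (\<lambda>i. {..real k})"
          and E="{Pi\<^sub>E {..<n} A | A. \<forall>i\<in>{..<n}. A i \<in> range (\<lambda>a::real. {..a})}"])
      show "Int_stable {Pi\<^sub>E {..<n} A | A. \<forall>i\<in>{..<n}. A i \<in> range (\<lambda>a::real. {..a})}"
      proof (rule Int_stableI)
        fix X Y assume "X \<in> {Pi\<^sub>E {..<n} A | A. \<forall>i\<in>{..<n}. A i \<in> range (\<lambda>a::real. {..a})}"
          "Y \<in> {Pi\<^sub>E {..<n} A | A. \<forall>i\<in>{..<n}. A i \<in> range (\<lambda>a::real. {..a})}"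
        then obtain F G where FG: "X = Pi\<^sub>E {..<n} F" "\<forall>i\<in>{..<n}. F i \<in> range (\<lambda>a::real. {..a})"
          "Y = Pi\<^sub>E {..<n} G" "\<forall>i\<in>{..<n}. G i \<in> range (\<lambda>a::real. {..a})" by blast
        have "X \<inter> Y = Pi\<^sub>E {..<n} (\<lambda>i. F i \<inter> G i)" unfolding FG by (simp add: PiE_Int)
        moreover have "\<forall>i\<in>{..<n}. F i \<inter> G i \<in> range (\<lambda>a::real. {..a})"
        proof
          fix i assume i: "i \<in> {..<n}"
          obtain a b where "F i = {..a}" "G i = {..b}" using FG(2,4) i by blast
          then have "F i \<inter> G i = {..min a b}" by auto
          then show "F i \<inter> G i \<in> range (\<lambda>a::real. {..a})" by blast
        qed
        ultimately show "X \<inter> Y \<in> {Pi\<^sub>E {..<n} A | A. \<forall>i\<in>{..<n}. A i \<in> range (\<lambda>a::real. {..a})}"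
          by blast
      qed
      show "{Pi\<^sub>E {..<n} A | A. \<forall>i\<in>{..<n}. A i \<in> range (\<lambda>a::real. {..a})} \<subseteq> Pow (Rn n)"
        by (auto simp: PiE_iff)
      show "sets M1 = sigma_sets (Rn n) {Pi\<^sub>E {..<n} A | A. \<forall>i\<in>{..<n}. A i \<in> range (\<lambda>a::real. {..a})}"
        "sets M2 = sigma_sets (Rn n) {Pi\<^sub>E {..<n} A | A. \<forall>i\<in>{..<n}. A i \<in> range (\<lambda>a::real. {..a})}"
        unfolding M1_def M2_def using borel_Rn_generator by simp_all
      show "range (\<lambda>k. Pi\<^sub>E {..<n} (\<lambda>i. {..real k})) \<subseteq> {Pi\<^sub>E {..<n} A | A. \<forall>i\<in>{..<n}. A i \<in> range (\<lambda>a::real. {..a})}"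
        by blast
      show "(\<Union>k. Pi\<^sub>E {..<n} (\<lambda>i. {..real k})) = Rn n"
      proof (intro equalityI subsetI)
        fix x assume x: "x \<in> Rn n"
        obtain k where k: "norm_Rn n x \<le> real k" using real_arch_simple by blast
        have "x i \<le> real k" if "i < n" for i using abs_le_norm_Rn[OF that, of x] k by linarith
        then show "x \<in> (\<Union>k. Pi\<^sub>E {..<n} (\<lambda>i. {..real k}))" using x by (auto simp: PiE_iff)
      qed (auto simp: PiE_iff)
      show "emeasure M1 (Pi\<^sub>E {..<n} (\<lambda>i. {..real k})) \<noteq> \<infinity>" for k
      proof -
        have s: "Pi\<^sub>E {..<n} (\<lambda>i. {..real k}) \<in> sets (borel_Rn n)" by (rule sets_PiM_I_finite) auto
        have "emeasure M1 (Pi\<^sub>E {..<n} (\<lambda>i. {..real k})) \<le> (\<integral>\<^sup>+x. 1 \<partial>\<mu>)"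
          unfolding e1[OF s] by (intro nn_integral_mono) (simp add: indicator_def)
        also have "\<dots> = 1" unfolding nn_integral_const M.emeasure_space_1 by simp
        also have "(1::ennreal) < \<infinity>" by simp
        finally show ?thesis by simp
      qed
    next
      fix X assume "X \<in> {Pi\<^sub>E {..<n} A | A. \<forall>i\<in>{..<n}. A i \<in> range (\<lambda>a::real. {..a})}"
      then obtain F where F: "X = Pi\<^sub>E {..<n} F" "\<forall>i\<in>{..<n}. F i \<in> range (\<lambda>a::real. {..a})" by blast
      then obtain a where "\<forall>i\<in>{..<n}. F i = {..a i}" unfolding image_iff Bex_def by metis
      then have X: "X = Pi\<^sub>E {..<n} (\<lambda>i. {..a i})" unfolding F(1) by (intro PiE_cong) auto
      have Xs[measurable]: "X \<in> sets (borel_Rn n)" unfolding X by (rule sets_PiM_I_finite) auto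
      have Xdir[measurable]: "(\<lambda>x. indicator X (dir n x) :: real) \<in> borel_measurable (borel_Rn n)"
        by (rule measurable_compose[OF dir_measurable borel_measurable_indicator[OF Xs]])
      have "emeasure M1 X = (\<integral>\<^sup>+x. ennreal (indicator A (norm_Rn n x) * indicator X (dir n x)) \<partial>\<mu>)"
        unfolding e1[OF Xs] by (rule nn_integral_cong) (auto simp: indicator_def)
      also have "\<dots> = ennreal (\<integral>x. indicator A (norm_Rn n x) * indicator X (dir n x) \<partial>\<mu>)"
        by (rule nn_integral_eq_integral, rule M.integrable_const_bound[where B=1])
           (auto simp: indicator_def)
      also have "\<dots> = ennreal (\<alpha> * (\<integral>y. indicator X (dir n y) \<partial>gauss n))"
        unfolding \<alpha>_def polar_factorises_box[OF n mu g0 A X] ..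
      also have "(\<integral>y. indicator X (dir n y) \<partial>gauss n) = measure (gauss n) (dir n -` X \<inter> Rn n)"
      proof -
        have "(\<integral>y. indicator X (dir n y) \<partial>gauss n) = (\<integral>y. indicator (dir n -` X) y \<partial>gauss n :: real)"
          by (rule Bochner_Integration.integral_cong) (auto simp: indicator_def)
        then show ?thesis by simp
      qed
      also have "ennreal (\<alpha> * measure (gauss n) (dir n -` X \<inter> Rn n)) = emeasure M2 X"
        unfolding e2[OF Xs] by (simp add: ennreal_mult'' G.emeasure_eq_measure)
      finally show "emeasure M1 X = emeasure M2 X" .
    qed
    then have eq: "emeasure M1 B = emeasure M2 B" by simp
    have "emeasure (distr \<mu> (borel \<Otimes>\<^sub>M borel_Rn n) (polar n)) (A \<times> B)
        = emeasure \<mu> (polar n -` (A \<times> B) \<inter> space \<mu>)"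
      by (rule emeasure_distr) auto
    also have "\<dots> = (\<integral>\<^sup>+x. indicator (polar n -` (A \<times> B) \<inter> space \<mu>) x \<partial>\<mu>)"
      by (rule nn_integral_indicator[symmetric], rule measurable_sets[where A="borel \<Otimes>\<^sub>M borel_Rn n"]) auto
    also have "\<dots> = emeasure M1 B"
      unfolding e1[OF B] by (rule nn_integral_cong) (auto simp: indicator_def polar_def)
    also have "\<dots> = emeasure (distr \<mu> borel (norm_Rn n)) A * emeasure (distr (gauss n) (borel_Rn n) (dir n)) B"
    proof -
      have "norm_Rn n -` A \<inter> space \<mu> = {x \<in> Rn n. norm_Rn n x \<in> A}" unfolding spM by blast
      then show ?thesis unfolding eq e2[OF B] \<alpha>_def
        by (simp add: emeasure_distr M.emeasure_eq_measure)
    qed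
    finally show "emeasure (distr \<mu> borel (norm_Rn n)) A * emeasure (distr (gauss n) (borel_Rn n) (dir n)) B
        = emeasure (distr \<mu> (borel \<Otimes>\<^sub>M borel_Rn n) (polar n)) (A \<times> B)" ..
  qed
  then show ?thesis ..
qed

section \<open>The radial law of a log-concave measure\<close>

lemma orthogonal_reflect:
  assumes u: "inner_Rn n u u = 1"
  shows "orthogonal_Rn n (reflect n u)"
proof -
  define a where "a i j = (if i = j then 1 else 0) - 2 * u i * u j" for i j :: nat
  have uu: "(\<Sum>k<n. u k * u k) = 1" using u by (simp add: inner_Rn_def)
  have 1: "reflect n u x = (\<lambda>i\<in>{..<n}. \<Sum>j<n. a i j * x j)" for x
  proof (rule Rn_eqI[OF reflect_in_Rn])
    fix k assume k: "k < n"
    have "(\<Sum>j<n. a k j * x j) = (\<Sum>j<n. (if k = j then x j else 0) - 2 * u k * (x j * u j))"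
      by (intro sum.cong) (auto simp: a_def left_diff_distrib)
    also have "\<dots> = x k - 2 * u k * inner_Rn n x u"
      using k by (simp add: sum_subtractf sum_distrib_left[symmetric] inner_Rn_def)
    finally show "reflect n u x k = (\<lambda>i\<in>{..<n}. \<Sum>j<n. a i j * x j) k"
      using k by (simp add: reflect_apply)
  qed simp
  have 2: "(\<Sum>k<n. a i k * a j k) = (if i = j then 1 else 0)" if ij: "i < n" "j < n" for i j
  proof -
    have "(\<Sum>k<n. a i k * a j k) = (\<Sum>k<n. (if i = k then (if j = k then 1 else 0) else 0)
        - (if i = k then 2 * u j * u k else 0) - (if j = k then 2 * u i * u k else 0)
        + 4 * u i * u j * (u k * u k))"
      by (intro sum.cong refl) (simp add: a_def algebra_simps)
    also have "\<dots> = (if i = j then 1 else 0) - 2 * u j * u i - 2 * u i * u j + 4 * u i * u j"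
      using ij by (simp add: sum.distrib sum_subtractf sum_distrib_left[symmetric] uu)
    finally show ?thesis by simp
  qed
  show ?thesis unfolding orthogonal_Rn_def using 1 2 by (intro exI[of _ a]) auto
qed

text \<open>Rotation invariance is formulated with images, reflection invariance with preimages; the
  two coincide because a reflection is an involution.\<close>

lemma rotation_invariant_imp_reflect_inv:
  assumes "rotation_invariant_Rn n \<mu>"
  shows "reflect_inv n \<mu>"
  unfolding reflect_inv_def
proof (intro allI impI ballI)
  fix u A assume u: "inner_Rn n u u = 1" and A: "A \<in> sets (borel_Rn n)"
  have AR: "A \<subseteq> Rn n" using sets.sets_into_space[OF A] by (simp add: space_borel_Rn)
  have "reflect n u -` A \<inter> Rn n = reflect n u ` A"
  proof (intro equalityI subsetI)
    fix x assume "x \<in> reflect n u -` A \<inter> Rn n"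
    then have "reflect n u x \<in> A" "reflect n u (reflect n u x) = x" using reflect_reflect[OF u] by blast+
    then show "x \<in> reflect n u ` A" by (metis imageI)
  next
    fix x assume "x \<in> reflect n u ` A"
    then obtain y where "y \<in> A" "x = reflect n u y" by blast
    moreover have "reflect n u (reflect n u y) = y" using \<open>y \<in> A\<close> AR reflect_reflect[OF u] by blast
    ultimately show "x \<in> reflect n u -` A \<inter> Rn n" using reflect_in_Rn by (metis IntI vimageI)
  qed
  then show "emeasure \<mu> (reflect n u -` A \<inter> Rn n) = emeasure \<mu> A"
    using assms orthogonal_reflect[OF u] A unfolding rotation_invariant_Rn_def by metis
qed

section \<open>Volume of balls and the law of the norm\<close>

lemma space_leb_PiM: "space (leb_PiM {..<n}) = Rn n" by (simp add: space_PiM)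

lemma borel_measurable_leb_PiM: "borel_measurable (leb_PiM {..<n}) = borel_measurable (borel_Rn n)"
  by (rule measurable_cong_sets) (auto simp: sets_leb_PiM)

lemma measurable_leb_PiM: "measurable (leb_PiM {..<n}) M = measurable (borel_Rn n) M"
  by (rule measurable_cong_sets) (auto simp: sets_leb_PiM)

lemma sigma_finite_leb_PiM: "sigma_finite_measure (leb_PiM {..<n})"
  by (rule lborel_prod.sigma_finite) simp

definition ball_vol :: "nat \<Rightarrow> real" where
  "ball_vol n = measure (leb_PiM {..<n}) {x \<in> Rn n. norm_Rn n x \<le> 1}"

lemma norm_ball_sets: "{x \<in> Rn n. norm_Rn n x \<le> r} \<in> sets (borel_Rn n)"
proof -
  have "{x \<in> space (borel_Rn n). norm_Rn n x \<le> r} \<in> sets (borel_Rn n)" by measurable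
  then show ?thesis by (simp only: space_borel_Rn)
qed

lemma emeasure_unit_ball: "emeasure (leb_PiM {..<n}) {x \<in> Rn n. norm_Rn n x \<le> 1} = ennreal (ball_vol n)"
proof -
  have "{x \<in> Rn n. norm_Rn n x \<le> 1} \<subseteq> Pi\<^sub>E {..<n} (\<lambda>_. {-1..1})"
  proof
    fix x assume x: "x \<in> {x \<in> Rn n. norm_Rn n x \<le> 1}"
    then have xR: "x \<in> Rn n" and x1: "norm_Rn n x \<le> 1" by (simp_all only: mem_Collect_eq)
    have "x i \<in> {-1..1}" if "i < n" for i
      using order_trans[OF abs_le_norm_Rn[OF that] x1] by (simp add: abs_le_iff)
    then show "x \<in> Pi\<^sub>E {..<n} (\<lambda>_. {-1..1})" using xR by (simp add: PiE_iff)
  qed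
  then have "emeasure (leb_PiM {..<n}) {x \<in> Rn n. norm_Rn n x \<le> 1} \<le> emeasure (leb_PiM {..<n}) (Pi\<^sub>E {..<n} (\<lambda>_. {-1..1}))"
    by (rule emeasure_mono) (simp add: sets_PiM_I_finite)
  also have "\<dots> = (\<Prod>i<n. emeasure lborel {-1..1::real})" by (rule lborel_prod.emeasure_PiM) auto
  also have "\<dots> = ennreal (2 ^ n)"
  proof -
    have e: "emeasure lborel {-1..1::real} = ennreal 2" by simp
    show ?thesis unfolding e by (simp only: prod_constant card_lessThan ennreal_power zero_le_numeral)
  qed
  also have "\<dots> < \<infinity>" by simp
  finally show ?thesis unfolding ball_vol_def by (subst emeasure_eq_ennreal_measure) auto
qed

lemma emeasure_ball:
  assumes r: "0 < r"
  shows "emeasure (leb_PiM {..<n}) {x \<in> Rn n. norm_Rn n x \<le> r} = ennreal (ball_vol n * r ^ n)"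
proof -
  let ?m = "leb_PiM {..<n}"
  define B where "B s = {x \<in> Rn n. norm_Rn n x \<le> s}" for s
  have Bs: "B s \<in> sets (borel_Rn n)" for s unfolding B_def by (rule norm_ball_sets)
  have Bm: "B s \<in> sets ?m" for s using Bs by (simp only: sets_leb_PiM)
  have "ennreal (\<bar>1 / r\<bar> ^ n) * (\<integral>\<^sup>+x. indicator (B 1) (smul n (1 / r) x) \<partial>?m) = (\<integral>\<^sup>+x. indicator (B 1) x \<partial>?m)"
    by (rule nn_integral_smul) (use r in simp, rule borel_measurable_indicator[OF Bs])
  moreover have "(\<integral>\<^sup>+x. indicator (B 1) (smul n (1 / r) x) \<partial>?m) = (\<integral>\<^sup>+x. indicator (B r) x \<partial>?m)"
  proof (rule nn_integral_cong)
    fix x assume "x \<in> space ?m"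
    then have "smul n (1 / r) x \<in> B 1 \<longleftrightarrow> x \<in> B r"
      using r smul_in_Rn[of n "1 / r" x] by (simp only: B_def space_leb_PiM mem_Collect_eq norm_smul) (simp add: field_simps)
    then show "indicator (B 1) (smul n (1 / r) x) = (indicator (B r) x :: ennreal)" by (simp add: indicator_def)
  qed
  ultimately have "ennreal (\<bar>1 / r\<bar> ^ n) * emeasure ?m (B r) = emeasure ?m (B 1)"
    by (simp only: nn_integral_indicator[OF Bm])
  also have "\<dots> = ennreal (ball_vol n)" unfolding B_def by (rule emeasure_unit_ball)
  finally have "ennreal (r ^ n) * (ennreal (\<bar>1 / r\<bar> ^ n) * emeasure ?m (B r)) = ennreal (r ^ n) * ennreal (ball_vol n)" by simp
  moreover have "ennreal (r ^ n) * ennreal (\<bar>1 / r\<bar> ^ n) = 1"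
    using r by (simp add: ennreal_mult'[symmetric] power_mult_distrib[symmetric])
  ultimately have "emeasure ?m (B r) = ennreal (r ^ n) * ennreal (ball_vol n)"
    by (simp only: mult.assoc[symmetric] mult_1_left)
  also have "\<dots> = ennreal (ball_vol n * r ^ n)"
    using r by (subst ennreal_mult'[symmetric]) (auto simp: mult.commute)
  finally show ?thesis by (simp only: B_def)
qed

text \<open>Integration in polar coordinates for radial functions, obtained without surface measure:
  the volume of balls scales like \<open>r^n\<close>, which determines the pushforward on
  half-lines, and differentiation gives its density. The factor \<open>ball_vol n * n\<close> is the
  area of the unit sphere.\<close>

lemma law_norm_lebesgue:
  assumes n: "1 \<le> n"
  shows "distr (leb_PiM {..<n}) borel (norm_Rn n)
    = density lborel (\<lambda>r. ennreal (indicator {0<..} r * (ball_vol n * n * r ^ (n - 1))))"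
    (is "?M = ?N")
proof -
  let ?m = "leb_PiM {..<n}"
  have w0: "0 \<le> ball_vol n" by (simp add: ball_vol_def)
  have N: "norm_Rn n \<in> measurable ?m borel" by (simp add: measurable_leb_PiM)
  have M_eq: "emeasure ?M {..r} = emeasure ?m {x \<in> Rn n. norm_Rn n x \<le> r}" for r
  proof -
    have "norm_Rn n -` {..r} \<inter> space ?m = {x \<in> Rn n. norm_Rn n x \<le> r}" unfolding space_leb_PiM by blast
    then show ?thesis by (simp add: emeasure_distr[OF N])
  qed
  have eq: "emeasure ?M {..r} = emeasure ?N {..r}" for r
  proof (cases "0 < r")
    case True
    have "emeasure ?N {..r} = (\<integral>\<^sup>+x. ennreal (indicator {0<..} x * (ball_vol n * n * x ^ (n - 1))) * indicator {..r} x \<partial>lborel)"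
      by (rule emeasure_density) auto
    also have "\<dots> = (\<integral>\<^sup>+x. ennreal (ball_vol n * n * x ^ (n - 1)) * indicator {0..r} x \<partial>lborel)"
      by (rule nn_integral_cong_AE, rule eventually_mono[OF AE_lborel_singleton[of 0]])
         (auto simp: indicator_def)
    also have "\<dots> = ball_vol n * r ^ n - ball_vol n * 0 ^ n"
      by (rule nn_integral_FTC_Icc[where F="\<lambda>x. ball_vol n * x ^ n"])
         (use True w0 in \<open>auto intro!: derivative_eq_intros simp: mult_ac\<close>)
    finally show ?thesis using n by (simp add: M_eq emeasure_ball[OF True] power_0_left)
  next
    case False
    have "emeasure ?N {..r} = (\<integral>\<^sup>+x. ennreal (indicator {0<..} x * (ball_vol n * n * x ^ (n - 1))) * indicator {..r} x \<partial>lborel)"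
      by (rule emeasure_density) auto
    also have "\<dots> = (\<integral>\<^sup>+x. 0 \<partial>(lborel :: real measure))"
      by (rule nn_integral_cong) (use False in \<open>auto simp: indicator_def\<close>)
    finally have z: "emeasure ?N {..r} = 0" by simp
    have "emeasure ?M {..r} \<le> 0"
    proof (rule ennreal_le_epsilon)
      fix e :: real assume e: "0 < e"
      \<comment> \<open>For a nonpositive radius the set lies in balls of arbitrarily small radius
        s, whose volume is at most \<open>(ball_vol n + 1) s\<close> because
        \<open>s <= 1 <= n\<close>.\<close>
      define s where "s = min 1 (e / (ball_vol n + 1))"
      have s: "0 < s" "s \<le> 1" using e w0 by (auto simp: s_def)
      have "{x \<in> Rn n. norm_Rn n x \<le> r} \<subseteq> {x \<in> Rn n. norm_Rn n x \<le> s}"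
      proof -
        have "r \<le> s" using False s by simp
        then show ?thesis by (blast intro: order_trans)
      qed
      then have "emeasure ?M {..r} \<le> ennreal (ball_vol n * s ^ n)"
        unfolding M_eq emeasure_ball[OF s(1), symmetric]
        by (rule emeasure_mono) (simp only: sets_leb_PiM norm_ball_sets)
      also have "ball_vol n * s ^ n \<le> (ball_vol n + 1) * s"
        using s w0 n power_decreasing[of 1 n s] by (intro mult_mono) auto
      also have "\<dots> \<le> (ball_vol n + 1) * (e / (ball_vol n + 1))"
        using w0 by (intro mult_left_mono) (auto simp: s_def)
      also have "\<dots> = e" using w0 by simp
      finally show "emeasure ?M {..r} \<le> 0 + ennreal e" by (simp add: ennreal_leI)
    qed
    then show ?thesis using z by simp
  qed
  show ?thesis
  proof (rule measure_eqI_generator_eq[where \<Omega>=UNIV and E="range (\<lambda>a::real. {..a})" and A="\<lambda>k. {..real k}"])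
    show "Int_stable (range (\<lambda>a::real. {..a}))"
    proof (rule Int_stableI)
      fix X Y assume "X \<in> range (\<lambda>a::real. {..a})" "Y \<in> range (\<lambda>a::real. {..a})"
      then obtain a b where "X = {..a}" "Y = {..b}" by blast
      then have "X \<inter> Y = {..min a b}" by auto
      then show "X \<inter> Y \<in> range (\<lambda>a::real. {..a})" by blast
    qed
    show "sets ?M = sigma_sets UNIV (range (\<lambda>a::real. {..a}))" "sets ?N = sigma_sets UNIV (range (\<lambda>a::real. {..a}))"
      by (simp_all add: borel_eq_atMost)
    show "emeasure ?M {..real k} \<noteq> \<infinity>" for k
    proof -
      have "{..real k} \<subseteq> {..real k + 1}" by auto
      then have "emeasure ?M {..real k} \<le> emeasure ?M {..real k + 1}" by (rule emeasure_mono) simp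
      also have "\<dots> < \<infinity>" by (simp add: M_eq emeasure_ball)
      finally show ?thesis by simp
    qed
    show "(\<Union>k. {..real k}) = UNIV" by (auto simp: real_arch_simple)
  qed (use eq in auto)
qed

lemma law_norm_density:
  assumes n: "1 \<le> n" and G[measurable]: "G \<in> borel_measurable borel"
  shows "distr (density (leb_PiM {..<n}) (\<lambda>x. G (norm_Rn n x))) borel (norm_Rn n)
    = density lborel (\<lambda>r. ennreal (indicator {0<..} r * (ball_vol n * n * r ^ (n - 1))) * G r)"
proof -
  have N: "norm_Rn n \<in> measurable (leb_PiM {..<n}) borel" by (simp add: measurable_leb_PiM)
  have "distr (density (leb_PiM {..<n}) (\<lambda>x. G (norm_Rn n x))) borel (norm_Rn n)
      = density (distr (leb_PiM {..<n}) borel (norm_Rn n)) G"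
    by (rule density_distr[symmetric, OF G N])
  also have "\<dots> = density lborel (\<lambda>r. ennreal (indicator {0<..} r * (ball_vol n * n * r ^ (n - 1))) * G r)"
    unfolding law_norm_lebesgue[OF n] by (rule density_density_eq) measurable
  finally show ?thesis .
qed

lemma AE_norm_nonzero:
  assumes n: "1 \<le> n"
  shows "AE x in leb_PiM {..<n}. norm_Rn n x \<noteq> 0"
proof -
  have N: "norm_Rn n \<in> measurable (leb_PiM {..<n}) borel" by (simp add: measurable_leb_PiM)
  have "AE r in distr (leb_PiM {..<n}) borel (norm_Rn n). r \<noteq> 0"
    unfolding law_norm_lebesgue[OF n] by (subst AE_density) (auto simp: indicator_def)
  then show ?thesis by (subst (asm) AE_distr_iff[OF N]) auto
qed

lemma AE_gauss_iff:
  assumes n: "1 \<le> n"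
  shows "(AE x in gauss n. P x) \<longleftrightarrow> (AE x in leb_PiM {..<n}. P x)"
  unfolding gauss_density
  by (subst AE_density) (simp_all add: borel_measurable_leb_PiM gauss_profile_pos)

text \<open>Otherwise \<open>law_norm_lebesgue\<close> would make Lebesgue measure vanish, and with
  it the Gaussian probability measure, which has a density with respect to it.\<close>

lemma ball_vol_pos:
  assumes n: "1 \<le> n"
  shows "0 < ball_vol n"
proof (rule ccontr)
  assume "\<not> 0 < ball_vol n"
  then have "ball_vol n = 0" by (simp add: ball_vol_def less_le)
  then have "distr (leb_PiM {..<n}) borel (norm_Rn n) = density lborel (\<lambda>_. 0)"
    unfolding law_norm_lebesgue[OF n] by simp
  then have "emeasure (distr (leb_PiM {..<n}) borel (norm_Rn n)) UNIV = 0"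
    by (simp add: emeasure_density)
  then have "emeasure (leb_PiM {..<n}) (space (leb_PiM {..<n})) = 0"
    by (subst (asm) emeasure_distr) (simp_all add: measurable_leb_PiM)
  then have "AE x in leb_PiM {..<n}. False"
    by (intro AE_I[where N="space (leb_PiM {..<n})"]) auto
  then have "AE x in gauss n. False" using AE_gauss_iff[OF n, of "\<lambda>_. False"] by simp
  then show False using prob_space.AE_False[OF prob_gauss] by simp
qed

lemma law_norm_gauss:
  assumes n: "1 \<le> n"
  obtains c where "chi n c"
    "distr (gauss n) borel (norm_Rn n) = radial_density.law n {0<..} (\<lambda>s. s\<^sup>2 / 2 + c)"
proof -
  define k where "k = ball_vol n * n * (1 / sqrt (2 * pi)) ^ n"
  have k: "k > 0" using ball_vol_pos[OF n] n by (simp add: k_def)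
  define c where "c = - ln k"
  have law: "distr (gauss n) borel (norm_Rn n) = density lborel (\<lambda>x. ennreal (indicator {0<..} x * (x ^ (n - 1) * exp (- (x\<^sup>2 / 2 + c)))))"
    unfolding gauss_density
  proof (subst law_norm_density[OF n])
    have "ennreal (indicator {0<..} r * (ball_vol n * n * r ^ (n - 1))) * ennreal (gauss_profile n r)
        = ennreal (indicator {0<..} r * (r ^ (n - 1) * exp (- (r\<^sup>2 / 2 + c))))" for r
    proof -
      have "exp (- (r\<^sup>2 / 2 + c)) = exp (- r\<^sup>2 / 2 + ln k)" by (simp add: c_def)
      also have "\<dots> = exp (- r\<^sup>2 / 2) * k" using k by (simp only: exp_add exp_ln)
      finally have "exp (- (r\<^sup>2 / 2 + c)) = exp (- r\<^sup>2 / 2) * k" .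
      then have e: "(ball_vol n * n * r ^ (n - 1)) * gauss_profile n r = r ^ (n - 1) * exp (- (r\<^sup>2 / 2 + c))"
        by (simp add: gauss_profile_def k_def)
      show ?thesis unfolding e[symmetric]
        by (simp add: indicator_def ennreal_mult''[OF less_imp_le[OF gauss_profile_pos]])
    qed
    then show "density lborel (\<lambda>r. ennreal (indicator {0<..} r * (ball_vol n * n * r ^ (n - 1))) * ennreal (gauss_profile n r))
        = density lborel (\<lambda>x. ennreal (indicator {0<..} x * (x ^ (n - 1) * exp (- (x\<^sup>2 / 2 + c)))))" by simp
  qed simp
  interpret G: prob_space "gauss n" by (rule prob_gauss)
  interpret N: prob_space "distr (gauss n) borel (norm_Rn n)" by (rule G.prob_space_distr) simp
  have "chi n c"
  proof (unfold chi_def, unfold_locales)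
    show "convex_on {0<..} (\<lambda>s::real. s\<^sup>2 / 2 + c)"
      by (rule convex_on_realI[where f'="\<lambda>x. x"]) (auto intro!: derivative_eq_intros)
    show "x\<^sup>2 / 2 + c \<le> y\<^sup>2 / 2 + c" if "x \<in> {0<..}" "x \<le> y" for x y :: real
      using power_mono[of x y 2] that by simp
    show "(\<integral>\<^sup>+x. ennreal (indicator {0<..} x * (x ^ (n - 1) * exp (- (x\<^sup>2 / 2 + c)))) \<partial>lborel) = 1"
      using N.emeasure_space_1 unfolding law by (simp add: emeasure_density)
  qed (use n in auto)
  then interpret chi n c .
  show thesis
    by (rule that[OF \<open>chi n c\<close>]) (simp add: law law_def h_def[abs_def])
qed

lemma exp_minus_measurable[measurable]: "exp_minus \<in> borel_measurable borel"
  unfolding exp_minus_def[abs_def] by measurable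

text \<open>Polar coordinates lose no information, not even at the origin, so measures with equal
  polar pushforwards are equal.\<close>

lemma smul_polar:
  "M = distr (distr M (borel \<Otimes>\<^sub>M borel_Rn n) (polar n)) (borel_Rn n) (\<lambda>(r, x). smul n r x)"
  if s: "sets M = sets (borel_Rn n)"
proof -
  have [measurable_cong]: "sets M = sets (borel_Rn n)" by (rule s)
  have sp: "space M = Rn n" using sets_eq_imp_space_eq[OF s] by (simp only: space_borel_Rn)
  have "distr (distr M (borel \<Otimes>\<^sub>M borel_Rn n) (polar n)) (borel_Rn n) (\<lambda>(r, x). smul n r x)
      = distr M (borel_Rn n) ((\<lambda>(r, x). smul n r x) \<circ> polar n)"
    by (rule distr_distr) measurable
  also have "\<dots> = distr M M (\<lambda>x. x)"
  proof (rule distr_cong)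
    fix x assume "x \<in> space M"
    then show "((\<lambda>(r, x). smul n r x) \<circ> polar n) x = x"
      by (simp only: sp o_def polar_def case_prod_conv smul_norm_dir)
  qed (simp_all add: s)
  also have "\<dots> = M" by (rule distr_id)
  finally show ?thesis ..
qed

section \<open>From a reflection-invariant log-concave measure to a convex radial potential\<close>

locale radial_log_concave =
  fixes n :: nat and \<mu> :: "(nat \<Rightarrow> real) measure" and V :: "(nat \<Rightarrow> real) \<Rightarrow> ereal"
  assumes n: "1 \<le> n" and prob: "prob_space \<mu>" and sets_mu[measurable_cong]: "sets \<mu> = sets (borel_Rn n)"
    and V_convex: "convex_Rn n V" and V_meas: "V \<in> borel_measurable (lebesgue_Rn n)"
    and mu_V: "\<And>A. A \<in> sets (borel_Rn n) \<Longrightarrow> emeasure \<mu> A = (\<integral>\<^sup>+x\<in>A. exp_minus (V x) \<partial>lebesgue_Rn n)"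
    and inv: "reflect_inv n \<mu>"
begin

sublocale M: prob_space \<mu> by (rule prob)

lemma space_mu: "space \<mu> = Rn n"
  using sets_eq_imp_space_eq[OF sets_mu] by (simp only: space_borel_Rn)

text \<open>The potential is only Lebesgue measurable, so its exponential is replaced by an almost
  everywhere equal Borel function before product-measure arguments are applied.\<close>

lemma Borel_density:
  obtains f0 where "f0 \<in> borel_measurable (leb_PiM {..<n})" "\<mu> = density (leb_PiM {..<n}) f0"
    "AE x in leb_PiM {..<n}. exp_minus (V x) = f0 x"
proof -
  let ?m = "leb_PiM {..<n}"
  have leb: "lebesgue_Rn n = completion ?m" by (simp add: lebesgue_Rn_def)
  have "(\<lambda>x. exp_minus (V x)) \<in> borel_measurable (completion ?m)"
    using measurable_compose[OF V_meas exp_minus_measurable] unfolding leb .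
  then obtain f0 where f0: "f0 \<in> borel_measurable ?m" "AE x in ?m. exp_minus (V x) = f0 x"
    using completion_ex_borel_measurable[of "\<lambda>x. exp_minus (V x)" ?m] by blast
  have "\<mu> = density ?m f0"
  proof (rule measure_eqI)
    show "sets \<mu> = sets (density ?m f0)" by (simp only: sets_mu sets_density sets_leb_PiM)
    fix A assume "A \<in> sets \<mu>"
    then have A: "A \<in> sets (borel_Rn n)" "A \<in> sets ?m" by (simp_all only: sets_mu sets_leb_PiM)
    have "emeasure \<mu> A = (\<integral>\<^sup>+x. exp_minus (V x) * indicator A x \<partial>completion ?m)"
      using mu_V[OF A(1)] unfolding leb .
    also have "\<dots> = (\<integral>\<^sup>+x. f0 x * indicator A x \<partial>completion ?m)"
      by (rule nn_integral_cong_AE, rule AE_completion) (use f0(2) in \<open>eventually_elim, simp\<close>)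
    also have "\<dots> = (\<integral>\<^sup>+x. f0 x * indicator A x \<partial>?m)"
      by (rule nn_integral_completion)
    also have "\<dots> = emeasure (density ?m f0) A" by (rule emeasure_density[symmetric]) (use f0 A in auto)
    finally show "emeasure \<mu> A = emeasure (density ?m f0) A" .
  qed
  with f0 that show thesis by blast
qed

lemma AE_mu: "(AE x in leb_PiM {..<n}. P x) \<Longrightarrow> (AE x in \<mu>. P x)"
proof -
  assume P: "AE x in leb_PiM {..<n}. P x"
  obtain f0 where f0: "f0 \<in> borel_measurable (leb_PiM {..<n})" "\<mu> = density (leb_PiM {..<n}) f0"
    by (rule Borel_density)
  show "AE x in \<mu>. P x" unfolding f0(2) AE_density[OF f0(1)] using P by eventually_elim simp
qed

lemma polar_mu: "distr \<mu> (borel \<Otimes>\<^sub>M borel_Rn n) (polar n)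
    = distr \<mu> borel (norm_Rn n) \<Otimes>\<^sub>M distr (gauss n) (borel_Rn n) (dir n)"
  by (rule polar_factorises[OF n prob sets_mu inv AE_mu[OF AE_norm_nonzero[OF n]]])
     (simp only: AE_gauss_iff[OF n] AE_norm_nonzero[OF n])

lemma polar_gauss: "distr (gauss n) (borel \<Otimes>\<^sub>M borel_Rn n) (polar n)
    = distr (gauss n) borel (norm_Rn n) \<Otimes>\<^sub>M distr (gauss n) (borel_Rn n) (dir n)"
  by (rule polar_factorises[OF n prob_gauss sets_gauss reflect_inv_gauss])
     (simp_all only: AE_gauss_iff[OF n] AE_norm_nonzero[OF n])

text \<open>Radon-Nikodym is applied only to the laws of the norm. Since the direction is
  independent of the norm with the same law under \<open>\<mu>\<close> and the Gaussian, the
  one-dimensional density D, composed with the norm, is already the density of \<open>\<mu>\<close>.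
  Uniqueness of densities then identifies it with \<open>exp_minus (V x)\<close> almost
  everywhere.\<close>

lemma radial_density_exists:
  obtains G where "G \<in> borel_measurable borel" "\<mu> = density (leb_PiM {..<n}) (\<lambda>x. G (norm_Rn n x))"
    "AE x in leb_PiM {..<n}. exp_minus (V x) = G (norm_Rn n x)"
proof -
  let ?m = "leb_PiM {..<n}" and ?B = "borel \<Otimes>\<^sub>M borel_Rn n"
  let ?nu = "distr \<mu> borel (norm_Rn n)" and ?chi = "distr (gauss n) borel (norm_Rn n)"
    and ?s = "distr (gauss n) (borel_Rn n) (dir n)"
  interpret G: prob_space "gauss n" by (rule prob_gauss)
  interpret N: prob_space ?nu by (rule M.prob_space_distr) measurable
  interpret C: prob_space ?chi by (rule G.prob_space_distr) simp
  interpret S: prob_space ?s by (rule G.prob_space_distr) simp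
  have "absolutely_continuous ?chi ?nu"
    unfolding absolutely_continuous_def
  proof
    fix A assume "A \<in> null_sets ?chi"
    then have A[measurable]: "A \<in> sets borel" and "AE r in ?chi. r \<notin> A"
      by (auto simp: AE_not_in)
    then have "AE x in gauss n. norm_Rn n x \<notin> A" by (subst (asm) AE_distr_iff) auto
    then have "AE x in \<mu>. norm_Rn n x \<notin> A" unfolding AE_gauss_iff[OF n] by (rule AE_mu)
    then have "AE r in ?nu. r \<notin> A" by (subst AE_distr_iff) auto
    then show "A \<in> null_sets ?nu" by (subst (asm) AE_iff_null_sets[symmetric]) auto
  qed
  then obtain D where D[measurable]: "D \<in> borel_measurable borel" and nu: "density ?chi D = ?nu"
    using C.Radon_Nikodym[of ?nu] by auto
  define G where "G r = ennreal (gauss_profile n r) * D r" for r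
  have G[measurable]: "G \<in> borel_measurable borel" unfolding G_def[abs_def] by measurable
  let ?g = "density (gauss n) (\<lambda>x. D (norm_Rn n x))"
  have "distr ?g ?B (polar n) = density (distr (gauss n) ?B (polar n)) (\<lambda>p. D (fst p))"
  proof -
    have "density (distr (gauss n) ?B (polar n)) (\<lambda>p. D (fst p)) = distr (density (gauss n) (\<lambda>x. D (fst (polar n x)))) ?B (polar n)"
      by (rule density_distr) measurable
    then show ?thesis by (simp add: polar_def)
  qed
  also have "\<dots> = density (?chi \<Otimes>\<^sub>M ?s) (\<lambda>(x, y). D x * 1)"
    unfolding polar_gauss by (simp add: case_prod_beta')
  also have "\<dots> = density ?chi D \<Otimes>\<^sub>M density ?s (\<lambda>_. 1)"
    by (rule pair_measure_density[symmetric])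
       (simp_all add: density_1 S.sigma_finite_measure_axioms)
  also have "\<dots> = ?nu \<Otimes>\<^sub>M ?s" by (simp only: nu density_1)
  also have "\<dots> = distr \<mu> ?B (polar n)" by (rule polar_mu[symmetric])
  finally have P: "distr ?g ?B (polar n) = distr \<mu> ?B (polar n)" .
  have "\<mu> = ?g"
    by (subst smul_polar[OF sets_mu], subst smul_polar[of ?g n]) (simp_all add: P)
  also have "\<dots> = density ?m (\<lambda>x. G (norm_Rn n x))"
    unfolding gauss_density G_def
    by (rule density_density_eq) (simp_all add: borel_measurable_leb_PiM)
  finally have mu: "\<mu> = density ?m (\<lambda>x. G (norm_Rn n x))" .
  obtain f0 where f0: "f0 \<in> borel_measurable ?m" "\<mu> = density ?m f0"
    "AE x in ?m. exp_minus (V x) = f0 x" by (rule Borel_density)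
  interpret L: sigma_finite_measure ?m by (rule sigma_finite_leb_PiM)
  have "(\<lambda>x. G (norm_Rn n x)) \<in> borel_measurable ?m" by (simp add: borel_measurable_leb_PiM)
  then have "AE x in ?m. f0 x = G (norm_Rn n x)"
    using L.density_unique_iff[OF f0(1), of "\<lambda>x. G (norm_Rn n x)"] f0(2) mu by simp
  with f0(3) have "AE x in ?m. exp_minus (V x) = G (norm_Rn n x)" by eventually_elim simp
  from that[OF G mu this] show thesis .
qed

text \<open>The identity holds only almost everywhere in space, while convexity is needed along a
  line. Fubini in polar coordinates supplies a direction along which it holds for almost every
  radius, simultaneously at r and -r.\<close>

lemma radial_line:
  assumes G: "G \<in> borel_measurable borel" "AE x in leb_PiM {..<n}. exp_minus (V x) = G (norm_Rn n x)"
  obtains \<theta> where "\<theta> \<in> Rn n" "norm_Rn n \<theta> = 1"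
    "AE r in lborel. 0 < r \<longrightarrow> exp_minus (V (smul n r \<theta>)) = G r \<and> exp_minus (V (smul n (- r) \<theta>)) = G r"
proof -
  let ?m = "leb_PiM {..<n}" and ?B = "borel \<Otimes>\<^sub>M borel_Rn n"
  let ?chi = "distr (gauss n) borel (norm_Rn n)" and ?s = "distr (gauss n) (borel_Rn n) (dir n)"
  interpret Ga: prob_space "gauss n" by (rule prob_gauss)
  interpret C: prob_space ?chi by (rule Ga.prob_space_distr) simp
  interpret S: prob_space ?s by (rule Ga.prob_space_distr) simp
  interpret CS: pair_prob_space ?chi ?s ..
  obtain N where N: "{x \<in> space ?m. \<not> exp_minus (V x) = G (norm_Rn n x)} \<subseteq> N" "emeasure ?m N = 0" "N \<in> sets ?m"
    by (rule AE_E[OF G(2)])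
  have Ns[measurable]: "N \<in> sets (borel_Rn n)" using N(3) by (simp only: sets_leb_PiM)
  \<comment> \<open>The antipodal copy of the exceptional set, again null; avoiding both sets
    handles the two halves of the line together.\<close>
  define N' where "N' = smul n (- 1) -` N \<inter> Rn n"
  have N's[measurable]: "N' \<in> sets (borel_Rn n)"
    using measurable_sets[OF smul_measurable' Ns] unfolding N'_def space_borel_Rn .
  have "ennreal (\<bar>- 1\<bar> ^ n) * (\<integral>\<^sup>+x. indicator N (smul n (- 1) x) \<partial>?m) = (\<integral>\<^sup>+x. indicator N x \<partial>?m)"
    by (rule nn_integral_smul) (simp, rule borel_measurable_indicator[OF Ns])
  moreover have "(\<integral>\<^sup>+x. indicator N (smul n (- 1) x) \<partial>?m) = (\<integral>\<^sup>+x. indicator N' x \<partial>?m)"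
  proof (rule nn_integral_cong)
    fix x assume "x \<in> space ?m"
    then have "smul n (- 1) x \<in> N \<longleftrightarrow> x \<in> N'" unfolding N'_def space_leb_PiM by blast
    then show "indicator N (smul n (- 1) x) = (indicator N' x :: ennreal)" by (simp add: indicator_def)
  qed
  ultimately have N'0: "emeasure ?m N' = 0"
    using N(2,3) N's by (simp add: sets_leb_PiM)
  have nulls: "N \<in> null_sets ?m" "N' \<in> null_sets ?m"
    using N N'0 N's by (auto simp: null_sets_def sets_leb_PiM)
  have "AE x in ?m. x \<notin> N \<and> x \<notin> N'"
    using AE_not_in[OF nulls(1)] AE_not_in[OF nulls(2)] by eventually_elim simp
  then have AEg: "AE x in gauss n. x \<notin> N \<and> x \<notin> N'" unfolding AE_gauss_iff[OF n] .
  have Qm: "(\<lambda>p. smul n (fst p) (snd p)) \<in> measurable ?B (borel_Rn n)"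
    using smul_measurable by (simp only: case_prod_beta')
  have set1: "{p \<in> space ?B. smul n (fst p) (snd p) \<notin> N \<and> smul n (fst p) (snd p) \<notin> N'} \<in> sets ?B"
  proof -
    have "{x \<in> space (borel_Rn n). x \<notin> N \<and> x \<notin> N'} \<in> sets (borel_Rn n)" by measurable
    from measurable_sets[OF Qm this]
    have "(\<lambda>p. smul n (fst p) (snd p)) -` {x \<in> space (borel_Rn n). x \<notin> N \<and> x \<notin> N'} \<inter> space ?B \<in> sets ?B" .
    also have "(\<lambda>p. smul n (fst p) (snd p)) -` {x \<in> space (borel_Rn n). x \<notin> N \<and> x \<notin> N'} \<inter> space ?B
        = {p \<in> space ?B. smul n (fst p) (snd p) \<notin> N \<and> smul n (fst p) (snd p) \<notin> N'}"
      using smul_in_Rn unfolding space_borel_Rn by blast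
    finally show ?thesis .
  qed
  have "AE p in distr (gauss n) ?B (polar n). smul n (fst p) (snd p) \<notin> N \<and> smul n (fst p) (snd p) \<notin> N'"
  proof (subst AE_distr_iff[OF _ set1])
    show "polar n \<in> measurable (gauss n) ?B" by measurable
    show "AE x in gauss n. smul n (fst (polar n x)) (snd (polar n x)) \<notin> N \<and> smul n (fst (polar n x)) (snd (polar n x)) \<notin> N'"
      using AEg AE_space[of "gauss n"]
    proof eventually_elim
      case (elim x)
      then have "smul n (fst (polar n x)) (snd (polar n x)) = x"
        by (simp only: polar_def fst_conv snd_conv space_gauss smul_norm_dir)
      with elim show ?case by simp
    qed
  qed
  then have AE1: "AE p in ?chi \<Otimes>\<^sub>M ?s. smul n (fst p) (snd p) \<notin> N \<and> smul n (fst p) (snd p) \<notin> N'"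
    unfolding polar_gauss .
  have AE2: "AE r in ?chi. AE y in ?s. smul n r y \<notin> N \<and> smul n r y \<notin> N'"
    using CS.AE_pair[OF AE1] by simp
  have sp: "space (?chi \<Otimes>\<^sub>M ?s) = space ?B" "sets (?chi \<Otimes>\<^sub>M ?s) = sets ?B"
    by (auto simp: space_pair_measure intro!: sets_pair_measure_cong)
  have AE3: "AE y in ?s. AE r in ?chi. smul n r y \<notin> N \<and> smul n r y \<notin> N'"
    by (subst CS.AE_commute[symmetric]) (use set1 AE2 in \<open>simp_all only: sp\<close>)
  have "AE x in gauss n. norm_Rn n (dir n x) = 1"
    unfolding AE_gauss_iff[OF n] using AE_norm_nonzero[OF n] by eventually_elim (rule norm_dir)
  then have AE4: "AE y in ?s. norm_Rn n y = 1" by (subst AE_distr_iff) auto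
  have "\<exists>\<theta>. \<theta> \<in> Rn n \<and> norm_Rn n \<theta> = 1 \<and> (AE r in ?chi. smul n r \<theta> \<notin> N \<and> smul n r \<theta> \<notin> N')"
  proof (rule ccontr)
    assume c: "\<not> ?thesis"
    have "AE y in ?s. False" using AE3 AE4 AE_space[of ?s]
    proof eventually_elim
      case (elim y)
      then have "y \<in> Rn n" by (simp only: space_distr space_borel_Rn)
      with elim c show ?case by blast
    qed
    then show False using S.AE_False by simp
  qed
  then obtain \<theta> where th: "\<theta> \<in> Rn n" "norm_Rn n \<theta> = 1"
    and AEr: "AE r in ?chi. smul n r \<theta> \<notin> N \<and> smul n r \<theta> \<notin> N'" by blast
  obtain c where c: "chi n c" "?chi = radial_density.law n {0<..} (\<lambda>s. s\<^sup>2 / 2 + c)"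
    by (rule law_norm_gauss[OF n])
  interpret X: chi n c by (rule c(1))
  have "AE r in density lborel (\<lambda>x. ennreal (X.h x)). smul n r \<theta> \<notin> N \<and> smul n r \<theta> \<notin> N'"
    using AEr unfolding c(2) X.law_def .
  then have "AE r in lborel. 0 < ennreal (X.h r) \<longrightarrow> smul n r \<theta> \<notin> N \<and> smul n r \<theta> \<notin> N'"
    by (subst (asm) AE_density) auto
  then have "AE r in lborel. 0 < r \<longrightarrow> exp_minus (V (smul n r \<theta>)) = G r \<and> exp_minus (V (smul n (- r) \<theta>)) = G r"
  proof eventually_elim
    case (elim r)
    show ?case
    proof
      assume r: "0 < r"
      then have "0 < ennreal (X.h r)" using X.h_pos[of r] by simp
      then have r1: "smul n r \<theta> \<notin> N" and r2: "smul n r \<theta> \<notin> N'" using elim by auto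
      have "exp_minus (V (smul n r \<theta>)) = G (norm_Rn n (smul n r \<theta>))"
        using N(1) r1 smul_in_Rn[of n r \<theta>] unfolding space_leb_PiM by blast
      moreover have e: "smul n (- 1) (smul n r \<theta>) = smul n (- r) \<theta>" by (auto simp: smul_def fun_eq_iff)
      have "smul n (- r) \<theta> \<notin> N" using r2 smul_in_Rn[of n r \<theta>] unfolding N'_def e[symmetric] by blast
      then have "exp_minus (V (smul n (- r) \<theta>)) = G (norm_Rn n (smul n (- r) \<theta>))"
        using N(1) smul_in_Rn[of n "- r" \<theta>] unfolding space_leb_PiM by blast
      ultimately show "exp_minus (V (smul n r \<theta>)) = G r \<and> exp_minus (V (smul n (- r) \<theta>)) = G r"
        using r by (simp add: norm_smul th)
    qed
  qed
  with that[OF th] show thesis .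
qed

text \<open>Along the chosen line the potential is convex and agrees, almost everywhere, with the
  same radial profile at r and -r. An even convex function is nondecreasing on the positive axis,
  which is where the monotonicity of \<open>v\<close> comes from.\<close>

lemma law_norm_mu:
  obtains D v where "radial_density n D v" "distr \<mu> borel (norm_Rn n) = radial_density.law n D v"
proof -
  obtain G where G: "G \<in> borel_measurable borel" "\<mu> = density (leb_PiM {..<n}) (\<lambda>x. G (norm_Rn n x))"
    "AE x in leb_PiM {..<n}. exp_minus (V x) = G (norm_Rn n x)" by (rule radial_density_exists)
  obtain \<theta> where th: "\<theta> \<in> Rn n" "norm_Rn n \<theta> = 1"
    and AEr: "AE r in lborel. 0 < r \<longrightarrow> exp_minus (V (smul n r \<theta>)) = G r \<and> exp_minus (V (smul n (- r) \<theta>)) = G r"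
    by (rule radial_line[OF G(1,3)])
  define W where "W r = V (smul n r \<theta>)" for r
  define w where "w r = real_of_ereal (W r)" for r
  have Wm: "W r \<noteq> - \<infinity>" for r
    using V_convex smul_in_Rn[of n r \<theta>] unfolding convex_Rn_def W_def by blast
  have Wc: "W ((1 - l) * a + l * b) \<le> ereal (1 - l) * W a + ereal l * W b" if l: "0 < l" "l < 1" for l a b
  proof -
    have "(\<lambda>i\<in>{..<n}. (1 - l) * smul n a \<theta> i + l * smul n b \<theta> i) = smul n ((1 - l) * a + l * b) \<theta>"
      by (auto simp: smul_def fun_eq_iff algebra_simps)
    moreover have "V (\<lambda>i\<in>{..<n}. (1 - l) * smul n a \<theta> i + l * smul n b \<theta> i)
        \<le> ereal (1 - l) * V (smul n a \<theta>) + ereal l * V (smul n b \<theta>)"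
      using V_convex smul_in_Rn[of n a \<theta>] smul_in_Rn[of n b \<theta>] l unfolding convex_Rn_def by blast
    ultimately show ?thesis unfolding W_def by (simp only:)
  qed
  have Wr: "W r = ereal (w r)" if "W r < \<infinity>" for r
    using that Wm[of r] unfolding w_def by (cases "W r") auto
  have wc: "W ((1 - l) * a + l * b) < \<infinity> \<and> w ((1 - l) * a + l * b) \<le> (1 - l) * w a + l * w b"
    if l: "0 \<le> l" "l \<le> 1" and ab: "W a < \<infinity>" "W b < \<infinity>" for l a b
  proof (cases "0 < l \<and> l < 1")
    case True
    have "W ((1 - l) * a + l * b) \<le> ereal ((1 - l) * w a + l * w b)"
      using Wc[of l a b] True by (simp add: Wr[OF ab(1)] Wr[OF ab(2)])
    moreover from this have "W ((1 - l) * a + l * b) < \<infinity>" by (rule le_less_trans) simp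
    ultimately show ?thesis using Wr[of "(1 - l) * a + l * b"] by simp
  next
    case False
    then have "l = 0 \<or> l = 1" using l by auto
    then show ?thesis using ab by auto
  qed
  \<comment> \<open>Radii at which the potential is finite on both sides. \<open>D\<close> below is
    the interior of this initial interval, on which convexity gives continuity.\<close>
  define S where "S = {r. 0 < r \<and> W r < \<infinity> \<and> W (- r) < \<infinity>}"
  define D where "D = (\<Union>s\<in>S. {0<..<s})"
  have two: "W x < \<infinity> \<and> w x \<le> (1 - (x + s) / (2 * s)) * w (- s) + (x + s) / (2 * s) * w s"
    if s: "s \<in> S" and x: "- s \<le> x" "x \<le> s" for s x
  proof -
    have s0: "0 < s" "W s < \<infinity>" "W (- s) < \<infinity>" using s by (auto simp: S_def)
    have e: "(1 - (x + s) / (2 * s)) * (- s) + (x + s) / (2 * s) * s = x" using s0 by (simp add: field_simps)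
    show ?thesis using wc[of "(x + s) / (2 * s)" "- s" s] s0 x unfolding e by (simp add: divide_le_eq)
  qed
  have DS: "r \<in> S" if rD: "r \<in> D" for r
  proof -
    obtain s where s: "s \<in> S" "0 < r" "r < s" using rD by (auto simp: D_def)
    then show ?thesis using two[OF s(1), of r] two[OF s(1), of "- r"] by (auto simp: S_def)
  qed
  \<comment> \<open>Symmetrisation makes \<open>v\<close> monotone at every point of
    \<open>D\<close>, not just almost everywhere; the density is unchanged since \<open>w r\<close>
    and \<open>w (- r)\<close> agree almost everywhere there. The logarithm absorbs the area of the
    unit sphere.\<close>
  define v where "v r = (w r + w (- r)) / 2 - ln (ball_vol n * n)" for r
  have k: "0 < ball_vol n * n" using ball_vol_pos[OF n] n by simp
  \<comment> \<open>Only an endpoint can lie in \<open>S\<close> without lying in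
    \<open>D\<close>.\<close>
  have "AE r in lborel. r \<in> S \<longrightarrow> r \<in> D"
  proof (cases "S - D = {}")
    case False
    then obtain r where r: "r \<in> S" "r \<notin> D" by blast
    have "S - D \<subseteq> {r}"
    proof
      fix s assume s: "s \<in> S - D"
      then have "\<not> s < r" "\<not> r < s" using r by (auto simp: D_def S_def)
      then show "s \<in> {r}" by simp
    qed
    then show ?thesis by (intro eventually_mono[OF AE_lborel_singleton[of r]]) blast
  qed auto
  with AEr have AEh: "AE r in lborel. ennreal (indicator {0<..} r * (ball_vol n * n * r ^ (n - 1))) * G r
      = ennreal (indicator D r * (r ^ (n - 1) * exp (- v r)))"
  proof eventually_elim
    case (elim r)
    show ?case
    proof (cases "0 < r")
      case False
      then have "r \<notin> D" by (auto simp: D_def)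
      then show ?thesis using False by simp
    next
      case True
      have g: "exp_minus (W r) = G r" "exp_minus (W (- r)) = G r" using elim True by (simp_all add: W_def)
      show ?thesis
      proof (cases "r \<in> D")
        case rD: True
        then have fin: "W r = ereal (w r)" "W (- r) = ereal (w (- r))" using DS[OF rD] Wr by (auto simp: S_def)
        have g1: "G r = ennreal (exp (- w r))" using g(1) fin by (simp add: exp_minus_def)
        have g2: "G r = ennreal (exp (- w (- r)))" using g(2) fin by (simp add: exp_minus_def)
        have "exp (- w r) = exp (- w (- r))" using g1 g2 by (simp add: ennreal_inj)
        then have "w (- r) = w r" by simp
        then have "exp (- v r) = exp (- w r + ln (ball_vol n * n))" by (simp add: v_def)
        also have "\<dots> = exp (- w r) * (ball_vol n * n)" using k by (simp only: exp_add exp_ln)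
        finally have ev: "r ^ (n - 1) * exp (- v r) = (ball_vol n * n * r ^ (n - 1)) * exp (- w r)" by simp
        show ?thesis unfolding g1 ev using True rD by (simp add: ennreal_mult'')
      next
        case False
        then have "r \<notin> S" using elim by blast
        then have "W r = \<infinity> \<or> W (- r) = \<infinity>" using True by (auto simp: S_def)
        then have "G r = 0" using g by (auto simp: exp_minus_def)
        then show ?thesis using False by simp
      qed
    qed
  qed
  have law: "distr \<mu> borel (norm_Rn n) = density lborel (\<lambda>r. ennreal (indicator D r * (r ^ (n - 1) * exp (- v r))))"
    if D: "D \<in> sets borel" and vm: "(\<lambda>r. indicator D r * (r ^ (n - 1) * exp (- v r))) \<in> borel_measurable borel"
  proof -
    have "distr \<mu> borel (norm_Rn n) = density lborel (\<lambda>r. ennreal (indicator {0<..} r * (ball_vol n * n * r ^ (n - 1))) * G r)"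
      by (subst G(2)) (rule law_norm_density[OF n G(1)])
    also have "\<dots> = density lborel (\<lambda>r. ennreal (indicator D r * (r ^ (n - 1) * exp (- v r))))"
      by (rule density_cong[OF _ _ AEh]) (use G(1) vm in simp_all)
    finally show ?thesis .
  qed
  have D_open: "open D" unfolding D_def by auto
  have D_pos: "0 < x" if "x \<in> D" for x using that by (auto simp: D_def)
  have D_down: "x \<in> D" if "y \<in> D" "0 < x" "x \<le> y" for x y
    using that by (auto simp: D_def intro: le_less_trans)
  have D_conv: "convex D"
    unfolding is_interval_convex_1[symmetric] is_interval_1 using D_pos D_down by (meson order_less_le_trans)
  have fin: "W r < \<infinity> \<and> W (- r) < \<infinity>" if "r \<in> D" for r using DS[OF that] by (simp add: S_def)
  have v_conv: "convex_on D v"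
  proof (rule convex_onI[OF _ D_conv])
    fix l a b assume l: "0 < l" "l < (1::real)" and ab: "a \<in> D" "b \<in> D"
    have 1: "w ((1 - l) * a + l * b) \<le> (1 - l) * w a + l * w b"
      using wc[of l a b] l fin[OF ab(1)] fin[OF ab(2)] by simp
    have 2: "w (- ((1 - l) * a + l * b)) \<le> (1 - l) * w (- a) + l * w (- b)"
      using wc[of l "- a" "- b"] l fin[OF ab(1)] fin[OF ab(2)] by simp
    have e: "(1 - l) * ((p + p') / 2 - K) + l * ((q + q') / 2 - K)
        = (((1 - l) * p + l * q) + ((1 - l) * p' + l * q')) / 2 - K" for K p p' q q'
      by (simp add: field_simps)
    show "v ((1 - l) *\<^sub>R a + l *\<^sub>R b) \<le> (1 - l) * v a + l * v b"
      unfolding v_def e real_scaleR_def by (intro diff_right_mono divide_right_mono add_mono[OF 1 2]) simp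
  qed
  have v_mono: "v x \<le> v y" if "x \<in> D" "y \<in> D" "x \<le> y" for x y
  proof -
    have y: "y \<in> S" by (rule DS[OF that(2)])
    have x0: "0 < x" using D_pos that by blast
    define l where "l = (x + y) / (2 * y)"
    have l': "(- x + y) / (2 * y) = 1 - l" using x0 that by (simp add: l_def field_simps)
    have "w x \<le> (1 - l) * w (- y) + l * w y" using two[OF y, of x] x0 that by (simp add: l_def)
    moreover have "w (- x) \<le> l * w (- y) + (1 - l) * w y"
      using two[OF y, of "- x"] x0 that unfolding l' by simp
    ultimately have "w x + w (- x) \<le> ((1 - l) * w (- y) + l * w y) + (l * w (- y) + (1 - l) * w y)"
      by (rule add_mono)
    also have "\<dots> = w y + w (- y)" by (simp add: algebra_simps)
    finally show ?thesis by (simp add: v_def)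
  qed
  have vm: "(\<lambda>r. indicator D r * (r ^ (n - 1) * exp (- v r))) \<in> borel_measurable borel"
  proof -
    have "continuous_on D (\<lambda>x. x ^ (n - 1) * exp (- v x))"
      by (intro continuous_intros convex_on_continuous[OF D_open v_conv])
    then have "(\<lambda>x. indicator D x *\<^sub>R (x ^ (n - 1) * exp (- v x))) \<in> borel_measurable borel"
      by (rule borel_measurable_continuous_on_indicator[rotated]) (use D_open in simp)
    then show ?thesis by simp
  qed
  note law = law[OF borel_open[OF D_open] vm]
  interpret N: prob_space "distr \<mu> borel (norm_Rn n)" by (rule M.prob_space_distr) measurable
  have total: "(\<integral>\<^sup>+x. ennreal (indicator D x * (x ^ (n - 1) * exp (- v x))) \<partial>lborel) = 1"
    using N.emeasure_space_1 vm unfolding law by (simp add: emeasure_density)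
  have "D \<noteq> {}"
  proof
    assume "D = {}"
    then show False using total by simp
  qed
  then have rd: "radial_density n D v"
    using n D_open D_pos D_down v_conv v_mono total by unfold_locales
  interpret R: radial_density n D v by (rule rd)
  show thesis by (rule that[OF rd]) (simp only: law R.law_def R.h_def[abs_def])
qed

lemma emeasure_norm_dir:
  assumes "A \<in> sets borel" "B \<in> sets (borel_Rn n)"
  shows "emeasure \<mu> {x \<in> Rn n. norm_Rn n x \<in> A \<and> dir n x \<in> B}
    = emeasure \<mu> {x \<in> Rn n. norm_Rn n x \<in> A} * emeasure (gauss n) {x \<in> Rn n. dir n x \<in> B}"
proof -
  interpret G: prob_space "gauss n" by (rule prob_gauss)
  interpret S: prob_space "distr (gauss n) (borel_Rn n) (dir n)" by (rule G.prob_space_distr) simp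
  have 1: "polar n -` (A \<times> B) \<inter> space \<mu> = {x \<in> Rn n. norm_Rn n x \<in> A \<and> dir n x \<in> B}"
    unfolding space_mu polar_def by blast
  have 2: "norm_Rn n -` A \<inter> space \<mu> = {x \<in> Rn n. norm_Rn n x \<in> A}"
    unfolding space_mu by blast
  have 3: "dir n -` B \<inter> space (gauss n) = {x \<in> Rn n. dir n x \<in> B}"
    unfolding space_gauss by blast
  have "emeasure (distr \<mu> (borel \<Otimes>\<^sub>M borel_Rn n) (polar n)) (A \<times> B) = emeasure \<mu> (polar n -` (A \<times> B) \<inter> space \<mu>)"
    by (rule emeasure_distr) (use assms in measurable)
  moreover have "emeasure (distr \<mu> (borel \<Otimes>\<^sub>M borel_Rn n) (polar n)) (A \<times> B)
      = emeasure (distr \<mu> borel (norm_Rn n)) A * emeasure (distr (gauss n) (borel_Rn n) (dir n)) B"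
    unfolding polar_mu by (rule S.emeasure_pair_measure_Times) (use assms in simp_all)
  moreover have "emeasure (distr \<mu> borel (norm_Rn n)) A = emeasure \<mu> (norm_Rn n -` A \<inter> space \<mu>)"
    by (rule emeasure_distr) (use assms in measurable)
  moreover have "emeasure (distr (gauss n) (borel_Rn n) (dir n)) B = emeasure (gauss n) (dir n -` B \<inter> space (gauss n))"
    by (rule emeasure_distr) (use assms in measurable)
  ultimately show ?thesis unfolding 1 2 3 by simp
qed

lemma nn_integral_reflect_mu:
  assumes u: "inner_Rn n u u = 1" and g[measurable]: "g \<in> borel_measurable (borel_Rn n)"
  shows "(\<integral>\<^sup>+x. g (reflect n u x) \<partial>\<mu>) = (\<integral>\<^sup>+x. g x \<partial>\<mu>)"
proof -
  have R: "reflect n u \<in> measurable \<mu> (borel_Rn n)" by measurable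
  have "distr \<mu> (borel_Rn n) (reflect n u) = \<mu>"
  proof (rule measure_eqI)
    show "sets (distr \<mu> (borel_Rn n) (reflect n u)) = sets \<mu>" by (simp add: sets_mu)
    fix A assume "A \<in> sets (distr \<mu> (borel_Rn n) (reflect n u))"
    then have A: "A \<in> sets (borel_Rn n)" by simp
    have "emeasure (distr \<mu> (borel_Rn n) (reflect n u)) A = emeasure \<mu> (reflect n u -` A \<inter> space \<mu>)"
      by (rule emeasure_distr[OF R A])
    then show "emeasure (distr \<mu> (borel_Rn n) (reflect n u)) A = emeasure \<mu> A"
      using inv u A unfolding reflect_inv_def space_mu by metis
  qed
  then show ?thesis using nn_integral_distr[OF R, of g] by simp
qed

lemma second_moment_coordinate:
  assumes i: "i < n"
  shows "(\<integral>\<^sup>+x. ennreal ((x i)\<^sup>2) \<partial>\<mu>) = (\<integral>\<^sup>+x. ennreal ((x 0)\<^sup>2) \<partial>\<mu>)"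
proof (cases "i = 0")
  case False
  \<comment> \<open>The unit normal of the hyperplane \<open>x 0 = x i\<close>; the reflection
    exchanges these two coordinates.\<close>
  define u where "u k = (if k = 0 then 1 / sqrt 2 else if k = i then - 1 / sqrt 2 else 0)" for k :: nat
  have inner_u: "inner_Rn n x u = (x 0 - x i) / sqrt 2" for x
  proof -
    have "inner_Rn n x u = (\<Sum>k<n. (if k = 0 then x k / sqrt 2 else 0) + (if k = i then - x k / sqrt 2 else 0))"
      unfolding inner_Rn_def using False by (intro sum.cong) (auto simp: u_def)
    also have "\<dots> = x 0 / sqrt 2 + - x i / sqrt 2" using i n by (simp add: sum.distrib)
    finally show ?thesis by (simp add: diff_divide_distrib)
  qed
  have uu: "inner_Rn n u u = 1" using False by (simp add: inner_u) (simp add: u_def real_div_sqrt)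
  have r: "reflect n u x 0 = x i" for x
    using n by (simp add: reflect_apply inner_u u_def diff_divide_distrib)
  have "(\<lambda>x. ennreal ((x 0)\<^sup>2)) \<in> borel_measurable (borel_Rn n)"
    by (intro measurable_compose[OF component_measurable]) (use n in auto)
  from nn_integral_reflect_mu[OF uu this] show ?thesis by (simp add: r)
qed simp

text \<open>For the moment, \<open>1 + y <= exp y\<close> bounds the second moment of one coordinate
  by \<open>t^2\<close>, and the coordinates share it by symmetry. For the tail, a norm above r
  together with a direction having at least half its square in the first coordinate forces
  \<open>(x 0)^2 >= r^2 / 2\<close>; by independence this event has mass at least
  \<open>Fb r exp (- 4 n)\<close>.\<close>

lemma radial_psi2_mu:
  assumes t: "0 < t" and psi: "(\<integral>\<^sup>+x. ennreal (exp ((x 0)\<^sup>2 / t\<^sup>2)) \<partial>\<mu>) \<le> 2"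
  obtains D v where "radial_psi2 n D v t" "distr \<mu> borel (norm_Rn n) = radial_density.law n D v"
proof -
  obtain D v where Dv: "radial_density n D v" "distr \<mu> borel (norm_Rn n) = radial_density.law n D v"
    by (rule law_norm_mu)
  interpret R: radial_density n D v by (rule Dv(1))
  have [measurable]: "(\<lambda>x. x i) \<in> borel_measurable (borel_Rn n)" if "i < n" for i
    using component_measurable[OF that] .
  have n0: "0 < n" using n by simp
  have [measurable]: "(\<lambda>x. x 0) \<in> borel_measurable (borel_Rn n)" using component_measurable[OF n0] .
  have m0: "(\<integral>\<^sup>+x. ennreal ((x 0)\<^sup>2) \<partial>\<mu>) \<le> ennreal (t\<^sup>2)"
  proof -
    have "1 + (\<integral>\<^sup>+x. ennreal ((x 0)\<^sup>2 / t\<^sup>2) \<partial>\<mu>) = (\<integral>\<^sup>+x. 1 + ennreal ((x 0)\<^sup>2 / t\<^sup>2) \<partial>\<mu>)"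
      by (subst nn_integral_add) (simp_all add: M.emeasure_space_1)
    also have "\<dots> \<le> (\<integral>\<^sup>+x. ennreal (exp ((x 0)\<^sup>2 / t\<^sup>2)) \<partial>\<mu>)"
    proof (rule nn_integral_mono)
      fix x :: "nat \<Rightarrow> real"
      have "ennreal (1 + (x 0)\<^sup>2 / t\<^sup>2) \<le> ennreal (exp ((x 0)\<^sup>2 / t\<^sup>2))"
        by (intro ennreal_leI exp_ge_add_one_self)
      then show "1 + ennreal ((x 0)\<^sup>2 / t\<^sup>2) \<le> ennreal (exp ((x 0)\<^sup>2 / t\<^sup>2))" by simp
    qed
    also have "\<dots> \<le> 1 + 1" using psi by simp
    finally have 1: "(\<integral>\<^sup>+x. ennreal ((x 0)\<^sup>2 / t\<^sup>2) \<partial>\<mu>) \<le> 1"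
      by (simp only: ennreal_add_left_cancel_le) simp
    have "(\<integral>\<^sup>+x. ennreal ((x 0)\<^sup>2) \<partial>\<mu>) = (\<integral>\<^sup>+x. ennreal (t\<^sup>2) * ennreal ((x 0)\<^sup>2 / t\<^sup>2) \<partial>\<mu>)"
      using t by (intro nn_integral_cong) (simp add: ennreal_mult'[symmetric])
    also have "\<dots> = ennreal (t\<^sup>2) * (\<integral>\<^sup>+x. ennreal ((x 0)\<^sup>2 / t\<^sup>2) \<partial>\<mu>)"
      by (rule nn_integral_cmult) measurable
    also have "\<dots> \<le> ennreal (t\<^sup>2) * 1" by (rule mult_left_mono[OF 1]) simp
    finally show ?thesis by simp
  qed
  have "(\<integral>\<^sup>+x. ennreal (x\<^sup>2 * R.h x) \<partial>lborel) = (\<integral>\<^sup>+x. ennreal (x\<^sup>2) \<partial>R.law)"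
    unfolding R.law_def
    by (subst nn_integral_density) (auto intro!: nn_integral_cong simp: ennreal_mult' R.h_nonneg mult.commute)
  also have "\<dots> = (\<integral>\<^sup>+x. ennreal ((norm_Rn n x)\<^sup>2) \<partial>\<mu>)"
    unfolding Dv(2)[symmetric]
  proof (rule nn_integral_distr)
    have "(\<lambda>x::real. x\<^sup>2) \<in> borel_measurable borel"
      by (intro borel_measurable_continuous_onI continuous_intros)
    then have "(\<lambda>x::real. ennreal (x\<^sup>2)) \<in> borel_measurable borel"
      by (rule measurable_compose[OF _ measurable_ennreal])
    then show "(\<lambda>x::real. ennreal (x\<^sup>2)) \<in> borel_measurable (distr \<mu> borel (norm_Rn n))"
      by (simp only: measurable_distr_eq1)
  qed measurable
  also have "\<dots> = (\<integral>\<^sup>+x. (\<Sum>i<n. ennreal ((x i)\<^sup>2)) \<partial>\<mu>)"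
    unfolding norm_Rn_sq' by (simp add: sum_ennreal)
  also have "\<dots> = (\<Sum>i<n. \<integral>\<^sup>+x. ennreal ((x i)\<^sup>2) \<partial>\<mu>)"
    by (rule nn_integral_sum) (simp add: measurable_cong_sets[OF sets_mu refl])
  also have "\<dots> = (\<Sum>i<n. \<integral>\<^sup>+x. ennreal ((x 0)\<^sup>2) \<partial>\<mu>)"
    by (rule sum.cong) (auto intro: second_moment_coordinate)
  also have "\<dots> \<le> (\<Sum>i<n. ennreal (t\<^sup>2))" by (rule sum_mono) (rule m0)
  also have "\<dots> = ennreal (n * t\<^sup>2)" by (simp add: ennreal_mult' ennreal_of_nat_eq_real_of_nat)
  finally have mom: "(\<integral>\<^sup>+x. ennreal (x\<^sup>2 * R.h x) \<partial>lborel) \<le> ennreal (n * t\<^sup>2)" .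
  have tail: "R.Fb r * exp (r\<^sup>2 / (2 * t\<^sup>2)) \<le> 2 * exp (4 * n)" if r: "r \<in> D" for r
  proof -
    have r0: "0 < r" using R.D_pos[OF r] .
    define B where "B = {y \<in> Rn n. 1/2 \<le> (y 0)\<^sup>2}"
    have B: "B \<in> sets (borel_Rn n)"
    proof -
      have "{y \<in> space (borel_Rn n). 1/2 \<le> (y 0)\<^sup>2} \<in> sets (borel_Rn n)" by measurable
      then show ?thesis unfolding B_def space_borel_Rn .
    qed
    define A where "A = {x \<in> Rn n. norm_Rn n x \<in> {r<..} \<and> dir n x \<in> B}"
    have A: "A \<in> sets \<mu>"
    proof -
      have "{x \<in> space \<mu>. norm_Rn n x \<in> {r<..} \<and> dir n x \<in> B} \<in> sets \<mu>" using B by measurable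
      then show ?thesis unfolding A_def space_mu .
    qed
    have e1: "emeasure \<mu> {x \<in> Rn n. norm_Rn n x \<in> {r<..}} = ennreal (R.Fb r)"
    proof -
      have "norm_Rn n -` {r<..} \<inter> space \<mu> = {x \<in> Rn n. norm_Rn n x \<in> {r<..}}" unfolding space_mu by blast
      then have "emeasure \<mu> {x \<in> Rn n. norm_Rn n x \<in> {r<..}} = emeasure (distr \<mu> borel (norm_Rn n)) {r<..}"
        by (subst emeasure_distr) simp_all
      then show ?thesis unfolding Dv(2) R.Fb_nn by (simp add: R.emeasure_law)
    qed
    have "{x \<in> Rn n. dir n x \<in> B} = {x \<in> Rn n. 1/2 \<le> (dir n x 0)\<^sup>2}"
      using dir_in_Rn unfolding B_def by blast
    then have e2: "ennreal (exp (- (4 * real n))) \<le> emeasure (gauss n) {x \<in> Rn n. dir n x \<in> B}"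
      using gauss_dir_0_ge[OF n] by simp
    have "ennreal (exp (r\<^sup>2 / (2 * t\<^sup>2)) * (R.Fb r * exp (- (4 * real n))))
        = ennreal (exp (r\<^sup>2 / (2 * t\<^sup>2))) * (ennreal (R.Fb r) * ennreal (exp (- (4 * real n))))"
      by (simp only: ennreal_mult'[OF exp_ge_zero] ennreal_mult'[OF less_imp_le[OF R.Fb_bounds(1)[OF r]]])
    also have "\<dots> \<le> ennreal (exp (r\<^sup>2 / (2 * t\<^sup>2))) * (ennreal (R.Fb r) * emeasure (gauss n) {x \<in> Rn n. dir n x \<in> B})"
      by (intro mult_left_mono e2) auto
    also have "\<dots> = ennreal (exp (r\<^sup>2 / (2 * t\<^sup>2))) * emeasure \<mu> A"
      unfolding A_def by (subst emeasure_norm_dir[OF _ B]) (simp_all add: e1[simplified])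
    also have "\<dots> = (\<integral>\<^sup>+x. ennreal (exp (r\<^sup>2 / (2 * t\<^sup>2))) * indicator A x \<partial>\<mu>)"
      by (rule nn_integral_cmult_indicator[symmetric, OF A])
    also have "\<dots> \<le> (\<integral>\<^sup>+x. ennreal (exp ((x 0)\<^sup>2 / t\<^sup>2)) \<partial>\<mu>)"
    proof (rule nn_integral_mono)
      fix x
      show "ennreal (exp (r\<^sup>2 / (2 * t\<^sup>2))) * indicator A x \<le> ennreal (exp ((x 0)\<^sup>2 / t\<^sup>2))"
      proof (cases "x \<in> A")
        case True
        then have N: "r < norm_Rn n x" and d: "1/2 \<le> (dir n x 0)\<^sup>2" unfolding A_def B_def by simp_all
        have "1/2 \<le> (x 0)\<^sup>2 / (norm_Rn n x)\<^sup>2" using d n0 by (simp add: dir_def power_divide)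
        then have "(norm_Rn n x)\<^sup>2 / 2 \<le> (x 0)\<^sup>2" using N r0 by (simp add: pos_le_divide_eq)
        moreover have "r\<^sup>2 \<le> (norm_Rn n x)\<^sup>2" by (rule power_mono) (use N r0 in auto)
        ultimately have "r\<^sup>2 / 2 / t\<^sup>2 \<le> (x 0)\<^sup>2 / t\<^sup>2" by (intro divide_right_mono) auto
        then have "ennreal (exp (r\<^sup>2 / (2 * t\<^sup>2))) \<le> ennreal (exp ((x 0)\<^sup>2 / t\<^sup>2))"
          by (intro ennreal_leI) simp
        then show ?thesis using True by simp
      qed simp
    qed
    also have "\<dots> \<le> ennreal 2" using psi by simp
    finally have "exp (r\<^sup>2 / (2 * t\<^sup>2)) * (R.Fb r * exp (- (4 * real n))) \<le> 2"
      by (subst (asm) ennreal_le_iff) auto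
    then show ?thesis by (simp add: exp_minus field_simps)
  qed
  have "radial_psi2 n D v t"
    by (intro radial_psi2.intro Dv(1) radial_psi2_axioms.intro t mom tail)
  from that[OF this Dv(2)] show thesis .
qed

end

section \<open>The radial map\<close>

lemma tendsto_continuous_map:
  assumes g: "continuous_map (powertop_real {..<n}) euclideanreal g"
    and y: "\<And>t. y t \<in> Rn n" "y0 \<in> Rn n" and lim: "\<And>i. i < n \<Longrightarrow> ((\<lambda>t. y t i) \<longlongrightarrow> y0 i) F"
  shows "((\<lambda>t. g (y t)) \<longlongrightarrow> g y0) F"
proof -
  have "limitin (powertop_real {..<n}) y y0 F"
    unfolding limitin_componentwise using y lim by (auto simp: PiE_def)
  from continuous_map_limit[OF g this] show ?thesis by (simp add: o_def)
qed

lemma continuous_map_bounded: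
  assumes g: "continuous_map (powertop_real {..<n}) euclideanreal g"
  shows "\<exists>B. \<forall>x\<in>Rn n. (\<forall>i<n. \<bar>x i\<bar> \<le> R) \<longrightarrow> \<bar>g x\<bar> \<le> B"
proof -
  have "compactin (powertop_real {..<n}) (Pi\<^sub>E {..<n} (\<lambda>_. {-R..R}))"
    by (simp add: compactin_PiE)
  then have "compact (g ` Pi\<^sub>E {..<n} (\<lambda>_. {-R..R}))"
    using image_compactin[OF _ g] by simp
  then obtain B where B: "\<And>z. z \<in> g ` Pi\<^sub>E {..<n} (\<lambda>_. {-R..R}) \<Longrightarrow> norm z \<le> B"
    using compact_imp_bounded bounded_iff by metis
  have "\<bar>g x\<bar> \<le> B" if "x \<in> Rn n" "\<forall>i<n. \<bar>x i\<bar> \<le> R" for x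
  proof -
    have "x \<in> Pi\<^sub>E {..<n} (\<lambda>_. {-R..R})" using that by (auto simp: PiE_iff abs_le_iff)
    then show ?thesis using B[of "g x"] by simp
  qed
  then show ?thesis by blast
qed

text \<open>The identification of the product and Borel sigma-algebras is applied on the full
  function space: g is extended by restricting arguments to the first n coordinates, and pulled back
  by padding with zeros.\<close>

lemma continuous_map_borel_Rn:
  assumes g: "continuous_map (powertop_real {..<n}) euclideanreal g"
  shows "g \<in> borel_measurable (borel_Rn n)"
proof -
  define G where "G x = g (restrict x {..<n})" for x :: "nat \<Rightarrow> real"
  have "continuous_map (powertop_real UNIV) (powertop_real {..<n}) (\<lambda>x. restrict x {..<n})"
  proof -
    have "continuous_map (powertop_real UNIV) euclideanreal (\<lambda>x. x k)" for k :: nat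
      using continuous_map_product_projection[of k UNIV "\<lambda>_. euclideanreal"] by simp
    then show ?thesis by (auto simp: continuous_map_componentwise)
  qed
  then have "continuous_map (powertop_real UNIV) euclideanreal G"
    unfolding G_def using continuous_map_compose[OF _ g] by (simp add: o_def)
  then have "continuous_on UNIV G" by (simp add: euclidean_product_topology)
  then have "G \<in> borel_measurable borel" by (rule borel_measurable_continuous_onI)
  then have G: "G \<in> borel_measurable (Pi\<^sub>M UNIV (\<lambda>_. borel))"
    by (simp add: measurable_cong_sets[OF sets_PiM_equal_borel refl])
  have "(\<lambda>x. \<lambda>i\<in>UNIV. if i < n then x i else 0) \<in> measurable (borel_Rn n) (Pi\<^sub>M UNIV (\<lambda>_. borel :: real measure))"
  proof (rule measurable_restrict)
    fix i :: nat
    show "(\<lambda>x. if i < n then x i else 0) \<in> borel_measurable (borel_Rn n)"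
      by (cases "i < n") (simp_all add: component_measurable)
  qed
  from measurable_compose[OF this G]
  have "(\<lambda>x. G (\<lambda>i. if i < n then x i else 0)) \<in> borel_measurable (borel_Rn n)"
    by (simp only: restrict_UNIV)
  then show ?thesis
  proof (rule measurable_cong[THEN iffD1, rotated])
    fix x assume "x \<in> space (borel_Rn n)"
    then have x: "x \<in> Rn n" by (simp only: space_borel_Rn)
    have "restrict (\<lambda>i. if i < n then x i else 0) {..<n} = x"
      by (rule Rn_eqI[OF _ x]) auto
    then show "G (\<lambda>i. if i < n then x i else 0) = g x" by (simp only: G_def)
  qed
qed

section \<open>Chain rule from continuous partial derivatives\<close>

locale C1_function =
  fixes n :: nat and f :: "(nat \<Rightarrow> real) \<Rightarrow> real"
  assumes f_cont: "continuous_map (powertop_real {..<n}) euclideanreal f"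
    and f_diff: "\<And>i x. i < n \<Longrightarrow> x \<in> Rn n \<Longrightarrow> (\<lambda>t. f (x(i := t))) differentiable (at (x i))"
    and p_cont: "\<And>i. i < n \<Longrightarrow> continuous_map (powertop_real {..<n}) euclideanreal (partial_Rn i f)"
begin

lemma partial_deriv:
  assumes "i < n" "x \<in> Rn n"
  shows "((\<lambda>t. f (x(i := t))) has_real_derivative partial_Rn i f (x(i := s))) (at s)"
proof -
  have "x(i := s) \<in> Rn n" using assms by (auto simp: PiE_iff extensional_def)
  from f_diff[OF assms(1) this]
  have "(\<lambda>t. f (x(i := t))) differentiable (at s)" by simp
  then have "((\<lambda>t. f (x(i := t))) has_real_derivative deriv (\<lambda>t. f (x(i := t))) s) (at s)"
    by (simp add: DERIV_deriv_iff_real_differentiable)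
  then show ?thesis by (simp add: partial_Rn_def)
qed

lemma partial_mvt:
  assumes i: "i < n" and x: "x \<in> Rn n"
  shows "\<exists>c. \<bar>c - a\<bar> \<le> \<bar>b - a\<bar> \<and> f (x(i := b)) - f (x(i := a)) = partial_Rn i f (x(i := c)) * (b - a)"
proof (cases "a = b")
  case False
  show ?thesis
  proof (cases "a < b")
    case True
    obtain z where "a < z" "z < b" "f (x(i := b)) - f (x(i := a)) = (b - a) * partial_Rn i f (x(i := z))"
      using MVT2[OF True, of "\<lambda>t. f (x(i := t))" "\<lambda>s. partial_Rn i f (x(i := s))"] partial_deriv[OF i x] by blast
    then show ?thesis by (intro exI[of _ z]) (auto simp: mult.commute)
  next
    case False
    then have "b < a" using \<open>a \<noteq> b\<close> by simp
    then obtain z where "b < z" "z < a" "f (x(i := a)) - f (x(i := b)) = (a - b) * partial_Rn i f (x(i := z))"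
      using MVT2[of b a "\<lambda>t. f (x(i := t))" "\<lambda>s. partial_Rn i f (x(i := s))"] partial_deriv[OF i x] by blast
    then show ?thesis by (intro exI[of _ z]) (auto simp: algebra_simps)
  qed
qed (auto intro: exI[of _ a])

text \<open>Only partial derivatives are at hand, so the coordinates are moved one after the other.
  Each step is a one-variable mean value theorem, whose intermediate point converges to the base
  point, and continuity of the partial derivative identifies the limit.\<close>

lemma chain_rule:
  assumes y: "\<And>t. y t \<in> Rn n"
    and y': "\<And>i. i < n \<Longrightarrow> ((\<lambda>t. y t i) has_real_derivative y' i) (at t0)"
  shows "((\<lambda>t. f (y t)) has_real_derivative (\<Sum>i<n. partial_Rn i f (y t0) * y' i)) (at t0)"
proof -
  \<comment> \<open>The first j coordinates have already moved to time t, the others are still at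
    time t0; the values of f along these points telescope.\<close>
  define z where "z j t = (\<lambda>i\<in>{..<n}. if i < j then y t i else y t0 i)" for j t
  have zR: "z j t \<in> Rn n" for j t by (simp add: z_def)
  have z_step: "z (Suc j) t = (z j t)(j := y t j)" "(z j t)(j := y t0 j) = z j t" if "j < n" for j t
    using that by (auto simp: z_def fun_eq_iff restrict_def)
  have z_end: "z 0 t = y t0" "z n t = y t" for t
    by (rule Rn_eqI[OF zR y], simp add: z_def)+
  have y_cont: "((\<lambda>t. y t i) \<longlongrightarrow> y t0 i) (at t0)" if "i < n" for i
    using DERIV_isCont[OF y'[OF that]] by (simp add: isCont_def)
  have step: "((\<lambda>t. f (z (Suc j) t) - f (z j t)) has_real_derivative partial_Rn j f (y t0) * y' j) (at t0)"
    if j: "j < n" for j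
  proof -
    have "\<exists>c. \<forall>t. \<bar>c t - y t0 j\<bar> \<le> \<bar>y t j - y t0 j\<bar> \<and>
        f (z (Suc j) t) - f (z j t) = partial_Rn j f ((z j t)(j := c t)) * (y t j - y t0 j)"
      using partial_mvt[OF j zR, of "y t0 j" "y _ j"] z_step[OF j] by (intro choice) (metis (no_types, lifting))
    then obtain c where c: "\<And>t. \<bar>c t - y t0 j\<bar> \<le> \<bar>y t j - y t0 j\<bar>"
      "\<And>t. f (z (Suc j) t) - f (z j t) = partial_Rn j f ((z j t)(j := c t)) * (y t j - y t0 j)" by blast
    have c_lim: "(c \<longlongrightarrow> y t0 j) (at t0)"
    proof (rule Lim_null[THEN iffD2], rule Lim_null_comparison)
      show "eventually (\<lambda>t. norm (c t - y t0 j) \<le> \<bar>y t j - y t0 j\<bar>) (at t0)" using c(1) by simp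
      show "((\<lambda>t. \<bar>y t j - y t0 j\<bar>) \<longlongrightarrow> 0) (at t0)"
        using y_cont[OF j] by (simp add: tendsto_rabs_zero_iff LIM_zero)
    qed
    have "((\<lambda>t. partial_Rn j f ((z j t)(j := c t))) \<longlongrightarrow> partial_Rn j f (y t0)) (at t0)"
    proof (rule tendsto_continuous_map[OF p_cont[OF j] _ y])
      show "(z j t)(j := c t) \<in> Rn n" for t using j by (auto simp: z_def PiE_iff extensional_def)
      fix i assume i: "i < n"
      show "((\<lambda>t. ((z j t)(j := c t)) i) \<longlongrightarrow> y t0 i) (at t0)"
      proof (cases "i = j")
        case True
        then show ?thesis using c_lim by simp
      next
        case False
        then show ?thesis using i y_cont[OF i] by (cases "i < j") (simp_all add: z_def)
      qed
    qed
    then have "((\<lambda>t. partial_Rn j f ((z j t)(j := c t)) * ((y t j - y t0 j) / (t - t0))) \<longlongrightarrow> partial_Rn j f (y t0) * y' j) (at t0)"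
      using y'[OF j] by (intro tendsto_mult) (simp_all add: has_field_derivative_iff)
    moreover have "f (z (Suc j) t0) - f (z j t0) = 0" using c(2)[of t0] by simp
    ultimately show ?thesis unfolding has_field_derivative_iff by (simp add: c(2))
  qed
  have "((\<lambda>t. f (y t0) + (\<Sum>j<n. f (z (Suc j) t) - f (z j t))) has_real_derivative
      0 + (\<Sum>i<n. partial_Rn i f (y t0) * y' i)) (at t0)"
    by (intro DERIV_add DERIV_const DERIV_sum step) simp
  moreover have "f (y t0) + (\<Sum>j<n. f (z (Suc j) t) - f (z j t)) = f (y t)" for t
    using sum_lessThan_telescope[of "\<lambda>j. f (z j t)" n] by (simp add: z_end)
  ultimately show ?thesis by simp
qed

end

section \<open>The radial map T and the derivatives of f composed with it\<close>

locale radial_map = C1_function +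
  fixes \<phi> \<phi>' :: "real \<Rightarrow> real" and L :: real
  assumes n: "1 \<le> n" and L: "0 < L"
    and \<phi>_0: "\<And>s. s \<le> 0 \<Longrightarrow> \<phi> s = 0 \<and> \<phi>' s = 0"
    and \<phi>_deriv: "\<And>s. 0 < s \<Longrightarrow> (\<phi> has_real_derivative \<phi>' s) (at s)"
    and \<phi>'_cont: "continuous_on {0<..} \<phi>'"
    and \<phi>'_bounds: "\<And>s. 0 < s \<Longrightarrow> 0 \<le> \<phi>' s \<and> \<phi>' s \<le> L"
    and \<phi>_bounds: "\<And>s. 0 < s \<Longrightarrow> 0 < \<phi> s \<and> \<phi> s \<le> L * s"
begin

definition T :: "(nat \<Rightarrow> real) \<Rightarrow> nat \<Rightarrow> real" where "T x = smul n (\<phi> (norm_Rn n x)) (dir n x)"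

definition p :: "nat \<Rightarrow> (nat \<Rightarrow> real) \<Rightarrow> real" where "p i x = partial_Rn i f (T x)"

text \<open>The partial derivative of \<open>f\<close> composed with \<open>T\<close> away from the
  origin: the Jacobian of \<open>T\<close> is \<open>q I + (\<phi>' - q) x x^T / |x|^2\<close> with
  \<open>q = \<phi>(|x|) / |x|\<close>. At the origin division by zero gives the value 0.\<close>

definition D :: "nat \<Rightarrow> (nat \<Rightarrow> real) \<Rightarrow> real" where
  "D i x = \<phi> (norm_Rn n x) / norm_Rn n x * p i x
     + (\<phi>' (norm_Rn n x) * norm_Rn n x - \<phi> (norm_Rn n x)) / norm_Rn n x ^ 3 * x i * (\<Sum>j<n. x j * p j x)"

lemma T_in_Rn: "T x \<in> Rn n" by (simp add: T_def smul_in_Rn)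

lemma T_apply: "j < n \<Longrightarrow> T x j = \<phi> (norm_Rn n x) / norm_Rn n x * x j"
  by (simp add: T_def smul_def dir_def)

lemma \<phi>_abs_le: "\<bar>\<phi> s\<bar> \<le> L * \<bar>s\<bar>"
proof (cases "0 < s")
  case True
  then show ?thesis using \<phi>_bounds[of s] by simp
next
  case False
  then have "\<phi> s = 0" using \<phi>_0[of s] by simp
  then show ?thesis using L by simp
qed

lemma T_abs_le: "j < n \<Longrightarrow> \<bar>T x j\<bar> \<le> L * norm_Rn n x"
proof -
  assume j: "j < n"
  show ?thesis
  proof (cases "norm_Rn n x = 0")
    case False
    then have N: "0 < norm_Rn n x" using norm_Rn_nonneg[of n x] by simp
    have "\<bar>T x j\<bar> = \<bar>\<phi> (norm_Rn n x)\<bar> * (\<bar>x j\<bar> / norm_Rn n x)"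
      using N j by (simp add: T_apply abs_mult)
    also have "\<dots> \<le> (L * norm_Rn n x) * 1"
      using \<phi>_abs_le[of "norm_Rn n x"] abs_le_norm_Rn[OF j, of x] N L by (intro mult_mono) auto
    finally show ?thesis by simp
  qed (simp add: T_apply j)
qed

lemma norm_fun_upd:
  assumes i: "i < n"
  shows "norm_Rn n (x(i := t)) = sqrt (t\<^sup>2 + (\<Sum>j\<in>{..<n} - {i}. (x j)\<^sup>2))"
proof -
  have "(norm_Rn n (x(i := t)))\<^sup>2 = t\<^sup>2 + (\<Sum>j\<in>{..<n} - {i}. (x j)\<^sup>2)"
    unfolding norm_Rn_sq' using i by (subst sum.remove[of _ i]) auto
  then show ?thesis using norm_Rn_nonneg by (metis real_sqrt_unique)
qed

lemma D_deriv:
  assumes x: "x \<in> Rn n" and i: "i < n" and N: "norm_Rn n x \<noteq> 0"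
  shows "((\<lambda>t. f (T (x(i := t)))) has_real_derivative D i x) (at (x i))"
proof -
  define N where "N = norm_Rn n x"
  have N0: "0 < N" using N norm_Rn_nonneg[of n x] by (simp add: N_def)
  define R where "R = (\<Sum>j\<in>{..<n} - {i}. (x j)\<^sup>2)"
  have NR: "N = sqrt ((x i)\<^sup>2 + R)" using norm_fun_upd[OF i, of x "x i"] by (simp add: N_def R_def)
  then have pos: "0 < (x i)\<^sup>2 + R" using N0 by simp
  have "((\<lambda>t. sqrt (t\<^sup>2 + R)) has_real_derivative (inverse (sqrt ((x i)\<^sup>2 + R)) / 2) * (2 * x i)) (at (x i))"
    using pos by (auto intro!: derivative_eq_intros)
  moreover have "(\<lambda>t. norm_Rn n (x(i := t))) = (\<lambda>t. sqrt (t\<^sup>2 + R))"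
    by (rule ext) (simp only: norm_fun_upd[OF i] R_def)
  moreover have "inverse (sqrt ((x i)\<^sup>2 + R)) / 2 * (2 * x i) = x i / N"
    unfolding NR divide_inverse by (simp only: mult_ac) simp
  ultimately have dN: "((\<lambda>t. norm_Rn n (x(i := t))) has_real_derivative x i / N) (at (x i))"
    by (simp only:)
  have Nx: "norm_Rn n (x(i := x i)) = N" by (simp add: N_def)
  have "((\<lambda>t. \<phi> (norm_Rn n (x(i := t)))) has_real_derivative \<phi>' N * (x i / N)) (at (x i))"
    by (rule DERIV_chain2[OF _ dN]) (use \<phi>_deriv[OF N0] in \<open>simp only: Nx\<close>)
  then have dq: "((\<lambda>t. \<phi> (norm_Rn n (x(i := t))) / norm_Rn n (x(i := t))) has_real_derivative
      (\<phi>' N * (x i / N) * N - \<phi> N * (x i / N)) / (N * N)) (at (x i))"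
    using DERIV_divide[OF _ dN, of "\<lambda>t. \<phi> (norm_Rn n (x(i := t)))"] N0 by (simp only: Nx)
  define q where "q = \<phi> N / N"
  define q' where "q' = (\<phi>' N * N - \<phi> N) / N ^ 3 * x i"
  have q'_eq: "(\<phi>' N * (x i / N) * N - \<phi> N * (x i / N)) / (N * N) = q'"
    unfolding q'_def using N0 by (simp add: field_simps power3_eq_cube)
  have dT: "((\<lambda>t. T (x(i := t)) j) has_real_derivative (q' * x j + q * (if j = i then 1 else 0))) (at (x i))"
    if j: "j < n" for j
  proof -
    have "((\<lambda>t. (x(i := t)) j) has_real_derivative (if j = i then 1 else 0)) (at (x i))"
      by (cases "j = i") auto
    from DERIV_mult[OF dq[unfolded q'_eq] this]
    show ?thesis unfolding T_apply[OF j]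
      by (rule DERIV_cong) (simp add: q_def N_def mult.commute)
  qed
  have "((\<lambda>t. f (T (x(i := t)))) has_real_derivative
      (\<Sum>j<n. partial_Rn j f (T (x(i := x i))) * (q' * x j + q * (if j = i then 1 else 0)))) (at (x i))"
    by (rule chain_rule[OF T_in_Rn dT])
  also have "(\<Sum>j<n. partial_Rn j f (T (x(i := x i))) * (q' * x j + q * (if j = i then 1 else 0)))
      = (\<Sum>j<n. q' * (x j * p j x) + (if j = i then q * p j x else 0))"
    by (intro sum.cong) (auto simp: p_def algebra_simps)
  also have "\<dots> = q' * (\<Sum>j<n. x j * p j x) + q * p i x"
    using i by (simp add: sum.distrib sum_distrib_left)
  also have "\<dots> = D i x" by (simp add: D_def q_def q'_def N_def)
  finally show ?thesis .
qed

text \<open>At the origin, where \<open>T\<close> need not be differentiable, continuity follows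
  from \<open>|T x| <= L |x|\<close> coordinatewise. It lets the interval inequality treat that
  point as an exceptional one.\<close>

lemma fT_isCont:
  assumes x: "x \<in> Rn n" and i: "i < n"
  shows "isCont (\<lambda>t. f (T (x(i := t)))) s"
proof (cases "norm_Rn n (x(i := s)) = 0")
  case False
  have "x(i := s) \<in> Rn n" using x i by (auto simp: PiE_iff extensional_def)
  from DERIV_isCont[OF D_deriv[OF this i False]] show ?thesis by simp
next
  case True
  define R where "R = (\<Sum>j\<in>{..<n} - {i}. (x j)\<^sup>2)"
  have N: "((\<lambda>t. norm_Rn n (x(i := t))) \<longlongrightarrow> 0) (at s)"
  proof -
    have "((\<lambda>t. sqrt (t\<^sup>2 + R)) \<longlongrightarrow> sqrt (s\<^sup>2 + R)) (at s)" by (intro tendsto_intros)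
    then show ?thesis using True unfolding norm_fun_upd[OF i] R_def by simp
  qed
  have "((\<lambda>t. f (T (x(i := t)))) \<longlongrightarrow> f (T (x(i := s)))) (at s)"
  proof (rule tendsto_continuous_map[OF f_cont T_in_Rn T_in_Rn])
    fix j assume j: "j < n"
    have "((\<lambda>t. T (x(i := t)) j) \<longlongrightarrow> 0) (at s)"
    proof (rule Lim_null_comparison)
      show "eventually (\<lambda>t. norm (T (x(i := t)) j) \<le> L * norm_Rn n (x(i := t))) (at s)"
        using T_abs_le[OF j] by simp
      show "((\<lambda>t. L * norm_Rn n (x(i := t))) \<longlongrightarrow> 0) (at s)" using tendsto_mult_right_zero[OF N] .
    qed
    moreover have "T (x(i := s)) j = 0" using T_abs_le[OF j, of "x(i := s)"] True by simp
    ultimately show "((\<lambda>t. T (x(i := t)) j) \<longlongrightarrow> T (x(i := s)) j) (at s)" by simp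
  qed
  then show ?thesis by (simp add: isCont_def)
qed

text \<open>The Jacobian of \<open>T\<close> is symmetric with eigenvalue \<open>\<phi>'\<close> in
  the radial direction and \<open>\<phi>(|x|) / |x|\<close> in the tangential ones, both between 0
  and L. Concretely, the square expands to a combination of the squares of the two eigenvalues, and
  Cauchy-Schwarz bounds the weight of the radial one.\<close>

lemma D_sq_le: "(\<Sum>i<n. (D i x)\<^sup>2) \<le> L\<^sup>2 * (\<Sum>i<n. (p i x)\<^sup>2)"
proof (cases "norm_Rn n x = 0")
  case True
  then show ?thesis by (simp add: D_def sum_nonneg)
next
  case False
  define N where "N = norm_Rn n x"
  have N0: "0 < N" using False norm_Rn_nonneg[of n x] by (simp add: N_def)
  define q where "q = \<phi> N / N"
  define r where "r = (\<phi>' N * N - \<phi> N) / N ^ 3"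
  define s where "s = (\<Sum>j<n. x j * p j x)"
  define P where "P = (\<Sum>i<n. (p i x)\<^sup>2)"
  have D_eq: "D i x = q * p i x + r * s * x i" for i by (simp add: D_def q_def r_def s_def N_def)
  have "(\<Sum>i<n. (D i x)\<^sup>2) = (\<Sum>i<n. q\<^sup>2 * (p i x)\<^sup>2 + 2 * q * r * s * (x i * p i x) + r\<^sup>2 * s\<^sup>2 * (x i)\<^sup>2)"
    unfolding D_eq by (intro sum.cong) (auto simp: power2_eq_square algebra_simps)
  also have "\<dots> = q\<^sup>2 * P + 2 * q * r * s * s + r\<^sup>2 * s\<^sup>2 * N\<^sup>2"
    by (simp add: sum.distrib sum_distrib_left[symmetric] P_def s_def N_def norm_Rn_sq')
  also have "\<dots> = q\<^sup>2 * P + (s\<^sup>2 / N\<^sup>2) * ((\<phi>' N)\<^sup>2 - q\<^sup>2)"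
  proof -
    have e: "\<phi>' N = q + N\<^sup>2 * r" using N0 by (simp add: r_def q_def field_simps power2_eq_square power3_eq_cube)
    show ?thesis unfolding e using N0 by (simp add: field_simps power2_eq_square)
  qed
  also have "\<dots> \<le> L\<^sup>2 * P"
  proof -
    have q: "0 \<le> q" "q \<le> L" using \<phi>_bounds[OF N0] N0 by (auto simp: q_def divide_le_eq)
    have qL: "q\<^sup>2 \<le> L\<^sup>2" using power_mono[OF q(2,1)] .
    have dL: "(\<phi>' N)\<^sup>2 \<le> L\<^sup>2" using \<phi>'_bounds[OF N0] by (auto intro: power_mono)
    have P0: "0 \<le> P" by (simp add: P_def sum_nonneg)
    have "s\<^sup>2 \<le> (\<Sum>j<n. (x j)\<^sup>2) * (\<Sum>j<n. (p j x)\<^sup>2)"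
      unfolding s_def by (rule Cauchy_Schwarz_ineq_sum)
    then have sP: "s\<^sup>2 / N\<^sup>2 \<le> P" using N0 by (simp add: divide_le_eq norm_Rn_sq'[symmetric] N_def P_def mult.commute)
    show ?thesis
    proof (cases "(\<phi>' N)\<^sup>2 \<le> q\<^sup>2")
      case True
      then have "(s\<^sup>2 / N\<^sup>2) * ((\<phi>' N)\<^sup>2 - q\<^sup>2) \<le> 0" by (intro mult_nonneg_nonpos) auto
      then show ?thesis using mult_right_mono[OF qL P0] by simp
    next
      case False
      then have "(s\<^sup>2 / N\<^sup>2) * ((\<phi>' N)\<^sup>2 - q\<^sup>2) \<le> P * ((\<phi>' N)\<^sup>2 - q\<^sup>2)"
        by (intro mult_right_mono sP) simp
      then have "q\<^sup>2 * P + (s\<^sup>2 / N\<^sup>2) * ((\<phi>' N)\<^sup>2 - q\<^sup>2) \<le> (\<phi>' N)\<^sup>2 * P" by (simp add: algebra_simps)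
      then show ?thesis using mult_right_mono[OF dL P0] by simp
    qed
  qed
  finally show ?thesis by (simp add: P_def)
qed

lemma \<phi>_measurable: "\<phi> \<in> borel_measurable borel"
proof -
  have "continuous_on {0<..} \<phi>"
    by (rule continuous_at_imp_continuous_on) (use \<phi>_deriv DERIV_isCont in auto)
  then have "(\<lambda>x. indicator {0<..} x *\<^sub>R \<phi> x) \<in> borel_measurable borel"
    by (rule borel_measurable_continuous_on_indicator[rotated]) simp
  also have "(\<lambda>x. indicator {0<..} x *\<^sub>R \<phi> x) = \<phi>" using \<phi>_0 by (auto simp: fun_eq_iff indicator_def)
  finally show ?thesis .
qed

lemma \<phi>'_measurable: "\<phi>' \<in> borel_measurable borel"
proof -
  have "(\<lambda>x. indicator {0<..} x *\<^sub>R \<phi>' x) \<in> borel_measurable borel"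
    by (rule borel_measurable_continuous_on_indicator[OF _ \<phi>'_cont]) simp
  also have "(\<lambda>x. indicator {0<..} x *\<^sub>R \<phi>' x) = \<phi>'" using \<phi>_0 by (auto simp: fun_eq_iff indicator_def)
  finally show ?thesis .
qed

lemma T_measurable: "T \<in> measurable (borel_Rn n) (borel_Rn n)"
proof -
  have "(\<lambda>x. \<lambda>j\<in>{..<n}. \<phi> (norm_Rn n x) / norm_Rn n x * x j) \<in> measurable (borel_Rn n) (borel_Rn n)"
    by (intro measurable_restrict borel_measurable_times borel_measurable_divide norm_Rn_measurable
        measurable_compose[OF norm_Rn_measurable \<phi>_measurable] component_measurable) auto
  also have "(\<lambda>x. \<lambda>j\<in>{..<n}. \<phi> (norm_Rn n x) / norm_Rn n x * x j) = T"
    by (rule ext, rule Rn_eqI[OF _ T_in_Rn]) (simp_all add: T_apply)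
  finally show ?thesis .
qed

lemma fT_measurable: "(\<lambda>x. f (T x)) \<in> borel_measurable (borel_Rn n)"
  by (rule measurable_compose[OF T_measurable continuous_map_borel_Rn[OF f_cont]])

lemma p_measurable: "i < n \<Longrightarrow> p i \<in> borel_measurable (borel_Rn n)"
  unfolding p_def[abs_def]
  by (rule measurable_compose[OF T_measurable continuous_map_borel_Rn[OF p_cont]])

lemma D_measurable: "i < n \<Longrightarrow> D i \<in> borel_measurable (borel_Rn n)"
  unfolding D_def[abs_def]
  by (intro borel_measurable_add borel_measurable_times borel_measurable_divide borel_measurable_diff
      borel_measurable_power borel_measurable_sum norm_Rn_measurable component_measurable p_measurable
      measurable_compose[OF norm_Rn_measurable \<phi>_measurable]
      measurable_compose[OF norm_Rn_measurable \<phi>'_measurable]) auto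

lemma bounded_on_cube:
  obtains B where "0 \<le> B"
    "\<And>x. x \<in> Rn n \<Longrightarrow> (\<And>i. i < n \<Longrightarrow> \<bar>x i\<bar> \<le> K) \<Longrightarrow> \<bar>f (T x)\<bar> \<le> B"
    "\<And>x i. x \<in> Rn n \<Longrightarrow> (\<And>i. i < n \<Longrightarrow> \<bar>x i\<bar> \<le> K) \<Longrightarrow> i < n \<Longrightarrow> \<bar>D i x\<bar> \<le> B"
proof -
  define R where "R = L * sqrt (n * K\<^sup>2)"
  have TR: "\<bar>T x j\<bar> \<le> R" if "\<And>i. i < n \<Longrightarrow> \<bar>x i\<bar> \<le> K" "j < n" for x j
  proof -
    have K0: "0 \<le> K" using that(1)[OF that(2)] by linarith
    have "(norm_Rn n x)\<^sup>2 \<le> (\<Sum>i<n. K\<^sup>2)" unfolding norm_Rn_sq'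
    proof (rule sum_mono)
      fix i assume "i \<in> {..<n}"
      then have "\<bar>x i\<bar> \<le> \<bar>K\<bar>" using that(1)[of i] K0 by simp
      then show "(x i)\<^sup>2 \<le> K\<^sup>2" by (simp only: abs_le_square_iff)
    qed
    then have "norm_Rn n x \<le> sqrt (n * K\<^sup>2)" by (intro real_le_rsqrt) simp
    then show ?thesis using T_abs_le[OF that(2), of x] mult_left_mono[of "norm_Rn n x" "sqrt (n * K\<^sup>2)" L] L
      unfolding R_def by linarith
  qed
  obtain B1 where B1: "\<And>x. x \<in> Rn n \<Longrightarrow> (\<forall>i<n. \<bar>x i\<bar> \<le> R) \<Longrightarrow> \<bar>f x\<bar> \<le> B1"
    using continuous_map_bounded[OF f_cont, of R] by blast
  have "\<forall>i. \<exists>B. i < n \<longrightarrow> (\<forall>x\<in>Rn n. (\<forall>j<n. \<bar>x j\<bar> \<le> R) \<longrightarrow> \<bar>partial_Rn i f x\<bar> \<le> B)"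
    using continuous_map_bounded[OF p_cont, of _ R] by blast
  then obtain B2 where B2: "\<And>i x. i < n \<Longrightarrow> x \<in> Rn n \<Longrightarrow> (\<forall>j<n. \<bar>x j\<bar> \<le> R) \<Longrightarrow> \<bar>partial_Rn i f x\<bar> \<le> B2 i"
    using choice[of "\<lambda>i B. i < n \<longrightarrow> (\<forall>x\<in>Rn n. (\<forall>j<n. \<bar>x j\<bar> \<le> R) \<longrightarrow> \<bar>partial_Rn i f x\<bar> \<le> B)"] by blast
  define B where "B = \<bar>B1\<bar> + L * sqrt (\<Sum>i<n. (B2 i)\<^sup>2)"
  have s0: "0 \<le> L * sqrt (\<Sum>i<n. (B2 i)\<^sup>2)" using L by (simp add: sum_nonneg)
  show thesis
  proof (rule that[of B])
    show "0 \<le> B" using s0 by (simp add: B_def)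
    fix x assume x: "x \<in> Rn n" "\<And>i. i < n \<Longrightarrow> \<bar>x i\<bar> \<le> K"
    have TT: "\<forall>j<n. \<bar>T x j\<bar> \<le> R" using TR[of x] x(2) by blast
    show "\<bar>f (T x)\<bar> \<le> B" using B1[OF T_in_Rn TT] s0 by (simp add: B_def)
    fix i assume i: "i < n"
    have "(D i x)\<^sup>2 \<le> (\<Sum>i<n. (D i x)\<^sup>2)" by (rule member_le_sum) (use i in auto)
    also have "\<dots> \<le> L\<^sup>2 * (\<Sum>i<n. (p i x)\<^sup>2)" by (rule D_sq_le)
    also have "\<dots> \<le> L\<^sup>2 * (\<Sum>i<n. (B2 i)\<^sup>2)"
    proof (intro mult_left_mono sum_mono)
      fix j assume "j \<in> {..<n}"
      then have "\<bar>p j x\<bar> \<le> \<bar>B2 j\<bar>" using B2[OF _ T_in_Rn TT, of j] by (simp add: p_def)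
      then show "(p j x)\<^sup>2 \<le> (B2 j)\<^sup>2" by (simp only: abs_le_square_iff)
    qed simp
    also have "\<dots> = (L * sqrt (\<Sum>i<n. (B2 i)\<^sup>2))\<^sup>2" by (simp add: power_mult_distrib sum_nonneg)
    finally have "\<bar>D i x\<bar> \<le> L * sqrt (\<Sum>i<n. (B2 i)\<^sup>2)" using s0 by (metis power2_le_imp_le power2_abs)
    then show "\<bar>D i x\<bar> \<le> B" by (simp add: B_def)
  qed
qed

end

section \<open>Gaussian log-Sobolev inequality for radial maps\<close>

lemma integral_uniform_measure:
  fixes h :: "'a \<Rightarrow> real"
  assumes M: "prob_space M" and A[measurable]: "A \<in> sets M" and pos: "0 < measure M A"
    and h[measurable]: "h \<in> borel_measurable M"
  shows "(\<integral>x. h x \<partial>uniform_measure M A) = (\<integral>x. indicator A x * h x \<partial>M) / measure M A"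
proof -
  interpret prob_space M by fact
  have "uniform_measure M A = density M (\<lambda>x. ennreal (indicator A x / measure M A))"
    unfolding uniform_measure_def
    by (intro density_cong) (use pos divide_ennreal[of 1 "prob A"] in \<open>auto simp: emeasure_eq_measure indicator_def\<close>)
  then have "(\<integral>x. h x \<partial>uniform_measure M A) = (\<integral>x. (indicator A x / measure M A) *\<^sub>R h x \<partial>M)"
    by (simp only:) (rule integral_density, auto)
  also have "\<dots> = (\<integral>x. indicator A x * h x / measure M A \<partial>M)" by simp
  finally show ?thesis by simp
qed

lemma std_gauss_interval_pos:
  fixes K :: real
  assumes "0 < K"
  shows "0 < measure std_gauss {-K..K}"
proof -
  interpret G: prob_space std_gauss by (rule prob_std_gauss)
  have "ennreal (exp (- 1 - K\<^sup>2 / 2) * (K - (- K))) \<le> emeasure std_gauss {-K..K}"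
    by (rule std_gauss_interval_ge) (use assms std_normal_density_ge[of _ K] in auto)
  moreover have "0 < exp (- 1 - K\<^sup>2 / 2) * (K - (- K))" using assms by simp
  ultimately show ?thesis unfolding G.emeasure_eq_measure ennreal_le_iff[OF measure_nonneg] by (rule less_le_trans[rotated])
qed

text \<open>Dictionary between expectations under the Gaussian conditioned on an interval and the
  gauge integrals in which \<open>log_Sobolev_interval\<close> is stated; the normalisation of the
  density cancels in the quotient.\<close>

lemma uniform_std_gauss_integral:
  fixes h :: "real \<Rightarrow> real" and K B :: real
  assumes K: "0 < K" and h[measurable]: "h \<in> borel_measurable borel" and B: "\<And>x. x \<in> {-K..K} \<Longrightarrow> \<bar>h x\<bar> \<le> B"
  shows "(\<lambda>x. h x * exp (- x\<^sup>2 / 2)) integrable_on {-K..K}"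
    and "(\<integral>x. h x \<partial>uniform_measure std_gauss {-K..K})
      = integral {-K..K} (\<lambda>x. h x * exp (- x\<^sup>2 / 2)) / integral {-K..K} (\<lambda>x. exp (- x\<^sup>2 / 2))"
proof -
  define c where "c = 1 / sqrt (2 * pi)"
  have c0: "c \<noteq> 0" by (simp add: c_def)
  interpret G: prob_space std_gauss by (rule prob_std_gauss)
  have *: "(\<lambda>x. h x * exp (- x\<^sup>2 / 2)) integrable_on {-K..K}
      \<and> (\<integral>x. indicator {-K..K} x * h x \<partial>std_gauss) = c * integral {-K..K} (\<lambda>x. h x * exp (- x\<^sup>2 / 2))"
    if h[measurable]: "h \<in> borel_measurable borel" and B: "\<And>x. x \<in> {-K..K} \<Longrightarrow> \<bar>h x\<bar> \<le> B" for h :: "real \<Rightarrow> real" and B :: real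
  proof -
    have si: "set_integrable lborel {-K..K} (\<lambda>x. h x * exp (- x\<^sup>2 / 2))"
      unfolding set_integrable_def
    proof (rule integrableI_bounded_set_indicator[where B = B])
      show "AE x in lborel. x \<in> {-K..K} \<longrightarrow> norm (h x * exp (- x\<^sup>2 / 2)) \<le> B"
      proof (intro AE_I2 impI)
        fix x assume x: "x \<in> {-K..K}"
        have "\<bar>h x\<bar> * exp (- x\<^sup>2 / 2) \<le> B * 1" using B[OF x] by (intro mult_mono) auto
        then show "norm (h x * exp (- x\<^sup>2 / 2)) \<le> B" by (simp add: abs_mult)
      qed
    qed (use K in \<open>auto simp: emeasure_lborel_Icc_eq\<close>)
    have "(\<integral>x. indicator {-K..K} x * h x \<partial>std_gauss) = (\<integral>x. std_normal_density x *\<^sub>R (indicator {-K..K} x * h x) \<partial>lborel)"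
      by (rule integral_density) auto
    also have "\<dots> = (\<integral>x. c * (indicator {-K..K} x *\<^sub>R (h x * exp (- x\<^sup>2 / 2))) \<partial>lborel)"
      by (intro Bochner_Integration.integral_cong) (auto simp: std_normal_density_def c_def)
    also have "\<dots> = c * (LINT x : {-K..K} | lborel. h x * exp (- x\<^sup>2 / 2))"
      unfolding set_lebesgue_integral_def by (rule integral_mult_right_zero)
    finally show ?thesis using set_borel_integral_eq_integral[OF si] by simp
  qed
  show "(\<lambda>x. h x * exp (- x\<^sup>2 / 2)) integrable_on {-K..K}" using *[OF h B] by blast
  have "measure std_gauss {-K..K} = (\<integral>x. indicator {-K..K} x * 1 \<partial>std_gauss)" by simp
  also have "\<dots> = c * integral {-K..K} (\<lambda>x. 1 * exp (- x\<^sup>2 / 2))" using *[of "\<lambda>_. 1" 1] by simp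
  finally have q: "measure std_gauss {-K..K} = c * integral {-K..K} (\<lambda>x. exp (- x\<^sup>2 / 2))" by simp
  have "(\<integral>x. h x \<partial>uniform_measure std_gauss {-K..K}) = (\<integral>x. indicator {-K..K} x * h x \<partial>std_gauss) / measure std_gauss {-K..K}"
    by (rule integral_uniform_measure[OF prob_std_gauss _ std_gauss_interval_pos[OF K]]) auto
  then show "(\<integral>x. h x \<partial>uniform_measure std_gauss {-K..K})
      = integral {-K..K} (\<lambda>x. h x * exp (- x\<^sup>2 / 2)) / integral {-K..K} (\<lambda>x. exp (- x\<^sup>2 / 2))"
    using *[OF h B] c0 by (simp add: q)
qed

text \<open>\<open>log_Sobolev_interval\<close> divided by \<open>Z\<close>: the mean of g is
  \<open>m / Z\<close>, so the logarithm of \<open>Z g / m\<close> is exactly the one appearing in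
  the entropy.\<close>

lemma ent_uniform_std_gauss_le:
  fixes g g' :: "real \<Rightarrow> real" and K e B C :: real
  assumes K: "0 < K" and g[measurable]: "g \<in> borel_measurable borel" and g'[measurable]: "g' \<in> borel_measurable borel"
    and e: "0 < e" and gb: "\<And>x. x \<in> {-K..K} \<Longrightarrow> e \<le> g x \<and> g x \<le> B"
    and g'b: "\<And>x. x \<in> {-K..K} \<Longrightarrow> (g' x)\<^sup>2 / g x \<le> C"
    and cg: "continuous_on {-K..K} g" and S: "finite S"
    and dg: "\<And>x. x \<in> {-K<..<K} - S \<Longrightarrow> (g has_real_derivative g' x) (at x)"
  shows "ent (uniform_measure std_gauss {-K..K}) g \<le> (\<integral>x. (g' x)\<^sup>2 / g x \<partial>uniform_measure std_gauss {-K..K}) / 2"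
proof -
  define w where "w = (\<lambda>x::real. exp (- x\<^sup>2 / 2))"
  define P where "P = uniform_measure std_gauss {-K..K}"
  define Z where "Z = integral {-K..K} w"
  define m where "m = integral {-K..K} (\<lambda>x. g x * w x)"
  define G where "G = B * (\<bar>ln e\<bar> + \<bar>ln B\<bar>)"
  have gpos: "0 < g x" if "x \<in> {-K..K}" for x using gb[OF that] e by linarith
  have rep: "(\<lambda>x. h x * w x) integrable_on {-K..K}" "(\<integral>x. h x \<partial>P) = integral {-K..K} (\<lambda>x. h x * w x) / Z"
    if "h \<in> borel_measurable borel" "\<And>x. x \<in> {-K..K} \<Longrightarrow> \<bar>h x\<bar> \<le> D" for h :: "real \<Rightarrow> real" and D :: real
    using uniform_std_gauss_integral[OF K that] unfolding w_def P_def Z_def by blast+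
  have b1: "\<bar>g x\<bar> \<le> B" if "x \<in> {-K..K}" for x using gb[OF that] e by linarith
  have b2: "\<bar>g x * ln (g x)\<bar> \<le> G" if "x \<in> {-K..K}" for x
    unfolding G_def using gb[OF that] by (intro abs_x_ln_x_le[OF e]) auto
  have b3: "\<bar>(g' x)\<^sup>2 / g x\<bar> \<le> C" if "x \<in> {-K..K}" for x
    using g'b[OF that] gpos[OF that] by simp
  have Z: "0 < Z"
  proof -
    have "continuous_on {-K..K} w" unfolding w_def by (intro continuous_intros) auto
    then have "integral {-K..K} (\<lambda>x. exp (- K\<^sup>2 / 2)) \<le> Z" unfolding Z_def
    proof (intro integral_le integrable_continuous_real)
      fix x assume "x \<in> {-K..K}"
      then have "x\<^sup>2 \<le> K\<^sup>2" by (intro abs_le_square_iff[THEN iffD1]) auto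
      then show "exp (- K\<^sup>2 / 2) \<le> w x" by (simp add: w_def)
    qed auto
    moreover have "0 < integral {-K..K} (\<lambda>x. exp (- K\<^sup>2 / 2))" using K by simp
    ultimately show ?thesis by linarith
  qed
  have m_eq: "(\<integral>x. g x \<partial>P) = m / Z" unfolding m_def by (rule rep(2)[OF g b1])
  have m: "0 < m"
  proof -
    have "integral {-K..K} (\<lambda>x. e * w x) \<le> m" unfolding m_def
    proof (rule integral_le)
      show "(\<lambda>x. e * w x) integrable_on {-K..K}" by (rule rep(1)[where h="\<lambda>_. e" and D=e]) (use e in auto)
      show "(\<lambda>x. g x * w x) integrable_on {-K..K}" by (rule rep(1)[OF g b1])
      fix x assume "x \<in> {-K..K}"
      then show "e * w x \<le> g x * w x" using gb[of x] by (intro mult_right_mono) (auto simp: w_def)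
    qed
    then show ?thesis using e Z by (simp add: Z_def[symmetric])  (metis less_le_trans mult_pos_pos)
  qed
  have "(\<lambda>x. ((g' x)\<^sup>2 / g x) * w x) integrable_on {-K..K}" by (rule rep(1)[OF _ b3]) auto
  then have "integral {-K..K} (\<lambda>x. g x * w x * ln (Z / m * g x)) \<le> integral {-K..K} (\<lambda>x. w x * (g' x)\<^sup>2 / g x) / 2"
    by (intro log_Sobolev_interval[OF K w_def cg gpos S dg _ Z_def m_def]) (simp_all add: mult.commute)
  also have "integral {-K..K} (\<lambda>x. w x * (g' x)\<^sup>2 / g x) = Z * (\<integral>x. (g' x)\<^sup>2 / g x \<partial>P)"
    using rep(2)[OF _ b3] Z by (simp add: mult.commute)
  also have "integral {-K..K} (\<lambda>x. g x * w x * ln (Z / m * g x))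
      = integral {-K..K} (\<lambda>x. (g x * ln (g x)) * w x - ln (m / Z) * (g x * w x))"
  proof (rule integral_cong)
    fix x assume "x \<in> {-K..K}"
    then have "ln (Z / m * g x) = ln (g x) - ln (m / Z)" using gpos[of x] Z m by (simp add: ln_mult ln_div)
    then show "g x * w x * ln (Z / m * g x) = (g x * ln (g x)) * w x - ln (m / Z) * (g x * w x)"
      by (simp only:) (simp add: algebra_simps)
  qed
  also have "\<dots> = integral {-K..K} (\<lambda>x. (g x * ln (g x)) * w x) - integral {-K..K} (\<lambda>x. ln (m / Z) * (g x * w x))"
    by (intro integral_diff rep(1)[OF _ b2] integrable_on_mult_right[OF rep(1)[OF g b1]]) auto
  also have "\<dots> = Z * (\<integral>x. g x * ln (g x) \<partial>P) - ln (m / Z) * m"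
    using rep(2)[OF _ b2] Z by (simp add: m_def)
  also have "\<dots> = Z * ent P g" unfolding ent_def m_eq using Z by (simp add: algebra_simps)
  finally have "Z * ent P g \<le> Z * ((\<integral>x. (g' x)\<^sup>2 / g x \<partial>P) / 2)" by simp
  then show ?thesis using Z unfolding P_def[symmetric] by (simp only: mult_le_cancel_left_pos)
qed

text \<open>Redrawing one coordinate independently leaves a product measure invariant. It turns the
  integrals along coordinate lines produced by tensorisation back into integrals over the
  cube.\<close>

lemma integral_PiM_resample:
  fixes P :: "'b measure" and h :: "('a \<Rightarrow> 'b) \<Rightarrow> real"
  assumes P: "prob_space P" and I: "finite I" and i: "i \<in> I"
    and h[measurable]: "h \<in> borel_measurable (Pi\<^sub>M I (\<lambda>_. P))" and B: "\<And>x. x \<in> space (Pi\<^sub>M I (\<lambda>_. P)) \<Longrightarrow> \<bar>h x\<bar> \<le> B"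
  shows "(\<integral>x. (\<integral>t. h (x(i := t)) \<partial>P) \<partial>Pi\<^sub>M I (\<lambda>_. P)) = (\<integral>x. h x \<partial>Pi\<^sub>M I (\<lambda>_. P))"
    and "(\<lambda>x. \<integral>t. h (x(i := t)) \<partial>P) \<in> borel_measurable (Pi\<^sub>M I (\<lambda>_. P))"
    and "\<And>x. x \<in> space (Pi\<^sub>M I (\<lambda>_. P)) \<Longrightarrow> \<bar>\<integral>t. h (x(i := t)) \<partial>P\<bar> \<le> B"
proof -
  interpret P: prob_space P by fact
  interpret pp: product_prob_space "\<lambda>_::'a. P" by (intro product_prob_spaceI P)
  have PI: "prob_space (Pi\<^sub>M I (\<lambda>_. P))" by (intro prob_space_PiM P)
  define J where "J = I - {i}"
  have J: "I = insert i J" "finite J" "i \<notin> J" using I i by (auto simp: J_def)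
  define k where "k x = (\<integral>t. h (x(i := t)) \<partial>P)" for x
  have upd: "x(i := t) \<in> space (Pi\<^sub>M I (\<lambda>_. P))" if "x \<in> space (Pi\<^sub>M I (\<lambda>_. P))" "t \<in> space P" for x t
    using measurable_space[OF measurable_fun_upd_pair[OF i, of "\<lambda>_. P"], of "(x, t)"] that by (simp add: space_pair_measure)
  have kb: "\<bar>k x\<bar> \<le> B" if x: "x \<in> space (Pi\<^sub>M I (\<lambda>_. P))" for x
    unfolding k_def
  proof (rule P.expectation_abs_bound(2))
    have "(\<lambda>t. (x, t)) \<in> measurable P (Pi\<^sub>M I (\<lambda>_. P) \<Otimes>\<^sub>M P)" using x by simp
    from measurable_compose[OF measurable_compose[OF this measurable_fun_upd_pair[OF i, of "\<lambda>_. P"]] h]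
    show "(\<lambda>t. h (x(i := t))) \<in> borel_measurable P" by simp
    show "\<bar>h (x(i := t))\<bar> \<le> B" if "t \<in> space P" for t using B[OF upd[OF x that]] .
  qed
  have km[measurable]: "k \<in> borel_measurable (Pi\<^sub>M I (\<lambda>_. P))"
  proof -
    have "(\<lambda>(x, t). h (x(i := t))) \<in> borel_measurable (Pi\<^sub>M I (\<lambda>_. P) \<Otimes>\<^sub>M P)"
      using measurable_compose[OF measurable_fun_upd_pair[OF i, of "\<lambda>_. P"] h] by (simp add: case_prod_beta')
    from P.borel_measurable_lebesgue_integral[OF this] show ?thesis unfolding k_def .
  qed
  have ki: "integrable (Pi\<^sub>M (insert i J) (\<lambda>_. P)) k"
    using prob_space.expectation_abs_bound(1)[OF PI km kb] unfolding J(1) .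
  have hi: "integrable (Pi\<^sub>M (insert i J) (\<lambda>_. P)) h"
    using prob_space.expectation_abs_bound(1)[OF PI h B] unfolding J(1) .
  have kk: "(\<integral>y. k (x(i := y)) \<partial>P) = (\<integral>t. h (x(i := t)) \<partial>P)" for x
    by (simp add: k_def P.prob_space)
  have "(\<integral>x. k x \<partial>Pi\<^sub>M (insert i J) (\<lambda>_. P)) = (\<integral>x. h x \<partial>Pi\<^sub>M (insert i J) (\<lambda>_. P))"
    unfolding pp.product_integral_insert[OF J(2,3) ki] pp.product_integral_insert[OF J(2,3) hi] kk ..
  then show "(\<integral>x. (\<integral>t. h (x(i := t)) \<partial>P) \<partial>Pi\<^sub>M I (\<lambda>_. P)) = (\<integral>x. h x \<partial>Pi\<^sub>M I (\<lambda>_. P))"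
    unfolding k_def J(1) .
  show "(\<lambda>x. \<integral>t. h (x(i := t)) \<partial>P) \<in> borel_measurable (Pi\<^sub>M I (\<lambda>_. P))"
    and "\<And>x. x \<in> space (Pi\<^sub>M I (\<lambda>_. P)) \<Longrightarrow> \<bar>\<integral>t. h (x(i := t)) \<partial>P\<bar> \<le> B"
    using km kb unfolding k_def by blast+
qed

section \<open>The Gaussian measure conditioned on a cube\<close>

definition cube :: "nat \<Rightarrow> real \<Rightarrow> (nat \<Rightarrow> real) set" where
  "cube n K = Pi\<^sub>E {..<n} (\<lambda>_. {-K..K})"

lemma cube_iff: "x \<in> cube n K \<longleftrightarrow> x \<in> Rn n \<and> (\<forall>i<n. \<bar>x i\<bar> \<le> K)"
  unfolding cube_def by (auto simp: PiE_iff abs_le_iff minus_le_iff)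

lemma cube_sets[measurable]: "cube n K \<in> sets (borel_Rn n)"
  unfolding cube_def by (rule sets_PiM_I_finite) auto

lemma measure_gauss_cube_pos:
  assumes "0 < K"
  shows "0 < measure (gauss n) (cube n K)"
proof -
  interpret p: product_prob_space "\<lambda>_::nat. std_gauss" by (intro product_prob_spaceI prob_std_gauss)
  interpret f: finite_product_prob_space "\<lambda>_::nat. std_gauss" "{..<n}" by standard simp
  have "measure (gauss n) (cube n K) = (\<Prod>i<n. measure std_gauss {-K..K})"
    unfolding gauss_def cube_def by (rule f.finite_measure_PiM_emb) auto
  also have "\<dots> > 0" by (intro prod_pos) (use std_gauss_interval_pos[OF assms] in auto)
  finally show ?thesis .
qed

text \<open>Conditioning a product measure on a box conditions each factor; hence tensorisation
  applies to the Gaussian on a cube.\<close>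

lemma PiM_uniform_std_gauss:
  assumes K: "0 < K"
  shows "Pi\<^sub>M {..<n} (\<lambda>_. uniform_measure std_gauss {-K..K}) = uniform_measure (gauss n) (cube n K)"
proof -
  interpret s: prob_space std_gauss by (rule prob_std_gauss)
  interpret g: prob_space "gauss n" by (rule prob_gauss)
  have q: "0 < measure std_gauss {-K..K}" by (rule std_gauss_interval_pos[OF K])
  have P: "prob_space (uniform_measure std_gauss {-K..K})"
    by (rule prob_space_uniform_measure) (use q in \<open>auto simp: s.emeasure_eq_measure\<close>)
  interpret p: product_prob_space "\<lambda>_::nat. uniform_measure std_gauss {-K..K}" by (intro product_prob_spaceI P)
  interpret gp: product_prob_space "\<lambda>_::nat. std_gauss" by (intro product_prob_spaceI prob_std_gauss)
  interpret f: finite_product_prob_space "\<lambda>_::nat. std_gauss" "{..<n}" by standard simp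
  have box: "measure (gauss n) (Pi\<^sub>E {..<n} A) = (\<Prod>i<n. measure std_gauss (A i))" if "\<And>i. i < n \<Longrightarrow> A i \<in> sets borel" for A
    unfolding gauss_def by (rule f.finite_measure_PiM_emb) (use that in auto)
  have "uniform_measure (gauss n) (cube n K) = Pi\<^sub>M {..<n} (\<lambda>_. uniform_measure std_gauss {-K..K})"
  proof (rule p.PiM_eqI)
    show "sets (uniform_measure (gauss n) (cube n K)) = sets (Pi\<^sub>M {..<n} (\<lambda>_. uniform_measure std_gauss {-K..K}))"
      by (simp add: sets_gauss) (rule sets_PiM_cong, auto)
    fix A assume "\<And>i. i \<in> {..<n} \<Longrightarrow> A i \<in> sets (uniform_measure std_gauss {-K..K})"
    then have A: "A i \<in> sets borel" if "i < n" for i using that by simp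
    have AE: "Pi\<^sub>E {..<n} A \<in> sets (borel_Rn n)" by (rule sets_PiM_I_finite) (use A in auto)
    have int: "cube n K \<inter> Pi\<^sub>E {..<n} A = Pi\<^sub>E {..<n} (\<lambda>i. {-K..K} \<inter> A i)"
      unfolding cube_def by (rule PiE_Int)
    have z: "0 < measure (gauss n) (cube n K)" by (rule measure_gauss_cube_pos[OF K])
    have "emeasure (uniform_measure (gauss n) (cube n K)) (Pi\<^sub>E {..<n} A)
        = ennreal (measure (gauss n) (cube n K \<inter> Pi\<^sub>E {..<n} A) / measure (gauss n) (cube n K))"
      using AE z by (subst emeasure_uniform_measure) (auto simp: g.emeasure_eq_measure divide_ennreal)
    also have "\<dots> = ennreal (\<Prod>i<n. measure std_gauss ({-K..K} \<inter> A i) / measure std_gauss {-K..K})"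
      unfolding int using A by (subst box, simp) (simp add: cube_def box prod_dividef)
    also have "\<dots> = (\<Prod>i<n. emeasure (uniform_measure std_gauss {-K..K}) (A i))"
    proof -
      have "emeasure (uniform_measure std_gauss {-K..K}) (A i) = ennreal (measure std_gauss ({-K..K} \<inter> A i) / measure std_gauss {-K..K})"
        if "i < n" for i
        using A[OF that] q by (subst emeasure_uniform_measure) (auto simp: s.emeasure_eq_measure divide_ennreal)
      then show ?thesis by (simp add: prod_ennreal)
    qed
    finally show "emeasure (uniform_measure (gauss n) (cube n K)) (Pi\<^sub>E {..<n} A)
        = (\<Prod>i\<in>{..<n}. emeasure (uniform_measure std_gauss {-K..K}) (A i))" .
  qed simp
  then show ?thesis by simp
qed

text \<open>Fatou's lemma in a form that delivers integrability of the limit together with the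
  limiting bound.\<close>

lemma Fatou_real:
  fixes u :: "nat \<Rightarrow> 'a \<Rightarrow> real" and v :: "'a \<Rightarrow> real"
  assumes i: "\<And>k. integrable M (u k)" and nn: "\<And>k x. x \<in> space M \<Longrightarrow> 0 \<le> u k x"
    and lim: "\<And>x. x \<in> space M \<Longrightarrow> (\<lambda>k. u k x) \<longlonglongrightarrow> v x"
    and le: "\<And>k. (\<integral>x. u k x \<partial>M) \<le> c k" and c: "c \<longlonglongrightarrow> c0"
  shows "integrable M v" and "(\<integral>x. v x \<partial>M) \<le> c0"
proof -
  have v[measurable]: "v \<in> borel_measurable M"
    by (rule borel_measurable_LIMSEQ_real[OF lim]) (use i in auto)
  have v0: "0 \<le> v x" if "x \<in> space M" for x
    by (rule LIMSEQ_le_const[OF lim[OF that]]) (use nn[OF that] in auto)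
  have ck: "0 \<le> c k" for k
  proof -
    have "0 \<le> (\<integral>x. u k x \<partial>M)" by (rule Bochner_Integration.integral_nonneg) (rule nn)
    then show ?thesis using le[of k] by linarith
  qed
  have c0: "0 \<le> c0" by (rule LIMSEQ_le_const[OF c]) (use ck in auto)
  have "(\<integral>\<^sup>+x. ennreal (v x) \<partial>M) = (\<integral>\<^sup>+x. liminf (\<lambda>k. ennreal (u k x)) \<partial>M)"
  proof (rule nn_integral_cong)
    fix x assume x: "x \<in> space M"
    show "ennreal (v x) = liminf (\<lambda>k. ennreal (u k x))"
      using lim_imp_Liminf[OF _ tendsto_ennrealI[OF lim[OF x]]] by simp
  qed
  also have "\<dots> \<le> liminf (\<lambda>k. \<integral>\<^sup>+x. ennreal (u k x) \<partial>M)"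
    by (rule nn_integral_liminf) (use i in auto)
  also have "\<dots> \<le> liminf (\<lambda>k. ennreal (c k))"
  proof (intro Liminf_mono always_eventually allI)
    fix k
    have "(\<integral>\<^sup>+x. ennreal (u k x) \<partial>M) = ennreal (\<integral>x. u k x \<partial>M)"
      by (rule nn_integral_eq_integral[OF i]) (use nn in auto)
    then show "(\<integral>\<^sup>+x. ennreal (u k x) \<partial>M) \<le> ennreal (c k)" using le[of k] by (simp add: ennreal_leI)
  qed
  also have "\<dots> = ennreal c0" using lim_imp_Liminf[OF _ tendsto_ennrealI[OF c]] by simp
  finally have *: "(\<integral>\<^sup>+x. ennreal (v x) \<partial>M) \<le> ennreal c0" .
  show iv: "integrable M v"
    by (rule integrableI_nonneg[OF v]) (use v0 * in \<open>auto simp: le_less_trans\<close>)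
  have "ennreal (\<integral>x. v x \<partial>M) \<le> ennreal c0"
    using * nn_integral_eq_integral[OF iv] v0 by simp
  then show "(\<integral>x. v x \<partial>M) \<le> c0" using c0 by (simp add: ennreal_le_iff)
qed

lemma cube_Int_Rn: "cube n K \<inter> Rn n = cube n K"
  unfolding cube_def by (intro Int_absorb2 PiE_mono) simp

lemma eventually_in_cube:
  fixes x :: "nat \<Rightarrow> real" and K :: "nat \<Rightarrow> real"
  assumes x: "x \<in> Rn n" and K: "\<And>k. real k \<le> K k"
  shows "eventually (\<lambda>k. x \<in> cube n (K k)) sequentially"
proof -
  obtain N :: nat where N: "(\<Sum>i<n. \<bar>x i\<bar>) \<le> N" using real_arch_simple by blast
  have "x \<in> cube n (K k)" if "N \<le> k" for k
  proof -
    have "\<bar>x i\<bar> \<le> K k" if "i < n" for i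
    proof -
      have "\<bar>x i\<bar> \<le> (\<Sum>i<n. \<bar>x i\<bar>)" by (rule member_le_sum) (use that in auto)
      then show ?thesis using N K[of k] \<open>N \<le> k\<close> by linarith
    qed
    then show ?thesis using x by (simp add: cube_iff)
  qed
  then show ?thesis unfolding eventually_sequentially by blast
qed

lemma measure_gauss_cube_tendsto: "(\<lambda>k. measure (gauss n) (cube n (real k))) \<longlonglongrightarrow> 1"
proof -
  interpret g: prob_space "gauss n" by (rule prob_gauss)
  have "(\<lambda>k. measure (gauss n) (cube n (real k))) \<longlonglongrightarrow> measure (gauss n) (\<Union>k. cube n (real k))"
  proof (rule g.finite_Lim_measure_incseq)
    show "incseq (\<lambda>k. cube n (real k))"
      unfolding incseq_def cube_def by (intro allI impI PiE_mono) auto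
  qed auto
  moreover have "(\<Union>k. cube n (real k)) = Rn n"
  proof (intro equalityI subsetI)
    fix x :: "nat \<Rightarrow> real" assume x: "x \<in> Rn n"
    obtain k where "x \<in> cube n (real k)"
      using eventually_happens'[OF _ eventually_in_cube[OF x, of real]] by auto
    then show "x \<in> (\<Union>k. cube n (real k))" by blast
  qed (auto simp: cube_def)
  moreover have "measure (gauss n) (Rn n) = 1" using g.prob_space by simp
  ultimately show ?thesis by simp
qed

text \<open>Makes \<open>x ln x + 1\<close> nonnegative, as Fatou's lemma requires.\<close>

lemma mult_ln_ge: "- 1 \<le> x * ln (x::real)" if "0 < x"
proof -
  have "1 - 1 / x \<le> ln x" using ln_le_minus_one[of "1 / x"] that by (simp add: ln_div)
  then have "x * (1 - 1 / x) \<le> x * ln x" using that by (intro mult_left_mono) auto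
  then show ?thesis using that by (simp add: algebra_simps)
qed

section \<open>The log-Sobolev inequality on a cube for f composed with T\<close>

context radial_map
begin

definition F :: "(nat \<Rightarrow> real) \<Rightarrow> real" where "F x = (f (T x))\<^sup>2"

text \<open>Regularised square: adding e keeps the argument of the logarithm away from 0, and
  cutting off outside the cube makes the function bounded, while on the cube it is just
  \<open>e + F x\<close>.\<close>

definition G :: "real \<Rightarrow> real \<Rightarrow> (nat \<Rightarrow> real) \<Rightarrow> real" where
  "G e K x = e + indicator (cube n K) x * F x"

text \<open>The squared gradient of \<open>f\<close> evaluated at \<open>T x\<close>; once
  \<open>T\<close> is known to push the Gaussian to \<open>\<mu>\<close>, this is the Dirichlet
  energy of \<open>f\<close> under \<open>\<mu>\<close>.\<close>

definition energy :: real where "energy = (\<integral>x. (\<Sum>i<n. (p i x)\<^sup>2) \<partial>gauss n)"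

lemma F_nonneg: "0 \<le> F x" by (simp add: F_def)

lemma F_measurable[measurable]: "F \<in> borel_measurable (borel_Rn n)"
  unfolding F_def[abs_def] by (intro borel_measurable_power fT_measurable)

lemma G_measurable[measurable]: "G e K \<in> borel_measurable (borel_Rn n)"
  unfolding G_def[abs_def] by measurable

lemma G_ge: "e \<le> G e K x" using F_nonneg[of x] by (simp add: G_def indicator_def)

lemma F_bounded_on_cube: "\<exists>B. \<forall>x\<in>cube n K. F x \<le> B"
proof -
  obtain B where B: "0 \<le> B" "\<And>x. x \<in> Rn n \<Longrightarrow> (\<And>i. i < n \<Longrightarrow> \<bar>x i\<bar> \<le> K) \<Longrightarrow> \<bar>f (T x)\<bar> \<le> B"
    using bounded_on_cube[of K] by metis
  have "F x \<le> B\<^sup>2" if "x \<in> cube n K" for x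
  proof -
    have "\<bar>f (T x)\<bar> \<le> \<bar>B\<bar>" using B(2)[of x] B(1) that unfolding cube_iff by simp
    then show ?thesis unfolding F_def by (simp only: abs_le_square_iff)
  qed
  then show ?thesis by blast
qed

text \<open>On a coordinate line g is \<open>e + u^2\<close> with u the restriction of
  \<open>f\<close> composed with \<open>T\<close>, so
  \<open>g'^2 / g = 4 u^2 u'^2 / (e + u^2) <= 4 u'^2\<close>, uniformly in e. The factor 1/2 of the
  interval inequality leaves 2.\<close>

lemma ent_line_le:
  assumes K: "0 < K" and e: "0 < e" and x: "x \<in> cube n K" and i: "i < n"
    and B: "0 \<le> B" "\<And>x. x \<in> cube n K \<Longrightarrow> F x \<le> B" "\<And>x. x \<in> cube n K \<Longrightarrow> (D i x)\<^sup>2 \<le> B"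
  shows "ent (uniform_measure std_gauss {-K..K}) (\<lambda>t. G e K (x(i := t)))
    \<le> 2 * (\<integral>t. indicator (cube n K) (x(i := t)) * (D i (x(i := t)))\<^sup>2 \<partial>uniform_measure std_gauss {-K..K})"
proof -
  let ?P = "uniform_measure std_gauss {-K..K}"
  interpret s: prob_space std_gauss by (rule prob_std_gauss)
  have P: "prob_space ?P"
    by (rule prob_space_uniform_measure) (use std_gauss_interval_pos[OF K] in \<open>auto simp: s.emeasure_eq_measure\<close>)
  have xR: "x \<in> Rn n" using x by (simp add: cube_iff)
  have ux: "x(i := t) \<in> Rn n" for t using xR i by (auto simp: PiE_iff extensional_def)
  have uc: "x(i := t) \<in> cube n K" if "t \<in> {-K..K}" for t
    using x that ux unfolding cube_iff by (auto simp: abs_le_iff)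
  have um[measurable]: "(\<lambda>t. x(i := t)) \<in> measurable borel (borel_Rn n)"
  proof -
    have "(\<lambda>t. (x, t)) \<in> measurable borel (borel_Rn n \<Otimes>\<^sub>M borel)" using xR by (simp add: space_borel_Rn)
    from measurable_compose[OF this measurable_fun_upd_pair[of i "{..<n}" "\<lambda>_. borel"]] i show ?thesis by simp
  qed
  define g where "g t = G e K (x(i := t))" for t
  define g' where "g' t = 2 * f (T (x(i := t))) * D i (x(i := t))" for t
  have g_eq: "g t = e + (f (T (x(i := t))))\<^sup>2" if "t \<in> {-K..K}" for t
    using uc[OF that] by (simp add: g_def G_def F_def)
  have gm[measurable]: "g \<in> borel_measurable borel"
    unfolding g_def[abs_def] by (rule measurable_compose[OF um G_measurable])
  have dm[measurable]: "(\<lambda>t. D i (x(i := t))) \<in> borel_measurable borel"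
    by (rule measurable_compose[OF um D_measurable[OF i]])
  have fm[measurable]: "(\<lambda>t. f (T (x(i := t)))) \<in> borel_measurable borel"
    by (rule measurable_compose[OF um fT_measurable])
  have g'm[measurable]: "g' \<in> borel_measurable borel"
    unfolding g'_def[abs_def] by measurable
  have q: "(g' t)\<^sup>2 / g t \<le> 4 * (D i (x(i := t)))\<^sup>2" if t: "t \<in> {-K..K}" for t
  proof -
    have pos: "0 < e + (f (T (x(i := t))))\<^sup>2" using e by (simp add: add_pos_nonneg)
    have "(g' t)\<^sup>2 = (4 * (D i (x(i := t)))\<^sup>2) * (f (T (x(i := t))))\<^sup>2"
      by (simp add: g'_def power_mult_distrib)
    also have "\<dots> \<le> (4 * (D i (x(i := t)))\<^sup>2) * (e + (f (T (x(i := t))))\<^sup>2)"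
      by (rule mult_left_mono) (use e in auto)
    finally show ?thesis unfolding g_eq[OF t] using pos by (simp add: divide_le_eq)
  qed
  have "ent ?P g \<le> (\<integral>t. (g' t)\<^sup>2 / g t \<partial>?P) / 2"
  proof (rule ent_uniform_std_gauss_le[OF K gm g'm e])
    fix t assume t: "t \<in> {-K..K}"
    show "e \<le> g t \<and> g t \<le> e + B" unfolding g_eq[OF t] using B(2)[OF uc[OF t]] by (simp add: F_def)
    show "(g' t)\<^sup>2 / g t \<le> 4 * B" using q[OF t] B(3)[OF uc[OF t]] by linarith
  next
    have "continuous_on {-K..K} (\<lambda>t. e + (f (T (x(i := t))))\<^sup>2)"
      by (intro continuous_intros continuous_at_imp_continuous_on ballI fT_isCont xR i)
    then show "continuous_on {-K..K} g" by (rule continuous_on_cong[THEN iffD2, rotated 2]) (auto simp: g_eq)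
  next
    \<comment> \<open>A line parallel to axis i can meet the origin only at t = 0, so a single
      exceptional point suffices.\<close>
    fix t assume t: "t \<in> {-K<..<K} - {0}"
    have N: "norm_Rn n (x(i := t)) \<noteq> 0" using t i unfolding norm_Rn_eq_0_iff by auto
    have d: "((\<lambda>s. f (T (x(i := s)))) has_real_derivative D i (x(i := t))) (at t)"
      using D_deriv[OF ux i N] by simp
    have "((\<lambda>s. e + (f (T (x(i := s))))\<^sup>2) has_real_derivative g' t) (at t)"
      unfolding g'_def by (rule derivative_eq_intros d refl)+ simp
    then show "(g has_real_derivative g' t) (at t)"
      by (rule has_field_derivative_transform_within_open[of _ _ _ "{-K<..<K}"]) (use t g_eq in auto)
  qed simp
  also have "(\<integral>t. (g' t)\<^sup>2 / g t \<partial>?P) \<le> (\<integral>t. 4 * (indicator (cube n K) (x(i := t)) * (D i (x(i := t)))\<^sup>2) \<partial>?P)"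
  proof (rule integral_mono_AE')
    show "integrable ?P (\<lambda>t. 4 * (indicator (cube n K) (x(i := t)) * (D i (x(i := t)))\<^sup>2))"
    proof (rule prob_space.expectation_abs_bound(1)[OF P, where b = "4 * B"])
      have "(\<lambda>t. indicator (cube n K) (x(i := t)) :: real) \<in> borel_measurable borel"
        by (rule measurable_compose[OF um borel_measurable_indicator]) simp
      then show "(\<lambda>t. 4 * (indicator (cube n K) (x(i := t)) * (D i (x(i := t)))\<^sup>2)) \<in> borel_measurable ?P"
        by simp
      show "\<bar>4 * (indicator (cube n K) (x(i := t)) * (D i (x(i := t)))\<^sup>2)\<bar> \<le> 4 * B" for t
        using B(1) B(3)[of "x(i := t)"] by (auto simp: indicator_def)
    qed
    show "AE t in ?P. (g' t)\<^sup>2 / g t \<le> 4 * (indicator (cube n K) (x(i := t)) * (D i (x(i := t)))\<^sup>2)"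
      by (rule AE_uniform_measureI) (use q uc in auto)
  qed simp
  finally show ?thesis unfolding g_def[symmetric] by simp
qed

text \<open>Tensorisation reduces to coordinate lines, resampling recombines the line integrals, and
  \<open>D_sq_le\<close> bounds the sum of the squared derivatives. Multiplying by the mass of the
  cube undoes the conditioning and gives a bound that depends on neither K nor e.\<close>

theorem ent_cube_le:
  assumes K: "0 < K" and e: "0 < e" and E: "integrable (gauss n) (\<lambda>x. \<Sum>i<n. (p i x)\<^sup>2)"
  shows "measure (gauss n) (cube n K) * ent (uniform_measure (gauss n) (cube n K)) (G e K) \<le> 2 * L\<^sup>2 * energy"
proof -
  let ?P = "uniform_measure std_gauss {-K..K}" and ?z = "measure (gauss n) (cube n K)"
  let ?\<pi> = "Pi\<^sub>M {..<n} (\<lambda>_. uniform_measure std_gauss {-K..K})"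
  interpret s: prob_space std_gauss by (rule prob_std_gauss)
  interpret g: prob_space "gauss n" by (rule prob_gauss)
  have z: "0 < ?z" by (rule measure_gauss_cube_pos[OF K])
  have P: "prob_space ?P"
    by (rule prob_space_uniform_measure) (use std_gauss_interval_pos[OF K] in \<open>auto simp: s.emeasure_eq_measure\<close>)
  have \<pi>: "?\<pi> = uniform_measure (gauss n) (cube n K)" by (rule PiM_uniform_std_gauss[OF K])
  have sets: "sets ?\<pi> = sets (borel_Rn n)" by (rule sets_PiM_cong) auto
  have mg: "borel_measurable ?\<pi> = borel_measurable (borel_Rn n)" "borel_measurable (gauss n) = borel_measurable (borel_Rn n)"
    by (rule measurable_cong_sets; simp only: sets sets_gauss)+
  have p\<pi>: "prob_space ?\<pi>" by (intro prob_space_PiM P)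
  obtain B0 where B0: "0 \<le> B0"
    "\<And>x. x \<in> Rn n \<Longrightarrow> (\<And>i. i < n \<Longrightarrow> \<bar>x i\<bar> \<le> K) \<Longrightarrow> \<bar>f (T x)\<bar> \<le> B0"
    "\<And>x i. x \<in> Rn n \<Longrightarrow> (\<And>i. i < n \<Longrightarrow> \<bar>x i\<bar> \<le> K) \<Longrightarrow> i < n \<Longrightarrow> \<bar>D i x\<bar> \<le> B0"
    using bounded_on_cube[of K] by metis
  define B where "B = B0\<^sup>2"
  have B: "0 \<le> B" by (simp add: B_def)
  have FB: "F x \<le> B" if "x \<in> cube n K" for x
  proof -
    have "\<bar>f (T x)\<bar> \<le> \<bar>B0\<bar>" using B0(2)[of x] B0(1) that unfolding cube_iff by simp
    then show ?thesis unfolding F_def B_def by (simp only: abs_le_square_iff)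
  qed
  have DB: "(D i x)\<^sup>2 \<le> B" if "x \<in> cube n K" "i < n" for x i
  proof -
    have "\<bar>D i x\<bar> \<le> \<bar>B0\<bar>" using B0(3)[of x i] B0(1) that unfolding cube_iff by simp
    then show ?thesis unfolding B_def by (simp only: abs_le_square_iff)
  qed
  define d where "d i x = indicator (cube n K) x * (D i x)\<^sup>2" for i x
  have dm: "d i \<in> borel_measurable (borel_Rn n)" if "i < n" for i
    unfolding d_def[abs_def] by (intro borel_measurable_times borel_measurable_indicator cube_sets borel_measurable_power D_measurable that)
  have db: "\<bar>d i x\<bar> \<le> B" if "i < n" for i x
    using DB[of x i] that B by (auto simp: d_def indicator_def)
  have d0: "0 \<le> d i x" for i x by (simp add: d_def)
  have line: "(\<integral>x. ent ?P (\<lambda>t. G e K (x(i := t))) \<partial>?\<pi>) \<le> 2 * (\<integral>x. d i x \<partial>?\<pi>)" if i: "i < n" for i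
  proof -
    have i': "i \<in> {..<n}" using i by simp
    have dm': "d i \<in> borel_measurable ?\<pi>" unfolding mg by (rule dm[OF i])
    note re = integral_PiM_resample[OF P finite_lessThan i' dm' db[OF i]]
    have "(\<integral>x. ent ?P (\<lambda>t. G e K (x(i := t))) \<partial>?\<pi>) \<le> (\<integral>x. 2 * (\<integral>t. d i (x(i := t)) \<partial>?P) \<partial>?\<pi>)"
    proof (rule integral_mono_AE')
      show "integrable ?\<pi> (\<lambda>x. 2 * (\<integral>t. d i (x(i := t)) \<partial>?P))"
        by (intro integrable_mult_right prob_space.expectation_abs_bound(1)[OF p\<pi> re(2,3)])
      show "AE x in ?\<pi>. ent ?P (\<lambda>t. G e K (x(i := t))) \<le> 2 * (\<integral>t. d i (x(i := t)) \<partial>?P)"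
        unfolding \<pi> d_def
        by (rule AE_uniform_measureI) (use ent_line_le[OF K e _ i B FB DB[OF _ i]] in auto)
    qed (auto intro!: AE_I2 Bochner_Integration.integral_nonneg d0)
    also have "\<dots> = 2 * (\<integral>x. d i x \<partial>?\<pi>)" using re(1) by simp
    finally show ?thesis .
  qed
  have "ent ?\<pi> (G e K) \<le> (\<Sum>i<n. \<integral>x. ent ?P (\<lambda>t. G e K (x(i := t))) \<partial>?\<pi>)"
  proof (rule ent_PiM_le[OF P _ e])
    show "G e K \<in> borel_measurable ?\<pi>" unfolding mg by (rule G_measurable)
    show "e \<le> G e K x \<and> G e K x \<le> e + B" for x
      using G_ge[of e K x] FB[of x] B by (auto simp: G_def indicator_def)
  qed simp
  also have "\<dots> \<le> (\<Sum>i<n. 2 * (\<integral>x. d i x \<partial>?\<pi>))" by (intro sum_mono line) simp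
  also have "\<dots> = (\<Sum>i<n. 2 * ((\<integral>x. d i x \<partial>gauss n) / ?z))"
  proof (intro sum.cong refl)
    fix i assume "i \<in> {..<n}"
    then have "d i \<in> borel_measurable (gauss n)" unfolding mg using dm by simp
    then have "(\<integral>x. d i x \<partial>?\<pi>) = (\<integral>x. indicator (cube n K) x * d i x \<partial>gauss n) / ?z"
      unfolding \<pi> by (intro integral_uniform_measure[OF prob_gauss _ z]) auto
    also have "(\<lambda>x. indicator (cube n K) x * d i x) = d i" by (auto simp: d_def indicator_def)
    finally show "2 * (\<integral>x. d i x \<partial>?\<pi>) = 2 * ((\<integral>x. d i x \<partial>gauss n) / ?z)" by simp
  qed
  also have "\<dots> = 2 / ?z * (\<Sum>i<n. \<integral>x. d i x \<partial>gauss n)" by (simp add: sum_distrib_left sum_divide_distrib)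
  also have "(\<Sum>i<n. \<integral>x. d i x \<partial>gauss n) = (\<integral>x. (\<Sum>i<n. d i x) \<partial>gauss n)"
  proof (rule Bochner_Integration.integral_sum[symmetric])
    fix i assume "i \<in> {..<n}"
    then have i: "i < n" by simp
    show "integrable (gauss n) (d i)"
      by (rule g.expectation_abs_bound(1)[OF _ db[OF i]]) (unfold mg, rule dm[OF i])
  qed
  also have "2 / ?z * (\<integral>x. (\<Sum>i<n. d i x) \<partial>gauss n) \<le> 2 / ?z * (L\<^sup>2 * energy)"
  proof (rule mult_left_mono)
    have le: "(\<Sum>i<n. d i x) \<le> L\<^sup>2 * (\<Sum>i<n. (p i x)\<^sup>2)" for x
    proof -
      have "(\<Sum>i<n. d i x) \<le> (\<Sum>i<n. (D i x)\<^sup>2)" by (intro sum_mono) (simp add: d_def indicator_def)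
      also have "\<dots> \<le> L\<^sup>2 * (\<Sum>i<n. (p i x)\<^sup>2)" by (rule D_sq_le)
      finally show ?thesis .
    qed
    have "(\<integral>x. (\<Sum>i<n. d i x) \<partial>gauss n) \<le> (\<integral>x. L\<^sup>2 * (\<Sum>i<n. (p i x)\<^sup>2) \<partial>gauss n)"
      by (intro integral_mono_AE' AE_I2 integrable_mult_right E le mult_nonneg_nonneg sum_nonneg zero_le_power2)
    then show "(\<integral>x. (\<Sum>i<n. d i x) \<partial>gauss n) \<le> L\<^sup>2 * energy" by (simp add: energy_def)
  qed (use z in simp)
  finally have "ent ?\<pi> (G e K) \<le> 2 / ?z * (L\<^sup>2 * energy)" .
  then show ?thesis using z unfolding \<pi>[symmetric] by (simp add: pos_le_divide_eq mult_ac)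
qed

end

section \<open>Passage from cubes to the whole space\<close>

context radial_map
begin

text \<open>Testing the entropy on a large cube against a function with small values where \<open>F\<close> is under control shows
  that a finite energy forces \<open>F\<close> to be integrable.\<close>
lemma F_integrable:
  assumes E: "integrable (gauss n) (\<lambda>x. \<Sum>i<n. (p i x)\<^sup>2)"
  shows "integrable (gauss n) F"
proof -
  interpret g: prob_space "gauss n" by (rule prob_gauss)
  have mg: "borel_measurable (gauss n) = borel_measurable (borel_Rn n)"
    by (rule measurable_cong_sets) (simp_all only: sets_gauss)
  \<comment> \<open>A fixed cube of mass above 2/3 is singled out, on which \<open>F\<close> is
    bounded; the value 2/3 is what keeps the mean of the test function below 1.\<close>
  have "eventually (\<lambda>k. 2 / 3 < measure (gauss n) (cube n (real k))) sequentially"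
    using order_tendstoD(1)[OF measure_gauss_cube_tendsto, of "2 / 3"] by simp
  then obtain k0 where k0: "\<And>k. k0 \<le> k \<Longrightarrow> 2 / 3 < measure (gauss n) (cube n (real k))"
    unfolding eventually_sequentially by blast
  have k1: "2 / 3 < measure (gauss n) (cube n (real (Suc k0)))" by (rule k0) simp
  define C0 where "C0 = cube n (real (Suc k0))"
  define c0 where "c0 = measure (gauss n) C0"
  have c0: "2 / 3 < c0" using k1 by (simp add: c0_def C0_def)
  have C0[measurable]: "C0 \<in> sets (borel_Rn n)" by (simp add: C0_def)
  obtain b where b: "\<And>x. x \<in> C0 \<Longrightarrow> F x \<le> b" using F_bounded_on_cube[of "real (Suc k0)"] unfolding C0_def by blast
  define b1 where "b1 = 1 + \<bar>b\<bar>"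
  define M where "M = 2 * L\<^sup>2 * energy / ln 2 + 2 * b1"
  define C where "C k = cube n (real (Suc k0 + k))" for k
  have C[measurable]: "C k \<in> sets (borel_Rn n)" for k by (simp add: C_def)
  have CR: "C k \<inter> Rn n = C k" "C0 \<inter> Rn n = C0" for k
    by (simp_all only: C_def C0_def cube_Int_Rn)
  have sub: "C0 \<subseteq> C k" for k
    unfolding C0_def C_def cube_def by (intro PiE_mono) auto
  have FC: "\<exists>B. \<forall>x. \<bar>indicator (C k) x * F x\<bar> \<le> B" for k
  proof -
    obtain B where B: "\<And>x. x \<in> C k \<Longrightarrow> F x \<le> B" using F_bounded_on_cube[of "real (Suc k0 + k)"] unfolding C_def by blast
    have "\<bar>indicator (C k) x * F x\<bar> \<le> \<bar>B\<bar>" for x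
      using B[of x] F_nonneg[of x] by (cases "x \<in> C k") auto
    then show ?thesis by blast
  qed
  have iF: "integrable (gauss n) (\<lambda>x. indicator (C k) x * F x)" for k
  proof -
    obtain B where B: "\<And>x. \<bar>indicator (C k) x * F x\<bar> \<le> B" using FC by blast
    show ?thesis by (rule g.expectation_abs_bound(1)[OF _ B]) (unfold mg, measurable)
  qed
  have bound: "(\<integral>x. indicator (C k) x * F x \<partial>gauss n) \<le> M" for k
  proof -
    define K where "K = real (Suc k0 + k)"
    have K: "0 < K" by (simp add: K_def)
    have CK: "C k = cube n K" by (simp add: C_def K_def)
    define z where "z = measure (gauss n) (C k)"
    have z: "0 < z" unfolding z_def CK by (rule measure_gauss_cube_pos[OF K])
    have z1: "z \<le> 1" by (simp add: z_def)
    define \<pi> where "\<pi> = uniform_measure (gauss n) (C k)"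
    have p\<pi>: "prob_space \<pi>"
      unfolding \<pi>_def by (rule prob_space_uniform_measure) (use z in \<open>auto simp: g.emeasure_eq_measure z_def\<close>)
    interpret q: prob_space \<pi> by (rule p\<pi>)
    have m\<pi>: "borel_measurable \<pi> = borel_measurable (borel_Rn n)"
      by (rule measurable_cong_sets) (simp_all add: \<pi>_def)
    have rep: "(\<integral>x. h x \<partial>\<pi>) = (\<integral>x. indicator (C k) x * h x \<partial>gauss n) / z"
      if "h \<in> borel_measurable (borel_Rn n)" for h
      unfolding \<pi>_def z_def by (rule integral_uniform_measure[OF prob_gauss]) (use that z in \<open>simp_all add: mg z_def\<close>)
    define H where "H = G 1 K"
    define \<kappa> where "\<kappa> x = (if x \<in> C0 then 1 / 2 else 2 :: real)" for x
    have H_eq: "H x = 1 + indicator (C k) x * F x" for x by (simp add: H_def G_def CK)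
    have Hm[measurable]: "H \<in> borel_measurable (borel_Rn n)" by (simp add: H_def)
    have km[measurable]: "\<kappa> \<in> borel_measurable (borel_Rn n)" unfolding \<kappa>_def[abs_def] by measurable
    have H1: "1 \<le> H x" for x unfolding H_def by (rule G_ge)
    obtain B where B: "\<And>x. \<bar>indicator (C k) x * F x\<bar> \<le> B" using FC by blast
    have HB: "H x \<le> 2 + \<bar>B\<bar>" for x using B[of x] unfolding H_eq by linarith
    have iH: "integrable \<pi> H" by (rule q.expectation_bounds(1)[OF _ H1 HB]) (unfold m\<pi>, measurable)
    have iH0: "integrable \<pi> (\<lambda>x. indicator C0 x * H x)"
    proof (rule q.expectation_abs_bound(1)[where b = "2 + \<bar>B\<bar>"])
      show "\<bar>indicator C0 x * H x\<bar> \<le> 2 + \<bar>B\<bar>" for x using HB[of x] H1[of x] by (auto simp: indicator_def)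
    qed (unfold m\<pi>, measurable)
    have \<kappa>_le: "(\<integral>x. \<kappa> x \<partial>\<pi>) \<le> 1"
    proof -
      have "(\<integral>x. \<kappa> x \<partial>\<pi>) = (\<integral>x. indicator (C k) x * \<kappa> x \<partial>gauss n) / z" by (rule rep[OF km])
      also have "(\<lambda>x. indicator (C k) x * \<kappa> x) = (\<lambda>x. 2 * indicator (C k) x - 3 / 2 * indicator C0 x)"
        using sub by (auto simp: \<kappa>_def indicator_def fun_eq_iff)
      also have "(\<integral>x. 2 * indicator (C k) x - 3 / 2 * indicator C0 x \<partial>gauss n) = 2 * z - 3 / 2 * c0"
        by (subst Bochner_Integration.integral_diff) (auto simp: z_def c0_def CR g.emeasure_eq_measure)
      also have "(2 * z - 3 / 2 * c0) / z \<le> 1" using z z1 c0 by (simp add: pos_divide_le_eq)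
      finally show ?thesis .
    qed
    have "1 / 2 \<le> (\<integral>x. \<kappa> x \<partial>\<pi>)"
      by (rule q.expectation_bounds(2)[where b = 2]) (unfold m\<pi>, auto simp: \<kappa>_def)
    then have "ln (\<integral>x. \<kappa> x \<partial>\<pi>) \<le> 0" using \<kappa>_le by simp
    moreover have H0: "1 \<le> (\<integral>x. H x \<partial>\<pi>)"
      by (rule q.expectation_bounds(2)[OF _ H1 HB]) (unfold m\<pi>, measurable)
    ultimately have "(\<integral>x. H x \<partial>\<pi>) * ln (\<integral>x. \<kappa> x \<partial>\<pi>) \<le> 0" by (intro mult_nonneg_nonpos) auto
    moreover have "(\<integral>x. H x * ln (\<kappa> x) \<partial>\<pi>) - (\<integral>x. H x \<partial>\<pi>) * ln (\<integral>x. \<kappa> x \<partial>\<pi>) \<le> ent \<pi> H"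
    proof (rule q.Gibbs_variational[where e = "1 / 2" and B = "2 + \<bar>B\<bar>"])
      show "1 / 2 \<le> H x" for x using H1[of x] by simp
    qed (unfold m\<pi>, auto simp: \<kappa>_def HB)
    ultimately have "(\<integral>x. H x * ln (\<kappa> x) \<partial>\<pi>) \<le> ent \<pi> H" by linarith
    \<comment> \<open>The integrand is \<open>- ln 2 * H\<close> on the fixed cube and
      \<open>ln 2 * H\<close> elsewhere. The full integral of \<open>H\<close> is therefore
      controlled by the entropy and by the integral over the fixed cube, where \<open>H\<close> is
      bounded.\<close>
    also have "(\<lambda>x. H x * ln (\<kappa> x)) = (\<lambda>x. ln 2 * H x - 2 * ln 2 * (indicator C0 x * H x))"
      by (auto simp: \<kappa>_def indicator_def fun_eq_iff ln_div)
    also have "(\<integral>x. ln 2 * H x - 2 * ln 2 * (indicator C0 x * H x) \<partial>\<pi>)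
        = ln 2 * (\<integral>x. H x \<partial>\<pi>) - 2 * ln 2 * (\<integral>x. indicator C0 x * H x \<partial>\<pi>)"
      using iH iH0 by (subst Bochner_Integration.integral_diff) auto
    finally have "z * (ln 2 * (\<integral>x. H x \<partial>\<pi>) - 2 * ln 2 * (\<integral>x. indicator C0 x * H x \<partial>\<pi>)) \<le> z * ent \<pi> H"
      using z by (intro mult_left_mono) auto
    also have "\<dots> \<le> 2 * L\<^sup>2 * energy"
      unfolding z_def \<pi>_def CK H_def by (rule ent_cube_le[OF K _ E]) simp
    finally have *: "ln 2 * (z * (\<integral>x. H x \<partial>\<pi>)) - 2 * ln 2 * (z * (\<integral>x. indicator C0 x * H x \<partial>\<pi>)) \<le> 2 * L\<^sup>2 * energy"
      by (simp add: algebra_simps)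
    have "z * (\<integral>x. indicator C0 x * H x \<partial>\<pi>) = (\<integral>x. indicator (C k) x * (indicator C0 x * H x) \<partial>gauss n)"
      using z by (subst rep) simp_all
    also have "\<dots> \<le> b1"
    proof (rule g.expectation_bounds(3)[where a = 0])
      fix x
      show "0 \<le> indicator (C k) x * (indicator C0 x * H x)" using H1[of x] by (simp add: indicator_def)
      show "indicator (C k) x * (indicator C0 x * H x) \<le> b1"
        using b[of x] sub by (auto simp: indicator_def H_eq b1_def)
    qed (unfold mg, measurable)
    finally have b1: "z * (\<integral>x. indicator C0 x * H x \<partial>\<pi>) \<le> b1" .
    have "(\<integral>x. indicator (C k) x * F x \<partial>gauss n) \<le> (\<integral>x. indicator (C k) x * H x \<partial>gauss n)"
    proof (rule integral_mono[OF iF])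
      show "integrable (gauss n) (\<lambda>x. indicator (C k) x * H x)"
      proof (rule g.expectation_abs_bound(1)[where b = "2 + \<bar>B\<bar>"])
        show "\<bar>indicator (C k) x * H x\<bar> \<le> 2 + \<bar>B\<bar>" for x using HB[of x] H1[of x] by (auto simp: indicator_def)
      qed (unfold mg, measurable)
      show "indicator (C k) x * F x \<le> indicator (C k) x * H x" for x by (simp add: H_eq indicator_def)
    qed
    also have "\<dots> = z * (\<integral>x. H x \<partial>\<pi>)" using z by (subst rep) simp_all
    also have "\<dots> \<le> M"
    proof -
      have l: "0 < ln (2::real)" by simp
      have "2 * ln 2 * (z * (\<integral>x. indicator C0 x * H x \<partial>\<pi>)) \<le> 2 * ln 2 * b1" using b1 l by (intro mult_left_mono) auto
      then have "ln 2 * (z * (\<integral>x. H x \<partial>\<pi>)) \<le> 2 * L\<^sup>2 * energy + 2 * ln 2 * b1" using * by linarith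
      also have "\<dots> = ln 2 * M" using l by (simp add: M_def distrib_left)
      finally have "ln 2 * (z * (\<integral>x. H x \<partial>\<pi>)) \<le> ln 2 * M" .
      then show ?thesis using l by (simp only: mult_le_cancel_left_pos)
    qed
    finally show ?thesis .
  qed
  show ?thesis
  proof (rule Fatou_real(1)[OF iF _ _ bound tendsto_const])
    show "0 \<le> indicator (C k) x * F x" for k x using F_nonneg[of x] by (simp add: indicator_def)
    fix x assume "x \<in> space (gauss n)"
    then have x: "x \<in> Rn n" by simp
    show "(\<lambda>k. indicator (C k) x * F x) \<longlonglongrightarrow> F x"
    proof (rule tendsto_eventually)
      have "eventually (\<lambda>k. x \<in> C k) sequentially" unfolding C_def by (rule eventually_in_cube[OF x]) simp
      then show "eventually (\<lambda>k. indicator (C k) x * F x = F x) sequentially" by eventually_elim simp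
    qed
  qed
qed

text \<open>The cubes grow while the regularisation e tends to 0. Fatou's lemma handles the
  \<open>x ln x\<close> term, whereas the means converge by dominated convergence thanks to
  \<open>F_integrable\<close>.\<close>

theorem ent_gauss_le:
  assumes E: "integrable (gauss n) (\<lambda>x. \<Sum>i<n. (p i x)\<^sup>2)"
  shows "integrable (gauss n) (\<lambda>x. F x * ln (F x))" and "ent (gauss n) F \<le> 2 * L\<^sup>2 * energy"
proof -
  interpret g: prob_space "gauss n" by (rule prob_gauss)
  have mg: "borel_measurable (gauss n) = borel_measurable (borel_Rn n)"
    by (rule measurable_cong_sets) (simp_all only: sets_gauss)
  define A where "A = 2 * L\<^sup>2 * energy"
  have A: "0 \<le> A" unfolding A_def energy_def
    by (intro mult_nonneg_nonneg Bochner_Integration.integral_nonneg sum_nonneg) auto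
  note iF = F_integrable[OF E]
  define m where "m = (\<integral>x. F x \<partial>gauss n)"
  have m0: "0 \<le> m" unfolding m_def by (rule Bochner_Integration.integral_nonneg) (rule F_nonneg)
  have "integrable (gauss n) (\<lambda>x. F x * ln (F x)) \<and> (\<integral>x. F x * ln (F x) \<partial>gauss n) \<le> A + m * ln m"
  \<comment> \<open>The limit of \<open>ln (mm / z)\<close> requires a positive mean; for mean zero,
    \<open>F\<close> vanishes almost everywhere and the claim is immediate.\<close>
  proof (cases "m = 0")
    case True
    then have "AE x in gauss n. F x = 0"
      using integral_nonneg_eq_0_iff_AE[OF iF] F_nonneg unfolding m_def by simp
    then have ae: "AE x in gauss n. F x * ln (F x) = 0" by eventually_elim simp
    have meas: "(\<lambda>x. F x * ln (F x)) \<in> borel_measurable (gauss n)" unfolding mg by measurable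
    have "integrable (gauss n) (\<lambda>x. F x * ln (F x))"
      using integrable_cong_AE[OF meas _ ae, of] by simp
    moreover have "(\<integral>x. F x * ln (F x) \<partial>gauss n) = 0"
      using integral_cong_AE[OF meas _ ae] by simp
    ultimately show ?thesis using A True by simp
  next
    case False
    then have m: "0 < m" using m0 by simp
    define C where "C k = cube n (real (Suc k))" for k
    define e where "e k = 1 / real (Suc k)" for k
    define z where "z k = measure (gauss n) (C k)" for k
    define g where "g k = G (e k) (real (Suc k))" for k
    define mm where "mm k = (\<integral>x. indicator (C k) x * g k x \<partial>gauss n)" for k
    \<comment> \<open>The summand 1 makes the integrand nonnegative; in the limit it contributes
      total mass 1 on both sides and cancels.\<close>
    define u where "u k x = indicator (C k) x * (g k x * ln (g k x) + 1)" for k x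
    define c where "c k = A + mm k * ln (mm k / z k) + z k" for k
    have C[measurable]: "C k \<in> sets (borel_Rn n)" for k by (simp add: C_def)
    have CR: "C k \<inter> Rn n = C k" for k by (simp only: C_def cube_Int_Rn)
    have e0: "0 < e k" for k by (simp add: e_def)
    have g_eq: "g k x = e k + indicator (C k) x * F x" for k x by (simp add: g_def G_def C_def)
    have gm[measurable]: "g k \<in> borel_measurable (borel_Rn n)" for k by (simp add: g_def)
    have ge: "e k \<le> g k x" for k x unfolding g_def by (rule G_ge)
    have z: "0 < z k" for k unfolding z_def C_def by (rule measure_gauss_cube_pos) simp
    have e_lim: "e \<longlonglongrightarrow> 0" unfolding e_def[abs_def] using lim_1_over_n by (rule LIMSEQ_Suc)
    have z_lim: "z \<longlonglongrightarrow> 1" unfolding z_def C_def by (rule LIMSEQ_Suc[OF measure_gauss_cube_tendsto])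
    have C_lim: "eventually (\<lambda>k. x \<in> C k) sequentially" if "x \<in> Rn n" for x
      unfolding C_def by (rule eventually_in_cube[OF that]) simp
    have iCF: "integrable (gauss n) (\<lambda>x. indicator (C k) x * F x)" for k
    proof (rule Bochner_Integration.integrable_bound[OF iF])
      show "AE x in gauss n. norm (indicator (C k) x * F x) \<le> norm (F x)" by (auto simp: indicator_def)
    qed (unfold mg, measurable)
    have mm_eq: "mm k = e k * z k + (\<integral>x. indicator (C k) x * F x \<partial>gauss n)" for k
    proof -
      have "(\<lambda>x. indicator (C k) x * g k x) = (\<lambda>x. e k * indicator (C k) x + indicator (C k) x * F x)"
        by (auto simp: g_eq indicator_def fun_eq_iff)
      then show ?thesis unfolding mm_def using iCF
        by (simp add: z_def CR g.emeasure_eq_measure)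
    qed
    have "(\<lambda>k. \<integral>x. indicator (C k) x * F x \<partial>gauss n) \<longlonglongrightarrow> m"
      unfolding m_def
    proof (rule integral_dominated_convergence[where w = F])
      show "AE x in gauss n. (\<lambda>k. indicator (C k) x * F x) \<longlonglongrightarrow> F x"
      proof (rule AE_I2)
        fix x assume "x \<in> space (gauss n)"
        then have "eventually (\<lambda>k. x \<in> C k) sequentially" by (intro C_lim) simp
        then have "eventually (\<lambda>k. indicator (C k) x * F x = F x) sequentially" by eventually_elim simp
        then show "(\<lambda>k. indicator (C k) x * F x) \<longlonglongrightarrow> F x" by (rule tendsto_eventually)
      qed
      show "AE x in gauss n. norm (indicator (C k) x * F x) \<le> F x" for k
        using F_nonneg by (auto simp: indicator_def)
    qed (use iF in \<open>unfold mg, measurable\<close>)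
    then have "(\<lambda>k. e k * z k + (\<integral>x. indicator (C k) x * F x \<partial>gauss n)) \<longlonglongrightarrow> 0 * 1 + m"
      by (intro tendsto_add tendsto_mult e_lim z_lim)
    then have mm_lim: "mm \<longlonglongrightarrow> m" by (simp add: mm_eq[abs_def])
    have "c \<longlonglongrightarrow> A + m * ln (m / 1) + 1" unfolding c_def[abs_def]
      by (intro tendsto_intros mm_lim z_lim) (use m in auto)
    then have c_lim: "c \<longlonglongrightarrow> A + m * ln m + 1" by simp
    have gB: "\<exists>B. \<forall>x. g k x \<le> B" for k
    proof -
      obtain B where B: "\<And>x. x \<in> C k \<Longrightarrow> F x \<le> B" using F_bounded_on_cube[of "real (Suc k)"] unfolding C_def by blast
      have "g k x \<le> e k + \<bar>B\<bar>" for x using B[of x] by (cases "x \<in> C k") (auto simp: g_eq)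
      then show ?thesis by blast
    qed
    have ij: "integrable (gauss n) (\<lambda>x. indicator (C k) x * (g k x * ln (g k x)))" for k
    proof -
      obtain B where B: "\<And>x. g k x \<le> B" using gB by blast
      show ?thesis
      proof (rule g.expectation_abs_bound(1)[where b = "B * (\<bar>ln (e k)\<bar> + \<bar>ln B\<bar>)"])
        fix x
        have "\<bar>g k x * ln (g k x)\<bar> \<le> B * (\<bar>ln (e k)\<bar> + \<bar>ln B\<bar>)" by (rule abs_x_ln_x_le[OF e0 ge B])
        then show "\<bar>indicator (C k) x * (g k x * ln (g k x))\<bar> \<le> B * (\<bar>ln (e k)\<bar> + \<bar>ln B\<bar>)"
          by (cases "x \<in> C k") auto
      qed (unfold mg, measurable)
    qed
    have u_eq: "u k = (\<lambda>x. indicator (C k) x * (g k x * ln (g k x)) + indicator (C k) x)" for k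
      by (auto simp: u_def indicator_def fun_eq_iff)
    have iu: "integrable (gauss n) (u k)" for k
      unfolding u_eq using ij[of k] by (simp add: g.emeasure_eq_measure)
    have u_le: "(\<integral>x. u k x \<partial>gauss n) \<le> c k" for k
    proof -
      define \<pi> where "\<pi> = uniform_measure (gauss n) (C k)"
      have rep: "(\<integral>x. h x \<partial>\<pi>) = (\<integral>x. indicator (C k) x * h x \<partial>gauss n) / z k"
        if "h \<in> borel_measurable (borel_Rn n)" for h
        unfolding \<pi>_def z_def by (rule integral_uniform_measure[OF prob_gauss]) (use that z[of k] in \<open>simp_all add: mg z_def\<close>)
      have "z k * ent \<pi> (g k) \<le> A"
        unfolding z_def \<pi>_def C_def g_def A_def by (rule ent_cube_le[OF _ e0 E]) simp
      also have "z k * ent \<pi> (g k) = (\<integral>x. indicator (C k) x * (g k x * ln (g k x)) \<partial>gauss n) - mm k * ln (mm k / z k)"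
        unfolding ent_def by (subst (1 2 3) rep) (use z[of k] in \<open>simp_all add: mm_def[symmetric] right_diff_distrib\<close>)
      finally show ?thesis unfolding u_eq c_def using ij[of k] by (simp add: g.emeasure_eq_measure z_def CR)
    qed
    have u_nonneg: "0 \<le> u k x" for k x
    proof -
      have "0 < g k x" using ge[of k x] e0[of k] by linarith
      from mult_ln_ge[OF this] show ?thesis by (simp add: u_def indicator_def)
    qed
    have u_lim: "(\<lambda>k. u k x) \<longlonglongrightarrow> F x * ln (F x) + 1" if "x \<in> space (gauss n)" for x
    proof -
      have ev: "eventually (\<lambda>k. x \<in> C k) sequentially" using that by (intro C_lim) simp
      have "(\<lambda>k. (e k + F x) * ln (e k + F x)) \<longlonglongrightarrow> F x * ln (F x)"
      proof (cases "F x = 0")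
        case True
        have "(\<lambda>k. - (ln (real (Suc k)) / real (Suc k))) \<longlonglongrightarrow> - 0"
          by (intro tendsto_minus LIMSEQ_Suc[OF lim_ln_over_n])
        then show ?thesis using True by (simp add: e_def ln_div)
      next
        case False
        have "(\<lambda>k. (e k + F x) * ln (e k + F x)) \<longlonglongrightarrow> (0 + F x) * ln (0 + F x)"
          by (intro tendsto_intros e_lim) (use False in simp)
        then show ?thesis by simp
      qed
      then have "(\<lambda>k. (e k + F x) * ln (e k + F x) + 1) \<longlonglongrightarrow> F x * ln (F x) + 1"
        by (rule tendsto_add[OF _ tendsto_const])
      moreover have "eventually (\<lambda>k. (e k + F x) * ln (e k + F x) + 1 = u k x) sequentially"
        using ev by eventually_elim (simp add: u_def g_eq)
      ultimately show ?thesis by (rule Lim_transform_eventually)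
    qed
    note fatou = Fatou_real[OF iu u_nonneg u_lim u_le c_lim]
    have i1: "integrable (gauss n) (\<lambda>x. F x * ln (F x))"
      using Bochner_Integration.integrable_diff[OF fatou(1) g.integrable_const[of 1]] by simp
    moreover have "measure (gauss n) (Rn n) = 1" using g.prob_space by simp
    ultimately show ?thesis using fatou(2) by simp
  qed
  then show "integrable (gauss n) (\<lambda>x. F x * ln (F x))" "ent (gauss n) F \<le> 2 * L\<^sup>2 * energy"
    unfolding ent_def m_def A_def by auto
qed

end

section \<open>The log-Sobolev inequality for a rotationally invariant log-concave measure\<close>

text \<open>Equality of levels decides whether \<open>\<phi> s <= r\<close>, by comparing the level
  of s with that of r. Up to a null set this event is the half-line ending at the point of D with
  the level of r, or is null or full when that level is 0 or 1.\<close>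

lemma radial_law_transport:
  assumes X: "radial_density n D v" and Y: "radial_density k E w"
    and \<phi>: "\<phi> \<in> borel_measurable borel"
    and cdf: "\<And>s. s \<in> D \<Longrightarrow> cdf (radial_density.law k E w) (\<phi> s) = cdf (radial_density.law n D v) s"
  shows "distr (radial_density.law n D v) borel \<phi> = radial_density.law k E w"
proof -
  interpret X: radial_density n D v by fact
  interpret Y: radial_density k E w by fact
  have \<phi>m[measurable]: "\<phi> \<in> borel_measurable X.law"
    using \<phi> by (simp only: measurable_cong_sets[OF X.sets_law refl])
  have D: "AE s in X.law. s \<in> D"
  proof -
    have m: "(\<lambda>x. ennreal (X.h x)) \<in> borel_measurable lborel" by simp
    show ?thesis unfolding X.law_def AE_density[OF m]
    proof (intro AE_I2 impI)
      fix x assume "0 < ennreal (X.h x)"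
      then show "x \<in> D" using X.h_0[of x] by (cases "x \<in> D") simp_all
    qed
  qed
  have ne: "AE s in X.law. s \<noteq> a" for a
    unfolding X.law_def by (subst AE_density) (use AE_lborel_singleton[of a] in auto)
  have eq: "measure X.law {s. \<phi> s \<le> r} = Y.F r" for r
  proof -
    have less: "\<phi> s \<le> r" if "s \<in> D" "X.F s < Y.F r" for s
    proof (rule ccontr)
      assume "\<not> \<phi> s \<le> r"
      then have "Y.F r \<le> Y.F (\<phi> s)" by (intro Y.F_mono) simp
      then show False using that cdf[OF that(1)] by simp
    qed
    have greater: "\<not> \<phi> s \<le> r" if "s \<in> D" "Y.F r < X.F s" for s
    proof
      assume "\<phi> s \<le> r"
      then have "Y.F (\<phi> s) \<le> Y.F r" by (rule Y.F_mono)
      then show False using that cdf[OF that(1)] by simp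
    qed
    have S[measurable]: "{s. \<phi> s \<le> r} \<in> sets X.law"
      using measurable_sets[OF \<phi>m, of "{..r}"] by (simp add: vimage_def)
    consider "Y.F r = 0" | "Y.F r = 1" | "0 < Y.F r" "Y.F r < 1"
      using Y.law.cdf_nonneg[of r] Y.law.cdf_bounded_prob[of r] by linarith
    then show ?thesis
    proof cases
      case 1
      have "AE s in X.law. s \<notin> {s. \<phi> s \<le> r}"
        using D by eventually_elim (use greater X.F_bounds(1) 1 in auto)
      then show ?thesis using 1 S by (simp add: AE_iff_measurable[OF S] X.law.emeasure_eq_measure)
    next
      case 2
      have "AE s in X.law. s \<in> {s. \<phi> s \<le> r}"
        using D by eventually_elim (use less X.F_bounds(2) 2 in auto)
      then show ?thesis using 2 X.law.prob_eq_1[OF S] by simp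
    next
      case 3
      obtain s0 where s0: "s0 \<in> D" "X.F s0 = Y.F r" using X.quantile[OF 3] by metis
      have "AE s in X.law. s \<in> {s. \<phi> s \<le> r} \<longleftrightarrow> s \<in> {..s0}"
        using D ne[of s0]
      proof eventually_elim
        case (elim s)
        consider "s < s0" | "s0 < s" using elim by linarith
        then show ?case
        proof cases
          case 1
          then show ?thesis using less[OF elim(1)] X.F_strict[OF elim(1) s0(1)] s0(2) by simp
        next
          case 2
          then show ?thesis using greater[OF elim(1)] X.F_strict[OF s0(1) elim(1)] s0(2) by simp
        qed
      qed
      then have "measure X.law {s. \<phi> s \<le> r} = measure X.law {..s0}"
        by (rule X.law.finite_measure_eq_AE) (use S in auto)
      then show ?thesis using s0(2) by (simp add: cdf_def)
    qed
  qed
  have "real_distribution (distr X.law borel \<phi>)" by (rule X.law.real_distribution_distr) simp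
  moreover have "cdf (distr X.law borel \<phi>) = Y.F"
    by (rule ext) (simp add: cdf_def measure_distr vimage_def eq[unfolded cdf_def])
  ultimately show ?thesis using cdf_unique[OF _ Y.law.real_distribution_axioms] Y.law.real_distribution_axioms
    by (metis cdf_unique)
qed

lemma ereal_expectation_eq_integral:
  assumes "integrable M g"
  shows "ereal_expectation M g = ereal (\<integral>x. g x \<partial>M)"
proof -
  have "(\<integral>\<^sup>+x. ennreal (g x) \<partial>M) \<noteq> \<infinity>" "(\<integral>\<^sup>+x. ennreal (- g x) \<partial>M) \<noteq> \<infinity>"
    using assms by (auto simp: real_integrable_def)
  then obtain a b where ab: "0 \<le> a" "0 \<le> b" "(\<integral>\<^sup>+x. ennreal (g x) \<partial>M) = ennreal a" "(\<integral>\<^sup>+x. ennreal (- g x) \<partial>M) = ennreal b"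
    by (metis ennreal_cases infinity_ennreal_def)
  then show ?thesis unfolding ereal_expectation_def real_lebesgue_integral_def[OF assms]
    by (simp add: enn2ereal_ennreal)
qed

lemma Ent_eq_ent:
  assumes "integrable M g" "\<And>x. 0 \<le> g x" "integrable M (\<lambda>x. g x * ln (g x))"
  shows "Ent M g = ereal (ent M g)"
proof -
  have "(\<integral>\<^sup>+x. ennreal (g x) \<partial>M) \<noteq> \<infinity>" using assms(1) by (simp add: real_integrable_def)
  then show ?thesis unfolding Ent_def ent_def by (simp add: ereal_expectation_eq_integral[OF assms(3)])
qed

lemma smooth_imp_C1:
  assumes "smooth_Rn n f"
  shows "C1_function n f"
proof -
  have "Ck_Rn n (Suc 0) f" using assms unfolding smooth_Rn_def by blast
  then show ?thesis by unfold_locales auto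
qed

context radial_log_concave
begin

text \<open>In polar coordinates \<open>T\<close> acts as \<phi> on the norm and as the identity on
  the direction, so independence makes it push the Gaussian to \<open>\<mu>\<close>. Entropy and
  energy are then transferred from \<open>ent_gauss_le\<close>; infinite energy makes the right-hand
  side infinite.\<close>

theorem log_Sobolev_mu:
  assumes t: "0 < t" and psi: "(\<integral>\<^sup>+x. ennreal (exp ((x 0)\<^sup>2 / t\<^sup>2)) \<partial>\<mu>) \<le> 2"
  shows "log_Sobolev n \<mu> (30720 * t)"
proof -
  let ?B = "borel \<Otimes>\<^sub>M borel_Rn n"
  let ?nu = "distr \<mu> borel (norm_Rn n)" and ?chi = "distr (gauss n) borel (norm_Rn n)"
    and ?s = "distr (gauss n) (borel_Rn n) (dir n)"
  interpret Ga: prob_space "gauss n" by (rule prob_gauss)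
  obtain D v where Dv: "radial_psi2 n D v t" "?nu = radial_density.law n D v"
    by (rule radial_psi2_mu[OF t psi])
  obtain c where c: "chi n c" "?chi = radial_density.law n {0<..} (\<lambda>s. s\<^sup>2 / 2 + c)"
    by (rule law_norm_gauss[OF n])
  obtain \<phi>1 \<phi>1' where \<phi>1: "\<And>s. 0 < s \<Longrightarrow> \<phi>1 s \<in> D"
    "\<And>s. 0 < s \<Longrightarrow> cdf (radial_density.law n D v) (\<phi>1 s) = cdf (radial_density.law n {0<..} (\<lambda>s. s\<^sup>2 / 2 + c)) s"
    "\<And>s. 0 < s \<Longrightarrow> (\<phi>1 has_real_derivative \<phi>1' s) (at s)"
    "continuous_on {0<..} \<phi>1'"
    "\<And>s. 0 < s \<Longrightarrow> 0 \<le> \<phi>1' s \<and> \<phi>1' s \<le> 30720 * t"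
    "\<And>s. 0 < s \<Longrightarrow> 0 < \<phi>1 s \<and> \<phi>1 s \<le> 30720 * t * s"
    by (rule radial_transport[OF c(1) Dv(1)]) blast
  \<comment> \<open>Extension by zero gives a Borel function on the whole line and fixes the value
    of \<open>T\<close> at the origin.\<close>
  define \<phi> where "\<phi> s = (if 0 < s then \<phi>1 s else 0)" for s
  define \<phi>' where "\<phi>' s = (if 0 < s then \<phi>1' s else 0)" for s
  have d: "(\<phi> has_real_derivative \<phi>' s) (at s)" if "0 < s" for s
  proof (rule has_field_derivative_transform_within_open[where S = "{0<..}"])
    show "(\<phi>1 has_real_derivative \<phi>' s) (at s)" using \<phi>1(3)[OF that] that by (simp add: \<phi>'_def)
  qed (use that in \<open>auto simp: \<phi>_def\<close>)
  have c': "continuous_on {0<..} \<phi>'"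
    using \<phi>1(4) by (rule continuous_on_cong[THEN iffD1, rotated 2]) (auto simp: \<phi>'_def)
  show ?thesis unfolding log_Sobolev_def
  proof (intro allI impI)
    fix f assume "smooth_Rn n f"
    then interpret C1_function n f by (rule smooth_imp_C1)
    interpret R: radial_map n f \<phi> \<phi>' "30720 * t"
      by unfold_locales (use n t \<phi>1(5,6) d c' in \<open>auto simp: \<phi>_def \<phi>'_def\<close>)
    have push: "distr (gauss n) (borel_Rn n) R.T = \<mu>"
    proof -
      have \<phi>_law: "distr ?chi borel \<phi> = ?nu" unfolding Dv(2) c(2)
      proof (rule radial_law_transport[OF _ _ R.\<phi>_measurable])
        show "radial_density n {0<..} (\<lambda>s. s\<^sup>2 / 2 + c)" using c(1) by (simp add: chi_def)
        show "radial_density n D v" using Dv(1) by (simp add: radial_psi2_def)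
        show "cdf (radial_density.law n D v) (\<phi> s) = cdf (radial_density.law n {0<..} (\<lambda>s. s\<^sup>2 / 2 + c)) s"
          if "s \<in> {0<..}" for s using \<phi>1(2) that by (simp add: \<phi>_def)
      qed
      have m1: "(\<lambda>(r, x). (\<phi> r, x)) \<in> measurable ?B ?B"
        unfolding case_prod_beta'
        by (intro measurable_Pair measurable_compose[OF measurable_fst R.\<phi>_measurable] measurable_snd)
      have "distr (gauss n) (borel_Rn n) R.T
          = distr (gauss n) (borel_Rn n) ((\<lambda>(r, x). smul n r x) \<circ> ((\<lambda>(r, x). (\<phi> r, x)) \<circ> polar n))"
        by (simp add: R.T_def[abs_def] polar_def o_def)
      also have "\<dots> = distr (distr (distr (gauss n) ?B (polar n)) ?B (\<lambda>(r, x). (\<phi> r, x))) (borel_Rn n) (\<lambda>(r, x). smul n r x)"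
      proof -
        have p: "polar n \<in> measurable (gauss n) ?B" by measurable
        show ?thesis by (simp only: distr_distr[OF m1 p] distr_distr[OF smul_measurable measurable_comp[OF p m1]])
      qed
      also have "distr (distr (gauss n) ?B (polar n)) ?B (\<lambda>(r, x). (\<phi> r, x)) = distr \<mu> ?B (polar n)"
      proof -
        interpret S: prob_space ?s by (rule Ga.prob_space_distr) simp
        have id: "distr ?s (borel_Rn n) (\<lambda>x. x) = ?s" by (rule distr_id2) simp
        have sf: "sigma_finite_measure (distr ?s (borel_Rn n) (\<lambda>x. x))" unfolding id by unfold_locales
        have "distr (?chi \<Otimes>\<^sub>M ?s) (borel \<Otimes>\<^sub>M borel_Rn n) (\<lambda>(r, x). (\<phi> r, x)) = distr ?chi borel \<phi> \<Otimes>\<^sub>M distr ?s (borel_Rn n) (\<lambda>x. x)"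
          by (rule pair_measure_distr[symmetric, OF _ _ sf]) (use R.\<phi>_measurable in \<open>auto simp: measurable_distr_eq1\<close>)
        also have "\<dots> = ?nu \<Otimes>\<^sub>M ?s" unfolding \<phi>_law id ..
        finally show ?thesis unfolding polar_gauss polar_mu .
      qed
      also have "distr (distr \<mu> ?B (polar n)) (borel_Rn n) (\<lambda>(r, x). smul n r x) = \<mu>"
        by (rule smul_polar[OF sets_mu, symmetric])
      finally show ?thesis .
    qed
    have Tm: "R.T \<in> measurable (gauss n) (borel_Rn n)"
      using R.T_measurable by (simp only: measurable_cong_sets[OF sets_gauss refl])
    have nn: "(\<integral>\<^sup>+x. h x \<partial>\<mu>) = (\<integral>\<^sup>+x. h (R.T x) \<partial>gauss n)" if "h \<in> borel_measurable (borel_Rn n)" for h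
      by (subst push[symmetric]) (rule nn_integral_distr[OF Tm], simp add: that)
    have pm: "partial_Rn i f \<in> borel_measurable (borel_Rn n)" if "i < n" for i
      by (rule continuous_map_borel_Rn[OF p_cont[OF that]])
    have fm[measurable]: "f \<in> borel_measurable (borel_Rn n)" by (rule continuous_map_borel_Rn[OF f_cont])
    have grad: "(norm_Rn n (grad_Rn n f x))\<^sup>2 = (\<Sum>i<n. (partial_Rn i f x)\<^sup>2)" for x
      unfolding norm_Rn_sq' by (intro sum.cong) (auto simp: grad_Rn_def)
    have "(\<lambda>x. \<Sum>i<n. (partial_Rn i f x)\<^sup>2) \<in> borel_measurable (borel_Rn n)"
      by (intro borel_measurable_sum borel_measurable_power pm) simp
    then have gm: "(\<lambda>x. ennreal (\<Sum>i<n. (partial_Rn i f x)\<^sup>2)) \<in> borel_measurable (borel_Rn n)" by measurable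
    define I where "I = (\<integral>\<^sup>+x. ennreal ((norm_Rn n (grad_Rn n f x))\<^sup>2) \<partial>\<mu>)"
    have I_eq: "I = (\<integral>\<^sup>+x. ennreal (\<Sum>i<n. (R.p i x)\<^sup>2) \<partial>gauss n)"
      unfolding I_def grad nn[OF gm] R.p_def ..
    show "Ent \<mu> (\<lambda>x. (f x)\<^sup>2) \<le> ereal (2 * (30720 * t)\<^sup>2) * enn2ereal (\<integral>\<^sup>+x. ennreal ((norm_Rn n (grad_Rn n f x))\<^sup>2) \<partial>\<mu>)"
      unfolding I_def[symmetric]
    proof (cases "I = \<infinity>")
      case True
      then show "Ent \<mu> (\<lambda>x. (f x)\<^sup>2) \<le> ereal (2 * (30720 * t)\<^sup>2) * enn2ereal I" using t by simp
    next
      case False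
      have sm: "(\<lambda>x. \<Sum>i<n. (R.p i x)\<^sup>2) \<in> borel_measurable (gauss n)"
        unfolding measurable_cong_sets[OF sets_gauss refl]
        by (intro borel_measurable_sum borel_measurable_power R.p_measurable) simp
      have E: "integrable (gauss n) (\<lambda>x. \<Sum>i<n. (R.p i x)\<^sup>2)"
        by (rule integrableI_nonneg[OF sm]) (use False I_eq in \<open>auto intro!: AE_I2 sum_nonneg simp: top.not_eq_extremum\<close>)
      have "I = ennreal R.energy" unfolding I_eq R.energy_def
        by (rule nn_integral_eq_integral[OF E]) (auto intro!: AE_I2 sum_nonneg)
      moreover have "0 \<le> R.energy" unfolding R.energy_def
        by (intro Bochner_Integration.integral_nonneg sum_nonneg) simp
      ultimately have I: "enn2ereal I = ereal R.energy" by (simp add: enn2ereal_ennreal)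
      have int: "integrable \<mu> h = integrable (gauss n) (\<lambda>x. h (R.T x))" "(\<integral>x. h x \<partial>\<mu>) = (\<integral>x. h (R.T x) \<partial>gauss n)"
        if "h \<in> borel_measurable (borel_Rn n)" for h :: "_ \<Rightarrow> real"
        by (subst push[symmetric], rule integrable_distr_eq[OF Tm that], subst push[symmetric], rule integral_distr[OF Tm that])
      have m1: "(\<lambda>x. (f x)\<^sup>2) \<in> borel_measurable (borel_Rn n)" "(\<lambda>x. (f x)\<^sup>2 * ln ((f x)\<^sup>2)) \<in> borel_measurable (borel_Rn n)"
        by measurable
      have "Ent \<mu> (\<lambda>x. (f x)\<^sup>2) = ereal (ent \<mu> (\<lambda>x. (f x)\<^sup>2))"
      proof (rule Ent_eq_ent)
        show "integrable \<mu> (\<lambda>x. (f x)\<^sup>2)" unfolding int(1)[OF m1(1)]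
          using R.F_integrable[OF E] by (simp add: R.F_def[abs_def])
        show "integrable \<mu> (\<lambda>x. (f x)\<^sup>2 * ln ((f x)\<^sup>2))" unfolding int(1)[OF m1(2)]
          using R.ent_gauss_le(1)[OF E] by (simp add: R.F_def[abs_def])
      qed simp
      also have "ent \<mu> (\<lambda>x. (f x)\<^sup>2) = ent (gauss n) R.F"
        unfolding ent_def int(2)[OF m1(1)] int(2)[OF m1(2)] R.F_def ..
      also have "ereal (ent (gauss n) R.F) \<le> ereal (2 * (30720 * t)\<^sup>2 * R.energy)"
        using R.ent_gauss_le(2)[OF E] by simp
      finally show "Ent \<mu> (\<lambda>x. (f x)\<^sup>2) \<le> ereal (2 * (30720 * t)\<^sup>2) * enn2ereal I" by (simp add: I)
    qed
  qed
qed

end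

theorem theorem8:
  shows "\<exists>C::real. C > 0 \<and>
    (\<forall>n::nat. n \<ge> 1 \<longrightarrow>
      (\<forall>\<mu>::(nat \<Rightarrow> real) measure.
        prob_measure_Rn n \<mu> \<longrightarrow> log_concave_Rn n \<mu> \<longrightarrow> rotation_invariant_Rn n \<mu> \<longrightarrow>
        rho_LS n \<mu> \<le> ereal C * psi2_norm \<mu> (\<lambda>x. inner_Rn n x (axis_Rn n 0))))"
proof (intro exI[of _ 30720] conjI allI impI)
  fix n :: nat and \<mu> :: "(nat \<Rightarrow> real) measure"
  assume n: "1 \<le> n" and p: "prob_measure_Rn n \<mu>" and l: "log_concave_Rn n \<mu>" and r: "rotation_invariant_Rn n \<mu>"
  obtain V where V: "convex_Rn n V" "V \<in> borel_measurable (lebesgue_Rn n)"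
    "\<forall>A\<in>sets (borel_Rn n). emeasure \<mu> A = (\<integral>\<^sup>+x\<in>A. exp_minus (V x) \<partial>lebesgue_Rn n)"
    using l unfolding log_concave_Rn_def by (elim exE conjE) (rule that)
  interpret radial_log_concave n \<mu> V
  proof (rule radial_log_concave.intro)
    show "sets \<mu> = sets (borel_Rn n)" "prob_space \<mu>" using p unfolding prob_measure_Rn_def by (rule conjunct1, rule conjunct2)
    show "emeasure \<mu> A = (\<integral>\<^sup>+x\<in>A. exp_minus (V x) \<partial>lebesgue_Rn n)" if "A \<in> sets (borel_Rn n)" for A
      using V(3) that by (rule bspec)
    show "reflect_inv n \<mu>" by (rule rotation_invariant_imp_reflect_inv[OF r])
  qed (fact n V(1,2))+
  \<comment> \<open>Dividing first turns the claim into a lower bound for an infimum, which also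
    covers the case of an empty set, where the norm is infinite.\<close>
  have "rho_LS n \<mu> / ereal 30720 \<le> psi2_norm \<mu> (\<lambda>x. inner_Rn n x (axis_Rn n 0))"
    unfolding psi2_norm_def
  proof (rule INF_greatest)
    fix t assume "t \<in> {t. 0 < t \<and> (\<integral>\<^sup>+x. ennreal (exp ((inner_Rn n x (axis_Rn n 0))\<^sup>2 / t\<^sup>2)) \<partial>\<mu>) \<le> 2}"
    then have t: "0 < t" and psi: "(\<integral>\<^sup>+x. ennreal (exp ((x 0)\<^sup>2 / t\<^sup>2)) \<partial>\<mu>) \<le> 2"
      by (simp_all add: inner_axis_0[OF n])
    have "rho_LS n \<mu> \<le> ereal (30720 * t)" unfolding rho_LS_def
      by (rule INF_lower) (use t log_Sobolev_mu[OF t psi] in simp)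
    then show "rho_LS n \<mu> / ereal 30720 \<le> ereal t" by (simp add: ereal_divide_le_pos)
  qed
  then show "rho_LS n \<mu> \<le> ereal 30720 * psi2_norm \<mu> (\<lambda>x. inner_Rn n x (axis_Rn n 0))"
    by (simp add: ereal_divide_le_pos)
qed simp

end
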